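(* Let $r\ge1$. The homomorphism of Hopf algebras $$\pi:\ \mathbf{MR}^{(r)}\longrightarrow\mathbf{Sym},\qquad S_j^{(i)}\longmapsto S_j,$$ maps the class of a projective $\mathcal H_{n,r}(0)$-module to the class of its restriction to $H_n(0)$. That is, for every $n\ge1$ and every finite-dimensional projective $\mathcal H_{n,r}(0)$-module $P$, $\pi(\mathbf{ch}([P]))=\mathbf{ch}_0([P\downarrow_{H_n(0)}])$.
   Context: **The algebras.** Fix $r\ge1$, the color set $C=\{1,\dots,r\}$, and $r$ distinct complex numbers $u_1,\dots,u_r$. Put $P_k(X)=\prod_{1\le l\le r,\,l\ne k}\frac{X-u_l}{u_k-u_l}$. The $0$-Ariki-Koike-Shoji algebra $\mathcal H_{n,r}(0)$ is the associative unital $\mathbb C$-algebra generated by $T_1,\dots,T_{n-1},\xi_1,\dots,\xi_n$ with relations: $T_i(T_i+1)=0$; $T_iT_{i+1}T_i=T_{i+1}T_iT_{i+1}$; $T_iT_j=T_jT_i$ for $|i-j|\ge2$; $(\xi_j-u_1)\cdots(\xi_j-u_r)=0$; $\xi_i\xi_j=\xi_j\xi_i$; $T_i\xi_i=\xi_{i+1}T_i+\sum_{1\le a<b\le r}(u_b-u_a)P_a(\xi_i)P_b(\xi_{i+1})$; $T_i(\xi_{i+1}+\xi_i)=(\xi_{i+1}+\xi_i)T_i$; $T_i\xi_j=\xi_jT_i$ for $j\ne i,i+1$. The subalgebra generated by the $T_i$ is the $0$-Hecke algebra $H_n(0)$. **Ribbons, simple and projective modules.** For a composition $I=(i_1,\dots,i_k)$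 of $n$, $\mathrm{Des}(I)=\{i_1,i_1+i_2,\dots,i_1+\cdots+i_{k-1}\}$. A colored ribbon of size $n$ is a pair $[I,\mathbf c]$, $I$ a composition of $n$, $\mathbf c\in C^n$. It is a cycloribbon if $c_j\le c_{j+1}$ for $j\notin\mathrm{Des}(I)$ and $c_j\ge c_{j+1}$ for $j\in\mathrm{Des}(I)$; an anticycloribbon if $c_j\ge c_{j+1}$ for $j\notin\mathrm{Des}(I)$ and $c_j\le c_{j+1}$ for $j\in\mathrm{Des}(I)$. The involution $\phi$ sends $[I,\mathbf c]$ to $[I',\mathbf c]$ where $\mathrm{Des}(I')=\{j\in\mathrm{Des}(I): c_j=c_{j+1}\}\cup\{j\notin\mathrm{Des}(I): c_j\ne c_{j+1}\}$; it exchanges cycloribbons and anticycloribbons. For a cycloribbon $[I,\mathbf c]$, $S_{[I,\mathbf c]}$ is the one-dimensional simple $\mathcal H_{n,r}(0)$-module on which $\xi_i$ acts by $u_{c_i}$ and $T_i$ acts by $-1$ if $i$ is a descent of the shape of $\phi([I,\mathbf c])$ and by $0$ otherwise; these are all the simple modules, without repetition. For an anticycloribbon $[K,\mathbf c]$, $P_{[K,\mathbf c]}$ is the indecomposable projective $\mathcal H_{n,r}(0)$-module whose unique simple quotient is $S_{\phi([K,\mathbf c])}$. **Colored compositions.** A colored composition of $n$ is a pair $(I,u)$ with $I=(i_1,\dots,i_p)$ a composition of $n$ and $u=(u_1,\dots,u_p)\in C^p$ (a word of colors, not the complex parameters). The colored composition corresponding to the anticycloribbon $[K,\mathbf c]$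 is $(I,u)$ with $\mathrm{Des}(I)=\mathrm{Des}(K)\cap\{j:c_j=c_{j+1}\}\ \cup\ \{j:c_j\ne c_{j+1}\}$, and $u_k$ the common color of the $c_j$ with $j$ in the $k$-th block of $I$. This is a bijection between anticycloribbons and colored compositions. **The Hopf algebra $\mathbf{MR}^{(r)}$.** It is the free associative $\mathbb C$-algebra on symbols $S_j^{(i)}$, $j\ge1$, $1\le i\le r$, graded by $\deg S_j^{(i)}=j$, with $\Delta S_n^{(k)}=\sum_{i=0}^nS_i^{(k)}\otimes S_{n-i}^{(k)}$, $S_0^{(k)}=1$. For a colored composition, $S^{(I,u)}=S_{i_1}^{(u_1)}\cdots S_{i_p}^{(u_p)}$. Write $(J,v)\le(I,u)$ if $(J,v)$ is obtained from $(I,u)$ by adding up groups of consecutive parts of the same color. The colored ribbon basis $(R_{(I,u)})$ is defined by $S^{(I,u)}=\sum_{(J,v)\le(I,u)}R_{(J,v)}$. The class of a projective $\mathcal H_{n,r}(0)$-module is regarded as an element of $\mathbf{MR}^{(r)}$ through the isomorphism of Hopf algebras $\mathbf{ch}:\bigoplus_nK_0(\mathcal H_{n,r}(0))\to\mathbf{MR}^{(r)}$, $[P_{[K,\mathbf c]}]\mapsto R_{(I,u)}$, where $(I,u)$ corresponds to $[K,\mathbf c]$ and $K_0$ denotes the complexified Grothendieck group of finite-dimensional projective left modules. **The Hopf algebra $\mathbf{Sym}$.** Noncommutative symmetric functions: the case $r=1$ of the Hopf algebra $\mathbf{MR}^{(r)}$ (with $S_j=S_j^{(1)}$), i.e. the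 free associative $\mathbb C$-algebra on $S_j$, $j\ge1$, graded by $\deg S_j=j$, with $\Delta S_n=\sum_{i=0}^n S_i\otimes S_{n-i}$, $S_0=1$, and ribbon basis $R_I$ defined by $S_{i_1}\cdots S_{i_p}=\sum_JR_J$, $J$ running over compositions obtained from $I$ by adding up consecutive parts. The class of a projective $H_n(0)$-module is regarded as an element of $\mathbf{Sym}$ through the isomorphism $\mathbf{ch}_0:\bigoplus_nK_0(H_n(0))\to\mathbf{Sym}$, $[P_I]\mapsto R_I$, where $P_I$ is the indecomposable projective $H_n(0)$-module whose unique simple quotient is the one-dimensional module on which $T_i$ acts by $-1$ if $i\in\mathrm{Des}(I)$ and by $0$ otherwise. *)

theory Defs
  imports
    Complex_Main
    "HOL-Library.Poly_Mapping"
    "HOL-Library.Product_Plus"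
    "HOL-Algebra.Algebra"
begin

section \<open>Free algebras\<close>

text \<open>
  With concatenation as addition, \<^typ>\<open>'a list\<close> is the free monoid on \<^typ>\<open>'a\<close>. Hence
  \<open>'a list \<Rightarrow>\<^sub>0 complex\<close>, with the convolution product of \<open>Poly_Mapping\<close>, is the free associative
  unital complex algebra on \<^typ>\<open>'a\<close>, and \<open>'a list \<times> 'a list \<Rightarrow>\<^sub>0 complex\<close> is its tensor square.
\<close>

instantiation list :: (type) monoid_add
begin

definition zero_list :: "'a list" where "zero_list = []"
definition plus_list :: "'a list \<Rightarrow> 'a list \<Rightarrow> 'a list" where "plus_list = (@)"

instance
  by standard (simp_all add: zero_list_def plus_list_def)

end

definition cscale :: "complex \<Rightarrow> ('k \<Rightarrow>\<^sub>0 complex) \<Rightarrow> 'k \<Rightarrow>\<^sub>0 complex"  (infixr \<open>*\<^sub>k\<close> 75)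
  where "z *\<^sub>k p = Poly_Mapping.map ((*) z) p"

lemma lookup_cscale [simp]: "Poly_Mapping.lookup (z *\<^sub>k p) k = z * Poly_Mapping.lookup p k"
  by (simp add: cscale_def Poly_Mapping.map.rep_eq Poly_Mapping.when_def)

interpretation formal: vector_space "cscale :: complex \<Rightarrow> ('k \<Rightarrow>\<^sub>0 complex) \<Rightarrow> _"
  by standard (auto intro!: poly_mapping_eqI simp: lookup_add algebra_simps)

definition letter :: "'a \<Rightarrow> 'a list \<Rightarrow>\<^sub>0 complex"
  where "letter a = Poly_Mapping.single [a] 1"

text \<open>The unique algebra homomorphism sending each letter \<open>a\<close> to \<open>f a\<close>.\<close>

definition alg_ext :: "('a \<Rightarrow> 'm::monoid_add \<Rightarrow>\<^sub>0 complex) \<Rightarrow> ('a list \<Rightarrow>\<^sub>0 complex) \<Rightarrow> 'm \<Rightarrow>\<^sub>0 complex"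
  where "alg_ext f p = (\<Sum>w\<in>Poly_Mapping.keys p. Poly_Mapping.lookup p w *\<^sub>k prod_list (map f w))"

definition tensor :: "('m \<Rightarrow>\<^sub>0 complex) \<Rightarrow> ('n \<Rightarrow>\<^sub>0 complex) \<Rightarrow> 'm \<times> 'n \<Rightarrow>\<^sub>0 complex"
  where "tensor p q = (\<Sum>v\<in>Poly_Mapping.keys p. \<Sum>w\<in>Poly_Mapping.keys q.
    Poly_Mapping.single (v, w) (Poly_Mapping.lookup p v * Poly_Mapping.lookup q w))"

text \<open>The linear map \<open>f \<otimes> g\<close>.\<close>

definition tensor_map ::
  "(('m \<Rightarrow>\<^sub>0 complex) \<Rightarrow> 'k \<Rightarrow>\<^sub>0 complex) \<Rightarrow> (('n \<Rightarrow>\<^sub>0 complex) \<Rightarrow> 'l \<Rightarrow>\<^sub>0 complex)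
    \<Rightarrow> ('m \<times> 'n \<Rightarrow>\<^sub>0 complex) \<Rightarrow> 'k \<times> 'l \<Rightarrow>\<^sub>0 complex"
  where "tensor_map f g t =
    (\<Sum>(v, w)\<in>Poly_Mapping.keys t. Poly_Mapping.lookup t (v, w) *\<^sub>k
      tensor (f (Poly_Mapping.single v 1)) (g (Poly_Mapping.single w 1)))"


section \<open>Modules over complex algebras\<close>

text \<open>
  A complex algebra \<open>A\<close> is a record of type \<open>(complex, 'a) module\<close>: a ring together with a scalar
  multiplication. \<open>HOL-Algebra\<close> has modules over commutative rings only; its record type is reused
  here for left modules over arbitrary rings (the fields \<^const>\<open>monoid.mult\<close> and
  \<^const>\<open>monoid.one\<close> of a module
  carry no meaning). Its locale \<^locale>\<open>submodule\<close> does not involve commutativity.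
\<close>

locale left_module = A?: ring A + M?: abelian_group M
  for A :: "('a, 'm) ring_scheme" (structure) and M :: "('a, 'v) module" (structure) +
  assumes smult_closed:
      "\<lbrakk>a \<in> carrier A; x \<in> carrier M\<rbrakk> \<Longrightarrow> a \<odot>\<^bsub>M\<^esub> x \<in> carrier M"
    and smult_l_distr:
      "\<lbrakk>a \<in> carrier A; b \<in> carrier A; x \<in> carrier M\<rbrakk> \<Longrightarrow>
        (a \<oplus>\<^bsub>A\<^esub> b) \<odot>\<^bsub>M\<^esub> x = (a \<odot>\<^bsub>M\<^esub> x) \<oplus>\<^bsub>M\<^esub> (b \<odot>\<^bsub>M\<^esub> x)"
    and smult_r_distr:
      "\<lbrakk>a \<in> carrier A; x \<in> carrier M; y \<in> carrier M\<rbrakk> \<Longrightarrow>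
        a \<odot>\<^bsub>M\<^esub> (x \<oplus>\<^bsub>M\<^esub> y) = (a \<odot>\<^bsub>M\<^esub> x) \<oplus>\<^bsub>M\<^esub> (a \<odot>\<^bsub>M\<^esub> y)"
    and smult_assoc:
      "\<lbrakk>a \<in> carrier A; b \<in> carrier A; x \<in> carrier M\<rbrakk> \<Longrightarrow>
        (a \<otimes>\<^bsub>A\<^esub> b) \<odot>\<^bsub>M\<^esub> x = a \<odot>\<^bsub>M\<^esub> (b \<odot>\<^bsub>M\<^esub> x)"
    and smult_one:
      "x \<in> carrier M \<Longrightarrow> \<one>\<^bsub>A\<^esub> \<odot>\<^bsub>M\<^esub> x = x"

definition lmod_hom :: "(complex, 'a) module \<Rightarrow> ('a, 'v) module \<Rightarrow> ('a, 'w) module \<Rightarrow> ('v \<Rightarrow> 'w) set"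
  where "lmod_hom A M N = {f \<in> carrier M \<rightarrow> carrier N.
    (\<forall>x\<in>carrier M. \<forall>y\<in>carrier M. f (x \<oplus>\<^bsub>M\<^esub> y) = f x \<oplus>\<^bsub>N\<^esub> f y) \<and>
    (\<forall>a\<in>carrier A. \<forall>x\<in>carrier M. f (a \<odot>\<^bsub>M\<^esub> x) = a \<odot>\<^bsub>N\<^esub> f x)}"

definition lmod_iso :: "(complex, 'a) module \<Rightarrow> ('a, 'v) module \<Rightarrow> ('a, 'w) module \<Rightarrow> bool"
  where "lmod_iso A M N \<longleftrightarrow> (\<exists>f\<in>lmod_hom A M N. bij_betw f (carrier M) (carrier N))"

definition dsum :: "('a, 'v) module \<Rightarrow> ('a, 'w) module \<Rightarrow> ('a, 'v \<times> 'w) module"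
  where "dsum M N =
    \<lparr>carrier = carrier M \<times> carrier N, monoid.mult = undefined, monoid.one = undefined,
     ring.zero = (\<zero>\<^bsub>M\<^esub>, \<zero>\<^bsub>N\<^esub>),
     ring.add = (\<lambda>(x, y) (x', y'). (x \<oplus>\<^bsub>M\<^esub> x', y \<oplus>\<^bsub>N\<^esub> y')),
     smult = (\<lambda>a (x, y). (a \<odot>\<^bsub>M\<^esub> x, a \<odot>\<^bsub>N\<^esub> y))\<rparr>"

definition free_lmod :: "(complex, 'a) module \<Rightarrow> nat \<Rightarrow> ('a, nat \<Rightarrow> 'a) module"
  where "free_lmod A k =
    \<lparr>carrier = {..<k} \<rightarrow>\<^sub>E carrier A, monoid.mult = undefined, monoid.one = undefined,
     ring.zero = (\<lambda>i\<in>{..<k}. \<zero>\<^bsub>A\<^esub>),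
     ring.add = (\<lambda>f g. \<lambda>i\<in>{..<k}. f i \<oplus>\<^bsub>A\<^esub> g i),
     smult = (\<lambda>a f. \<lambda>i\<in>{..<k}. a \<otimes>\<^bsub>A\<^esub> f i)\<rparr>"

text \<open>Complex scalars act on a module through \<open>z \<mapsto> z\<cdot>1 \<in> A\<close>.\<close>

definition fin_dim :: "(complex, 'a) module \<Rightarrow> ('a, 'v) module \<Rightarrow> bool"
  where "fin_dim A M \<longleftrightarrow> (\<exists>B. finite B \<and> B \<subseteq> carrier M \<and>
    (\<forall>x\<in>carrier M. \<exists>z. x = (\<Oplus>\<^bsub>M\<^esub>b\<in>B. (z b \<odot>\<^bsub>A\<^esub> \<one>\<^bsub>A\<^esub>) \<odot>\<^bsub>M\<^esub> b)))"

text \<open>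
  Projective means: direct summand of a free module. A finite-dimensional module is finitely
  generated, so free modules of finite rank suffice.
\<close>

definition fd_projective :: "(complex, 'a) module \<Rightarrow> ('a, 'v) module \<Rightarrow> bool"
  where "fd_projective A M \<longleftrightarrow> left_module A M \<and> fin_dim A M \<and>
    (\<exists>k. \<exists>i\<in>lmod_hom A M (free_lmod A k). \<exists>p\<in>lmod_hom A (free_lmod A k) M.
      \<forall>x\<in>carrier M. p (i x) = x)"

definition indecomposable :: "(complex, 'a) module \<Rightarrow> ('a, 'v) module \<Rightarrow> bool"
  where "indecomposable A M \<longleftrightarrow> carrier M \<noteq> {\<zero>\<^bsub>M\<^esub>} \<and>
    (\<forall>N N'. submodule N A M \<longrightarrow> submodule N' A M \<longrightarrow> N \<inter> N' = {\<zero>\<^bsub>M\<^esub>} \<longrightarrow>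
      N <+>\<^bsub>M\<^esub> N' = carrier M \<longrightarrow> N = {\<zero>\<^bsub>M\<^esub>} \<or> N' = {\<zero>\<^bsub>M\<^esub>})"

definition maximal_submodule :: "(complex, 'a) module \<Rightarrow> ('a, 'v) module \<Rightarrow> 'v set \<Rightarrow> bool"
  where "maximal_submodule A M N \<longleftrightarrow> submodule N A M \<and> N \<noteq> carrier M \<and>
    (\<forall>L. submodule L A M \<longrightarrow> N \<subseteq> L \<longrightarrow> L = N \<or> L = carrier M)"

definition one_dim :: "(complex, 'a) module \<Rightarrow> ('a, 'v) module \<Rightarrow> bool"
  where "one_dim A M \<longleftrightarrow> left_module A M \<and>
    (\<exists>x\<in>carrier M. x \<noteq> \<zero>\<^bsub>M\<^esub> \<and> (\<forall>y\<in>carrier M. \<exists>z. y = (z \<odot>\<^bsub>A\<^esub> \<one>\<^bsub>A\<^esub>) \<odot>\<^bsub>M\<^esub> x))"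

definition acts_by :: "(complex, 'a) module \<Rightarrow> ('a, 'v) module \<Rightarrow> 'a \<Rightarrow> complex \<Rightarrow> bool"
  where "acts_by A M a z \<longleftrightarrow> (\<forall>x\<in>carrier M. a \<odot>\<^bsub>M\<^esub> x = (z \<odot>\<^bsub>A\<^esub> \<one>\<^bsub>A\<^esub>) \<odot>\<^bsub>M\<^esub> x)"

text \<open>
  \<open>M\<close> has exactly one maximal submodule, and \<open>S\<close> is the corresponding simple quotient (the kernel of
  a surjection onto the simple module \<open>S\<close> is maximal, hence it is that submodule).
\<close>

definition has_unique_simple_quotient ::
  "(complex, 'a) module \<Rightarrow> ('a, 'v) module \<Rightarrow> ('a, 'w) module \<Rightarrow> bool"
  where "has_unique_simple_quotient A M S \<longleftrightarrow> (\<exists>!N. maximal_submodule A M N) \<and>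
    maximal_submodule A S {\<zero>\<^bsub>S\<^esub>} \<and> (\<exists>f\<in>lmod_hom A M S. f ` carrier M = carrier S)"


section \<open>The complexified Grothendieck group\<close>

text \<open>
  Finite-dimensional modules can be carried by subsets of \<^typ>\<open>nat \<Rightarrow> complex\<close>, which is the universe
  from which \<open>K\<^sub>0\<close> is built. The isomorphism class of a module on any other type is represented by
  its isomorphic copies in that universe.
\<close>

type_synonym 'a umodule = "('a, nat \<Rightarrow> complex) module"

definition iso_class :: "(complex, 'a) module \<Rightarrow> ('a, 'v) module \<Rightarrow> 'a umodule set"
  where "iso_class A M = {L. left_module A L \<and> lmod_iso A M L}"

definition K0_formal :: "(complex, 'a) module \<Rightarrow> ('a umodule set \<Rightarrow>\<^sub>0 complex) set"
  where "K0_formal A =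
    formal.span {Poly_Mapping.single (iso_class A M) 1 | M :: 'a umodule. fd_projective A M}"

text \<open>Short exact sequences of projective modules split, so direct sums give all the relations.\<close>

definition K0_rels :: "(complex, 'a) module \<Rightarrow> ('a umodule set \<Rightarrow>\<^sub>0 complex) set"
  where "K0_rels A =
    formal.span {Poly_Mapping.single (iso_class A (dsum M N)) 1
        - Poly_Mapping.single (iso_class A M) 1 - Poly_Mapping.single (iso_class A N) 1
      | (M :: 'a umodule) (N :: 'a umodule). fd_projective A M \<and> fd_projective A N}"

definition K0_coset ::
  "(complex, 'a) module \<Rightarrow> ('a umodule set \<Rightarrow>\<^sub>0 complex) \<Rightarrow> ('a umodule set \<Rightarrow>\<^sub>0 complex) set"
  where "K0_coset A x = {y. y - x \<in> K0_rels A}"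

text \<open>\<open>K\<^sub>0(A)\<close> is the set of all \<open>K0_coset A x\<close> with \<open>x \<in> K0_formal A\<close>.\<close>

definition K0_class :: "(complex, 'a) module \<Rightarrow> ('a, 'v) module \<Rightarrow> ('a umodule set \<Rightarrow>\<^sub>0 complex) set"
  where "K0_class A M = K0_coset A (Poly_Mapping.single (iso_class A M) 1)"

definition K0_linear ::
  "(complex, 'a) module \<Rightarrow> (('a umodule set \<Rightarrow>\<^sub>0 complex) set \<Rightarrow> 'k \<Rightarrow>\<^sub>0 complex) \<Rightarrow> bool"
  where "K0_linear A g \<longleftrightarrow>
    (\<forall>x\<in>K0_formal A. \<forall>y\<in>K0_formal A.
      g (K0_coset A (x + y)) = g (K0_coset A x) + g (K0_coset A y)) \<and>
    (\<forall>z. \<forall>x\<in>K0_formal A. g (K0_coset A (z *\<^sub>k x)) = z *\<^sub>k g (K0_coset A x))"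

text \<open>
  The linear map on \<open>K\<^sub>0(A)\<close> with \<open>[M] \<mapsto> y\<close> whenever \<open>spec M y\<close>. It is applied below to
  specifications that prescribe the values on the basis of classes of indecomposable projectives;
  the map is then determined on \<open>K\<^sub>0(A)\<close> (but not on other arguments).
\<close>

definition K0_map ::
  "(complex, 'a) module \<Rightarrow> ('a umodule \<Rightarrow> ('k \<Rightarrow>\<^sub>0 complex) \<Rightarrow> bool)
    \<Rightarrow> ('a umodule set \<Rightarrow>\<^sub>0 complex) set \<Rightarrow> 'k \<Rightarrow>\<^sub>0 complex"
  where "K0_map A spec = (SOME g. K0_linear A g \<and> (\<forall>M y. spec M y \<longrightarrow> g (K0_class A M) = y))"


section \<open>The 0-Ariki-Koike-Shoji algebra and the 0-Hecke algebra\<close>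

datatype gen = T nat | Xi nat

text \<open>\<open>lag u r k x\<close> is \<open>P\<^sub>k(x)\<close>; the factors commute, so their order is immaterial.\<close>

definition lag :: "(nat \<Rightarrow> complex) \<Rightarrow> nat \<Rightarrow> nat \<Rightarrow> (gen list \<Rightarrow>\<^sub>0 complex) \<Rightarrow> gen list \<Rightarrow>\<^sub>0 complex"
  where "lag u r k x =
    prod_list (map (\<lambda>l. (1 / (u k - u l)) *\<^sub>k (x - u l *\<^sub>k 1)) (filter (\<lambda>l. l \<noteq> k) [1..<Suc r]))"

definition AKS_free :: "nat \<Rightarrow> (complex, gen list \<Rightarrow>\<^sub>0 complex) module"
  where "AKS_free n =
    \<lparr>carrier = {p. \<forall>w\<in>Poly_Mapping.keys p. set w \<subseteq> T ` {1..<n} \<union> Xi ` {1..n}},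
     monoid.mult = (*), monoid.one = 1, ring.zero = 0, ring.add = (+), smult = cscale\<rparr>"

text \<open>The defining relations \<open>lhs = rhs\<close>, as elements \<open>lhs - rhs\<close>.\<close>

definition AKS_relators :: "nat \<Rightarrow> nat \<Rightarrow> (nat \<Rightarrow> complex) \<Rightarrow> (gen list \<Rightarrow>\<^sub>0 complex) set"
  where "AKS_relators n r u =
    (let t = (\<lambda>i. letter (T i)); x = (\<lambda>j. letter (Xi j)) in
      {t i * (t i + 1) | i. i \<in> {1..<n}}
    \<union> {t i * t (i + 1) * t i - t (i + 1) * t i * t (i + 1) | i. i \<in> {1..<n} \<and> i + 1 \<in> {1..<n}}
    \<union> {t i * t j - t j * t i | i j. i \<in> {1..<n} \<and> j \<in> {1..<n} \<and> (i + 2 \<le> j \<or> j + 2 \<le> i)}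
    \<union> {prod_list (map (\<lambda>l. x j - u l *\<^sub>k 1) [1..<Suc r]) | j. j \<in> {1..n}}
    \<union> {x i * x j - x j * x i | i j. i \<in> {1..n} \<and> j \<in> {1..n}}
    \<union> {t i * x i - (x (i + 1) * t i +
          (\<Sum>(a, b) \<in> {(a, b). 1 \<le> a \<and> a < b \<and> b \<le> r}.
            (u b - u a) *\<^sub>k (lag u r a (x i) * lag u r b (x (i + 1))))) | i. i \<in> {1..<n}}
    \<union> {t i * (x (i + 1) + x i) - (x (i + 1) + x i) * t i | i. i \<in> {1..<n}}
    \<union> {t i * x j - x j * t i | i j. i \<in> {1..<n} \<and> j \<in> {1..n} \<and> j \<noteq> i \<and> j \<noteq> i + 1})"

definition AKS_ideal :: "nat \<Rightarrow> nat \<Rightarrow> (nat \<Rightarrow> complex) \<Rightarrow> (gen list \<Rightarrow>\<^sub>0 complex) set"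
  where "AKS_ideal n r u = Idl\<^bsub>AKS_free n\<^esub> (AKS_relators n r u)"

definition AKS :: "nat \<Rightarrow> nat \<Rightarrow> (nat \<Rightarrow> complex) \<Rightarrow> (complex, (gen list \<Rightarrow>\<^sub>0 complex) set) module"
  where "AKS n r u =
    (let F = AKS_free n; I = AKS_ideal n r u; Q = F Quot I in
     \<lparr>carrier = carrier Q, monoid.mult = monoid.mult Q, monoid.one = monoid.one Q,
      ring.zero = ring.zero Q, ring.add = ring.add Q,
      smult = (\<lambda>z B. \<Union>b\<in>B. I +>\<^bsub>F\<^esub> (z \<odot>\<^bsub>F\<^esub> b))\<rparr>)"

definition AKS_gen :: "nat \<Rightarrow> nat \<Rightarrow> (nat \<Rightarrow> complex) \<Rightarrow> gen \<Rightarrow> (gen list \<Rightarrow>\<^sub>0 complex) set"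
  where "AKS_gen n r u a = AKS_ideal n r u +>\<^bsub>AKS_free n\<^esub> letter a"

text \<open>
  \<open>H\<^sub>n(0)\<close> is the subalgebra generated by the \<open>T\<^sub>i\<close>; it shares the operations of \<^const>\<open>AKS\<close>.
  Therefore the restriction of a module \<open>P\<close> to \<open>H\<^sub>n(0)\<close> is the record \<open>P\<close> itself, viewed as
  a module over \<open>Hecke0 n r u\<close>.
\<close>

definition Hecke0 :: "nat \<Rightarrow> nat \<Rightarrow> (nat \<Rightarrow> complex) \<Rightarrow> (complex, (gen list \<Rightarrow>\<^sub>0 complex) set) module"
  where "Hecke0 n r u = (AKS n r u)\<lparr>carrier :=
    generate_ring (AKS n r u)
      (range (\<lambda>z. z \<odot>\<^bsub>AKS n r u\<^esub> \<one>\<^bsub>AKS n r u\<^esub>) \<union> (\<lambda>i. AKS_gen n r u (T i)) ` {1..<n})\<rparr>"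


section \<open>Compositions and colored ribbons\<close>

definition composition :: "nat \<Rightarrow> nat list \<Rightarrow> bool"
  where "composition n I \<longleftrightarrow> (\<forall>i\<in>set I. 1 \<le> i) \<and> sum_list I = n"

definition Des :: "nat list \<Rightarrow> nat set"
  where "Des I = {sum_list (take k I) | k. 1 \<le> k \<and> k < length I}"

text \<open>
  A color word \<open>c\<^sub>1\<dots>c\<^sub>n\<close> is a list; \<open>col c j\<close> is the letter \<open>c\<^sub>j\<close>, counted from 1.
  A colored ribbon \<open>[I, c]\<close> is a pair of lists.
\<close>

definition col :: "nat list \<Rightarrow> nat \<Rightarrow> nat"
  where "col c j = c ! (j - 1)"

definition colored_ribbon :: "nat \<Rightarrow> nat \<Rightarrow> nat list \<times> nat list \<Rightarrow> bool"
  where "colored_ribbon n r = (\<lambda>(I, c). composition n I \<and> length c = n \<and> set c \<subseteq> {1..r})"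

definition anticycloribbon :: "nat \<Rightarrow> nat \<Rightarrow> nat list \<times> nat list \<Rightarrow> bool"
  where "anticycloribbon n r = (\<lambda>(I, c). colored_ribbon n r (I, c) \<and>
    (\<forall>j\<in>{1..<n}. if j \<in> Des I then col c j \<le> col c (j + 1) else col c (j + 1) \<le> col c j))"

definition phi :: "nat \<Rightarrow> nat list \<times> nat list \<Rightarrow> nat list \<times> nat list"
  where "phi n = (\<lambda>(I, c).
    (THE I'. composition n I' \<and>
      Des I' = {j \<in> Des I. col c j = col c (j + 1)}
             \<union> {j \<in> {1..<n}. j \<notin> Des I \<and> col c j \<noteq> col c (j + 1)}, c))"

text \<open>
  A colored composition \<open>(I, u)\<close> is the list of the pairs \<open>(i\<^sub>k, u\<^sub>k)\<close>. The \<open>k\<close>-th block consists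
  of the \<open>j\<close> with \<open>i\<^sub>1+\<dots>+i\<^sub>k\<^sub>-\<^sub>1 < j \<le> i\<^sub>1+\<dots>+i\<^sub>k\<close>.
\<close>

definition colored_comp_of :: "nat \<Rightarrow> nat list \<times> nat list \<Rightarrow> (nat \<times> nat) list"
  where "colored_comp_of n = (\<lambda>(K, c).
    (THE L. composition n (map fst L) \<and>
      Des (map fst L) = (Des K \<inter> {j. col c j = col c (j + 1)})
                      \<union> {j \<in> {1..<n}. col c j \<noteq> col c (j + 1)} \<and>
      (\<forall>k<length L. \<forall>j\<in>{sum_list (take k (map fst L)) <.. sum_list (take (Suc k) (map fst L))}.
        col c j = snd (L ! k))))"

text \<open>\<open>coarser J L\<close>: \<open>J\<close> arises from \<open>L\<close> by adding up groups of consecutive parts of equal color.\<close>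

definition coarser :: "(nat \<times> nat) list \<Rightarrow> (nat \<times> nat) list \<Rightarrow> bool"
  where "coarser J L \<longleftrightarrow> (\<exists>gs. concat gs = L \<and>
    (\<forall>g\<in>set gs. g \<noteq> [] \<and> (\<forall>x\<in>set g. snd x = snd (hd g))) \<and>
    J = map (\<lambda>g. (sum_list (map fst g), snd (hd g))) gs)"

lemma coarser_length: "coarser J L \<Longrightarrow> J \<noteq> L \<Longrightarrow> length J < length L"
proof -
  assume "coarser J L" and ne: "J \<noteq> L"
  then obtain gs where gs: "concat gs = L" "\<forall>g\<in>set gs. g \<noteq> []"
    and J: "J = map (\<lambda>g. (sum_list (map fst g), snd (hd g))) gs"
    unfolding coarser_def by blast
  have le: "length gs \<le> length (concat gs)" if "\<forall>g\<in>set gs. g \<noteq> []" for gs :: "(nat \<times> nat) list list"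
    using that by (induction gs) (auto simp: neq_Nil_conv)
  have eq: "map (\<lambda>g. (sum_list (map fst g), snd (hd g))) gs = concat gs"
    if "\<forall>g\<in>set gs. g \<noteq> []" "length (concat gs) = length gs" for gs :: "(nat \<times> nat) list list"
    using that
  proof (induction gs)
    case (Cons g gs)
    have "length gs \<le> length (concat gs)" using Cons.prems by (intro le) auto
    moreover have "length g > 0" using Cons.prems by auto
    moreover have "length g + length (concat gs) = Suc (length gs)" using Cons.prems(2) by simp
    ultimately have 1: "length g = 1" "length (concat gs) = length gs"
      by linarith+
    then obtain x where "g = [x]" by (auto simp: length_Suc_conv)
    with 1 show ?case using Cons by simp
  qed simp
  have "length (concat gs) \<noteq> length gs"
    using eq[of gs] gs J ne by auto
  with le[of gs] gs J show ?thesis by auto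
qed

lemma coarser_refl: "coarser L L"
  unfolding coarser_def by (rule exI[of _ "map (\<lambda>x. [x]) L"]) (auto simp: comp_def)

lemma finite_coarser: "finite {J. coarser J L}"
proof -
  have "finite {gs. concat gs = L \<and> [] \<notin> set gs}" for L :: "(nat \<times> nat) list"
  proof (rule finite_subset)
    show "{gs. concat gs = L \<and> [] \<notin> set gs} \<subseteq>
      {gs. set gs \<subseteq> {g. set g \<subseteq> set L \<and> length g \<le> length L} \<and> length gs \<le> length L}"
    proof (rule, safe)
      fix gs g x assume "L = concat gs"
      show "x \<in> set (concat gs)" if "g \<in> set gs" "x \<in> set g" using that by auto
    next
      fix gs :: "(nat \<times> nat) list list" and g assume "g \<in> set gs"
      then show "length g \<le> length (concat gs)"
        by (induction gs) auto
    next
      fix gs :: "(nat \<times> nat) list list" assume "[] \<notin> set gs"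
      then show "length gs \<le> length (concat gs)"
      proof (induction gs)
        case (Cons g gs)
        then have "length g > 0" "length gs \<le> length (concat gs)" by auto
        then show ?case unfolding concat.simps length_append list.size by linarith
      qed simp
    qed
    show "finite {gs. set gs \<subseteq> {g. set g \<subseteq> set L \<and> length g \<le> length L} \<and> length gs \<le> length L}"
      by (intro finite_lists_length_le) auto
  qed
  then have "finite ((\<lambda>gs. map (\<lambda>g. (sum_list (map fst g), snd (hd g))) gs)
      ` {gs. concat gs = L \<and> [] \<notin> set gs})"
    by (rule finite_imageI)
  then show ?thesis
    by (rule finite_subset[rotated]) (auto simp: coarser_def)
qed


section \<open>The Hopf algebras \<open>MR\<^sup>(\<^sup>r\<^sup>)\<close> and \<open>Sym = MR\<^sup>(\<^sup>1\<^sup>)\<close>\<close>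

text \<open>The letter \<open>(j, i)\<close> stands for \<open>S\<^sub>j\<^sup>(\<^sup>i\<^sup>)\<close>.\<close>

type_synonym mr = "(nat \<times> nat) list \<Rightarrow>\<^sub>0 complex"

definition MR :: "nat \<Rightarrow> mr set"
  where "MR r = {p. \<forall>w\<in>Poly_Mapping.keys p. \<forall>(j, i)\<in>set w. 1 \<le> j \<and> 1 \<le> i \<and> i \<le> r}"

definition S :: "nat \<Rightarrow> nat \<Rightarrow> mr"
  where "S j i = (if j = 0 then 1 else letter (j, i))"

definition S_prod :: "(nat \<times> nat) list \<Rightarrow> mr"
  where "S_prod L = prod_list (map (\<lambda>(j, i). S j i) L)"

definition comult :: "mr \<Rightarrow> (nat \<times> nat) list \<times> (nat \<times> nat) list \<Rightarrow>\<^sub>0 complex"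
  where "comult = alg_ext (\<lambda>(n, k). \<Sum>i=0..n. tensor (S i k) (S (n - i) k))"

definition counit :: "mr \<Rightarrow> complex"
  where "counit p = Poly_Mapping.lookup p []"

text \<open>A bialgebra homomorphism of Hopf algebras commutes with the antipodes.\<close>

definition hopf_hom :: "nat \<Rightarrow> nat \<Rightarrow> (mr \<Rightarrow> mr) \<Rightarrow> bool"
  where "hopf_hom r s f \<longleftrightarrow> f \<in> MR r \<rightarrow> MR s \<and>
    (\<forall>p\<in>MR r. \<forall>q\<in>MR r. f (p + q) = f p + f q \<and> f (p * q) = f p * f q) \<and>
    (\<forall>z. \<forall>p\<in>MR r. f (z *\<^sub>k p) = z *\<^sub>k f p) \<and> f 1 = 1 \<and>
    (\<forall>p\<in>MR r. comult (f p) = tensor_map f f (comult p)) \<and>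
    (\<forall>p\<in>MR r. counit (f p) = counit p)"

text \<open>The colored ribbon basis: the defining relation \<open>S_prod_eq_sum_ribbon\<close>, solved recursively.\<close>

function ribbon :: "(nat \<times> nat) list \<Rightarrow> mr"
  where "ribbon L = S_prod L - (\<Sum>J\<in>{J. coarser J L \<and> J \<noteq> L}. ribbon J)"
  by auto
termination
  by (relation "Wellfounded.measure length") (auto intro: coarser_length)

declare ribbon.simps [simp del]

lemma S_prod_eq_sum_ribbon: "S_prod L = (\<Sum>J\<in>{J. coarser J L}. ribbon J)"
proof -
  have "{J. coarser J L} = insert L {J. coarser J L \<and> J \<noteq> L}"
    using coarser_refl by auto
  moreover have "finite {J. coarser J L \<and> J \<noteq> L}"
    using finite_coarser by (rule finite_subset[rotated]) auto
  ultimately have "(\<Sum>J\<in>{J. coarser J L}. ribbon J)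
      = ribbon L + (\<Sum>J\<in>{J. coarser J L \<and> J \<noteq> L}. ribbon J)"
    by simp
  then show ?thesis by (simp add: ribbon.simps[of L])
qed

text \<open>\<open>R\<^sub>I \<in> Sym\<close>, where \<open>S\<^sub>j = S\<^sub>j\<^sup>(\<^sup>1\<^sup>)\<close>.\<close>

definition Sym_ribbon :: "nat list \<Rightarrow> mr"
  where "Sym_ribbon I = ribbon (map (\<lambda>i. (i, 1)) I)"

text \<open>\<open>\<pi>\<close> is the algebra homomorphism with \<open>S\<^sub>j\<^sup>(\<^sup>i\<^sup>) \<mapsto> S\<^sub>j\<close>.\<close>

definition mr_to_sym :: "mr \<Rightarrow> mr"
  where "mr_to_sym = alg_ext (\<lambda>(j, i). S j 1)"


section \<open>Simple modules, indecomposable projective modules and characteristic maps\<close>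

definition AKS_simple ::
  "nat \<Rightarrow> nat \<Rightarrow> (nat \<Rightarrow> complex) \<Rightarrow> nat list \<times> nat list \<Rightarrow> ((gen list \<Rightarrow>\<^sub>0 complex) set, 'v) module \<Rightarrow> bool"
  where "AKS_simple n r u = (\<lambda>(I, c) M. one_dim (AKS n r u) M \<and>
    (\<forall>i\<in>{1..n}. acts_by (AKS n r u) M (AKS_gen n r u (Xi i)) (u (col c i))) \<and>
    (\<forall>i\<in>{1..<n}. acts_by (AKS n r u) M (AKS_gen n r u (T i))
      (if i \<in> Des (fst (phi n (I, c))) then -1 else 0)))"

definition AKS_proj ::
  "nat \<Rightarrow> nat \<Rightarrow> (nat \<Rightarrow> complex) \<Rightarrow> nat list \<times> nat list \<Rightarrow> ((gen list \<Rightarrow>\<^sub>0 complex) set, 'v) module \<Rightarrow> bool"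
  where "AKS_proj n r u Kc M \<longleftrightarrow> fd_projective (AKS n r u) M \<and> indecomposable (AKS n r u) M \<and>
    (\<exists>L :: (gen list \<Rightarrow>\<^sub>0 complex) set umodule.
      AKS_simple n r u (phi n Kc) L \<and> has_unique_simple_quotient (AKS n r u) M L)"

definition ch ::
  "nat \<Rightarrow> nat \<Rightarrow> (nat \<Rightarrow> complex) \<Rightarrow> ((gen list \<Rightarrow>\<^sub>0 complex) set umodule set \<Rightarrow>\<^sub>0 complex) set \<Rightarrow> mr"
  where "ch n r u = K0_map (AKS n r u) (\<lambda>M y.
    \<exists>Kc. anticycloribbon n r Kc \<and> AKS_proj n r u Kc M \<and> y = ribbon (colored_comp_of n Kc))"

definition Hecke0_simple ::
  "nat \<Rightarrow> nat \<Rightarrow> (nat \<Rightarrow> complex) \<Rightarrow> nat list \<Rightarrow> ((gen list \<Rightarrow>\<^sub>0 complex) set, 'v) module \<Rightarrow> bool"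
  where "Hecke0_simple n r u I M \<longleftrightarrow> one_dim (Hecke0 n r u) M \<and>
    (\<forall>i\<in>{1..<n}. acts_by (Hecke0 n r u) M (AKS_gen n r u (T i)) (if i \<in> Des I then -1 else 0))"

definition Hecke0_proj ::
  "nat \<Rightarrow> nat \<Rightarrow> (nat \<Rightarrow> complex) \<Rightarrow> nat list \<Rightarrow> ((gen list \<Rightarrow>\<^sub>0 complex) set, 'v) module \<Rightarrow> bool"
  where "Hecke0_proj n r u I M \<longleftrightarrow> fd_projective (Hecke0 n r u) M \<and> indecomposable (Hecke0 n r u) M \<and>
    (\<exists>L :: (gen list \<Rightarrow>\<^sub>0 complex) set umodule.
      Hecke0_simple n r u I L \<and> has_unique_simple_quotient (Hecke0 n r u) M L)"

definition ch0 ::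
  "nat \<Rightarrow> nat \<Rightarrow> (nat \<Rightarrow> complex) \<Rightarrow> ((gen list \<Rightarrow>\<^sub>0 complex) set umodule set \<Rightarrow>\<^sub>0 complex) set \<Rightarrow> mr"
  where "ch0 n r u = K0_map (Hecke0 n r u) (\<lambda>M y.
    \<exists>I. composition n I \<and> Hecke0_proj n r u I M \<and> y = Sym_ribbon I)"

end

(*
  The multiplicity of an indecomposable projective in a projective module P is read off from a trace:
  if P is the image of an idempotent matrix e over the algebra and chi is a character, then the trace
  of chi(e) is dim Hom(P, chi), which is additive and, on the projective cover of a character, equal
  to 1 or 0. Since every nonzero projective has a nonzero homomorphism to a one-dimensional module,
  these traces determine the class of P in K_0, for the 0-Ariki-Koike-Shoji algebra and for H_n(0).

  The algebra is free over H_n(0) on the weight idempotents wt(c) of the commuting elements xi_j,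
  where c runs over all colorings of {1..n}. Hence a trace of the restriction of P to H_n(0), for the
  simple module with descent set D, is the trace for the coinduced module. That module is triangular
  with respect to the order of the colorings c by an energy, and its diagonal is made up of one
  character per coloring c, with descents at the j such that c_j < c_(j+1), or c_j = c_(j+1) and
  j in D. On the side of Sym, pi maps a colored ribbon to the sum of the ribbons R_I whose descents
  agree with the given ones at the j with c_j = c_(j+1), so the two sides match.
*)
theory Submission
  imports Defs "HOL-Computational_Algebra.Polynomial"
begin

subsection \<open>Formal linear combinations and free algebras\<close>

text \<open>The maps \<open>ch\<close> and \<open>ch0\<close> are chosen by \<open>SOME\<close>
  among the linear maps with prescribed values, so two things must be shown: such a map exists,
  which the traces provide, and its value on every projective module is forced. For the latter a
  module is split into indecomposable summands, and each of these is recognized, by Fitting's lemma,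
  as the cover of any one-dimensional module that it maps onto.

  Since the algebras are given by generators and relations, the main obstacle is the independence of
  the weight idempotents over H_n(0). It comes from a coinduced module written down on families of
  linear functionals: once the relations are checked there, summing a family over the colorings
  gives back the functional that it was built from, and this detects every element outside the
  ideal.

  The energy is made for the coefficients of that module. Exchanging c_i and c_(i+1) has a nonzero
  coefficient only if i is in D and c_i < c_(i+1), or i is not in D and c_i > c_(i+1). Position
  weights that grow by 1 at i in D and fall by 1 elsewhere make the energy drop in both
  cases.\<close>

lemma poly_mapping_keys_induct [consumes 1, case_names zero single add]:
  fixes p :: "'k \<Rightarrow>\<^sub>0 complex"
  assumes keys: "\<forall>k\<in>Poly_Mapping.keys p. R k" and zero: "Q 0"
    and single: "\<And>k a. R k \<Longrightarrow> Q (Poly_Mapping.single k a)"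
    and add: "\<And>p p'. \<forall>k\<in>Poly_Mapping.keys p. R k \<Longrightarrow> \<forall>k\<in>Poly_Mapping.keys p'. R k \<Longrightarrow> Q p \<Longrightarrow> Q p' \<Longrightarrow> Q (p + p')"
  shows "Q p"
proof -
  have "Q (\<Sum>k\<in>K. Poly_Mapping.single k (Poly_Mapping.lookup p k)) \<and>
      (\<forall>k\<in>Poly_Mapping.keys (\<Sum>k\<in>K. Poly_Mapping.single k (Poly_Mapping.lookup p k)). R k)"
    if "K \<subseteq> Poly_Mapping.keys p" for K
    using finite_subset[OF that finite_keys] that
  proof (induction K rule: finite_induct)
    case (insert k K)
    let ?s = "Poly_Mapping.single k (Poly_Mapping.lookup p k)"
      and ?t = "\<Sum>k\<in>K. Poly_Mapping.single k (Poly_Mapping.lookup p k)"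
    have k: "R k" using insert.prems keys by blast
    then have s: "\<forall>k\<in>Poly_Mapping.keys ?s. R k" by simp
    have t: "Q ?t" "\<forall>k\<in>Poly_Mapping.keys ?t. R k" using insert by auto
    have "Q (?s + ?t)" by (rule add[OF s t(2) single[OF k] t(1)])
    moreover have "\<forall>k\<in>Poly_Mapping.keys (?s + ?t). R k" using keys_add[of ?s ?t] s t(2) by blast
    ultimately show ?case using insert by simp
  qed (simp add: zero)
  moreover have "(\<Sum>k\<in>Poly_Mapping.keys p. Poly_Mapping.single k (Poly_Mapping.lookup p k)) = p"
    by (rule poly_mapping_eqI) (auto simp: lookup_sum lookup_single when_def not_in_keys_iff_lookup_eq_zero)
  ultimately show ?thesis by (metis subset_refl)
qed

lemma poly_mapping_linear_induct [case_names single add]: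
  fixes p :: "'k \<Rightarrow>\<^sub>0 complex"
  assumes "\<And>k c. Q (Poly_Mapping.single k c)" "\<And>p q. Q p \<Longrightarrow> Q q \<Longrightarrow> Q (p + q)"
  shows "Q p"
proof (rule poly_mapping_keys_induct[where R = "\<lambda>_. True"])
  show "Q 0" using assms(1)[of undefined 0] by simp
qed (use assms in auto)

lemma cscale_conv_mult: "z *\<^sub>k p = Poly_Mapping.single 0 z * (p :: 'm::monoid_add \<Rightarrow>\<^sub>0 complex)"
  unfolding cscale_def by (rule mult_map_scale_conv_mult)

lemma cscale_single [simp]: "z *\<^sub>k Poly_Mapping.single k c = Poly_Mapping.single k (z * c)"
  by (rule poly_mapping_eqI) (simp add: lookup_single when_def)

lemma single_zero_commute:
  "p * Poly_Mapping.single 0 z = Poly_Mapping.single 0 z * (p :: 'm::monoid_add \<Rightarrow>\<^sub>0 complex)"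
  by (induction p rule: poly_mapping_linear_induct) (auto simp: mult_single algebra_simps)

lemma cscale_mult_left [simp]: "(z *\<^sub>k p) * q = z *\<^sub>k (p * (q :: 'm::monoid_add \<Rightarrow>\<^sub>0 complex))"
  by (simp add: cscale_conv_mult mult.assoc)

lemma cscale_mult_right [simp]: "p * (z *\<^sub>k q) = z *\<^sub>k (p * (q :: 'm::monoid_add \<Rightarrow>\<^sub>0 complex))"
  by (simp add: cscale_conv_mult single_zero_commute mult.assoc [symmetric])

lemma cscale_sum: "z *\<^sub>k (\<Sum>a\<in>B. f a) = (\<Sum>a\<in>B. z *\<^sub>k f a)"
  by (rule formal.scale_sum_right)

lemma keys_cscale: "Poly_Mapping.keys (z *\<^sub>k p) \<subseteq> Poly_Mapping.keys p"
  by (auto simp: in_keys_iff)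

definition lin_ext :: "('k \<Rightarrow> complex) \<Rightarrow> ('k \<Rightarrow>\<^sub>0 complex) \<Rightarrow> complex"
  where "lin_ext f p = (\<Sum>k\<in>Poly_Mapping.keys p. Poly_Mapping.lookup p k * f k)"

lemma lin_ext_superset:
  "finite B \<Longrightarrow> Poly_Mapping.keys p \<subseteq> B \<Longrightarrow> lin_ext f p = (\<Sum>k\<in>B. Poly_Mapping.lookup p k * f k)"
  unfolding lin_ext_def by (rule sum.mono_neutral_left) (auto simp: in_keys_iff)

lemma lin_ext_add [simp]: "lin_ext f (p + q) = lin_ext f p + lin_ext f q"
  using keys_add[of p q]
  by (simp add: lin_ext_superset[of "Poly_Mapping.keys p \<union> Poly_Mapping.keys q"] lookup_add
      algebra_simps sum.distrib)

lemma lin_ext_cscale [simp]: "lin_ext f (z *\<^sub>k p) = z * lin_ext f p"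
  using keys_cscale[of z p]
  by (simp add: lin_ext_superset[of "Poly_Mapping.keys p"] sum_distrib_left mult.assoc)

lemma lin_ext_single [simp]: "lin_ext f (Poly_Mapping.single k c) = c * f k"
  by (simp add: lin_ext_def)

lemma lin_ext_zero [simp]: "lin_ext f 0 = 0"
  by (simp add: lin_ext_def)

lemma lin_ext_diff: "lin_ext f (p - q) = lin_ext f p - lin_ext f q"
  using lin_ext_add[of f "p - q" q] by simp

lemma alg_ext_superset:
  "finite B \<Longrightarrow> Poly_Mapping.keys p \<subseteq> B \<Longrightarrow>
    alg_ext f p = (\<Sum>w\<in>B. Poly_Mapping.lookup p w *\<^sub>k prod_list (map f w))"
  unfolding alg_ext_def by (rule sum.mono_neutral_left) (auto simp: in_keys_iff)

lemma alg_ext_add [simp]: "alg_ext f (p + q) = alg_ext f p + alg_ext f q"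
  using keys_add[of p q]
  by (simp add: alg_ext_superset[of "Poly_Mapping.keys p \<union> Poly_Mapping.keys q"] lookup_add
      formal.scale_left_distrib sum.distrib)

lemma alg_ext_cscale [simp]: "alg_ext f (z *\<^sub>k p) = z *\<^sub>k alg_ext f p"
  using keys_cscale[of z p]
  by (simp add: alg_ext_superset[of "Poly_Mapping.keys p"] cscale_sum)

lemma alg_ext_single [simp]: "alg_ext f (Poly_Mapping.single w c) = c *\<^sub>k prod_list (map f w)"
  by (simp add: alg_ext_def)

lemma alg_ext_zero [simp]: "alg_ext f 0 = 0"
  by (simp add: alg_ext_def)

lemma alg_ext_one [simp]: "alg_ext f 1 = 1"
proof -
  have "alg_ext f (Poly_Mapping.single [] 1) = 1" by simp
  then show ?thesis by (metis single_one zero_list_def)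
qed

lemma alg_ext_letter [simp]: "alg_ext f (letter a) = f a"
  by (simp add: letter_def)

lemma alg_ext_sum [simp]: "alg_ext f (\<Sum>a\<in>B. g a) = (\<Sum>a\<in>B. alg_ext f (g a))"
  by (induction B rule: infinite_finite_induct) auto

lemma alg_ext_uminus [simp]: "alg_ext f (- p) = - alg_ext f p"
  using alg_ext_add[of f p "- p"] by (simp add: eq_neg_iff_add_eq_0 add.commute)

lemma alg_ext_diff [simp]: "alg_ext f (p - q) = alg_ext f p - alg_ext f q"
  using alg_ext_add[of f p "- q"] by simp

lemma alg_ext_mult [simp]: "alg_ext f (p * q) = alg_ext f p * alg_ext f q"
proof (induction p rule: poly_mapping_linear_induct)
  case (single v c)
  show ?case
    by (induction q rule: poly_mapping_linear_induct)
      (auto simp: mult_single plus_list_def algebra_simps)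
qed (simp add: algebra_simps)

lemma letter_mult_single:
  "Poly_Mapping.single (a # w) 1 = letter a * (Poly_Mapping.single w 1 :: 'a list \<Rightarrow>\<^sub>0 complex)"
  by (simp add: letter_def mult_single plus_list_def)

lemma single_Nil_one: "Poly_Mapping.single [] 1 = (1 :: 'a list \<Rightarrow>\<^sub>0 complex)"
  by (metis single_one zero_list_def)

definition words :: "'a set \<Rightarrow> ('a list \<Rightarrow>\<^sub>0 complex) set"
  where "words A = {p. \<forall>w\<in>Poly_Mapping.keys p. set w \<subseteq> A}"

lemma words_zero: "0 \<in> words A" and words_one: "1 \<in> words A"
  and words_letter: "a \<in> A \<Longrightarrow> letter a \<in> words A"
  and words_uminus: "p \<in> words A \<Longrightarrow> - p \<in> words A"
  by (auto simp: words_def letter_def zero_list_def in_keys_iff)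

lemma words_mono: "A \<subseteq> B \<Longrightarrow> words A \<subseteq> words B"
  by (auto simp: words_def)

lemma words_add: "p \<in> words A \<Longrightarrow> q \<in> words A \<Longrightarrow> p + q \<in> words A"
  using keys_add[of p q] by (auto simp: words_def)

lemma words_cscale: "p \<in> words A \<Longrightarrow> z *\<^sub>k p \<in> words A"
  using keys_cscale[of z p] by (auto simp: words_def)

lemma words_mult:
  assumes "p \<in> words A" "q \<in> words A"
  shows "p * q \<in> words A"
proof -
  have "set w \<subseteq> A" if w: "w \<in> Poly_Mapping.keys (p * q)" for w
  proof -
    obtain a b where "w = a + b" "a \<in> Poly_Mapping.keys p" "b \<in> Poly_Mapping.keys q"
      using keys_mult[of p q] w by blast
    then show ?thesis using assms unfolding words_def by (simp add: plus_list_def)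
  qed
  then show ?thesis unfolding words_def by blast
qed

text \<open>Words are built by putting one letter at a time in front, so a property of products has
  to be checked only for a letter as left factor. The membership hypotheses keep the induction
  inside the subalgebra generated by \<open>A\<close>.\<close>

lemma words_induct [consumes 1, case_names zero one letter add scale]:
  assumes p: "p \<in> words A" and zero: "Q 0" and one: "Q 1"
    and letter: "\<And>a p. a \<in> A \<Longrightarrow> p \<in> words A \<Longrightarrow> Q p \<Longrightarrow> Q (letter a * p)"
    and add: "\<And>p p'. p \<in> words A \<Longrightarrow> p' \<in> words A \<Longrightarrow> Q p \<Longrightarrow> Q p' \<Longrightarrow> Q (p + p')"
    and scale: "\<And>z p. p \<in> words A \<Longrightarrow> Q p \<Longrightarrow> Q (z *\<^sub>k p)"
  shows "Q p"
proof -
  from p have "\<forall>w\<in>Poly_Mapping.keys p. set w \<subseteq> A" by (simp add: words_def)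
  then show ?thesis
  proof (induction p rule: poly_mapping_keys_induct)
    case (single w z)
    have w: "Poly_Mapping.single w 1 \<in> words A" if "set w \<subseteq> A" for w using that by (simp add: words_def)
    have "Q (Poly_Mapping.single w 1)"
      using single
    proof (induction w)
      case Nil
      show ?case using one by (simp add: single_Nil_one)
    next
      case (Cons a w)
      have "a \<in> A" "set w \<subseteq> A" using Cons.prems by auto
      then show ?case unfolding letter_mult_single using Cons.IH by (intro letter w)
    qed
    from scale[OF w[OF single] this, of z] show ?case by simp
  qed (use zero add in \<open>auto simp: words_def\<close>)
qed

subsection \<open>The Hopf algebra homomorphism\<close>

lemma lookup_tensor [simp]:
  "Poly_Mapping.lookup (tensor p q) (v, w) = Poly_Mapping.lookup p v * Poly_Mapping.lookup q w"
proof -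
  have "Poly_Mapping.lookup (tensor p q) (v, w) =
     (\<Sum>v'\<in>Poly_Mapping.keys p. if v' = v then (\<Sum>w'\<in>Poly_Mapping.keys q.
        if w' = w then Poly_Mapping.lookup p v' * Poly_Mapping.lookup q w' else 0) else 0)"
    unfolding tensor_def lookup_sum
    by (intro sum.cong refl) (auto simp: lookup_single when_def intro!: sum.neutral)
  also have "\<dots> = Poly_Mapping.lookup p v * Poly_Mapping.lookup q w"
    by (simp add: not_in_keys_iff_lookup_eq_zero)
  finally show ?thesis .
qed

lemma tensor_add_left: "tensor (p + q) s = tensor p s + tensor q s"
  by (rule poly_mapping_eqI) (auto simp: lookup_add algebra_simps)

lemma tensor_add_right: "tensor s (p + q) = tensor s p + tensor s q"
  by (rule poly_mapping_eqI) (auto simp: lookup_add algebra_simps)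

lemma tensor_single: "tensor (Poly_Mapping.single v a) (Poly_Mapping.single w b)
    = Poly_Mapping.single (v, w) (a * b)"
  by (rule poly_mapping_eqI) (auto simp: lookup_single when_def split: if_splits)

lemma tensor_cscale_left: "tensor (z *\<^sub>k p) q = z *\<^sub>k tensor p q"
  by (rule poly_mapping_eqI) auto

lemma tensor_cscale_right: "tensor p (z *\<^sub>k q) = z *\<^sub>k tensor p q"
  by (rule poly_mapping_eqI) auto

lemma tensor_mult:
  fixes p p' :: "'m::monoid_add \<Rightarrow>\<^sub>0 complex" and q q' :: "'n::monoid_add \<Rightarrow>\<^sub>0 complex"
  shows "tensor p q * tensor p' q' = tensor (p * p') (q * q')"
proof (induction p rule: poly_mapping_linear_induct)
  case (single v a)
  show ?case
  proof (induction q rule: poly_mapping_linear_induct)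
    case (single w b)
    show ?case
    proof (induction p' rule: poly_mapping_linear_induct)
      case (single v' a')
      show ?case
        by (induction q' rule: poly_mapping_linear_induct)
          (simp_all add: tensor_single mult_single plus_prod_def algebra_simps tensor_add_right
            tensor_add_left)
    qed (simp add: algebra_simps tensor_add_right tensor_add_left)
  qed (simp add: algebra_simps tensor_add_right tensor_add_left)
qed (simp add: algebra_simps tensor_add_right tensor_add_left)

lemma tensor_map_superset:
  assumes "finite B" "Poly_Mapping.keys t \<subseteq> B"
  shows "tensor_map f g t = (\<Sum>vw\<in>B. Poly_Mapping.lookup t vw *\<^sub>k
      tensor (f (Poly_Mapping.single (fst vw) 1)) (g (Poly_Mapping.single (snd vw) 1)))"
  unfolding tensor_map_def split_beta
  using assms by (intro sum.mono_neutral_cong_left) (auto simp: in_keys_iff)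

lemma tensor_map_add: "tensor_map f g (s + t) = tensor_map f g s + tensor_map f g t"
  using keys_add[of s t]
  by (simp add: tensor_map_superset[of "Poly_Mapping.keys s \<union> Poly_Mapping.keys t"] lookup_add
      formal.scale_left_distrib sum.distrib)

lemma tensor_map_single: "tensor_map f g (Poly_Mapping.single (v, w) c)
    = c *\<^sub>k tensor (f (Poly_Mapping.single v 1)) (g (Poly_Mapping.single w 1))"
  by (simp add: tensor_map_def)

lemma tensor_map_sum: "finite B \<Longrightarrow> tensor_map f g (\<Sum>a\<in>B. h a) = (\<Sum>a\<in>B. tensor_map f g (h a))"
  by (induction B rule: finite_induct) (simp_all add: tensor_map_add, simp add: tensor_map_def)

lemma tensor_map_tensor:
  "tensor_map (alg_ext f) (alg_ext g) (tensor p q) = tensor (alg_ext f p) (alg_ext g q)"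
proof (induction p rule: poly_mapping_linear_induct)
  case (single v a)
  show ?case
    by (induction q rule: poly_mapping_linear_induct)
      (simp_all add: tensor_single tensor_map_single tensor_cscale_left tensor_cscale_right
        tensor_add_right tensor_map_add)
qed (simp add: tensor_add_left tensor_map_add)

lemma tensor_map_mult:
  "tensor_map (alg_ext f) (alg_ext g) (s * t)
    = tensor_map (alg_ext f) (alg_ext g) s * tensor_map (alg_ext f) (alg_ext g) t"
proof (induction s rule: poly_mapping_linear_induct)
  case (single vw c)
  show ?case
  proof (induction t rule: poly_mapping_linear_induct)
    case (single vw' c')
    obtain v w v' w' where [simp]: "vw = (v, w)" "vw' = (v', w')" by fastforce
    show ?case
      by (simp add: mult_single tensor_map_single tensor_mult plus_list_def)
  qed (simp add: algebra_simps tensor_map_add)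
qed (simp add: algebra_simps tensor_map_add)

lemma tensor_map_cscale: "tensor_map f g (z *\<^sub>k t) = z *\<^sub>k tensor_map f g t"
  using keys_cscale[of z t]
  by (simp add: tensor_map_superset[of "Poly_Mapping.keys t"] cscale_sum)

lemma tensor_one: "tensor 1 1 = (1 :: 'm::monoid_add \<times> 'n::monoid_add \<Rightarrow>\<^sub>0 complex)"
  using tensor_single[of 0 1 0 1] by (simp add: zero_prod_def [symmetric])

lemma tensor_map_mr_to_sym:
  "tensor_map mr_to_sym mr_to_sym (tensor p q) = tensor (mr_to_sym p) (mr_to_sym q)"
  unfolding mr_to_sym_def by (rule tensor_map_tensor)

lemma mr_to_sym_S [simp]: "mr_to_sym (S j i) = S j 1"
  by (auto simp: mr_to_sym_def S_def)

lemma comult_S: "comult (S n k) = (\<Sum>i=0..n. tensor (S i k) (S (n - i) k))"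
  by (auto simp: S_def comult_def tensor_one)

text \<open>Both sides are algebra homomorphisms in \<open>p\<close>, so it suffices to compare them
  on letters; there both are the coproduct of a complete function with the color replaced by
  1.\<close>

lemma comult_mr_to_sym: "comult (mr_to_sym p) = tensor_map mr_to_sym mr_to_sym (comult p)"
proof (induction p rule: poly_mapping_linear_induct)
  case (single w c)
  have 1: "comult (mr_to_sym (Poly_Mapping.single w 1))
      = tensor_map mr_to_sym mr_to_sym (comult (Poly_Mapping.single w 1))"
  proof (induction w)
    case Nil
    have "Poly_Mapping.single [] 1 = (1 :: mr)" using single_one[where 'a="(nat\<times>nat) list"]
      by (simp add: zero_list_def del: single_one)
    moreover have "tensor_map mr_to_sym mr_to_sym 1 = (1 :: (nat\<times>nat) list \<times> (nat\<times>nat) list \<Rightarrow>\<^sub>0 complex)"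
      using tensor_map_tensor[of "\<lambda>(j, i). S j 1" "\<lambda>(j, i). S j 1" 1 1]
      by (simp add: mr_to_sym_def tensor_one)
    ultimately show ?case by (simp add: mr_to_sym_def comult_def)
  next
    case (Cons a w)
    obtain j i where [simp]: "a = (j, i)" by fastforce
    have "comult (mr_to_sym (letter a)) = (\<Sum>k=0..j. tensor (S k 1) (S (j - k) 1))"
      using comult_S[of j 1] by (simp add: mr_to_sym_def)
    also have "\<dots> = tensor_map mr_to_sym mr_to_sym (\<Sum>k=0..j. tensor (S k i) (S (j - k) i))"
      by (simp add: tensor_map_sum tensor_map_mr_to_sym)
    also have "\<dots> = tensor_map mr_to_sym mr_to_sym (comult (letter a))"
      by (simp add: comult_def)
    finally have a: "comult (mr_to_sym (letter a)) = tensor_map mr_to_sym mr_to_sym (comult (letter a))" .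
    show ?case
      using Cons a unfolding letter_mult_single mr_to_sym_def comult_def
      by (simp only: alg_ext_mult tensor_map_mult)
  qed
  have 2: "Poly_Mapping.single w c = c *\<^sub>k Poly_Mapping.single w 1" by simp
  show ?case
    unfolding 2 using 1 by (simp add: mr_to_sym_def comult_def tensor_map_cscale del: cscale_single alg_ext_single)
next
  case (add p q)
  then show ?case by (simp add: mr_to_sym_def comult_def tensor_map_add)
qed

lemma mr_to_sym_word:
  assumes "\<forall>(j, i)\<in>set w. 1 \<le> j"
  shows "mr_to_sym (Poly_Mapping.single w c) = Poly_Mapping.single (map (\<lambda>(j, i). (j, 1)) w) c"
proof -
  have "prod_list (map (\<lambda>(j, i). S j 1) w) = Poly_Mapping.single (map (\<lambda>(j, i). (j, 1)) w) 1"
    using assms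
  proof (induction w)
    case Nil
    show ?case by (simp, metis single_one zero_list_def)
  next
    case (Cons a w)
    then show ?case by (cases a) (auto simp: S_def letter_mult_single)
  qed
  then show ?thesis by (simp add: mr_to_sym_def)
qed

text \<open>All degrees in \<open>MR r\<close> are positive, so no letter goes to
  \<open>S 0 1 = 1\<close> and words keep their length. This keeps the values in \<open>MR 1\<close>
  and preserves the coefficient of the empty word, which is the counit.\<close>

lemma mr_to_sym_conv_sum:
  assumes "p \<in> MR r"
  shows "mr_to_sym p = (\<Sum>w\<in>Poly_Mapping.keys p.
    Poly_Mapping.single (map (\<lambda>(j, i). (j, 1)) w) (Poly_Mapping.lookup p w))"
proof -
  have "mr_to_sym p = (\<Sum>w\<in>Poly_Mapping.keys p. mr_to_sym (Poly_Mapping.single w (Poly_Mapping.lookup p w)))"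
    by (simp add: mr_to_sym_def alg_ext_def[of _ p])
  also have "\<dots> = (\<Sum>w\<in>Poly_Mapping.keys p.
    Poly_Mapping.single (map (\<lambda>(j, i). (j, 1)) w) (Poly_Mapping.lookup p w))"
    using assms by (intro sum.cong refl mr_to_sym_word) (fastforce simp: MR_def)
  finally show ?thesis .
qed

lemma hopf_hom_mr_to_sym: "hopf_hom r 1 mr_to_sym"
  unfolding hopf_hom_def
proof (intro conjI ballI allI funcsetI)
  fix p assume p: "p \<in> MR r"
  note c = mr_to_sym_conv_sum[OF p]
  show "mr_to_sym p \<in> MR 1"
    unfolding MR_def
  proof safe
    fix w j i assume w: "w \<in> Poly_Mapping.keys (mr_to_sym p)" and ji: "(j, i) \<in> set w"
    obtain v where v: "v \<in> Poly_Mapping.keys p" "w = map (\<lambda>(j, i). (j, 1)) v"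
      using w unfolding c using keys_sum by (fastforce split: if_splits)
    show "1 \<le> j" "1 \<le> i" "i \<le> 1" using v ji p by (fastforce simp: MR_def)+
  qed
  show "counit (mr_to_sym p) = counit p"
    by (simp add: counit_def c lookup_sum lookup_single when_def not_in_keys_iff_lookup_eq_zero)
qed (simp_all add: comult_mr_to_sym, simp_all add: mr_to_sym_def)

subsection \<open>Lagrange interpolation in an algebra\<close>

text \<open>Only powers of the single element \<open>x\<close> occur, so evaluation is
  multiplicative even in a noncommutative algebra, and identities between the
  \<open>lag u r k x\<close> can be proved for complex polynomials.\<close>

definition peval :: "('m::monoid_add \<Rightarrow>\<^sub>0 complex) \<Rightarrow> complex poly \<Rightarrow> 'm \<Rightarrow>\<^sub>0 complex"
  where "peval x p = fold_coeffs (\<lambda>a f. a *\<^sub>k 1 + x * f) p 0"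

lemma peval_0 [simp]: "peval x 0 = 0"
  by (simp add: peval_def)

lemma peval_pCons [simp]: "peval x (pCons a p) = a *\<^sub>k 1 + x * peval x p"
  by (cases "p = 0 \<and> a = 0") (auto simp: peval_def)

lemma peval_add [simp]: "peval x (p + q) = peval x p + peval x q"
  by (induction p q rule: poly_induct2) (simp_all add: formal.scale_left_distrib algebra_simps)

lemma peval_smult [simp]: "peval x (smult z p) = z *\<^sub>k peval x p"
  by (induction p) (simp_all add: formal.scale_right_distrib)

lemma peval_mult [simp]: "peval x (p * q) = peval x p * peval x q"
  by (induction p) (simp_all add: algebra_simps)

lemma peval_prod_list: "peval x (prod_list (map f ls)) = prod_list (map (\<lambda>l. peval x (f l)) ls)"
  by (induction ls) (simp_all add: one_pCons)

lemma peval_sum: "peval x (sum f B) = (\<Sum>b\<in>B. peval x (f b))"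
  by (induction B rule: infinite_finite_induct) simp_all

definition lag_poly :: "(nat \<Rightarrow> complex) \<Rightarrow> nat \<Rightarrow> nat \<Rightarrow> complex poly"
  where "lag_poly u r k = prod_list (map (\<lambda>l. smult (1 / (u k - u l)) [:- u l, 1:]) (filter (\<lambda>l. l \<noteq> k) [1..<Suc r]))"

lemma lag_eq_peval: "lag u r k x = peval x (lag_poly u r k)"
proof -
  have "peval x (smult (1 / (u k - u l)) [:- u l, 1:]) = (1 / (u k - u l)) *\<^sub>k (x - u l *\<^sub>k 1)" for l
  proof -
    have "peval x [:- u l, 1:] = x - u l *\<^sub>k 1" by (simp add: formal.scale_minus_left)
    then show ?thesis by (simp only: peval_smult)
  qed
  then show ?thesis unfolding lag_def lag_poly_def peval_prod_list by simp
qed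

lemma poly_prod_list_map: "poly (prod_list (map f ls)) z = (\<Prod>l\<leftarrow>ls. poly (f l) z)"
  by (induction ls) simp_all

lemma degree_prod_list_linear:
  "(\<forall>l\<in>set ls. degree (f l) \<le> 1) \<Longrightarrow> degree (prod_list (map f ls) :: complex poly) \<le> length ls"
proof (induction ls)
  case (Cons l ls)
  have "degree (f l * prod_list (map f ls)) \<le> degree (f l) + degree (prod_list (map f ls))" by (rule degree_mult_le)
  also have "\<dots> \<le> 1 + length ls" using Cons by (intro add_mono) auto
  finally show ?case by simp
qed simp

text \<open>For \<open>m\<close> different from \<open>k\<close> the factor with
  \<open>l = m\<close> vanishes, and for \<open>m = k\<close> every factor is 1 because
  \<open>u\<close> is injective: the interpolation property at the nodes.\<close>

lemma lag_scalar:
  fixes u :: "nat \<Rightarrow> complex"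
  assumes "inj_on u {1..r}" "k \<in> {1..r}" "m \<in> {1..r}"
  shows "(\<Prod>l\<leftarrow>filter (\<lambda>l. l \<noteq> k) [1..<Suc r]. (1 / (u k - u l)) * (u m - u l)) = (if m = k then 1 else 0)"
proof (cases "m = k")
  case True
  have ne: "u k \<noteq> u l" if "l \<in> set (filter (\<lambda>l. l \<noteq> k) [1..<Suc r])" for l
    using inj_onD[OF assms(1), of k l] assms(2) that by (auto simp del: upt_Suc)
  then have "map (\<lambda>l. (1 / (u k - u l)) * (u m - u l)) (filter (\<lambda>l. l \<noteq> k) [1..<Suc r])
      = map (\<lambda>l. 1) (filter (\<lambda>l. l \<noteq> k) [1..<Suc r])"
  proof (intro map_cong refl)
    fix l assume "l \<in> set (filter (\<lambda>l. l \<noteq> k) [1..<Suc r])"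
    from ne[OF this] have "u k - u l \<noteq> 0" by simp
    then show "(1 / (u k - u l)) * (u m - u l) = 1" using True by simp
  qed
  then show ?thesis using True by (simp add: map_replicate_const del: upt_Suc)
next
  case False
  then have "0 \<in> set (map (\<lambda>l. (1 / (u k - u l)) * (u m - u l)) (filter (\<lambda>l. l \<noteq> k) [1..<Suc r]))"
    using assms(3) by (auto simp: image_iff intro!: bexI[of _ m] simp del: upt_Suc)
  then show ?thesis using False by (simp add: prod_list_zero_iff)
qed

text \<open>Both sides come from polynomials of degree less than \<open>r\<close> that agree at the
  \<open>r\<close> nodes. Hence the identity holds for every \<open>x\<close>, already in the free
  algebra.\<close>

lemma sum_lag:
  assumes "1 \<le> r" "inj_on u {1..r}"
  shows "(\<Sum>k\<in>{1..r}. lag u r k x) = 1"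
proof -
  have "(\<Sum>k\<in>{1..r}. lag_poly u r k) = 1"
  proof (rule poly_eqI_degree[where A = "u ` {1..r}"])
    have "degree (lag_poly u r k) \<le> r - 1" if "k \<in> {1..r}" for k
    proof -
      have "degree (lag_poly u r k) \<le> length (filter (\<lambda>l. l \<noteq> k) [1..<Suc r])"
        unfolding lag_poly_def by (rule degree_prod_list_linear) simp
      also have "\<dots> = card ({1..r} - {k})"
        by (subst distinct_card[symmetric]) (auto intro: arg_cong[of _ _ card] simp del: upt_Suc)
      also have "\<dots> = r - 1" using that by simp
      finally show ?thesis .
    qed
    then have "degree (\<Sum>k\<in>{1..r}. lag_poly u r k) \<le> r - 1" by (intro degree_sum_le) auto
    then show "degree (\<Sum>k\<in>{1..r}. lag_poly u r k) < card (u ` {1..r})" using assms by (simp add: card_image)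
    show "degree (1 :: complex poly) < card (u ` {1..r})" using assms by (simp add: card_image)
  next
    fix z assume "z \<in> u ` {1..r}"
    then obtain m where m: "m \<in> {1..r}" "z = u m" by blast
    have "poly (lag_poly u r k) z = (if m = k then 1 else 0)" if "k \<in> {1..r}" for k
    proof -
      have "poly (smult (1 / (u k - u l)) [:- u l, 1:]) (u m) = (1 / (u k - u l)) * (u m - u l)" for l
        by (simp add: diff_divide_distrib)
      then show ?thesis
        unfolding m(2) lag_scalar[OF assms(2) that m(1), symmetric] lag_poly_def poly_prod_list_map by (simp only:)
    qed
    then show "poly (\<Sum>k\<in>{1..r}. lag_poly u r k) z = poly 1 z" using m by (simp add: poly_sum)
  qed
  then have "(\<Sum>k\<in>{1..r}. peval x (lag_poly u r k)) = peval x 1" by (metis peval_sum)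
  then show ?thesis by (simp add: lag_eq_peval one_pCons)
qed

lemma prod_list_remove_commuting:
  fixes y :: "nat \<Rightarrow> 'm::monoid_add \<Rightarrow>\<^sub>0 complex"
  assumes "\<And>l m. y l * y m = y m * y l" "distinct ls" "k \<in> set ls"
  shows "y k * prod_list (map y (filter (\<lambda>l. l \<noteq> k) ls)) = prod_list (map y ls)"
  using assms(2,3)
proof (induction ls)
  case (Cons l ls)
  show ?case
  proof (cases "l = k")
    case True
    then have "filter (\<lambda>l. l \<noteq> k) ls = ls" using Cons.prems by (auto simp: filter_id_conv)
    then show ?thesis using True by simp
  next
    case False
    have "y k * (y l * P) = y l * (y k * P)" for P by (metis assms(1) mult.assoc)
    then show ?thesis using False Cons by simp
  qed
qed simp

lemma prod_list_cscale:
  "prod_list (map (\<lambda>l. z l *\<^sub>k (y l :: 'm::monoid_add \<Rightarrow>\<^sub>0 complex)) ls) = (\<Prod>l\<leftarrow>ls. z l) *\<^sub>k prod_list (map y ls)"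
  by (induction ls) simp_all

text \<open>Multiplication by \<open>x - u k *\<^sub>k 1\<close> supplies the one factor that is
  missing in the Lagrange polynomial, and the denominators make up \<open>z\<close>. Modulo the
  relations the right-hand side becomes 0.\<close>

lemma lag_annihilate:
  assumes "k \<in> {1..r}"
  shows "\<exists>z. (x - u k *\<^sub>k 1) * lag u r k x = z *\<^sub>k prod_list (map (\<lambda>l. x - u l *\<^sub>k 1) [1..<Suc r])"
proof -
  let ?y = "\<lambda>l. x - u l *\<^sub>k 1"
  have "?y l * ?y m = ?y m * ?y l" for l m by (simp add: algebra_simps)
  from prod_list_remove_commuting[of ?y "[1..<Suc r]" k, OF this]
  have "?y k * prod_list (map ?y (filter (\<lambda>l. l \<noteq> k) [1..<Suc r])) = prod_list (map ?y [1..<Suc r])"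
    using assms by auto
  then show ?thesis unfolding lag_def prod_list_cscale by (metis cscale_mult_right)
qed

hide_const (open) Polynomial.smult

subsection \<open>Compositions and descent sets\<close>

lemma Des_Nil [simp]: "Des [] = {}" and Des_single [simp]: "Des [a] = {}"
  by (auto simp: Des_def)

lemma Des_Cons:
  assumes "I \<noteq> []"
  shows "Des (a # I) = insert a ((+) a ` Des I)"
proof (intro equalityI subsetI)
  fix x assume "x \<in> Des (a # I)"
  then obtain k where k: "1 \<le> k" "k < length (a # I)" "x = sum_list (take k (a # I))"
    by (auto simp: Des_def)
  then obtain k' where [simp]: "k = Suc k'" by (cases k) auto
  show "x \<in> insert a ((+) a ` Des I)"
    using k by (cases "k' = 0") (auto simp: Des_def intro!: imageI)
next
  fix x assume "x \<in> insert a ((+) a ` Des I)"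
  then consider "x = a" | k where "1 \<le> k" "k < length I" "x = a + sum_list (take k I)"
    by (auto simp: Des_def)
  then show "x \<in> Des (a # I)"
  proof cases
    case 1
    then show ?thesis using assms by (auto simp: Des_def intro!: exI[of _ 1])
  next
    case 2
    then show ?thesis by (auto simp: Des_def intro!: exI[of _ "Suc k"])
  qed
qed

lemma Des_glue:
  assumes "I \<noteq> []"
  shows "Des ((a + hd I) # tl I) = (+) a ` Des I"
proof -
  obtain b J where [simp]: "I = b # J" using assms by (cases I) auto
  show ?thesis by (cases "J = []") (auto simp: Des_Cons image_image add.assoc)
qed

lemma Des_pos: "\<forall>i\<in>set I. 1 \<le> i \<Longrightarrow> x \<in> Des I \<Longrightarrow> 1 \<le> x"
proof -
  assume pos: "\<forall>i\<in>set I. 1 \<le> i" and "x \<in> Des I"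
  then obtain k where k: "1 \<le> k" "k < length I" "x = sum_list (take k I)" by (auto simp: Des_def)
  then obtain a J k' where "I = a # J" "k = Suc k'" by (cases I; cases k) auto
  then show "1 \<le> x" using pos k by simp
qed

lemma Des_subset: "composition n I \<Longrightarrow> Des I \<subseteq> {1..<n}"
proof (induction I arbitrary: n)
  case (Cons a I)
  show ?case
  proof (cases "I = []")
    case False
    have "Des I \<subseteq> {1..<n - a}" using Cons by (intro Cons.IH) (auto simp: composition_def)
    moreover have "0 < sum_list I" using False Cons.prems by (cases I) (auto simp: composition_def)
    ultimately show ?thesis using False Cons.prems by (fastforce simp: Des_Cons composition_def)
  qed simp
qed simp

lemma Des_inj:
  "composition n I \<Longrightarrow> composition n J \<Longrightarrow> Des I = Des J \<Longrightarrow> I = J"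
proof (induction I arbitrary: n J)
  case Nil
  then show ?case by (cases J) (auto simp: composition_def)
next
  case (Cons a I)
  then obtain b J' where [simp]: "J = b # J'" by (cases J) (auto simp: composition_def)
  have pos: "\<forall>i\<in>set I. 1 \<le> i" "\<forall>i\<in>set J'. 1 \<le> i" using Cons.prems by (auto simp: composition_def)
  show ?case
  proof (cases "I = [] \<or> J' = []")
    case True
    then have "I = [] \<and> J' = []" using Cons.prems(3) by (auto simp: Des_Cons split: if_splits)
      (metis Des_Cons Des_single insert_not_empty)+
    then show ?thesis using Cons.prems by (auto simp: composition_def)
  next
    case False
    then have D: "insert a ((+) a ` Des I) = insert b ((+) b ` Des J')"
      using Cons.prems(3) by (simp add: Des_Cons)
    \<comment> \<open>The first part is the least element of either set: the membership of
      \<open>a\<close> gives b \<le> a, and that of \<open>b\<close> gives a \<le> b.\<close>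
    have "a \<in> insert b ((+) b ` Des J')" "b \<in> insert a ((+) a ` Des I)" using D by blast+
    then have [simp]: "b = a" by auto
    have "Des I = Des J'"
    proof (rule Set.set_eqI)
      fix x
      show "x \<in> Des I \<longleftrightarrow> x \<in> Des J'"
        using D Des_pos[OF pos(1), of x] Des_pos[OF pos(2), of x]
        by (auto simp: set_eq_iff dest!: spec[of _ "a + x"])
    qed
    then show ?thesis using Cons.prems Cons.IH[of "n - a" J'] by (auto simp: composition_def)
  qed
qed

lemma Des_surj: "D \<subseteq> {1..<n} \<Longrightarrow> \<exists>I. composition n I \<and> Des I = D"
proof (induction n arbitrary: D rule: less_induct)
  case (less n)
  have fin: "finite D" using less.prems finite_subset by blast
  consider "n = 0" | "n \<noteq> 0" "D = {}" | "n \<noteq> 0" "D \<noteq> {}" by blast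
  then show ?case
  proof cases
    case 1
    then show ?thesis using less.prems by (intro exI[of _ "[]"]) (auto simp: composition_def)
  next
    case 2
    then show ?thesis by (intro exI[of _ "[n]"]) (auto simp: composition_def)
  next
    case 3
    \<comment> \<open>The smallest element of \<open>D\<close> has to be the first part; the other
      descents are shifted by it and handled by induction.\<close>
    define a where "a = Min D"
    have a: "a \<in> D" "\<And>x. x \<in> D \<Longrightarrow> a \<le> x" using fin 3 by (auto simp: a_def)
    then have a': "1 \<le> a" "a < n" using less.prems by auto
    define D' where "D' = {d. 0 < d \<and> a + d \<in> D}"
    have "D' \<subseteq> {1..<n - a}" using less.prems by (fastforce simp: D'_def)
    then obtain I where I: "composition (n - a) I" "Des I = D'" using less.IH[of "n - a" D'] a' by auto
    have "I \<noteq> []" using I(1) a' by (auto simp: composition_def)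
    then have "Des (a # I) = D" using a I(2) by (force simp: Des_Cons D'_def image_iff le_Suc_ex
          dest: le_Suc_ex)
    then show ?thesis using I(1) a' by (intro exI[of _ "a # I"]) (auto simp: composition_def)
  qed
qed

lemma finite_compositions: "finite {I. composition n I}"
proof (rule finite_imageD)
  show "finite (Des ` {I. composition n I})"
    by (rule finite_subset[of _ "Pow {1..<n}"]) (use Des_subset in auto)
  show "inj_on Des {I. composition n I}" by (auto intro: inj_onI Des_inj)
qed

lemma the_composition:
  assumes "D \<subseteq> {1..<n}"
  shows "composition n (THE I. composition n I \<and> Des I = D)"
    "Des (THE I. composition n I \<and> Des I = D) = D"
proof -
  have "\<exists>!I. composition n I \<and> Des I = D" using Des_surj[OF assms] Des_inj by blast
  from theI'[OF this] show "composition n (THE I. composition n I \<and> Des I = D)"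
    "Des (THE I. composition n I \<and> Des I = D) = D" by auto
qed

lemma phi_simps:
  assumes "composition n K"
  shows "snd (phi n (K, c)) = c" "composition n (fst (phi n (K, c)))"
    "Des (fst (phi n (K, c))) = {j \<in> Des K. col c j = col c (j + 1)}
        \<union> {j \<in> {1..<n}. j \<notin> Des K \<and> col c j \<noteq> col c (j + 1)}"
proof -
  have "{j \<in> Des K. col c j = col c (j + 1)}
        \<union> {j \<in> {1..<n}. j \<notin> Des K \<and> col c j \<noteq> col c (j + 1)} \<subseteq> {1..<n}"
    using Des_subset[OF assms] by auto
  note * = the_composition[OF this]
  show "snd (phi n (K, c)) = c" "composition n (fst (phi n (K, c)))"
    "Des (fst (phi n (K, c))) = {j \<in> Des K. col c j = col c (j + 1)}
        \<union> {j \<in> {1..<n}. j \<notin> Des K \<and> col c j \<noteq> col c (j + 1)}"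
    using * by (simp_all add: phi_def)
qed

text \<open>Where two neighboring colors agree \<open>phi\<close> keeps the descent status, and
  where they differ it complements it, so applying it twice changes nothing. The simple quotient
  attached to \<open>(K, c)\<close> is defined by applying \<open>phi\<close> twice, so its
  \<open>T\<close> values are given by the descents of \<open>K\<close> itself.\<close>

lemma Des_phi_phi:
  assumes "composition n K"
  shows "Des (fst (phi n (phi n (K, c)))) = Des K"
proof -
  obtain K' where K': "phi n (K, c) = (K', c)"
    using phi_simps(1)[OF assms, of c] by (metis prod.collapse)
  have c': "composition n K'" and D: "Des K' = {j \<in> Des K. col c j = col c (j + 1)}
        \<union> {j \<in> {1..<n}. j \<notin> Des K \<and> col c j \<noteq> col c (j + 1)}"
    using phi_simps[OF assms, of c] unfolding K' by auto
  show ?thesis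
    unfolding K' phi_simps(3)[OF c'] D using Des_subset[OF assms] by auto
qed

subsection \<open>Colored ribbons\<close>

definition monochromatic :: "(nat \<times> nat) list \<Rightarrow> bool"
  where "monochromatic g \<longleftrightarrow> g \<noteq> [] \<and> (\<forall>x\<in>set g. snd x = snd (hd g))"

lemma monochromatic_Cons:
  "monochromatic (x # g) \<longleftrightarrow> g = [] \<or> monochromatic g \<and> snd (hd g) = snd x"
  unfolding monochromatic_def by (cases g) auto

lemma coarser_alt_def: "coarser J L \<longleftrightarrow> (\<exists>gs. concat gs = L \<and> (\<forall>g\<in>set gs. monochromatic g) \<and>
    J = map (\<lambda>g. (sum_list (map fst g), snd (hd g))) gs)"
  unfolding coarser_def monochromatic_def ..

lemma coarser_Nil [simp]: "coarser J [] \<longleftrightarrow> J = []"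
proof
  assume "coarser J []"
  then obtain gs where "concat gs = []" "\<forall>g\<in>set gs. monochromatic g"
    "J = map (\<lambda>g. (sum_list (map fst g), snd (hd g))) gs"
    unfolding coarser_alt_def by blast
  then show "J = []" by (cases gs) (auto simp: monochromatic_def)
qed (simp add: coarser_refl)

lemma coarser_not_Nil: "coarser J L \<Longrightarrow> L \<noteq> [] \<Longrightarrow> J \<noteq> []"
  unfolding coarser_alt_def by auto

text \<open>The group containing the first part is either this part alone, or it is the first group
  of a coarsening of the tail, of the same color, enlarged by this part. This replaces the groupings
  in \<open>coarser\<close> by a recursion on the list.\<close>

lemma coarser_Cons:
  "coarser J ((a, i) # L) \<longleftrightarrow>
    (\<exists>J'. J = (a, i) # J' \<and> coarser J' L) \<or> (\<exists>b J'. J = (a + b, i) # J' \<and> coarser ((b, i) # J') L)"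
  (is "_ \<longleftrightarrow> ?A \<or> ?B")
proof
  assume "coarser J ((a, i) # L)"
  then obtain gs where gs: "concat gs = (a, i) # L" "\<forall>g\<in>set gs. monochromatic g"
    "J = map (\<lambda>g. (sum_list (map fst g), snd (hd g))) gs"
    unfolding coarser_alt_def by blast
  from gs(1,2) obtain g0 gs' where g0: "gs = g0 # gs'" "g0 \<noteq> []"
    by (cases gs) (auto simp: monochromatic_def)
  then obtain g where [simp]: "gs = ((a, i) # g) # gs'" using gs(1) by (cases g0) auto
  show "?A \<or> ?B"
  proof (cases "g = []")
    case True
    have "coarser (tl J) L" unfolding coarser_alt_def using gs True by (intro exI[of _ gs']) simp
    then show ?thesis using gs(3) True by simp
  next
    case False
    then have hd: "snd (hd g) = i" "monochromatic g" using gs(2) by (auto simp: monochromatic_Cons)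
    have "coarser ((sum_list (map fst g), i) # tl J) L"
      unfolding coarser_alt_def using gs hd False by (intro exI[of _ "g # gs'"]) simp
    then have "?B" using gs(3) by (intro exI[of _ "sum_list (map fst g)"] exI[of _ "tl J"]) simp
    then show ?thesis ..
  qed
next
  assume "?A \<or> ?B"
  then show "coarser J ((a, i) # L)"
  proof (elim disjE exE conjE)
    fix J' assume "J = (a, i) # J'" "coarser J' L"
    then obtain gs where "concat gs = L" "\<forall>g\<in>set gs. monochromatic g"
      "J' = map (\<lambda>g. (sum_list (map fst g), snd (hd g))) gs"
      unfolding coarser_alt_def by blast
    then show ?thesis unfolding coarser_alt_def
      using \<open>J = (a, i) # J'\<close> by (intro exI[of _ "[(a, i)] # gs"]) (simp add: monochromatic_Cons)
  next
    fix b J' assume J: "J = (a + b, i) # J'" "coarser ((b, i) # J') L"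
    from J(2) obtain gs where gs: "concat gs = L" "\<forall>g\<in>set gs. monochromatic g"
      "(b, i) # J' = map (\<lambda>g. (sum_list (map fst g), snd (hd g))) gs"
      unfolding coarser_alt_def by (elim exE conjE) (rule that)
    then obtain g gs' where [simp]: "gs = g # gs'" by (cases gs) auto
    show ?thesis
      unfolding coarser_alt_def using gs J
      by (intro exI[of _ "((a, i) # g) # gs'"]) (simp add: monochromatic_Cons)
  qed
qed

lemma coarser_pos: "coarser J L \<Longrightarrow> \<forall>x\<in>set L. 1 \<le> fst x \<Longrightarrow> \<forall>x\<in>set J. 1 \<le> fst x"
proof (induction L arbitrary: J)
  case (Cons ai L)
  obtain a i where [simp]: "ai = (a, i)" by fastforce
  have pos: "1 \<le> a" "\<forall>x\<in>set L. 1 \<le> fst x" using Cons.prems by auto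
  from Cons.prems(1) show ?case unfolding \<open>ai = (a, i)\<close> coarser_Cons
  proof (elim disjE exE conjE)
    fix J' assume "J = (a, i) # J'" "coarser J' L"
    then show ?thesis using Cons.IH[of J'] pos by simp
  next
    fix b J' assume "J = (a + b, i) # J'" "coarser ((b, i) # J') L"
    then show ?thesis using Cons.IH[of "(b, i) # J'"] pos by simp
  qed
qed simp

text \<open>The third equation is the product rule for ribbons, \<open>S a i\<close> times a ribbon
  equals the concatenated plus the glued ribbon, solved for the concatenated one; ribbons of
  different colors cannot be glued.\<close>

fun rec_ribbon :: "(nat \<times> nat) list \<Rightarrow> mr"
  where
    "rec_ribbon [] = 1"
  | "rec_ribbon [(a, i)] = S a i"
  | "rec_ribbon ((a, i) # (b, j) # L) = S a i * rec_ribbon ((b, j) # L)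
      - (if i = j then rec_ribbon ((a + b, i) # L) else 0)"

text \<open>The coarsenings of \<open>(a, i) # L\<close> either keep the first part or glue it to a
  coarsening of \<open>L\<close>. The product rule adds the two contributions that belong to one
  coarsening of \<open>L\<close>, and the sum becomes \<open>S a i\<close> times the sum for
  \<open>L\<close>.\<close>

lemma sum_rec_ribbon:
  "\<forall>x\<in>set L. 1 \<le> fst x \<Longrightarrow> (\<Sum>J\<in>{J. coarser J L}. rec_ribbon J) = S_prod L"
proof (induction L)
  case Nil
  show ?case by (simp add: S_prod_def)
next
  case (Cons ai L)
  obtain a i where [simp]: "ai = (a, i)" by fastforce
  show ?case
  proof (cases "L = []")
    case True
    have "{J. coarser J [(a, i)]} = {[(a, i)]}" by (auto simp: coarser_Cons)
    then show ?thesis using True by (simp add: S_prod_def)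
  next
    case False
    let ?C = "{J. coarser J L}" and ?C' = "{J. coarser J L \<and> snd (hd J) = i}"
    let ?g = "\<lambda>J. (a + fst (hd J), i) # tl J"
    have fin: "finite ?C" "finite ?C'" using finite_coarser[of L] by auto
    have C: "{J. coarser J ((a, i) # L)} = Cons (a, i) ` ?C \<union> ?g ` ?C'"
    proof (intro equalityI subsetI)
      fix J assume "J \<in> {J. coarser J ((a, i) # L)}"
      then have "(\<exists>J'. J = (a, i) # J' \<and> coarser J' L)
        \<or> (\<exists>b J'. J = (a + b, i) # J' \<and> coarser ((b, i) # J') L)"
        by (simp only: coarser_Cons mem_Collect_eq)
      then show "J \<in> Cons (a, i) ` ?C \<union> ?g ` ?C'"
      proof (elim disjE exE conjE)
        fix b J' assume "J = (a + b, i) # J'" "coarser ((b, i) # J') L"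
        then show ?thesis by (intro UnI2 image_eqI[of _ _ "(b, i) # J'"]) auto
      qed auto
    next
      fix J assume "J \<in> Cons (a, i) ` ?C \<union> ?g ` ?C'"
      then consider J' where "J = (a, i) # J'" "coarser J' L"
        | J' where "J = ?g J'" "coarser J' L" "snd (hd J') = i" by blast
      then show "J \<in> {J. coarser J ((a, i) # L)}"
      proof cases
        case (2 J')
        then have "J' = (fst (hd J'), i) # tl J'"
          using coarser_not_Nil[OF 2(2) False] by (cases J') auto
        then show ?thesis using 2 unfolding mem_Collect_eq coarser_Cons by metis
      qed (simp add: coarser_Cons)
    qed
    have pos: "J \<noteq> []" "1 \<le> fst (hd J)" if "coarser J L" for J
      using coarser_not_Nil[OF that False] coarser_pos[OF that] Cons.prems by auto
    \<comment> \<open>Parts are positive, so a glued first part is larger than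
      \<open>a\<close>.\<close>
    have disj: "Cons (a, i) ` ?C \<inter> ?g ` ?C' = {}"
      using pos by fastforce
    have inj: "inj_on ?g ?C'"
    proof (rule inj_onI)
      fix J1 J2 assume J: "J1 \<in> ?C'" "J2 \<in> ?C'" "?g J1 = ?g J2"
      then have "J1 \<noteq> []" "J2 \<noteq> []" using pos(1) by auto
      then show "J1 = J2" using J by (cases J1; cases J2) auto
    qed
    have step: "S a i * rec_ribbon J
        = rec_ribbon ((a, i) # J) + (if snd (hd J) = i then rec_ribbon (?g J) else 0)" if J: "coarser J L" for J
    proof -
      obtain b j J' where [simp]: "J = (b, j) # J'" using pos(1)[OF J] by (cases J) auto
      show ?thesis by auto
    qed
    have "(\<Sum>J\<in>{J. coarser J ((a, i) # L)}. rec_ribbon J)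
        = (\<Sum>J\<in>?C. rec_ribbon ((a, i) # J)) + (\<Sum>J\<in>?C'. rec_ribbon (?g J))"
      unfolding C using fin disj inj
      by (subst sum.union_disjoint) (auto simp: sum.reindex inj_on_def)
    also have "(\<Sum>J\<in>?C'. rec_ribbon (?g J)) = (\<Sum>J\<in>?C. if snd (hd J) = i then rec_ribbon (?g J) else 0)"
      using fin by (subst sum.inter_filter [symmetric]) auto
    also have "(\<Sum>J\<in>?C. rec_ribbon ((a, i) # J)) + \<dots> = (\<Sum>J\<in>?C. S a i * rec_ribbon J)"
      unfolding sum.distrib [symmetric] by (rule sum.cong [OF refl]) (use step in simp)
    also have "\<dots> = S_prod (ai # L)"
      using Cons by (simp add: sum_distrib_left [symmetric] S_prod_def)
    finally show ?thesis by simp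
  qed
qed

text \<open>Both families solve the same triangular system that expresses \<open>S_prod L\<close> as
  a sum over coarsenings, and proper coarsenings are shorter.\<close>

lemma ribbon_eq_rec_ribbon: "\<forall>x\<in>set L. 1 \<le> fst x \<Longrightarrow> ribbon L = rec_ribbon L"
proof (induction L rule: measure_induct_rule[of length])
  case (less L)
  have "ribbon L = S_prod L - (\<Sum>J\<in>{J. coarser J L \<and> J \<noteq> L}. rec_ribbon J)"
    unfolding ribbon.simps[of L] using less coarser_length coarser_pos
    by (intro arg_cong2[of _ _ _ _ "(-)"] sum.cong refl) blast
  also have "{J. coarser J L \<and> J \<noteq> L} = {J. coarser J L} - {L}" by auto
  also have "(\<Sum>J\<in>{J. coarser J L} - {L}. rec_ribbon J) = S_prod L - rec_ribbon L"
    using sum_rec_ribbon[OF less.prems] finite_coarser[of L]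
    by (subst sum_diff1) (auto simp: coarser_refl)
  finally show ?case by simp
qed

text \<open>Once colors are forgotten, a place where the color changes behaves like a product, which
  contributes both the concatenated and the glued ribbon. Where the color stays the same only the
  concatenated ribbon remains.\<close>

fun gluings :: "(nat \<times> nat) list \<Rightarrow> nat list list"
  where
    "gluings [] = [[]]"
  | "gluings [(a, i)] = [[a]]"
  | "gluings ((a, i) # (b, j) # L) = map (Cons a) (gluings ((b, j) # L))
      @ (if i = j then [] else map (\<lambda>I. (a + hd I) # tl I) (gluings ((b, j) # L)))"

lemma gluings_not_Nil: "I \<in> set (gluings (x # L)) \<Longrightarrow> I \<noteq> []"
  by (cases "x # L" rule: gluings.cases) (auto split: if_splits)

lemma gluings_add: "gluings ((a + b, i) # L) = map (\<lambda>I. (a + hd I) # tl I) (gluings ((b, i) # L))"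
  by (cases L) (auto simp: add.assoc)

text \<open>The product rule in Sym has two terms. For equal colors the subtracted ribbon of
  \<open>rec_ribbon\<close> cancels the glued one; for different colors nothing is subtracted and
  both survive. These are the two cases of \<open>gluings\<close>.\<close>

lemma mr_to_sym_rec_ribbon:
  "mr_to_sym (rec_ribbon L) = (\<Sum>I\<leftarrow>gluings L. rec_ribbon (map (\<lambda>a. (a, 1)) I))"
proof (induction L rule: rec_ribbon.induct)
  case (3 a i b j L)
  let ?R = "\<lambda>I. rec_ribbon (map (\<lambda>a. (a, 1)) I)"
  have *: "S a 1 * ?R I = ?R (a # I) + ?R ((a + hd I) # tl I)"
    if "I \<in> set (gluings ((b, j) # L))" for I
    using gluings_not_Nil[OF that] by (cases I) auto
  have "S a 1 * mr_to_sym (rec_ribbon ((b, j) # L)) = (\<Sum>I\<leftarrow>gluings ((b, j) # L). S a 1 * ?R I)"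
    using 3(1) by (simp add: sum_list_const_mult)
  also have "\<dots> = (\<Sum>I\<leftarrow>gluings ((b, j) # L). ?R (a # I) + ?R ((a + hd I) # tl I))"
    by (intro arg_cong[of _ _ sum_list] map_cong refl *)
  also have "\<dots> = (\<Sum>I\<leftarrow>gluings ((b, j) # L). ?R (a # I))
      + (\<Sum>I\<leftarrow>gluings ((b, j) # L). ?R ((a + hd I) # tl I))"
    by (rule sum_list_addf)
  finally have s: "S a 1 * mr_to_sym (rec_ribbon ((b, j) # L)) = \<dots>" .
  have m: "mr_to_sym (S a i * p - q) = S a 1 * mr_to_sym p - mr_to_sym q" for p q
    using mr_to_sym_S[of a i] by (simp add: mr_to_sym_def)
  show ?case
  proof (cases "i = j")
    case True
    then have "mr_to_sym (rec_ribbon ((a, i) # (b, j) # L))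
        = S a 1 * mr_to_sym (rec_ribbon ((b, j) # L)) - mr_to_sym (rec_ribbon ((a + b, i) # L))"
      using m by simp
    also have "mr_to_sym (rec_ribbon ((a + b, i) # L))
        = (\<Sum>I\<leftarrow>gluings ((b, j) # L). ?R ((a + hd I) # tl I))"
      using 3(2)[OF True] True by (simp add: gluings_add comp_def)
    finally show ?thesis using True s by (simp add: comp_def)
  next
    case False
    then have "mr_to_sym (rec_ribbon ((a, i) # (b, j) # L)) = S a 1 * mr_to_sym (rec_ribbon ((b, j) # L))"
      using m[of _ 0] by (simp add: mr_to_sym_def)
    then show ?thesis using False s by (simp add: comp_def)
  qed
next
  case 1
  show ?case by (simp add: mr_to_sym_def)
qed simp

section \<open>Descent sets of the uncolored ribbons that occur in the image of a colored
  ribbon\<close>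

definition color_changes :: "(nat \<times> nat) list \<Rightarrow> nat set"
  where "color_changes L = {sum_list (take k (map fst L)) | k. 1 \<le> k \<and> k < length L \<and>
    snd (L ! (k - 1)) \<noteq> snd (L ! k)}"

lemma color_changes_Cons:
  "color_changes ((a, i) # (b, j) # L)
    = (if i = j then {} else {a}) \<union> (+) a ` color_changes ((b, j) # L)"
proof (intro equalityI subsetI)
  fix x assume "x \<in> color_changes ((a, i) # (b, j) # L)"
  then obtain k where k: "1 \<le> k" "k < length ((a, i) # (b, j) # L)"
    "x = sum_list (take k (map fst ((a, i) # (b, j) # L)))"
    "snd (((a, i) # (b, j) # L) ! (k - 1)) \<noteq> snd (((a, i) # (b, j) # L) ! k)"
    unfolding color_changes_def by blast
  then obtain k' where [simp]: "k = Suc k'" by (cases k) auto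
  show "x \<in> (if i = j then {} else {a}) \<union> (+) a ` color_changes ((b, j) # L)"
  proof (cases "k' = 0")
    case False
    then show ?thesis using k unfolding color_changes_def
      by (intro UnI2 image_eqI[of _ _ "sum_list (take k' (map fst ((b, j) # L)))"])
         (auto simp: nth_Cons' intro!: exI[of _ k'])
  qed (use k in auto)
next
  fix x assume "x \<in> (if i = j then {} else {a}) \<union> (+) a ` color_changes ((b, j) # L)"
  then consider "i \<noteq> j" "x = a" | k where "1 \<le> k" "k < length ((b, j) # L)"
    "x = a + sum_list (take k (map fst ((b, j) # L)))"
    "snd (((b, j) # L) ! (k - 1)) \<noteq> snd (((b, j) # L) ! k)"
    by (auto simp: color_changes_def split: if_splits)
  then show "x \<in> color_changes ((a, i) # (b, j) # L)"
  proof cases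
    case 1
    then show ?thesis by (auto simp: color_changes_def intro!: exI[of _ 1])
  next
    case 2
    then show ?thesis unfolding color_changes_def
      by (auto simp: nth_Cons' intro!: exI[of _ "Suc k"])
  qed
qed

lemma color_changes_subset: "color_changes L \<subseteq> Des (map fst L)"
  by (auto simp: color_changes_def Des_def)

lemma gluings_composition:
  "I \<in> set (gluings L) \<Longrightarrow> \<forall>x\<in>set L. 1 \<le> fst x \<Longrightarrow> composition (sum_list (map fst L)) I"
proof (induction L arbitrary: I rule: gluings.induct)
  case (3 a i b j L)
  then obtain I' where I': "I' \<in> set (gluings ((b, j) # L))" "I = a # I' \<or> I = (a + hd I') # tl I'"
    by (auto split: if_splits)
  have "composition (sum_list (map fst ((b, j) # L))) I'"
    using 3(1)[OF I'(1)] 3(4) by simp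
  moreover obtain x I'' where "I' = x # I''" using gluings_not_Nil[OF I'(1)] by (cases I') auto
  ultimately show ?case using I'(2) 3(4) by (auto simp: composition_def)
qed (auto simp: composition_def)

text \<open>Each boundary between parts of different color can be kept or removed independently of
  the others, and all remaining boundaries are kept. Distinctness says that every resulting
  composition has multiplicity one.\<close>

lemma Des_gluings:
  assumes "\<forall>x\<in>set L. 1 \<le> fst x"
  shows "Des ` set (gluings L) = {D. D \<subseteq> Des (map fst L) \<and> Des (map fst L) - D \<subseteq> color_changes L}"
    and "distinct (gluings L)"
proof -
  have "Des ` set (gluings L) = {D. D \<subseteq> Des (map fst L) \<and> Des (map fst L) - D \<subseteq> color_changes L}
    \<and> distinct (gluings L)"
    using assms
  proof (induction L rule: gluings.induct)
    case (3 a i b j L)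
    let ?M = "(b, j) # L"
    let ?X = "{D. D \<subseteq> Des (map fst ?M) \<and> Des (map fst ?M) - D \<subseteq> color_changes ?M}"
    have IH: "Des ` set (gluings ?M) = ?X" "distinct (gluings ?M)" using 3 by auto
    have pos: "x \<in> Des (map fst ?M) \<Longrightarrow> 1 \<le> x" for x
      by (rule Des_pos[of "map fst ?M"]) (use 3(3) in auto)
    have D: "Des (map fst ((a, i) # ?M)) = insert a ((+) a ` Des (map fst ?M))"
      by (simp add: Des_Cons)
    have G1: "Des ` Cons a ` set (gluings ?M) = (\<lambda>D. insert a ((+) a ` D)) ` Des ` set (gluings ?M)"
      unfolding image_image by (intro image_cong refl Des_Cons) (rule gluings_not_Nil)
    have G2: "Des ` (\<lambda>I. (a + hd I) # tl I) ` set (gluings ?M)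
        = (\<lambda>D. (+) a ` D) ` Des ` set (gluings ?M)"
      unfolding image_image by (intro image_cong refl Des_glue) (rule gluings_not_Nil)
    have "Des ` set (gluings ((a, i) # ?M)) = (\<lambda>D. insert a ((+) a ` D)) ` Des ` set (gluings ?M)
        \<union> (if i = j then {} else (\<lambda>D. (+) a ` D) ` Des ` set (gluings ?M))"
      using G1 G2 by (simp add: image_Un)
    also have "\<dots> = {D. D \<subseteq> Des (map fst ((a, i) # ?M)) \<and>
        Des (map fst ((a, i) # ?M)) - D \<subseteq> color_changes ((a, i) # ?M)}" (is "?l = ?r")
    proof (intro equalityI subsetI)
      fix D assume "D \<in> ?l"
      then show "D \<in> ?r"
        unfolding IH D color_changes_Cons by (fastforce split: if_splits dest: pos)
    next
      fix D assume D': "D \<in> ?r"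
      \<comment> \<open>The part of \<open>D\<close> that comes from the tail, shifted back by the
        first part \<open>a\<close>.\<close>
      define D0 where "D0 = {x \<in> Des (map fst ?M). a + x \<in> D}"
      have "x \<in> color_changes ?M" if x: "x \<in> Des (map fst ?M)" "a + x \<notin> D" for x
      proof -
        have "a + x \<in> (if i = j then {} else {a}) \<union> (+) a ` color_changes ?M"
          using D' x unfolding D color_changes_Cons by blast
        then show ?thesis using pos[OF x(1)] by (auto split: if_splits)
      qed
      then have "D0 \<in> ?X" unfolding D0_def by blast
      moreover have "D = insert a ((+) a ` D0) \<or> i \<noteq> j \<and> D = (+) a ` D0"
      proof (cases "a \<in> D")
        case True
        then show ?thesis using D' unfolding D D0_def by auto
      next
        case False
        \<comment> \<open>The missing descent \<open>a\<close> must be a change of color, and it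
          cannot be one of the shifted changes of the tail because these are larger than
          \<open>a\<close>.\<close>
        then have "i \<noteq> j" using D' pos unfolding D color_changes_Cons
          using color_changes_subset[of ?M] by (fastforce split: if_splits)
        moreover have "D = (+) a ` D0" using False D' unfolding D D0_def by auto
        ultimately show ?thesis by simp
      qed
      ultimately show "D \<in> ?l" unfolding IH by auto
    qed
    finally have 1: "Des ` set (gluings ((a, i) # ?M)) = \<dots>" .
    have g: "I \<noteq> []" "1 \<le> hd I" if "I \<in> set (gluings ?M)" for I
    proof -
      show "I \<noteq> []" using gluings_not_Nil[OF that] .
      have "composition (sum_list (map fst ?M)) I" using gluings_composition[OF that] 3(3) by auto
      then show "1 \<le> hd I" using hd_in_set[OF \<open>I \<noteq> []\<close>] unfolding composition_def by blast
    qed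
    have "inj_on (\<lambda>I. (a + hd I) # tl I) (set (gluings ?M))"
    proof (rule inj_onI)
      fix I1 I2 assume I: "I1 \<in> set (gluings ?M)" "I2 \<in> set (gluings ?M)"
        "(a + hd I1) # tl I1 = (a + hd I2) # tl I2"
      then show "I1 = I2" using g(1)[OF I(1)] g(1)[OF I(2)] by (cases I1; cases I2) auto
    qed
    moreover have "inj_on (Cons a) (set (gluings ?M))" by (auto intro: inj_onI)
    moreover have "Cons a ` set (gluings ?M) \<inter> (\<lambda>I. (a + hd I) # tl I) ` set (gluings ?M) = {}"
      using g(2) by fastforce
    ultimately show ?case using 1 IH(2) by (auto simp: distinct_map)
  qed (auto simp: color_changes_def)
  then show "Des ` set (gluings L) = {D. D \<subseteq> Des (map fst L) \<and> Des (map fst L) - D \<subseteq> color_changes L}"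
    and "distinct (gluings L)" by auto
qed

text \<open>The blocks are cut at every change of color, so the color is constant on each block and
  can be read off at its last position. This gives the witness \<open>L0\<close> for the definite
  description in \<open>colored_comp_of\<close>.\<close>

lemma colored_comp_of_props:
  assumes K: "composition n K" and c: "length c = n"
  defines "L \<equiv> colored_comp_of n (K, c)"
  shows "composition n (map fst L)"
    "Des (map fst L) = (Des K \<inter> {j. col c j = col c (j + 1)}) \<union> {j \<in> {1..<n}. col c j \<noteq> col c (j + 1)}"
    "color_changes L = {j \<in> {1..<n}. col c j \<noteq> col c (j + 1)}"
proof -
  let ?D = "(Des K \<inter> {j. col c j = col c (j + 1)}) \<union> {j \<in> {1..<n}. col c j \<noteq> col c (j + 1)}"
  let ?P = "\<lambda>L. composition n (map fst L) \<and> Des (map fst L) = ?D \<and>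
      (\<forall>k<length L. \<forall>j\<in>{sum_list (take k (map fst L)) <.. sum_list (take (Suc k) (map fst L))}.
        col c j = snd (L ! k))"
  have "?D \<subseteq> {1..<n}" using Des_subset[OF K] by auto
  then obtain I where I: "composition n I" "Des I = ?D" using Des_surj by blast
  define L0 where "L0 = map (\<lambda>k. (I ! k, col c (sum_list (take (Suc k) I)))) [0..<length I]"
  have L0: "map fst L0 = I" "length L0 = length I" by (auto simp: L0_def comp_def map_nth)
  have const: "col c j = col c (sum_list (take (Suc k) I))"
    if k: "k < length I" and j: "sum_list (take k I) < j" "j \<le> sum_list (take (Suc k) I)" for k j
    using j(2,1)
  proof (induction j rule: inc_induct)
    case (step j)
    \<comment> \<open>Descents are partial sums, and none lies strictly inside a block. All changes
      of color belong to \<open>Des I\<close>, so positions \<open>j\<close> and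
      \<open>Suc j\<close> have the same color.\<close>
    have "j \<notin> Des I"
    proof
      assume "j \<in> Des I"
      then obtain l where l: "j = sum_list (take l I)" by (auto simp: Des_def)
      have mono: "l \<le> l' \<Longrightarrow> sum_list (take l I) \<le> sum_list (take l' I)" for l l'
        by (metis le_add1 le_add_diff_inverse sum_list_append take_add)
      show False using mono[of l k] mono[of "Suc k" l] l step by (cases "l \<le> k") auto
    qed
    moreover have "1 \<le> j" using step by simp
    moreover have "j < n"
    proof -
      have "sum_list (take (Suc k) I) \<le> n" using I(1)
        by (metis append_take_drop_id composition_def le_add1 sum_list_append)
      then show ?thesis using step by simp
    qed
    ultimately have "col c j = col c (Suc j)" using I(2) by auto
    then show ?case using step by simp
  qed simp
  have ex: "?P L0"
  proof (intro conjI allI impI ballI)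
    fix k j assume "k < length L0"
      and "j \<in> {sum_list (take k (map fst L0)) <.. sum_list (take (Suc k) (map fst L0))}"
    then have k: "k < length I" and j: "sum_list (take k I) < j" "j \<le> sum_list (take (Suc k) I)"
      unfolding L0 by auto
    have "snd (L0 ! k) = col c (sum_list (take (Suc k) I))" using k by (simp add: L0_def)
    then show "col c j = snd (L0 ! k)" using const[OF k j] by simp
  qed (simp_all only: L0 I)
  have uniq: "L' = L0" if P: "?P L'" for L'
  proof (rule nth_equalityI)
    have f: "map fst L' = map fst L0" using P I L0 Des_inj[of n "map fst L'" I] by auto
    then show len: "length L' = length L0" by (metis length_map)
    fix k assume k: "k < length L'"
    have "fst (L' ! k) = fst (L0 ! k)" using f k len by (metis nth_map)
    \<comment> \<open>The block is nonempty, so the condition on its positions determines the color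
      of the part.\<close>
    moreover have "sum_list (take (Suc k) I) \<in> {sum_list (take k I) <.. sum_list (take (Suc k) I)}"
    proof -
      have k': "k < length I" using k len L0(2) by simp
      then have "I ! k \<in> set I" by simp
      then have "1 \<le> I ! k" using I(1) unfolding composition_def by blast
      then show ?thesis using k' by (simp add: take_Suc_conv_app_nth)
    qed
    moreover have "\<forall>j\<in>{sum_list (take k I) <.. sum_list (take (Suc k) I)}. col c j = snd (L' ! k)"
      using P k unfolding f L0(1) by blast
    moreover have "\<forall>j\<in>{sum_list (take k I) <.. sum_list (take (Suc k) I)}. col c j = snd (L0 ! k)"
      using ex k unfolding len L0(1) by blast
    ultimately have "fst (L' ! k) = fst (L0 ! k)" "snd (L' ! k) = snd (L0 ! k)" by metis+
    then show "L' ! k = L0 ! k" by (simp add: prod_eq_iff)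
  qed
  have L: "L = L0" unfolding L_def colored_comp_of_def prod.case using ex uniq by (rule the_equality)
  then show "composition n (map fst L)" "Des (map fst L) = ?D" using ex by auto
  have ch: "snd (L0 ! k) = col c (sum_list (take (Suc k) I))" if "k < length I" for k
    using that by (simp add: L0_def)
  \<comment> \<open>The color of a block can be read at its first position as well, so a change
    between consecutive parts is a change between neighboring positions.\<close>
  have nxt: "snd (L0 ! k) = col c (sum_list (take k I) + 1)" if "k < length I" for k
  proof -
    have "1 \<le> I ! k" using I(1) that by (auto simp: composition_def)
    then show ?thesis unfolding ch[OF that]
      using that by (intro const[symmetric]) (auto simp: take_Suc_conv_app_nth)
  qed
  have prev: "snd (L0 ! (k - 1)) = col c (sum_list (take k I))" if "1 \<le> k" "k < length I" for k
    using ch[of "k - 1"] that by simp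
  have "color_changes L0 = {sum_list (take k I) | k. 1 \<le> k \<and> k < length I \<and>
      col c (sum_list (take k I)) \<noteq> col c (sum_list (take k I) + 1)}"
  proof -
    have "1 \<le> k \<and> k < length I \<and> snd (L0 ! (k - 1)) \<noteq> snd (L0 ! k) \<longleftrightarrow>
      1 \<le> k \<and> k < length I \<and> col c (sum_list (take k I)) \<noteq> col c (sum_list (take k I) + 1)" for k
      using prev[of k] nxt[of k] by metis
    then show ?thesis unfolding color_changes_def L0 by simp
  qed
  also have "\<dots> = {j \<in> Des I. col c j \<noteq> col c (j + 1)}" by (auto simp: Des_def)
  finally show "color_changes L = {j \<in> {1..<n}. col c j \<noteq> col c (j + 1)}" using I(2) L by auto
qed

text \<open>At positions of equal colors the colored composition is cut exactly at the descents of
  \<open>K\<close>, and \<open>gluings\<close> preserves this. All other positions are changes of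
  color, where the descent can be kept or removed.\<close>

lemma mr_to_sym_ribbon:
  assumes K: "composition n K" and c: "length c = n"
  shows "mr_to_sym (ribbon (colored_comp_of n (K, c))) = (\<Sum>I\<in>{I. composition n I \<and>
     (\<forall>j\<in>{1..<n}. col c j = col c (j + 1) \<longrightarrow> (j \<in> Des I \<longleftrightarrow> j \<in> Des K))}. Sym_ribbon I)"
proof -
  define L where "L = colored_comp_of n (K, c)"
  note L = colored_comp_of_props[OF K c, folded L_def]
  have pos: "\<forall>x\<in>set L. 1 \<le> fst x" using L(1) by (auto simp: composition_def)
  have comp: "composition n I" if "I \<in> set (gluings L)" for I
    using gluings_composition[OF that pos] L(1) by (simp add: composition_def)
  have "set (gluings L) = {I. composition n I \<and> Des I \<in> Des ` set (gluings L)}"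
    using comp Des_inj by blast
  also have "\<dots> = {I. composition n I \<and>
     (\<forall>j\<in>{1..<n}. col c j = col c (j + 1) \<longrightarrow> (j \<in> Des I \<longleftrightarrow> j \<in> Des K))}"
  proof (intro Collect_cong conj_cong refl)
    fix I assume "composition n I"
    note D = Des_subset[OF this] Des_subset[OF K]
    show "Des I \<in> Des ` set (gluings L) \<longleftrightarrow>
       (\<forall>j\<in>{1..<n}. col c j = col c (j + 1) \<longrightarrow> (j \<in> Des I \<longleftrightarrow> j \<in> Des K))"
      unfolding Des_gluings(1)[OF pos] L(2,3) using D by auto
  qed
  finally have set: "set (gluings L) = \<dots>" .
  have "mr_to_sym (ribbon L) = (\<Sum>I\<in>set (gluings L). rec_ribbon (map (\<lambda>a. (a, 1)) I))"
    using Des_gluings(2)[OF pos]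
    by (simp add: ribbon_eq_rec_ribbon[OF pos] mr_to_sym_rec_ribbon sum_list_distinct_conv_sum_set)
  also have "\<dots> = (\<Sum>I\<in>set (gluings L). Sym_ribbon I)"
    using comp by (intro sum.cong refl)
      (auto simp: Sym_ribbon_def composition_def intro!: ribbon_eq_rec_ribbon[symmetric])
  finally show ?thesis unfolding set unfolding L_def .
qed

subsection \<open>Left modules and traces of projective modules\<close>

context left_module
begin

lemma smult_zero_left: "x \<in> carrier M \<Longrightarrow> \<zero>\<^bsub>A\<^esub> \<odot>\<^bsub>M\<^esub> x = \<zero>\<^bsub>M\<^esub>"
proof -
  assume x: "x \<in> carrier M"
  have c: "\<zero>\<^bsub>A\<^esub> \<odot>\<^bsub>M\<^esub> x \<in> carrier M" using x by (simp add: smult_closed)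
  have "\<zero>\<^bsub>A\<^esub> \<odot>\<^bsub>M\<^esub> x \<oplus>\<^bsub>M\<^esub> \<zero>\<^bsub>A\<^esub> \<odot>\<^bsub>M\<^esub> x = \<zero>\<^bsub>A\<^esub> \<odot>\<^bsub>M\<^esub> x \<oplus>\<^bsub>M\<^esub> \<zero>\<^bsub>M\<^esub>"
    using smult_l_distr[of "\<zero>\<^bsub>A\<^esub>" "\<zero>\<^bsub>A\<^esub>" x] x c by simp
  then show ?thesis using c by (simp only: M.add.l_cancel M.zero_closed)
qed

lemma smult_zero_right: "a \<in> carrier A \<Longrightarrow> a \<odot>\<^bsub>M\<^esub> \<zero>\<^bsub>M\<^esub> = \<zero>\<^bsub>M\<^esub>"
proof -
  assume a: "a \<in> carrier A"
  have c: "a \<odot>\<^bsub>M\<^esub> \<zero>\<^bsub>M\<^esub> \<in> carrier M" using a by (simp add: smult_closed)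
  have "a \<odot>\<^bsub>M\<^esub> \<zero>\<^bsub>M\<^esub> \<oplus>\<^bsub>M\<^esub> a \<odot>\<^bsub>M\<^esub> \<zero>\<^bsub>M\<^esub> = a \<odot>\<^bsub>M\<^esub> \<zero>\<^bsub>M\<^esub> \<oplus>\<^bsub>M\<^esub> \<zero>\<^bsub>M\<^esub>"
    using smult_r_distr[of a "\<zero>\<^bsub>M\<^esub>" "\<zero>\<^bsub>M\<^esub>"] a c by simp
  then show ?thesis using c by (simp only: M.add.l_cancel M.zero_closed)
qed

lemma smult_minus_one: "x \<in> carrier M \<Longrightarrow> (\<ominus>\<^bsub>A\<^esub> \<one>\<^bsub>A\<^esub>) \<odot>\<^bsub>M\<^esub> x = \<ominus>\<^bsub>M\<^esub> x"
proof -
  assume x: "x \<in> carrier M"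
  have "(\<ominus>\<^bsub>A\<^esub> \<one>\<^bsub>A\<^esub>) \<odot>\<^bsub>M\<^esub> x \<oplus>\<^bsub>M\<^esub> x = \<zero>\<^bsub>M\<^esub>"
    using smult_l_distr[of "\<ominus>\<^bsub>A\<^esub> \<one>\<^bsub>A\<^esub>" "\<one>\<^bsub>A\<^esub>" x] x by (simp add: smult_one A.l_neg smult_zero_left)
  then show ?thesis using x by (simp add: M.minus_equality smult_closed)
qed

text \<open>Closure under negatives follows from the action of the element -1 of the
  algebra.\<close>

lemma is_submoduleI:
  assumes "U \<subseteq> carrier M" "\<zero>\<^bsub>M\<^esub> \<in> U" "\<And>x y. x \<in> U \<Longrightarrow> y \<in> U \<Longrightarrow> x \<oplus>\<^bsub>M\<^esub> y \<in> U"
    "\<And>a x. a \<in> carrier A \<Longrightarrow> x \<in> U \<Longrightarrow> a \<odot>\<^bsub>M\<^esub> x \<in> U"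
  shows "submodule U A M"
proof -
  have "\<ominus>\<^bsub>M\<^esub> x \<in> U" if "x \<in> U" for x
    using assms(4)[of "\<ominus>\<^bsub>A\<^esub> \<one>\<^bsub>A\<^esub>" x] that assms(1) by (auto simp: smult_minus_one subsetD)
  then show ?thesis
    using assms by (intro submodule.intro subgroup.intro submodule_axioms.intro) (simp_all add: a_inv_def)
qed

lemma is_submoduleD:
  assumes "submodule U A M"
  shows "U \<subseteq> carrier M" "\<zero>\<^bsub>M\<^esub> \<in> U" "\<And>x y. x \<in> U \<Longrightarrow> y \<in> U \<Longrightarrow> x \<oplus>\<^bsub>M\<^esub> y \<in> U"
    "\<And>a x. a \<in> carrier A \<Longrightarrow> x \<in> U \<Longrightarrow> a \<odot>\<^bsub>M\<^esub> x \<in> U" "\<And>x. x \<in> U \<Longrightarrow> \<ominus>\<^bsub>M\<^esub> x \<in> U"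
proof -
  interpret submodule U A M by fact
  show "U \<subseteq> carrier M" "\<zero>\<^bsub>M\<^esub> \<in> U" "\<And>x y. x \<in> U \<Longrightarrow> y \<in> U \<Longrightarrow> x \<oplus>\<^bsub>M\<^esub> y \<in> U"
    "\<And>a x. a \<in> carrier A \<Longrightarrow> x \<in> U \<Longrightarrow> a \<odot>\<^bsub>M\<^esub> x \<in> U" "\<And>x. x \<in> U \<Longrightarrow> \<ominus>\<^bsub>M\<^esub> x \<in> U"
    using subset one_closed m_closed smult_closed m_inv_closed by (auto simp: a_inv_def)
qed

lemma zero_submodule: "submodule {\<zero>\<^bsub>M\<^esub>} A M"
  by (rule is_submoduleI) (auto simp: smult_zero_right)

lemma carrier_submodule: "submodule (carrier M) A M"
  by (rule is_submoduleI) (auto simp: smult_closed)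

lemma submodule_left_module:
  assumes "submodule U A M"
  shows "left_module A (M\<lparr>carrier := U\<rparr>)"
proof -
  note U = is_submoduleD[OF assms]
  note s = subsetD[OF U(1)]
  have "abelian_group (M\<lparr>carrier := U\<rparr>)"
  proof (rule abelian_groupI; simp)
    show "\<exists>y\<in>U. y \<oplus>\<^bsub>M\<^esub> x = \<zero>\<^bsub>M\<^esub>" if "x \<in> U" for x
      using U(5)[OF that] M.l_neg[OF s[OF that]] by blast
  qed (use U s in \<open>auto simp: M.a_ac\<close>)
  then show ?thesis
    using A.ring_axioms U s
    by (intro left_module.intro left_module_axioms.intro)
      (auto simp: smult_l_distr smult_r_distr smult_assoc smult_one)
qed

end

lemma lmod_homD:
  assumes "f \<in> lmod_hom A M N"
  shows "\<And>x. x \<in> carrier M \<Longrightarrow> f x \<in> carrier N"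
    "\<And>x y. x \<in> carrier M \<Longrightarrow> y \<in> carrier M \<Longrightarrow> f (x \<oplus>\<^bsub>M\<^esub> y) = f x \<oplus>\<^bsub>N\<^esub> f y"
    "\<And>a x. a \<in> carrier A \<Longrightarrow> x \<in> carrier M \<Longrightarrow> f (a \<odot>\<^bsub>M\<^esub> x) = a \<odot>\<^bsub>N\<^esub> f x"
  using assms by (auto simp: lmod_hom_def)

lemma lmod_hom_comp: "f \<in> lmod_hom A M N \<Longrightarrow> g \<in> lmod_hom A N L \<Longrightarrow> g \<circ> f \<in> lmod_hom A M L"
  by (auto simp: lmod_hom_def Pi_iff)

lemma lmod_hom_zero:
  assumes "left_module A M" "left_module A N" "f \<in> lmod_hom A M N"
  shows "f \<zero>\<^bsub>M\<^esub> = \<zero>\<^bsub>N\<^esub>"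
proof -
  interpret M: left_module A M by fact
  interpret N: left_module A N by fact
  have "f (\<zero>\<^bsub>A\<^esub> \<odot>\<^bsub>M\<^esub> \<zero>\<^bsub>M\<^esub>) = \<zero>\<^bsub>A\<^esub> \<odot>\<^bsub>N\<^esub> f \<zero>\<^bsub>M\<^esub>"
    by (rule lmod_homD(3)[OF assms(3)]) auto
  then show ?thesis by (simp add: M.smult_zero_left N.smult_zero_left lmod_homD(1)[OF assms(3)])
qed

lemma lmod_iso_inverse:
  assumes "left_module A M" "f \<in> lmod_hom A M N" "bij_betw f (carrier M) (carrier N)"
  obtains f' where "f' \<in> lmod_hom A N M" "\<And>x. x \<in> carrier M \<Longrightarrow> f' (f x) = x"
    "\<And>y. y \<in> carrier N \<Longrightarrow> f (f' y) = y"
proof -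
  interpret M: left_module A M by fact
  define f' where "f' = inv_into (carrier M) f"
  have inv: "f' (f x) = x" if "x \<in> carrier M" for x
    using that assms(3) by (simp add: f'_def bij_betw_inv_into_left)
  have inv': "f (f' y) = y" "f' y \<in> carrier M" if "y \<in> carrier N" for y
    using that assms(3) by (simp_all add: f'_def bij_betw_inv_into_right bij_betw_apply bij_betw_inv_into)
      (meson assms(3) bij_betw_apply bij_betw_inv_into that)
  have "f' \<in> lmod_hom A N M"
    unfolding lmod_hom_def
  proof (intro CollectI conjI ballI funcsetI)
    fix x y assume "x \<in> carrier N" "y \<in> carrier N"
    then have "x \<oplus>\<^bsub>N\<^esub> y = f (f' x \<oplus>\<^bsub>M\<^esub> f' y)" "f' x \<oplus>\<^bsub>M\<^esub> f' y \<in> carrier M"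
      using inv' by (simp_all add: lmod_homD[OF assms(2)])
    then show "f' (x \<oplus>\<^bsub>N\<^esub> y) = f' x \<oplus>\<^bsub>M\<^esub> f' y" using inv by simp
  next
    fix a x assume "a \<in> carrier A" "x \<in> carrier N"
    then have "a \<odot>\<^bsub>N\<^esub> x = f (a \<odot>\<^bsub>M\<^esub> f' x)" "a \<odot>\<^bsub>M\<^esub> f' x \<in> carrier M"
      using inv' by (simp_all add: lmod_homD[OF assms(2)] M.smult_closed)
    then show "f' (a \<odot>\<^bsub>N\<^esub> x) = a \<odot>\<^bsub>M\<^esub> f' x" using inv by simp
  qed (rule inv'(2))
  from this inv inv'(1) show thesis by (rule that)
qed

lemma lmod_isoE:
  assumes "left_module A M" "lmod_iso A M N"
  obtains f f' where "f \<in> lmod_hom A M N" "f' \<in> lmod_hom A N M"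
    "\<And>x. x \<in> carrier M \<Longrightarrow> f' (f x) = x" "\<And>y. y \<in> carrier N \<Longrightarrow> f (f' y) = y"
  using assms lmod_iso_inverse unfolding lmod_iso_def by metis

lemma lmod_isoI:
  assumes "f \<in> lmod_hom A M N" "f' \<in> lmod_hom A N M"
    "\<And>x. x \<in> carrier M \<Longrightarrow> f' (f x) = x" "\<And>y. y \<in> carrier N \<Longrightarrow> f (f' y) = y"
  shows "lmod_iso A M N"
  unfolding lmod_iso_def
proof (intro bexI)
  show "bij_betw f (carrier M) (carrier N)"
    by (rule bij_betw_byWitness[of _ f']) (use assms(3,4) lmod_homD(1)[OF assms(1)] lmod_homD(1)[OF assms(2)] in auto)
qed (rule assms(1))

lemma lmod_hom_id: "(\<lambda>x. x) \<in> lmod_hom A M M"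
  by (auto simp: lmod_hom_def)

lemma lmod_iso_refl: "lmod_iso A M M"
  by (rule lmod_isoI[of "\<lambda>x. x" _ _ _ "\<lambda>x. x"]) (auto intro: lmod_hom_id)

lemma lmod_iso_sym: "left_module A M \<Longrightarrow> lmod_iso A M N \<Longrightarrow> lmod_iso A N M"
  by (erule (1) lmod_isoE) (rule lmod_isoI)

lemma lmod_iso_trans: "lmod_iso A M N \<Longrightarrow> lmod_iso A N L \<Longrightarrow> lmod_iso A M L"
  unfolding lmod_iso_def by (blast intro: lmod_hom_comp bij_betw_trans)

lemma iso_class_eq: "left_module A M \<Longrightarrow> lmod_iso A M N \<Longrightarrow> iso_class A M = iso_class A N"
  unfolding iso_class_def
  using lmod_iso_trans[of A M N] lmod_iso_trans[OF lmod_iso_sym[of A M N]] by auto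

text \<open>Transport of structure along \<open>j\<close>: the Grothendieck group contains only
  modules carried by the universe of \<open>umodule\<close>, so other modules enter it through such
  copies.\<close>

lemma umodule_copy:
  fixes j :: "'v \<Rightarrow> nat \<Rightarrow> complex"
  assumes "left_module A M" and inj: "inj_on j (carrier M)"
  obtains L :: "'a umodule" where "left_module A L" "lmod_iso A M L"
proof -
  interpret M: left_module A M by fact
  define j' where "j' = inv_into (carrier M) j"
  have j': "j' (j x) = x" if "x \<in> carrier M" for x using that inj by (simp add: j'_def)
  define L :: "'a umodule" where "L = \<lparr>carrier = j ` carrier M, monoid.mult = undefined, monoid.one = undefined,
     ring.zero = j \<zero>\<^bsub>M\<^esub>, ring.add = (\<lambda>x y. j (j' x \<oplus>\<^bsub>M\<^esub> j' y)), smult = (\<lambda>a x. j (a \<odot>\<^bsub>M\<^esub> j' x))\<rparr>"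
  have "abelian_group L"
  proof (rule abelian_groupI)
    fix x assume "x \<in> carrier L"
    then obtain x' where "x' \<in> carrier M" "x = j x'" by (auto simp: L_def)
    then show "\<exists>y\<in>carrier L. y \<oplus>\<^bsub>L\<^esub> x = \<zero>\<^bsub>L\<^esub>"
      by (intro bexI[of _ "j (\<ominus>\<^bsub>M\<^esub> x')"]) (auto simp: L_def j' M.M.l_neg)
  qed (auto simp: L_def j' M.M.a_ac)
  then have "left_module A L"
    using M.A.ring_axioms
    by (intro left_module.intro left_module_axioms.intro)
      (auto simp: L_def j' M.smult_l_distr M.smult_r_distr M.smult_assoc M.smult_one M.smult_closed)
  moreover have "lmod_iso A M L"
    unfolding lmod_iso_def
    by (rule bexI[of _ j]) (auto simp: lmod_hom_def L_def j' bij_betw_def inj)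
  ultimately show thesis by (rule that)
qed

lemma free_lmod_apply:
  assumes "b < k"
  shows "(x \<oplus>\<^bsub>free_lmod A k\<^esub> y) b = x b \<oplus>\<^bsub>A\<^esub> y b" "(a \<odot>\<^bsub>free_lmod A k\<^esub> x) b = a \<otimes>\<^bsub>A\<^esub> x b"
    "\<zero>\<^bsub>free_lmod A k\<^esub> b = \<zero>\<^bsub>A\<^esub>"
  using assms by (simp_all add: free_lmod_def)

lemma free_lmod_closed: "x \<in> carrier (free_lmod A k) \<Longrightarrow> b < k \<Longrightarrow> x b \<in> carrier A"
  by (auto simp: free_lmod_def)

lemma free_lmod_eqI:
  "x \<in> carrier (free_lmod A k) \<Longrightarrow> y \<in> carrier (free_lmod A k) \<Longrightarrow> (\<And>b. b < k \<Longrightarrow> x b = y b) \<Longrightarrow> x = y"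
  unfolding free_lmod_def by (auto intro: PiE_ext)

lemma free_lmod_left_module:
  assumes "ring A" shows "left_module A (free_lmod A k)"
proof -
  interpret ring A by fact
  let ?F = "free_lmod A k"
  have add: "x \<oplus>\<^bsub>?F\<^esub> y \<in> carrier ?F" if "x \<in> carrier ?F" "y \<in> carrier ?F" for x y
    using free_lmod_closed[OF that(1)] free_lmod_closed[OF that(2)] by (simp add: free_lmod_def)
  have smult: "a \<odot>\<^bsub>?F\<^esub> y \<in> carrier ?F" if "a \<in> carrier A" "y \<in> carrier ?F" for a y
    using that(1) free_lmod_closed[OF that(2)] by (simp add: free_lmod_def)
  have zero: "\<zero>\<^bsub>?F\<^esub> \<in> carrier ?F" by (simp add: free_lmod_def)
  note [simp] = free_lmod_apply free_lmod_closed add smult zero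
  have "abelian_group ?F"
  proof (rule abelian_groupI)
    fix x assume x: "x \<in> carrier ?F"
    let ?y = "\<lambda>i\<in>{..<k}. \<ominus>\<^bsub>A\<^esub> x i"
    have y: "?y \<in> carrier ?F" using free_lmod_closed[OF x] by (simp add: free_lmod_def)
    moreover have "?y \<oplus>\<^bsub>?F\<^esub> x = \<zero>\<^bsub>?F\<^esub>"
      by (rule free_lmod_eqI[of _ A k]) (use x y in \<open>simp_all add: l_neg free_lmod_closed[OF x]\<close>)
    ultimately show "\<exists>y\<in>carrier ?F. y \<oplus>\<^bsub>?F\<^esub> x = \<zero>\<^bsub>?F\<^esub>" by blast
  next
    fix x y z assume "x \<in> carrier ?F" "y \<in> carrier ?F" "z \<in> carrier ?F"
    then show "(x \<oplus>\<^bsub>?F\<^esub> y) \<oplus>\<^bsub>?F\<^esub> z = x \<oplus>\<^bsub>?F\<^esub> (y \<oplus>\<^bsub>?F\<^esub> z)"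
      by (intro free_lmod_eqI[of _ A k]) (simp_all add: a_assoc)
  next
    fix x y assume "x \<in> carrier ?F" "y \<in> carrier ?F"
    then show "x \<oplus>\<^bsub>?F\<^esub> y = y \<oplus>\<^bsub>?F\<^esub> x"
      by (intro free_lmod_eqI[of _ A k]) (simp_all add: a_comm)
  next
    fix x assume "x \<in> carrier ?F"
    then show "\<zero>\<^bsub>?F\<^esub> \<oplus>\<^bsub>?F\<^esub> x = x"
      by (intro free_lmod_eqI[of _ A k]) simp_all
  qed simp_all
  then show ?thesis
  proof (intro left_module.intro left_module_axioms.intro assms)
    fix a b x assume "a \<in> carrier A" "b \<in> carrier A" "x \<in> carrier ?F"
    then show "(a \<oplus>\<^bsub>A\<^esub> b) \<odot>\<^bsub>?F\<^esub> x = (a \<odot>\<^bsub>?F\<^esub> x) \<oplus>\<^bsub>?F\<^esub> (b \<odot>\<^bsub>?F\<^esub> x)"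
      "(a \<otimes>\<^bsub>A\<^esub> b) \<odot>\<^bsub>?F\<^esub> x = a \<odot>\<^bsub>?F\<^esub> (b \<odot>\<^bsub>?F\<^esub> x)"
      by (intro free_lmod_eqI[of _ A k]; simp add: l_distr m_assoc)+
  next
    fix a x y assume "a \<in> carrier A" "x \<in> carrier ?F" "y \<in> carrier ?F"
    then show "a \<odot>\<^bsub>?F\<^esub> (x \<oplus>\<^bsub>?F\<^esub> y) = (a \<odot>\<^bsub>?F\<^esub> x) \<oplus>\<^bsub>?F\<^esub> (a \<odot>\<^bsub>?F\<^esub> y)"
      by (intro free_lmod_eqI[of _ A k]; simp add: r_distr)
  next
    fix x assume "x \<in> carrier ?F"
    then show "\<one>\<^bsub>A\<^esub> \<odot>\<^bsub>?F\<^esub> x = x"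
      by (intro free_lmod_eqI[of _ A k]; simp)
  qed (assumption | rule smult)+
qed

definition unit_vec :: "(complex, 'a) module \<Rightarrow> nat \<Rightarrow> nat \<Rightarrow> nat \<Rightarrow> 'a"
  where "unit_vec A k a = (\<lambda>b\<in>{..<k}. if b = a then \<one>\<^bsub>A\<^esub> else \<zero>\<^bsub>A\<^esub>)"

lemma dsum_left_module:
  assumes "left_module A M" "left_module A N" shows "left_module A (dsum M N)"
proof -
  interpret M: left_module A M by fact
  interpret N: left_module A N by fact
  have "abelian_group (dsum M N)"
  proof (rule abelian_groupI)
    fix x assume "x \<in> carrier (dsum M N)"
    then show "\<exists>y\<in>carrier (dsum M N). y \<oplus>\<^bsub>dsum M N\<^esub> x = \<zero>\<^bsub>dsum M N\<^esub>"
      by (intro bexI[of _ "(\<ominus>\<^bsub>M\<^esub> fst x, \<ominus>\<^bsub>N\<^esub> snd x)"]) (auto simp: dsum_def M.M.l_neg N.M.l_neg)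
  qed (auto simp: dsum_def M.M.a_ac N.M.a_ac)
  then show ?thesis
    using M.A.ring_axioms by (intro left_module.intro left_module_axioms.intro)
      (auto simp: dsum_def M.smult_l_distr M.smult_r_distr M.smult_assoc M.smult_one M.smult_closed
        N.smult_l_distr N.smult_r_distr N.smult_assoc N.smult_one N.smult_closed)
qed

text \<open>Scalars enter only through the central elements \<open>sc z\<close>, which is also how
  they act on modules in \<open>fin_dim\<close>, \<open>one_dim\<close> and
  \<open>acts_by\<close>.\<close>

locale complex_algebra = ring A for A :: "(complex, 'a) module" (structure) +
  assumes scalar_closed [simp]: "z \<odot>\<^bsub>A\<^esub> \<one>\<^bsub>A\<^esub> \<in> carrier A"
    and scalar_add: "((z + w) \<odot>\<^bsub>A\<^esub> \<one>\<^bsub>A\<^esub>) = (z \<odot>\<^bsub>A\<^esub> \<one>\<^bsub>A\<^esub>) \<oplus>\<^bsub>A\<^esub> (w \<odot>\<^bsub>A\<^esub> \<one>\<^bsub>A\<^esub>)"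
    and scalar_mult: "((z * w) \<odot>\<^bsub>A\<^esub> \<one>\<^bsub>A\<^esub>) = (z \<odot>\<^bsub>A\<^esub> \<one>\<^bsub>A\<^esub>) \<otimes>\<^bsub>A\<^esub> (w \<odot>\<^bsub>A\<^esub> \<one>\<^bsub>A\<^esub>)"
    and scalar_one: "(1 \<odot>\<^bsub>A\<^esub> \<one>\<^bsub>A\<^esub>) = \<one>\<^bsub>A\<^esub>"
    and scalar_central: "a \<in> carrier A \<Longrightarrow> (z \<odot>\<^bsub>A\<^esub> \<one>\<^bsub>A\<^esub>) \<otimes>\<^bsub>A\<^esub> a = a \<otimes>\<^bsub>A\<^esub> (z \<odot>\<^bsub>A\<^esub> \<one>\<^bsub>A\<^esub>)"
begin

abbreviation sc :: "complex \<Rightarrow> 'a" where "sc z \<equiv> z \<odot>\<^bsub>A\<^esub> \<one>\<^bsub>A\<^esub>"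

definition character :: "('a \<Rightarrow> complex) \<Rightarrow> bool"
  where "character \<chi> \<longleftrightarrow> (\<forall>a\<in>carrier A. \<forall>b\<in>carrier A. \<chi> (a \<oplus>\<^bsub>A\<^esub> b) = \<chi> a + \<chi> b \<and> \<chi> (a \<otimes>\<^bsub>A\<^esub> b) = \<chi> a * \<chi> b)
    \<and> (\<forall>z. \<chi> (sc z) = z)"

lemma characterD:
  assumes "character \<chi>"
  shows "a \<in> carrier A \<Longrightarrow> b \<in> carrier A \<Longrightarrow> \<chi> (a \<oplus>\<^bsub>A\<^esub> b) = \<chi> a + \<chi> b"
    "a \<in> carrier A \<Longrightarrow> b \<in> carrier A \<Longrightarrow> \<chi> (a \<otimes>\<^bsub>A\<^esub> b) = \<chi> a * \<chi> b"
    "\<chi> (sc z) = z" "\<chi> \<one> = 1" "\<chi> \<zero> = 0"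
proof -
  have z: "\<chi> (sc z) = z" for z using assms by (simp add: character_def)
  have "\<chi> (\<zero> \<oplus> \<zero>) = \<chi> \<zero> + \<chi> \<zero>" using assms zero_closed unfolding character_def by blast
  then show "\<chi> \<zero> = 0" by simp
  show "\<chi> \<one> = 1" using z[of 1] by (simp add: scalar_one)
qed (use assms in \<open>auto simp: character_def\<close>)

text \<open>A homomorphism from \<open>M\<close> to the one-dimensional module given by \<open>\<chi>\<close>.\<close>

definition char_functional :: "('a \<Rightarrow> complex) \<Rightarrow> ('a, 'v) module \<Rightarrow> ('v \<Rightarrow> complex) \<Rightarrow> bool"
  where "char_functional \<chi> M g \<longleftrightarrow>
    (\<forall>x\<in>carrier M. \<forall>y\<in>carrier M. g (x \<oplus>\<^bsub>M\<^esub> y) = g x + g y) \<and>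
    (\<forall>a\<in>carrier A. \<forall>x\<in>carrier M. g (a \<odot>\<^bsub>M\<^esub> x) = \<chi> a * g x)"

lemma char_functionalD:
  assumes "char_functional \<chi> M g"
  shows "x \<in> carrier M \<Longrightarrow> y \<in> carrier M \<Longrightarrow> g (x \<oplus>\<^bsub>M\<^esub> y) = g x + g y"
    "a \<in> carrier A \<Longrightarrow> x \<in> carrier M \<Longrightarrow> g (a \<odot>\<^bsub>M\<^esub> x) = \<chi> a * g x"
  using assms by (auto simp: char_functional_def)

lemma char_functional_comp:
  "char_functional \<chi> N g \<Longrightarrow> f \<in> lmod_hom A M N \<Longrightarrow> char_functional \<chi> M (g \<circ> f)"
  unfolding char_functional_def by (auto simp: lmod_homD)

lemma char_functional_zero:
  assumes "left_module A M" "char_functional \<chi> M g"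
  shows "g \<zero>\<^bsub>M\<^esub> = 0"
proof -
  interpret M: left_module A M by fact
  have "g (\<zero>\<^bsub>M\<^esub> \<oplus>\<^bsub>M\<^esub> \<zero>\<^bsub>M\<^esub>) = g \<zero>\<^bsub>M\<^esub> + g \<zero>\<^bsub>M\<^esub>" using assms(2) M.M.zero_closed unfolding char_functional_def by blast
  then show ?thesis by simp
qed

lemma unit_vec_closed [simp]: "unit_vec A k a \<in> carrier (free_lmod A k)"
  by (auto simp: unit_vec_def free_lmod_def)

lemma char_functional_coordinate:
  assumes "character \<chi>" "b < k" shows "char_functional \<chi> (free_lmod A k) (\<lambda>x. \<chi> (x b))"
  unfolding char_functional_def
  by (simp add: free_lmod_apply[OF assms(2)] characterD[OF assms(1)] free_lmod_closed[OF _ assms(2)])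

lemma lmod_hom_freeI:
  assumes "left_module A M" "\<And>x. x \<in> carrier M \<Longrightarrow> f x \<in> carrier (free_lmod A k)"
    "\<And>x y b. x \<in> carrier M \<Longrightarrow> y \<in> carrier M \<Longrightarrow> b < k \<Longrightarrow> f (x \<oplus>\<^bsub>M\<^esub> y) b = f x b \<oplus> f y b"
    "\<And>a x b. a \<in> carrier A \<Longrightarrow> x \<in> carrier M \<Longrightarrow> b < k \<Longrightarrow> f (a \<odot>\<^bsub>M\<^esub> x) b = a \<otimes> f x b"
  shows "f \<in> lmod_hom A M (free_lmod A k)"
proof -
  interpret M: left_module A M by fact
  interpret F: left_module A "free_lmod A k" by (rule free_lmod_left_module) (rule ring_axioms)
  show ?thesis
    unfolding lmod_hom_def
  proof (intro CollectI conjI ballI funcsetI assms(2))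
    fix x y assume x: "x \<in> carrier M" and y: "y \<in> carrier M"
    show "f (x \<oplus>\<^bsub>M\<^esub> y) = f x \<oplus>\<^bsub>free_lmod A k\<^esub> f y"
      by (rule free_lmod_eqI[OF assms(2)[OF M.M.a_closed[OF x y]] F.M.a_closed[OF assms(2)[OF x] assms(2)[OF y]]])
        (simp add: assms(3)[OF x y] free_lmod_apply)
  next
    fix a x assume a: "a \<in> carrier A" and x: "x \<in> carrier M"
    show "f (a \<odot>\<^bsub>M\<^esub> x) = a \<odot>\<^bsub>free_lmod A k\<^esub> f x"
      by (rule free_lmod_eqI[OF assms(2)[OF M.smult_closed[OF a x]] F.smult_closed[OF a assms(2)[OF x]]])
        (simp add: assms(4)[OF a x] free_lmod_apply)
  qed
qed

lemma char_functional_free: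
  assumes "character \<chi>" "char_functional \<chi> (free_lmod A k) g" "x \<in> carrier (free_lmod A k)"
  shows "g x = (\<Sum>a<k. \<chi> (x a) * g (unit_vec A k a))"
proof -
  interpret F: left_module A "free_lmod A k" by (rule free_lmod_left_module) (rule ring_axioms)
  let ?F = "free_lmod A k"
  \<comment> \<open>The vector cut off after its first \<open>m\<close> coordinates; the induction
    adds one coordinate at a time and uses only binary additivity of \<open>g\<close>.\<close>
  define part where "part m = (\<lambda>b\<in>{..<k}. if b < m then x b else \<zero>)" for m
  have x: "x a \<in> carrier A" if "a < k" for a using assms(3) that by (auto simp: free_lmod_def)
  have part: "part m \<in> carrier ?F" for m using x by (auto simp: part_def free_lmod_def)
  have "g (part m) = (\<Sum>a<m. \<chi> (x a) * g (unit_vec A k a))" if "m \<le> k" for m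
    using that
  proof (induction m)
    case 0
    have "part 0 = \<zero>\<^bsub>?F\<^esub>" by (auto simp: part_def free_lmod_def)
    then show ?case using char_functional_zero[OF F.left_module_axioms assms(2)] by simp
  next
    case (Suc m)
    have "part (Suc m) = part m \<oplus>\<^bsub>?F\<^esub> (x m \<odot>\<^bsub>?F\<^esub> unit_vec A k m)"
    proof (rule free_lmod_eqI[OF part F.M.a_closed[OF part]])
      show "x m \<odot>\<^bsub>?F\<^esub> unit_vec A k m \<in> carrier ?F"
        using Suc.prems by (intro F.smult_closed x) auto
      show "part (Suc m) b = (part m \<oplus>\<^bsub>?F\<^esub> (x m \<odot>\<^bsub>?F\<^esub> unit_vec A k m)) b" if "b < k" for b
        using that x[OF that] x[of m] Suc.prems by (auto simp: part_def free_lmod_apply unit_vec_def less_Suc_eq)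
    qed
    moreover have "x m \<odot>\<^bsub>?F\<^esub> unit_vec A k m \<in> carrier ?F"
      using Suc.prems by (intro F.smult_closed x) auto
    ultimately show ?case
      using Suc part x by (simp add: char_functionalD[OF assms(2)])
  qed
  from this[of k] have "g (part k) = (\<Sum>a<k. \<chi> (x a) * g (unit_vec A k a))" by simp
  moreover have "part k = x"
    using assms(3) part by (intro free_lmod_eqI[of _ A k]) (auto simp: part_def)
  ultimately show ?thesis by simp
qed

text \<open>A chosen presentation of \<open>M\<close> as a retract of a free module. The composition
  of \<open>p\<close> with \<open>i\<close> is the idempotent whose trace will be taken.\<close>

definition proj_data :: "('a, 'v) module \<Rightarrow> nat \<Rightarrow> ('v \<Rightarrow> nat \<Rightarrow> 'a) \<Rightarrow> ((nat \<Rightarrow> 'a) \<Rightarrow> 'v) \<Rightarrow> bool"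
  where "proj_data M k i p \<longleftrightarrow> left_module A M \<and> i \<in> lmod_hom A M (free_lmod A k) \<and>
    p \<in> lmod_hom A (free_lmod A k) M \<and> (\<forall>x\<in>carrier M. p (i x) = x)"

lemma fd_projective_iff: "fd_projective A M \<longleftrightarrow> fin_dim A M \<and> (\<exists>k i p. proj_data M k i p)"
  unfolding fd_projective_def proj_data_def by blast

text \<open>With \<open>e\<close> the idempotent matrix over \<open>A\<close> that defines a projective module, the trace of the
  matrix \<open>\<chi> e\<close> is the dimension of the space of homomorphisms to the one-dimensional module \<open>\<chi>\<close>.\<close>

definition data_trace :: "('a \<Rightarrow> complex) \<Rightarrow> nat \<Rightarrow> ('v \<Rightarrow> nat \<Rightarrow> 'a) \<Rightarrow> ((nat \<Rightarrow> 'a) \<Rightarrow> 'v) \<Rightarrow> complex"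
  where "data_trace \<chi> k i p = (\<Sum>a<k. \<chi> (i (p (unit_vec A k a)) a))"

text \<open>Applying the character to the entries turns \<alpha> and \<beta> into complex matrices,
  for which this is the identity tr(AB) = tr(BA).\<close>

lemma trace_cyclic:
  assumes \<chi>: "character \<chi>" and \<alpha>: "\<alpha> \<in> lmod_hom A (free_lmod A k) (free_lmod A l)"
    and \<beta>: "\<beta> \<in> lmod_hom A (free_lmod A l) (free_lmod A k)"
  shows "(\<Sum>a<k. \<chi> (\<beta> (\<alpha> (unit_vec A k a)) a)) = (\<Sum>b<l. \<chi> (\<alpha> (\<beta> (unit_vec A l b)) b))"
proof -
  have *: "\<chi> (\<beta> y a) = (\<Sum>b<l. \<chi> (y b) * \<chi> (\<beta> (unit_vec A l b) a))"
    if "y \<in> carrier (free_lmod A l)" "a < k" for y a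
    using char_functional_free[OF \<chi> char_functional_comp[OF char_functional_coordinate[OF \<chi> that(2)] \<beta>] that(1)]
    by simp
  have **: "\<chi> (\<alpha> y b) = (\<Sum>a<k. \<chi> (y a) * \<chi> (\<alpha> (unit_vec A k a) b))"
    if "y \<in> carrier (free_lmod A k)" "b < l" for y b
    using char_functional_free[OF \<chi> char_functional_comp[OF char_functional_coordinate[OF \<chi> that(2)] \<alpha>] that(1)]
    by simp
  have "(\<Sum>a<k. \<chi> (\<beta> (\<alpha> (unit_vec A k a)) a))
      = (\<Sum>a<k. \<Sum>b<l. \<chi> (\<alpha> (unit_vec A k a) b) * \<chi> (\<beta> (unit_vec A l b) a))"
    by (intro sum.cong refl *) (auto intro: lmod_homD(1)[OF \<alpha>])
  also have "\<dots> = (\<Sum>b<l. \<Sum>a<k. \<chi> (\<beta> (unit_vec A l b) a) * \<chi> (\<alpha> (unit_vec A k a) b))"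
    by (subst sum.swap) (simp add: mult.commute)
  also have "\<dots> = (\<Sum>b<l. \<chi> (\<alpha> (\<beta> (unit_vec A l b)) b))"
    by (intro sum.cong refl **[symmetric]) (auto intro: lmod_homD(1)[OF \<beta>])
  finally show ?thesis .
qed

text \<open>Through the isomorphism the idempotents of the two presentations become the two
  compositions of a pair of maps \<alpha> and \<beta> in either order, so cyclicity applies. Taking
  the identity for \<open>f\<close> shows that the trace does not depend on the
  presentation.\<close>

lemma data_trace_iso:
  assumes \<chi>: "character \<chi>" and M: "proj_data M k i p" and N: "proj_data N l j q"
    and f: "f \<in> lmod_hom A M N" "f' \<in> lmod_hom A N M"
      "\<And>x. x \<in> carrier M \<Longrightarrow> f' (f x) = x" "\<And>y. y \<in> carrier N \<Longrightarrow> f (f' y) = y"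
  shows "data_trace \<chi> k i p = data_trace \<chi> l j q"
proof -
  have i: "i \<in> lmod_hom A M (free_lmod A k)" and p: "p \<in> lmod_hom A (free_lmod A k) M"
    and ip: "\<And>x. x \<in> carrier M \<Longrightarrow> p (i x) = x"
    and j: "j \<in> lmod_hom A N (free_lmod A l)" and q: "q \<in> lmod_hom A (free_lmod A l) N"
    and jq: "\<And>x. x \<in> carrier N \<Longrightarrow> q (j x) = x"
    using M N by (auto simp: proj_data_def)
  define \<alpha> where "\<alpha> = j \<circ> (f \<circ> p)"
  define \<beta> where "\<beta> = i \<circ> (f' \<circ> q)"
  have \<alpha>: "\<alpha> \<in> lmod_hom A (free_lmod A k) (free_lmod A l)"
    unfolding \<alpha>_def by (intro lmod_hom_comp[OF _ j] lmod_hom_comp[OF p] f)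
  have \<beta>: "\<beta> \<in> lmod_hom A (free_lmod A l) (free_lmod A k)"
    unfolding \<beta>_def by (intro lmod_hom_comp[OF _ i] lmod_hom_comp[OF q] f)
  have "\<beta> (\<alpha> x) = i (p x)" if "x \<in> carrier (free_lmod A k)" for x
    using that by (simp add: \<alpha>_def \<beta>_def jq f(3) lmod_homD(1)[OF p] lmod_homD(1)[OF f(1)])
  moreover have "\<alpha> (\<beta> x) = j (q x)" if "x \<in> carrier (free_lmod A l)" for x
    using that by (simp add: \<alpha>_def \<beta>_def ip f(4) lmod_homD(1)[OF q] lmod_homD(1)[OF f(2)])
  ultimately show ?thesis
    using trace_cyclic[OF \<chi> \<alpha> \<beta>] by (simp add: data_trace_def)
qed

definition mtrace :: "('a \<Rightarrow> complex) \<Rightarrow> ('a, 'v) module \<Rightarrow> complex"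
  where "mtrace \<chi> M = (SOME t. \<exists>k i p. proj_data M k i p \<and> t = data_trace \<chi> k i p)"

lemma mtrace_eq:
  assumes "character \<chi>" "proj_data M k i p"
  shows "mtrace \<chi> M = data_trace \<chi> k i p"
proof -
  have "\<exists>k' i' p'. proj_data M k' i' p' \<and> mtrace \<chi> M = data_trace \<chi> k' i' p'"
    unfolding mtrace_def by (rule someI_ex) (use assms(2) in blast)
  then obtain k' i' p' where d: "proj_data M k' i' p'" "mtrace \<chi> M = data_trace \<chi> k' i' p'" by blast
  show ?thesis
    unfolding d(2) by (rule data_trace_iso[OF assms(1) d(1) assms(2) lmod_hom_id lmod_hom_id]) simp_all
qed

lemma proj_data_iso:
  assumes M: "proj_data M k i p" and N: "left_module A N"
    and f: "f \<in> lmod_hom A M N" "f' \<in> lmod_hom A N M" "\<And>y. y \<in> carrier N \<Longrightarrow> f (f' y) = y"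
  shows "proj_data N k (i \<circ> f') (f \<circ> p)"
  using assms unfolding proj_data_def by (auto intro: lmod_hom_comp simp: lmod_homD(1)[OF f(2)])

lemma mtrace_iso:
  assumes \<chi>: "character \<chi>" and M: "proj_data M k i p" and N: "left_module A N" and iso: "lmod_iso A M N"
  shows "mtrace \<chi> M = mtrace \<chi> N" "\<exists>k i p. proj_data N k i p"
proof -
  have M': "left_module A M" using M by (simp add: proj_data_def)
  obtain f f' where f: "f \<in> lmod_hom A M N" "f' \<in> lmod_hom A N M"
    "\<And>x. x \<in> carrier M \<Longrightarrow> f' (f x) = x" "\<And>y. y \<in> carrier N \<Longrightarrow> f (f' y) = y"
    by (rule lmod_isoE[OF M' iso]) (rule that)
  have d: "proj_data N k (i \<circ> f') (f \<circ> p)" by (rule proj_data_iso[OF M N f(1,2,4)])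
  then show "\<exists>k i p. proj_data N k i p" by blast
  show "mtrace \<chi> M = mtrace \<chi> N"
    unfolding mtrace_eq[OF \<chi> M] mtrace_eq[OF \<chi> d] by (rule data_trace_iso[OF \<chi> M d f])
qed

text \<open>The direct sum is a retract of the free module of rank \<open>k + l\<close>, and its
  idempotent is block diagonal.\<close>

lemma proj_data_dsum:
  assumes \<chi>: "character \<chi>" and M: "proj_data M k i p" and N: "proj_data N l j q"
  shows "\<exists>k i p. proj_data (dsum M N) k i p" "mtrace \<chi> (dsum M N) = mtrace \<chi> M + mtrace \<chi> N"
proof -
  have M': "left_module A M" and i: "i \<in> lmod_hom A M (free_lmod A k)" and p: "p \<in> lmod_hom A (free_lmod A k) M"
    and ip: "\<And>x. x \<in> carrier M \<Longrightarrow> p (i x) = x"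
    and N': "left_module A N" and j: "j \<in> lmod_hom A N (free_lmod A l)" and q: "q \<in> lmod_hom A (free_lmod A l) N"
    and jq: "\<And>x. x \<in> carrier N \<Longrightarrow> q (j x) = x"
    using M N by (auto simp: proj_data_def)
  define i' where "i' = (\<lambda>(x, y). \<lambda>b\<in>{..<k + l}. if b < k then i x b else j y (b - k))"
  define r1 where "r1 z = (\<lambda>b\<in>{..<k}. z b :: 'a)" for z
  define r2 where "r2 z = (\<lambda>b\<in>{..<l}. z (b + k) :: 'a)" for z
  define p' where "p' z = (p (r1 z), q (r2 z))" for z
  have "r1 z \<in> carrier (free_lmod A k)" "r2 z \<in> carrier (free_lmod A l)"
    if "z \<in> carrier (free_lmod A (k + l))" for z
    using free_lmod_closed[OF that] by (simp_all add: r1_def r2_def free_lmod_def)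
  then have r: "r1 \<in> lmod_hom A (free_lmod A (k + l)) (free_lmod A k)"
     "r2 \<in> lmod_hom A (free_lmod A (k + l)) (free_lmod A l)"
    by (intro lmod_hom_freeI free_lmod_left_module ring_axioms; simp add: r1_def r2_def free_lmod_apply)+
  have ic: "i x b \<in> carrier A" if "x \<in> carrier M" "b < k" for x b
    using lmod_homD(1)[OF i that(1)] that(2) by (auto simp: free_lmod_def)
  have jc: "j x b \<in> carrier A" if "x \<in> carrier N" "b < l" for x b
    using lmod_homD(1)[OF j that(1)] that(2) by (auto simp: free_lmod_def)
  have "p' \<in> lmod_hom A (free_lmod A (k + l)) (dsum M N)"
    using lmod_hom_comp[OF r(1) p] lmod_hom_comp[OF r(2) q]
    by (auto simp: lmod_hom_def p'_def dsum_def Pi_iff)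
  moreover have "i' \<in> lmod_hom A (dsum M N) (free_lmod A (k + l))"
  proof -
    have "i (x \<oplus>\<^bsub>M\<^esub> x') b = i x b \<oplus> i x' b" if "x \<in> carrier M" "x' \<in> carrier M" "b < k" for x x' b
      using lmod_homD(2)[OF i that(1,2)] that(3) by (simp add: free_lmod_def)
    moreover have "j (x \<oplus>\<^bsub>N\<^esub> x') b = j x b \<oplus> j x' b" if "x \<in> carrier N" "x' \<in> carrier N" "b < l" for x x' b
      using lmod_homD(2)[OF j that(1,2)] that(3) by (simp add: free_lmod_def)
    moreover have "i (a \<odot>\<^bsub>M\<^esub> x) b = a \<otimes> i x b" if "x \<in> carrier M" "a \<in> carrier A" "b < k" for x a b
      using lmod_homD(3)[OF i that(2,1)] that(3) by (simp add: free_lmod_def)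
    moreover have "j (a \<odot>\<^bsub>N\<^esub> x) b = a \<otimes> j x b" if "x \<in> carrier N" "a \<in> carrier A" "b < l" for x a b
      using lmod_homD(3)[OF j that(2,1)] that(3) by (simp add: free_lmod_def)
    ultimately show ?thesis
    proof (intro lmod_hom_freeI dsum_left_module M' N')
      fix x assume "x \<in> carrier (dsum M N)"
      then show "i' x \<in> carrier (free_lmod A (k + l))"
        using ic jc by (auto simp: i'_def dsum_def free_lmod_def split: if_splits)
    qed (auto simp: i'_def dsum_def)
  qed
  moreover have i'r: "r1 (i' (x, y)) = i x" "r2 (i' (x, y)) = j y" if "x \<in> carrier M" "y \<in> carrier N" for x y
    using lmod_homD(1)[OF i that(1)] lmod_homD(1)[OF j that(2)]
    by (auto simp: r1_def r2_def i'_def free_lmod_def PiE_def extensional_def fun_eq_iff)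
  moreover have "p' (i' x) = x" if "x \<in> carrier (dsum M N)" for x
    using that i'r ip jq by (auto simp: p'_def dsum_def)
  ultimately have d: "proj_data (dsum M N) (k + l) i' p'"
    unfolding proj_data_def using dsum_left_module[OF M' N'] by blast
  then show "\<exists>k i p. proj_data (dsum M N) k i p" by blast
  have split: "(\<Sum>a<k + l. h a) = (\<Sum>a<k. h a) + (\<Sum>b<l. h (k + b))" for h :: "nat \<Rightarrow> complex"
    by (induction l) (auto simp: add.assoc)
  have u: "r1 (unit_vec A (k + l) a) = unit_vec A k a" if "a < k" for a
    using that by (auto simp: r1_def unit_vec_def)
  have u': "r2 (unit_vec A (k + l) (k + b)) = unit_vec A l b" if "b < l" for b
    using that by (auto simp: r2_def unit_vec_def)
  have "data_trace \<chi> (k + l) i' p' = (\<Sum>a<k. \<chi> (i (p (unit_vec A k a)) a))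
      + (\<Sum>b<l. \<chi> (j (q (unit_vec A l b)) b))"
    unfolding data_trace_def split
    by (intro arg_cong2[of _ _ _ _ "(+)"] sum.cong refl) (simp_all add: i'_def p'_def u u')
  then show "mtrace \<chi> (dsum M N) = mtrace \<chi> M + mtrace \<chi> N"
    unfolding mtrace_eq[OF \<chi> M] mtrace_eq[OF \<chi> N] mtrace_eq[OF \<chi> d] by (simp add: data_trace_def)
qed

end

subsection \<open>Finite-dimensional modules\<close>

text \<open>An inductive form of the span that occurs in \<open>fin_dim\<close>: it permits rule
  induction, for instance when a span is pushed through a homomorphism.\<close>

inductive_set cspan :: "(complex, 'a) module \<Rightarrow> ('a, 'v) module \<Rightarrow> 'v set \<Rightarrow> 'v set"
  for A M B where
    zero: "\<zero>\<^bsub>M\<^esub> \<in> cspan A M B"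
  | step: "x \<in> cspan A M B \<Longrightarrow> b \<in> B \<Longrightarrow> x \<oplus>\<^bsub>M\<^esub> ((z \<odot>\<^bsub>A\<^esub> \<one>\<^bsub>A\<^esub>) \<odot>\<^bsub>M\<^esub> b) \<in> cspan A M B"

text \<open>A basis of \<open>U\<close> extends to a basis of \<open>V\<close>; if nothing were
  added, \<open>V\<close> would lie in the subspace \<open>U\<close>.\<close>

lemma dim_strict_mono:
  assumes U: "formal.subspace U" and UV: "U \<subset> V" and V: "V \<subseteq> formal.span W" "finite W"
  shows "formal.dim U < formal.dim V"
proof -
  obtain B where B: "B \<subseteq> U" "formal.independent B" "U \<subseteq> formal.span B"
    using formal.maximal_independent_subset[of U] by blast
  obtain C where C: "B \<subseteq> C" "C \<subseteq> V" "formal.independent C" "V \<subseteq> formal.span C"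
    using formal.maximal_independent_subset_extend[of B V] B UV by blast
  have fin: "finite C" using formal.independent_span_bound[OF V(2) C(3)] C(2) V(1) by blast
  have dims: "formal.dim U = card B" "formal.dim V = card C"
    using formal.basis_card_eq_dim[OF B(1,3,2)] formal.basis_card_eq_dim[OF C(2,4,3)] by simp_all
  have "B \<noteq> C"
  proof
    assume "B = C"
    then have "V \<subseteq> U" using C(4) formal.span_minimal[OF B(1) U] by simp
    then show False using UV by blast
  qed
  then show ?thesis unfolding dims using psubset_card_mono[OF fin] C(1) by blast
qed

context complex_algebra
begin

lemma sc_zero: "sc 0 = \<zero>"
proof -
  have "sc 0 \<oplus> sc 0 = sc 0 \<oplus> \<zero>" using scalar_add[of 0 0] by simp
  then show ?thesis by (simp only: add.l_cancel scalar_closed zero_closed)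
qed

lemma cspan_subset:
  assumes "left_module A M" "B \<subseteq> carrier M" "x \<in> cspan A M B"
  shows "x \<in> carrier M"
proof -
  interpret M: left_module A M by fact
  show ?thesis using assms(3) by induction (use assms(2) in \<open>auto intro!: M.M.a_closed M.smult_closed\<close>)
qed

lemma cspan_iff:
  assumes M: "left_module A M" and B: "finite B" "B \<subseteq> carrier M"
  shows "x \<in> cspan A M B \<longleftrightarrow> (\<exists>z. x = (\<Oplus>\<^bsub>M\<^esub>b\<in>B. sc (z b) \<odot>\<^bsub>M\<^esub> b))"
proof
  interpret M: left_module A M by fact
  have cl [simp]: "sc z \<odot>\<^bsub>M\<^esub> b \<in> carrier M" if "b \<in> carrier M" for z b
    using that by (simp add: M.smult_closed)
  show "\<exists>z. x = (\<Oplus>\<^bsub>M\<^esub>b\<in>B. sc (z b) \<odot>\<^bsub>M\<^esub> b)" if "x \<in> cspan A M B"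
    using that
  proof induction
    case zero
    have "(\<Oplus>\<^bsub>M\<^esub>b\<in>B. sc ((\<lambda>_. 0) b) \<odot>\<^bsub>M\<^esub> b) = (\<Oplus>\<^bsub>M\<^esub>b\<in>B. \<zero>\<^bsub>M\<^esub>)"
      using B(2) by (intro M.M.finsum_cong') (auto simp: sc_zero M.smult_zero_left)
    then show ?case by (intro exI[of _ "\<lambda>_. 0"]) simp
  next
    case (step x b w)
    then obtain z where x: "x = (\<Oplus>\<^bsub>M\<^esub>b\<in>B. sc (z b) \<odot>\<^bsub>M\<^esub> b)" by blast
    define C where "C = B - {b}"
    have C: "B = insert b C" "b \<notin> C" "finite C" "C \<subseteq> carrier M" and b: "b \<in> carrier M"
      using step B by (auto simp: C_def)
    define R where "R = (\<Oplus>\<^bsub>M\<^esub>b\<in>C. sc (z b) \<odot>\<^bsub>M\<^esub> b)"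
    have R: "R \<in> carrier M" unfolding R_def using C by (intro M.M.finsum_closed) auto
    have "(\<Oplus>\<^bsub>M\<^esub>a\<in>B. sc ((z(b := z b + w)) a) \<odot>\<^bsub>M\<^esub> a)
        = (sc (z b + w) \<odot>\<^bsub>M\<^esub> b) \<oplus>\<^bsub>M\<^esub> (\<Oplus>\<^bsub>M\<^esub>a\<in>C. sc ((z(b := z b + w)) a) \<odot>\<^bsub>M\<^esub> a)"
      unfolding C(1) using C b by (subst M.M.finsum_insert) auto
    also have "(\<Oplus>\<^bsub>M\<^esub>a\<in>C. sc ((z(b := z b + w)) a) \<odot>\<^bsub>M\<^esub> a) = R"
      unfolding R_def using C by (intro M.M.finsum_cong') auto
    also have "sc (z b + w) \<odot>\<^bsub>M\<^esub> b = (sc (z b) \<odot>\<^bsub>M\<^esub> b) \<oplus>\<^bsub>M\<^esub> (sc w \<odot>\<^bsub>M\<^esub> b)"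
      using b by (simp add: scalar_add M.smult_l_distr)
    also have "\<dots> \<oplus>\<^bsub>M\<^esub> R = ((sc (z b) \<odot>\<^bsub>M\<^esub> b) \<oplus>\<^bsub>M\<^esub> R) \<oplus>\<^bsub>M\<^esub> (sc w \<odot>\<^bsub>M\<^esub> b)"
      using b R by (simp add: M.M.a_ac)
    also have "(sc (z b) \<odot>\<^bsub>M\<^esub> b) \<oplus>\<^bsub>M\<^esub> R = x"
      unfolding x R_def C(1) using C b by (subst M.M.finsum_insert) auto
    finally show ?case by (intro exI[of _ "z(b := z b + w)"]) simp
  qed
  show "x \<in> cspan A M B" if "\<exists>z. x = (\<Oplus>\<^bsub>M\<^esub>b\<in>B. sc (z b) \<odot>\<^bsub>M\<^esub> b)"
  proof -
    obtain z where x: "x = (\<Oplus>\<^bsub>M\<^esub>b\<in>B. sc (z b) \<odot>\<^bsub>M\<^esub> b)" using \<open>\<exists>z. _\<close> by blast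
    have "(\<Oplus>\<^bsub>M\<^esub>b\<in>C. sc (z b) \<odot>\<^bsub>M\<^esub> b) \<in> cspan A M B" if "C \<subseteq> B" for C
      using finite_subset[OF that B(1)] that
    proof (induction C rule: finite_induct)
      case empty
      show ?case by (simp add: cspan.zero)
    next
      case (insert b C)
      have c: "(\<Oplus>\<^bsub>M\<^esub>b\<in>C. sc (z b) \<odot>\<^bsub>M\<^esub> b) \<in> carrier M"
        using insert B by (intro M.M.finsum_closed) auto
      have "(\<Oplus>\<^bsub>M\<^esub>b\<in>insert b C. sc (z b) \<odot>\<^bsub>M\<^esub> b)
          = (\<Oplus>\<^bsub>M\<^esub>b\<in>C. sc (z b) \<odot>\<^bsub>M\<^esub> b) \<oplus>\<^bsub>M\<^esub> (sc (z b) \<odot>\<^bsub>M\<^esub> b)"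
        using insert B c by (subst M.M.finsum_insert) (auto simp: M.M.a_comm subset_iff)
      then show ?case using insert by (simp add: cspan.step)
    qed
    then show ?thesis using x by simp
  qed
qed

lemma fin_dim_iff:
  assumes "left_module A M"
  shows "fin_dim A M \<longleftrightarrow> (\<exists>B. finite B \<and> B \<subseteq> carrier M \<and> carrier M \<subseteq> cspan A M B)"
proof -
  have "carrier M \<subseteq> cspan A M B \<longleftrightarrow> (\<forall>x\<in>carrier M. \<exists>z. x = (\<Oplus>\<^bsub>M\<^esub>b\<in>B. sc (z b) \<odot>\<^bsub>M\<^esub> b))"
    if "finite B" "B \<subseteq> carrier M" for B
    unfolding subset_iff cspan_iff[OF assms that] by blast
  then show ?thesis unfolding fin_dim_def by meson
qed

lemma fin_dim_image:
  assumes M: "left_module A M" and N: "left_module A N" and f: "f \<in> lmod_hom A M N"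
    and onto: "f ` carrier M = carrier N" and fin: "fin_dim A M"
  shows "fin_dim A N"
proof -
  interpret M: left_module A M by fact
  obtain B where B: "finite B" "B \<subseteq> carrier M" "carrier M \<subseteq> cspan A M B"
    using fin fin_dim_iff[OF M] by blast
  have "f x \<in> cspan A N (f ` B)" if "x \<in> cspan A M B" for x
    using that
  proof induction
    case zero
    show ?case using lmod_hom_zero[OF M N f] by (simp add: cspan.zero)
  next
    case (step x b z)
    then have "x \<in> carrier M" "b \<in> carrier M" using cspan_subset[OF M B(2)] B(2) by auto
    then have "f (x \<oplus>\<^bsub>M\<^esub> (sc z \<odot>\<^bsub>M\<^esub> b)) = f x \<oplus>\<^bsub>N\<^esub> (sc z \<odot>\<^bsub>N\<^esub> f b)"
      using lmod_homD(2)[OF f, of x "sc z \<odot>\<^bsub>M\<^esub> b"] lmod_homD(3)[OF f, of "sc z" b] M.smult_closed by simp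
    then show ?case using step cspan.step[of "f x" A N "f ` B" "f b" z] by simp
  qed
  then have "carrier N \<subseteq> cspan A N (f ` B)" unfolding onto[symmetric] using B(3) by blast
  moreover have "f ` B \<subseteq> carrier N" using B(2) onto by blast
  ultimately show ?thesis using fin_dim_iff[OF N] B(1) by blast
qed

text \<open>Fix a finite spanning set and choose one coefficient vector for every element. The
  coefficients determine the element, so this choice is an injection even if the spanning set is not
  independent.\<close>

lemma fin_dim_inj:
  assumes M: "left_module A M" and fin: "fin_dim A M"
  obtains j :: "'v \<Rightarrow> nat \<Rightarrow> complex" where "inj_on j (carrier (M :: ('a, 'v) module))"
proof -
  interpret M: left_module A M by fact
  obtain B where B: "finite B" "B \<subseteq> carrier M"
    "\<forall>x\<in>carrier M. \<exists>z. x = (\<Oplus>\<^bsub>M\<^esub>b\<in>B. sc (z b) \<odot>\<^bsub>M\<^esub> b)"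
    using fin unfolding fin_dim_def by blast
  then obtain z where z: "x = (\<Oplus>\<^bsub>M\<^esub>b\<in>B. sc (z x b) \<odot>\<^bsub>M\<^esub> b)" if "x \<in> carrier M" for x by metis
  obtain e where e: "bij_betw e {0..<card B} B" using ex_bij_betw_nat_finite[OF B(1)] by blast
  have "inj_on (\<lambda>x n. z x (e n)) (carrier M)"
  proof (rule inj_onI)
    fix x y assume x: "x \<in> carrier M" and y: "y \<in> carrier M" and eq: "(\<lambda>n. z x (e n)) = (\<lambda>n. z y (e n))"
    have "z x b = z y b" if "b \<in> B" for b
    proof -
      obtain n where "b = e n" using e \<open>b \<in> B\<close> unfolding bij_betw_def by blast
      then show ?thesis using fun_cong[OF eq, of n] by simp
    qed
    then have "(\<Oplus>\<^bsub>M\<^esub>b\<in>B. sc (z x b) \<odot>\<^bsub>M\<^esub> b) = (\<Oplus>\<^bsub>M\<^esub>b\<in>B. sc (z y b) \<odot>\<^bsub>M\<^esub> b)"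
      using B(2) by (intro M.M.finsum_cong') (auto intro: M.smult_closed)
    then show "x = y" using z[OF x] z[OF y] by simp
  qed
  then show thesis by (rule that)
qed

text \<open>A stand-in for the dimension of a submodule: the dimension of its preimage under the
  linear map \<open>lc\<close> from formal combinations of a finite spanning set. As
  \<open>lc\<close> is onto, strict inclusions lift to preimages.\<close>

lemma submodule_measure:
  assumes M: "left_module A M" and fin: "fin_dim A M"
  obtains \<mu> :: "'v set \<Rightarrow> nat" where
    "\<And>U V. submodule U A (M :: ('a, 'v) module) \<Longrightarrow> submodule V A M \<Longrightarrow> U \<subset> V \<Longrightarrow> \<mu> U < \<mu> V"
proof -
  interpret M: left_module A M by fact
  have cl [simp]: "sc z \<odot>\<^bsub>M\<^esub> b \<in> carrier M" if "b \<in> carrier M" for z b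
    using that by (simp add: M.smult_closed)
  obtain B where B: "finite B" "B \<subseteq> carrier M"
    "\<forall>x\<in>carrier M. \<exists>z. x = (\<Oplus>\<^bsub>M\<^esub>b\<in>B. sc (z b) \<odot>\<^bsub>M\<^esub> b)"
    using fin unfolding fin_dim_def by blast
  define lc where "lc p = (\<Oplus>\<^bsub>M\<^esub>b\<in>B. sc (Poly_Mapping.lookup p b) \<odot>\<^bsub>M\<^esub> b)" for p
  have lc_zero: "lc 0 = \<zero>\<^bsub>M\<^esub>"
  proof -
    have "lc 0 = (\<Oplus>\<^bsub>M\<^esub>b\<in>B. \<zero>\<^bsub>M\<^esub>)"
      unfolding lc_def using B(2) by (intro M.M.finsum_cong') (auto simp: sc_zero M.smult_zero_left)
    then show ?thesis by simp
  qed
  have lc_add: "lc (p + q) = lc p \<oplus>\<^bsub>M\<^esub> lc q" for p q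
  proof -
    have "lc (p + q) = (\<Oplus>\<^bsub>M\<^esub>b\<in>B. (sc (Poly_Mapping.lookup p b) \<odot>\<^bsub>M\<^esub> b) \<oplus>\<^bsub>M\<^esub> (sc (Poly_Mapping.lookup q b) \<odot>\<^bsub>M\<^esub> b))"
      unfolding lc_def using B(2)
      by (intro M.M.finsum_cong') (auto simp: lookup_add scalar_add M.smult_l_distr subset_iff)
    also have "\<dots> = lc p \<oplus>\<^bsub>M\<^esub> lc q" unfolding lc_def using B by (intro M.M.finsum_addf) auto
    finally show ?thesis .
  qed
  have lc_scale: "lc (w *\<^sub>k p) = sc w \<odot>\<^bsub>M\<^esub> lc p" for w p
  proof -
    have "(\<Oplus>\<^bsub>M\<^esub>b\<in>C. sc (w * Poly_Mapping.lookup p b) \<odot>\<^bsub>M\<^esub> b)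
        = sc w \<odot>\<^bsub>M\<^esub> (\<Oplus>\<^bsub>M\<^esub>b\<in>C. sc (Poly_Mapping.lookup p b) \<odot>\<^bsub>M\<^esub> b)" if "C \<subseteq> B" for C
      using finite_subset[OF that B(1)] that
    proof (induction C rule: finite_induct)
      case empty
      show ?case by (simp add: M.smult_zero_right)
    next
      case (insert b C)
      have C: "b \<in> carrier M" "C \<subseteq> carrier M" using insert B by auto
      then have "(\<Oplus>\<^bsub>M\<^esub>b\<in>C. sc (Poly_Mapping.lookup p b) \<odot>\<^bsub>M\<^esub> b) \<in> carrier M"
        by (intro M.M.finsum_closed) auto
      moreover have "(\<Oplus>\<^bsub>M\<^esub>b\<in>insert b C. sc (w * Poly_Mapping.lookup p b) \<odot>\<^bsub>M\<^esub> b)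
         = (sc (w * Poly_Mapping.lookup p b) \<odot>\<^bsub>M\<^esub> b) \<oplus>\<^bsub>M\<^esub> (\<Oplus>\<^bsub>M\<^esub>b\<in>C. sc (w * Poly_Mapping.lookup p b) \<odot>\<^bsub>M\<^esub> b)"
        using insert C by (intro M.M.finsum_insert) auto
      moreover have "(\<Oplus>\<^bsub>M\<^esub>b\<in>insert b C. sc (Poly_Mapping.lookup p b) \<odot>\<^bsub>M\<^esub> b)
         = (sc (Poly_Mapping.lookup p b) \<odot>\<^bsub>M\<^esub> b) \<oplus>\<^bsub>M\<^esub> (\<Oplus>\<^bsub>M\<^esub>b\<in>C. sc (Poly_Mapping.lookup p b) \<odot>\<^bsub>M\<^esub> b)"
        using insert C by (intro M.M.finsum_insert) auto
      ultimately show ?case using insert C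
        by (simp add: scalar_mult M.smult_assoc M.smult_r_distr)
    qed
    from this[of B] show ?thesis by (simp add: lc_def)
  qed
  \<comment> \<open>\<open>lc\<close> ignores keys outside \<open>B\<close>; excluding them keeps
    the preimages finite-dimensional.\<close>
  define pre where "pre U = {p. Poly_Mapping.keys p \<subseteq> B \<and> lc p \<in> U}" for U
  have sub: "formal.subspace (pre U)" if "submodule U A M" for U
  proof (rule formal.subspaceI)
    note U = M.is_submoduleD[OF that]
    show "0 \<in> pre U" using U(2) by (simp add: pre_def lc_zero)
    show "x + y \<in> pre U" if "x \<in> pre U" "y \<in> pre U" for x y
      using that keys_add[of x y] U(3) unfolding pre_def by (auto simp: lc_add)
    show "c *\<^sub>k x \<in> pre U" if "x \<in> pre U" for c x
      using that keys_cscale[of c x] U(4) unfolding pre_def by (auto simp: lc_scale)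
  qed
  have span: "pre U \<subseteq> formal.span ((\<lambda>b. Poly_Mapping.single b 1) ` B)" for U
  proof
    fix p assume "p \<in> pre U"
    then have k: "Poly_Mapping.keys p \<subseteq> B" by (simp add: pre_def)
    have "p = (\<Sum>b\<in>B. Poly_Mapping.lookup p b *\<^sub>k Poly_Mapping.single b 1)"
      by (rule poly_mapping_eqI)
        (use k B(1) in \<open>auto simp: lookup_sum lookup_single when_def in_keys_iff\<close>)
    also have "\<dots> \<in> formal.span ((\<lambda>b. Poly_Mapping.single b 1) ` B)"
      by (intro formal.span_sum formal.span_scale formal.span_base imageI)
    finally show "p \<in> formal.span ((\<lambda>b. Poly_Mapping.single b 1) ` B)" .
  qed
  have "formal.dim (pre U) < formal.dim (pre V)"
    if U: "submodule U A M" and V: "submodule V A M" and UV: "U \<subset> V" for U V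
  proof (rule dim_strict_mono[OF sub[OF U] _ span])
    obtain x where x: "x \<in> V" "x \<notin> U" using UV by blast
    then obtain z where z: "x = (\<Oplus>\<^bsub>M\<^esub>b\<in>B. sc (z b) \<odot>\<^bsub>M\<^esub> b)"
      using B(3) M.is_submoduleD(1)[OF V] by blast
    define p where "p = (\<Sum>b\<in>B. Poly_Mapping.single b (z b))"
    have lk: "Poly_Mapping.lookup p b = (if b \<in> B then z b else 0)" for b
      using B(1) by (auto simp: p_def lookup_sum lookup_single when_def)
    have "lc p = x" unfolding lc_def z using B(2) by (intro M.M.finsum_cong') (auto simp: lk)
    moreover have "Poly_Mapping.keys p \<subseteq> B" using lk by (auto simp: in_keys_iff split: if_splits)
    ultimately have "p \<in> pre V" "p \<notin> pre U" using x by (auto simp: pre_def)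
    moreover have "pre U \<subseteq> pre V" using UV by (auto simp: pre_def)
    ultimately show "pre U \<subset> pre V" by blast
  qed (use B(1) in simp)
  then show thesis by (rule that)
qed

lemma kernel_submodule:
  assumes "left_module A M" "left_module A N" "f \<in> lmod_hom A M N"
  shows "submodule {x \<in> carrier M. f x = \<zero>\<^bsub>N\<^esub>} A M"
proof -
  interpret M: left_module A M by fact
  interpret N: left_module A N by fact
  show ?thesis
    by (rule M.is_submoduleI) (auto simp: lmod_hom_zero[OF assms] lmod_homD[OF assms(3)] M.smult_closed
        N.smult_zero_right)
qed

lemma image_submodule:
  assumes "left_module A M" "left_module A N" "f \<in> lmod_hom A M N"
  shows "submodule (f ` carrier M) A N"
proof -
  interpret M: left_module A M by fact
  interpret N: left_module A N by fact
  show ?thesis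
  proof (rule N.is_submoduleI)
    show "\<zero>\<^bsub>N\<^esub> \<in> f ` carrier M" using lmod_hom_zero[OF assms] by (metis M.M.zero_closed image_eqI)
  next
    fix x y assume "x \<in> f ` carrier M" "y \<in> f ` carrier M"
    then obtain x' y' where "x' \<in> carrier M" "y' \<in> carrier M" "x = f x'" "y = f y'" by blast
    then show "x \<oplus>\<^bsub>N\<^esub> y \<in> f ` carrier M"
      by (intro image_eqI[of _ _ "x' \<oplus>\<^bsub>M\<^esub> y'"]) (auto simp: lmod_homD[OF assms(3)])
  next
    fix a x assume "a \<in> carrier A" "x \<in> f ` carrier M"
    then obtain x' where "a \<in> carrier A" "x' \<in> carrier M" "x = f x'" by blast
    then show "a \<odot>\<^bsub>N\<^esub> x \<in> f ` carrier M"
      by (intro image_eqI[of _ _ "a \<odot>\<^bsub>M\<^esub> x'"]) (auto simp: lmod_homD[OF assms(3)] M.smult_closed)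
  qed (use lmod_homD(1)[OF assms(3)] in auto)
qed

text \<open>Fitting's lemma: images and kernels of the powers of \<open>h\<close> become stationary,
  and from that exponent on \<open>M\<close> is the direct sum of the image and the kernel, so one
  of them is zero.\<close>

lemma fitting:
  fixes M :: "('a, 'v) module"
  assumes M: "left_module A M" and fin: "fin_dim A M" and ind: "indecomposable A M"
    and h: "h \<in> lmod_hom A M M"
  shows "(\<exists>m. \<forall>x\<in>carrier M. (h ^^ m) x = \<zero>\<^bsub>M\<^esub>) \<or> h ` carrier M = carrier M"
proof -
  interpret M: left_module A M by fact
  obtain \<mu> :: "'v set \<Rightarrow> nat"
    where \<mu>: "\<And>U V. submodule U A M \<Longrightarrow> submodule V A M \<Longrightarrow> U \<subset> V \<Longrightarrow> \<mu> U < \<mu> V"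
    using submodule_measure[OF M fin] by blast
  have hm: "h ^^ m \<in> lmod_hom A M M" for m
  proof (induction m)
    case 0
    show ?case by (simp add: lmod_hom_def)
  next
    case (Suc m)
    show ?case unfolding funpow.simps by (rule lmod_hom_comp[OF Suc h])
  qed
  have cl: "x \<in> carrier M \<Longrightarrow> (h ^^ m) x \<in> carrier M" for m x using lmod_homD(1)[OF hm] by blast
  define I where "I m = (h ^^ m) ` carrier M" for m
  define K where "K m = {x \<in> carrier M. (h ^^ m) x = \<zero>\<^bsub>M\<^esub>}" for m
  have sI: "submodule (I m) A M" and sK: "submodule (K m) A M" for m
    unfolding I_def K_def by (rule image_submodule[OF M M hm], rule kernel_submodule[OF M M hm])
  have pow: "(h ^^ (m + n)) x = (h ^^ m) ((h ^^ n) x)" for m n x by (simp add: funpow_add)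
  have I_mono: "I (m + n) \<subseteq> I m" for m n
    using cl[of _ n] unfolding I_def by (auto simp: pow)
  have K_mono: "K n \<subseteq> K (m + n)" for m n
    using lmod_hom_zero[OF M M hm] unfolding K_def by (auto simp: pow)
  obtain a where a: "\<And>n. \<mu> (I a) \<le> \<mu> (I n)" using ex_has_least_nat[of "\<lambda>_. True" _ "\<lambda>n. \<mu> (I n)"] by blast
  \<comment> \<open>A kernel of largest size is found by minimizing the difference to the size of
    the whole module, since a least natural number always exists.\<close>
  obtain b where b: "\<And>n. \<mu> (carrier M) - \<mu> (K b) \<le> \<mu> (carrier M) - \<mu> (K n)"
    using ex_has_least_nat[of "\<lambda>_. True" _ "\<lambda>n. \<mu> (carrier M) - \<mu> (K n)"] by blast
  have Ia: "I (a + n) = I a" for n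
    using I_mono[of a n] \<mu>[OF sI[of "a + n"] sI[of a]] a[of "a + n"] by (meson leD psubsetI)
  have Kb: "K (n + b) = K b" for n
  proof (rule ccontr)
    assume "K (n + b) \<noteq> K b"
    then have "\<mu> (K b) < \<mu> (K (n + b))" using K_mono[of b n] \<mu>[OF sK sK] by blast
    moreover have "\<mu> (K (n + b)) \<le> \<mu> (carrier M)"
    proof (cases "K (n + b) = carrier M")
      case False
      moreover have "K (n + b) \<subseteq> carrier M" by (auto simp: K_def)
      ultimately show ?thesis using \<mu>[OF sK M.carrier_submodule, of "n + b"] by (simp add: psubset_eq)
    qed simp
    ultimately show False using b[of "n + b"] by linarith
  qed
  \<comment> \<open>The exponent lies beyond both stationary points and is positive, so that an
    image equal to the whole module makes \<open>h\<close> itself surjective.\<close>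
  define m where "m = Suc (a + b)"
  have Im: "I (m + m) = I m" using Ia[of "Suc b"] Ia[of "Suc b + m"] by (simp add: m_def ac_simps)
  have Km: "K (m + m) = K m" using Kb[of "Suc a"] Kb[of "Suc a + m"] by (simp add: m_def ac_simps)
  have int: "K m \<inter> I m = {\<zero>\<^bsub>M\<^esub>}"
  proof (intro equalityI subsetI)
    fix x assume "x \<in> K m \<inter> I m"
    then obtain y where y: "y \<in> carrier M" "x = (h ^^ m) y" "(h ^^ m) x = \<zero>\<^bsub>M\<^esub>" by (auto simp: K_def I_def)
    then have "y \<in> K (m + m)" by (simp add: K_def pow)
    then show "x \<in> {\<zero>\<^bsub>M\<^esub>}" using y unfolding Km by (simp add: K_def)
  qed (use M.is_submoduleD(2)[OF sK] M.is_submoduleD(2)[OF sI] in auto)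
  have sum: "K m <+>\<^bsub>M\<^esub> I m = carrier M"
  proof (intro equalityI subsetI)
    fix x assume x: "x \<in> carrier M"
    then have "(h ^^ m) x \<in> I (m + m)" unfolding Im by (simp add: I_def)
    then obtain y where y: "y \<in> carrier M" "(h ^^ m) x = (h ^^ m) ((h ^^ m) y)" by (auto simp: I_def pow)
    \<comment> \<open>The difference of \<open>x\<close> and \<open>(h ^^ m) y\<close> lies in the
      kernel by the choice of \<open>y\<close>. The negative is written as the action of -1, which
      homomorphisms respect by definition.\<close>
    define k where "k = x \<oplus>\<^bsub>M\<^esub> (\<ominus>\<^bsub>A\<^esub> \<one>\<^bsub>A\<^esub>) \<odot>\<^bsub>M\<^esub> (h ^^ m) y"
    have hy: "(h ^^ m) y \<in> carrier M" "(\<ominus>\<^bsub>A\<^esub> \<one>\<^bsub>A\<^esub>) \<odot>\<^bsub>M\<^esub> (h ^^ m) y \<in> carrier M"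
      using y cl by (auto intro: M.smult_closed)
    have "(h ^^ m) k = (h ^^ m) x \<oplus>\<^bsub>M\<^esub> (\<ominus>\<^bsub>A\<^esub> \<one>\<^bsub>A\<^esub>) \<odot>\<^bsub>M\<^esub> (h ^^ m) ((h ^^ m) y)"
      unfolding k_def using x hy lmod_homD(2)[OF hm[of m], of x "(\<ominus>\<^bsub>A\<^esub> \<one>\<^bsub>A\<^esub>) \<odot>\<^bsub>M\<^esub> (h ^^ m) y"]
        lmod_homD(3)[OF hm[of m], of "\<ominus>\<^bsub>A\<^esub> \<one>\<^bsub>A\<^esub>" "(h ^^ m) y"] by simp
    also have "\<dots> = \<zero>\<^bsub>M\<^esub>" using y cl x by (simp add: M.smult_minus_one M.M.r_neg)
    finally have "k \<in> K m" using x hy by (simp add: K_def k_def)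
    moreover have "(h ^^ m) y \<in> I m" using y by (simp add: I_def)
    moreover have "x = k \<oplus>\<^bsub>M\<^esub> (h ^^ m) y"
      unfolding k_def using x hy by (simp add: M.smult_minus_one M.M.a_assoc M.M.l_neg)
    ultimately show "x \<in> K m <+>\<^bsub>M\<^esub> I m" unfolding set_add_def' by blast
  next
    fix x assume "x \<in> K m <+>\<^bsub>M\<^esub> I m"
    then show "x \<in> carrier M"
      using M.is_submoduleD(1)[OF sK[of m]] M.is_submoduleD(1)[OF sI[of m]] unfolding set_add_def' by auto
  qed
  have "K m = {\<zero>\<^bsub>M\<^esub>} \<or> I m = {\<zero>\<^bsub>M\<^esub>}" using ind sK sI int sum unfolding indecomposable_def by blast
  then show ?thesis
  proof
    assume 0: "K m = {\<zero>\<^bsub>M\<^esub>}"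
    have "carrier M \<subseteq> h ` carrier M"
    proof
      fix x assume "x \<in> carrier M"
      then obtain y where "y \<in> I m" "x = \<zero>\<^bsub>M\<^esub> \<oplus>\<^bsub>M\<^esub> y" using sum unfolding 0 set_add_def' by auto
      then have "x \<in> I m" using M.is_submoduleD(1)[OF sI[of m]] by auto
      then show "x \<in> h ` carrier M" using cl[of _ "a + b"] unfolding I_def m_def by auto
    qed
    then show ?thesis using lmod_homD(1)[OF h] by blast
  next
    assume "I m = {\<zero>\<^bsub>M\<^esub>}"
    then show ?thesis unfolding I_def by blast
  qed
qed

end

subsection \<open>Projective covers of one-dimensional modules\<close>

context complex_algebra
begin

text \<open>The common form of \<open>AKS_proj\<close> and \<open>Hecke0_proj\<close>, in which the
  simple quotient is described by the character through which the algebra acts on it.\<close>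

definition simple_proj :: "('a \<Rightarrow> complex) \<Rightarrow> ('a, 'v) module \<Rightarrow> bool"
  where "simple_proj \<chi> M \<longleftrightarrow> fd_projective A M \<and> indecomposable A M \<and>
    (\<exists>L :: 'a umodule. one_dim A L \<and> (\<forall>a\<in>carrier A. acts_by A L a (\<chi> a)) \<and>
      has_unique_simple_quotient A M L)"

lemma char_functional_scale:
  assumes "character \<chi>" "char_functional \<chi> M g" "x \<in> carrier M"
  shows "g (sc z \<odot>\<^bsub>M\<^esub> x) = z * g x"
  using assms by (simp add: char_functionalD[OF assms(2)] characterD(3)[OF assms(1)])

text \<open>The kernel has codimension one: on the scalar multiples of a vector outside the kernel
  \<open>g\<close> takes every value, so this vector and the kernel together generate
  \<open>M\<close>.\<close>

lemma char_kernel_maximal: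
  assumes M: "left_module A M" and \<chi>: "character \<chi>" and g: "char_functional \<chi> M g"
    and x0: "x0 \<in> carrier M" "g x0 \<noteq> 0"
  shows "maximal_submodule A M {x \<in> carrier M. g x = 0}"
proof -
  interpret M: left_module A M by fact
  note g' = char_functionalD[OF g] char_functional_zero[OF M g]
  have sub: "submodule {x \<in> carrier M. g x = 0} A M"
    by (rule M.is_submoduleI) (auto simp: g' M.smult_closed)
  moreover have "U = {x \<in> carrier M. g x = 0} \<or> U = carrier M"
    if U: "submodule U A M" and le: "{x \<in> carrier M. g x = 0} \<subseteq> U" for U
  proof (cases "\<exists>y\<in>U. g y \<noteq> 0")
    case True
    then obtain y where y: "y \<in> U" "g y \<noteq> 0" by blast
    note U' = M.is_submoduleD[OF U]
    have "x \<in> U" if x: "x \<in> carrier M" for x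
    proof -
      let ?w = "sc (g x / g y) \<odot>\<^bsub>M\<^esub> y"
      have yc: "y \<in> carrier M" using y U'(1) by blast
      have w: "?w \<in> U" "?w \<in> carrier M" using U'(4)[OF scalar_closed y(1)] U'(1) by auto
      have mw: "\<ominus>\<^bsub>M\<^esub> ?w \<in> carrier M" using w by simp
      have "g (\<ominus>\<^bsub>M\<^esub> ?w) + g ?w = 0"
        using g'(1)[OF mw w(2)] w(2) by (simp add: M.M.l_neg g'(3))
      moreover have "g ?w = g x" using y yc by (simp add: char_functional_scale[OF \<chi> g])
      ultimately have "g (x \<oplus>\<^bsub>M\<^esub> \<ominus>\<^bsub>M\<^esub> ?w) = 0" using x mw g'(1)[OF x mw] by (simp add: algebra_simps)
      then have "x \<oplus>\<^bsub>M\<^esub> \<ominus>\<^bsub>M\<^esub> ?w \<in> U" using le x mw by auto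
      then have "(x \<oplus>\<^bsub>M\<^esub> \<ominus>\<^bsub>M\<^esub> ?w) \<oplus>\<^bsub>M\<^esub> ?w \<in> U" using U'(3) w by blast
      then show ?thesis using x w mw by (simp add: M.M.a_assoc M.M.l_neg)
    qed
    then show ?thesis using U'(1) by blast
  next
    case False
    then show ?thesis using le M.is_submoduleD(1)[OF U] by blast
  qed
  moreover have "{x \<in> carrier M. g x = 0} \<noteq> carrier M" using x0 by auto
  ultimately show ?thesis unfolding maximal_submodule_def by blast
qed

text \<open>If \<open>g'\<close> is nonzero, its kernel is a maximal submodule too and therefore
  equals the kernel of \<open>g\<close>. In either case \<open>g'\<close> vanishes where
  \<open>g\<close> does, so it is a multiple of \<open>g\<close>.\<close>

lemma char_functional_proportional:
  assumes M: "left_module A M" and \<chi>: "character \<chi>" and g: "char_functional \<chi> M g"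
    and \<chi>': "character \<chi>'" and g': "char_functional \<chi>' M g'"
    and uniq: "\<exists>!N. maximal_submodule A M N"
    and x0: "x0 \<in> carrier M" "g x0 \<noteq> 0" and x: "x \<in> carrier M"
  shows "g' x = g' x0 / g x0 * g x"
proof -
  interpret M: left_module A M by fact
  let ?w = "sc (- (g x / g x0)) \<odot>\<^bsub>M\<^esub> x0"
  have w: "?w \<in> carrier M" using x0 by (simp add: M.smult_closed)
  have "g (x \<oplus>\<^bsub>M\<^esub> ?w) = 0"
    using x w x0 by (simp add: char_functionalD(1)[OF g] char_functional_scale[OF \<chi> g])
  moreover have "g' y = 0" if "y \<in> carrier M" "g y = 0" for y
  proof (rule ccontr)
    assume "g' y \<noteq> 0"
    then have "{x \<in> carrier M. g' x = 0} = {x \<in> carrier M. g x = 0}"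
      using char_kernel_maximal[OF M \<chi>' g' that(1)] char_kernel_maximal[OF M \<chi> g x0] uniq by blast
    then show False using that \<open>g' y \<noteq> 0\<close> by blast
  qed
  ultimately have "g' (x \<oplus>\<^bsub>M\<^esub> ?w) = 0" using x w by simp
  then show ?thesis
    using x w x0 by (simp add: char_functionalD(1)[OF g'] char_functional_scale[OF \<chi>' g'])
qed

text \<open>Every coordinate of \<open>i\<close>, followed by \<chi>', is a multiple
  \<open>c b\<close> of \<open>g\<close>. If the characters agree, expanding
  \<open>g x0 = g (p (i x0))\<close> in coordinates shows that the trace is 1; if they differ at
  some \<open>a\<close>, comparing the action of \<open>a\<close> forces all the multiples to be
  0.\<close>

lemma mtrace_unique_quotient:
  assumes \<chi>: "character \<chi>" and \<chi>': "character \<chi>'" and d: "proj_data M k i p"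
    and g: "char_functional \<chi> M g" and x0: "x0 \<in> carrier M" "g x0 \<noteq> 0"
    and uniq: "\<exists>!N. maximal_submodule A M N"
  shows "mtrace \<chi>' M = (if \<forall>a\<in>carrier A. \<chi>' a = \<chi> a then 1 else 0)"
proof -
  have M: "left_module A M" and i: "i \<in> lmod_hom A M (free_lmod A k)"
    and p: "p \<in> lmod_hom A (free_lmod A k) M" and ip: "\<And>x. x \<in> carrier M \<Longrightarrow> p (i x) = x"
    using d by (auto simp: proj_data_def)
  interpret M: left_module A M by fact
  define c where "c b = \<chi>' (i x0 b) / g x0" for b
  have cf: "char_functional \<chi>' M (\<lambda>x. \<chi>' (i x b))" if "b < k" for b
    using char_functional_comp[OF char_functional_coordinate[OF \<chi>' that] i] by (simp add: comp_def)
  have c: "\<chi>' (i x b) = c b * g x" if "b < k" "x \<in> carrier M" for b x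
    using char_functional_proportional[OF M \<chi> g \<chi>' cf[OF that(1)] uniq x0 that(2)] by (simp add: c_def)
  have pu: "p (unit_vec A k b) \<in> carrier M" for b using lmod_homD(1)[OF p] by simp
  have tr: "mtrace \<chi>' M = (\<Sum>b<k. c b * g (p (unit_vec A k b)))"
    unfolding mtrace_eq[OF \<chi>' d] data_trace_def using c pu by (intro sum.cong) auto
  show ?thesis
  proof (cases "\<forall>a\<in>carrier A. \<chi>' a = \<chi> a")
    case True
    have "g x0 = g (p (i x0))" using ip x0 by simp
    also have "\<dots> = (\<Sum>b<k. \<chi> (i x0 b) * g (p (unit_vec A k b)))"
      using char_functional_free[OF \<chi> char_functional_comp[OF g p] lmod_homD(1)[OF i x0(1)]] by simp
    also have "\<dots> = (\<Sum>b<k. g x0 * (c b * g (p (unit_vec A k b))))"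
    proof (intro sum.cong refl)
      fix b assume "b \<in> {..<k}"
      then have "i x0 b \<in> carrier A" using free_lmod_closed[OF lmod_homD(1)[OF i x0(1)]] by simp
      then have "\<chi> (i x0 b) = c b * g x0" using True c[of b x0] \<open>b \<in> {..<k}\<close> x0 by simp
      then show "\<chi> (i x0 b) * g (p (unit_vec A k b)) = g x0 * (c b * g (p (unit_vec A k b)))" by simp
    qed
    also have "\<dots> = g x0 * mtrace \<chi>' M" unfolding tr by (simp add: sum_distrib_left)
    finally show ?thesis using True x0 by simp
  next
    case False
    then obtain a where a: "a \<in> carrier A" "\<chi>' a \<noteq> \<chi> a" by blast
    have "c b = 0" if "b < k" for b
    proof -
      have ax: "a \<odot>\<^bsub>M\<^esub> x0 \<in> carrier M" using a x0 M.smult_closed by blast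
      have "\<chi>' a * (c b * g x0) = c b * (\<chi> a * g x0)"
        using char_functionalD(2)[OF cf[OF that] a(1) x0(1)]
        unfolding c[OF that ax] c[OF that x0(1)] char_functionalD(2)[OF g a(1) x0(1)] by auto
      then have "(\<chi>' a - \<chi> a) * (c b * g x0) = 0" by (simp add: algebra_simps)
      then show ?thesis using a(2) x0(2) by simp
    qed
    then show ?thesis unfolding tr using False by simp
  qed
qed

text \<open>The functional is the coordinate with respect to a nonzero vector, which is well defined
  because nonzero scalars are invertible.\<close>

lemma one_dim_functional:
  assumes L: "one_dim A L" and act: "\<forall>a\<in>carrier A. acts_by A L a (\<chi> a)" and \<chi>: "character \<chi>"
  obtains g where "char_functional \<chi> L g" "\<exists>x\<in>carrier L. g x \<noteq> 0"
proof -
  interpret L: left_module A L using L by (simp add: one_dim_def)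
  obtain x where x: "x \<in> carrier L" "x \<noteq> \<zero>\<^bsub>L\<^esub>" "\<And>y. y \<in> carrier L \<Longrightarrow> \<exists>z. y = sc z \<odot>\<^bsub>L\<^esub> x"
    using L unfolding one_dim_def by blast
  have cl: "sc z \<odot>\<^bsub>L\<^esub> x \<in> carrier L" for z using x by (simp add: L.smult_closed)
  have uniq: "z = w" if eq: "sc z \<odot>\<^bsub>L\<^esub> x = sc w \<odot>\<^bsub>L\<^esub> x" for z w
  proof (rule ccontr)
    assume "z \<noteq> w"
    have "(sc (z - w) \<odot>\<^bsub>L\<^esub> x) \<oplus>\<^bsub>L\<^esub> (sc w \<odot>\<^bsub>L\<^esub> x) = \<zero>\<^bsub>L\<^esub> \<oplus>\<^bsub>L\<^esub> (sc w \<odot>\<^bsub>L\<^esub> x)"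
      using eq cl L.smult_l_distr[OF scalar_closed scalar_closed x(1), of "z - w" w] scalar_add[of "z - w" w]
      by simp
    then have 0: "sc (z - w) \<odot>\<^bsub>L\<^esub> x = \<zero>\<^bsub>L\<^esub>" using cl by (simp only: L.M.add.r_cancel L.M.zero_closed)
    have "x = sc (1 / (z - w) * (z - w)) \<odot>\<^bsub>L\<^esub> x" using \<open>z \<noteq> w\<close> x(1) by (simp add: scalar_one L.smult_one)
    also have "\<dots> = sc (1 / (z - w)) \<odot>\<^bsub>L\<^esub> (sc (z - w) \<odot>\<^bsub>L\<^esub> x)"
      using x(1) by (simp only: scalar_mult L.smult_assoc scalar_closed)
    also have "\<dots> = \<zero>\<^bsub>L\<^esub>" unfolding 0 by (simp add: L.smult_zero_right)
    finally show False using x(2) by simp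
  qed
  define g where "g y = (THE z. y = sc z \<odot>\<^bsub>L\<^esub> x)" for y
  have g: "g (sc z \<odot>\<^bsub>L\<^esub> x) = z" for z unfolding g_def using uniq by blast
  have "char_functional \<chi> L g"
    unfolding char_functional_def
  proof (intro conjI ballI)
    fix y y' assume "y \<in> carrier L" "y' \<in> carrier L"
    then obtain z z' where "y = sc z \<odot>\<^bsub>L\<^esub> x" "y' = sc z' \<odot>\<^bsub>L\<^esub> x" using x(3) by blast
    moreover have "(sc z \<odot>\<^bsub>L\<^esub> x) \<oplus>\<^bsub>L\<^esub> (sc z' \<odot>\<^bsub>L\<^esub> x) = sc (z + z') \<odot>\<^bsub>L\<^esub> x"
      using x(1) by (simp add: scalar_add L.smult_l_distr)
    ultimately show "g (y \<oplus>\<^bsub>L\<^esub> y') = g y + g y'" using g by simp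
  next
    fix a y assume a: "a \<in> carrier A" and y: "y \<in> carrier L"
    then obtain z where z: "y = sc z \<odot>\<^bsub>L\<^esub> x" using x(3) by blast
    have "a \<odot>\<^bsub>L\<^esub> y = sc (\<chi> a) \<odot>\<^bsub>L\<^esub> y" using act a y unfolding acts_by_def by blast
    also have "\<dots> = sc (\<chi> a * z) \<odot>\<^bsub>L\<^esub> x" unfolding z using x(1) by (simp add: scalar_mult L.smult_assoc)
    finally show "g (a \<odot>\<^bsub>L\<^esub> y) = \<chi> a * g y" using z g by simp
  qed
  moreover have "g x \<noteq> 0" using g[of 1] x(1) by (simp add: scalar_one L.smult_one)
  ultimately show thesis using that x(1) by blast
qed

lemma mtrace_simple_proj:
  assumes \<chi>: "character \<chi>" and \<chi>': "character \<chi>'" and M: "simple_proj \<chi> M"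
  shows "mtrace \<chi>' M = (if \<forall>a\<in>carrier A. \<chi>' a = \<chi> a then 1 else 0)"
proof -
  obtain L :: "'a umodule" where L: "one_dim A L" "\<forall>a\<in>carrier A. acts_by A L a (\<chi> a)"
    "has_unique_simple_quotient A M L"
    using M unfolding simple_proj_def by blast
  obtain g where g: "char_functional \<chi> L g" "\<exists>x\<in>carrier L. g x \<noteq> 0"
    using one_dim_functional[OF L(1,2) \<chi>] by blast
  have uniq: "\<exists>!N. maximal_submodule A M N"
    using L(3) unfolding has_unique_simple_quotient_def by (rule conjunct1)
  have "\<exists>f\<in>lmod_hom A M L. f ` carrier M = carrier L"
    using L(3)[unfolded has_unique_simple_quotient_def, THEN conjunct2, THEN conjunct2] .
  then obtain f where f: "f \<in> lmod_hom A M L" "f ` carrier M = carrier L" by blast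
  obtain y where y: "y \<in> carrier L" "g y \<noteq> 0" using g(2) by blast
  obtain x0 where "x0 \<in> carrier M" "y = f x0" using y(1) unfolding f(2)[symmetric] by blast
  then have "x0 \<in> carrier M" "(g \<circ> f) x0 \<noteq> 0" using y(2) by auto
  moreover obtain k i p where "proj_data M k i p"
    using M unfolding simple_proj_def fd_projective_iff by blast
  ultimately show ?thesis
    by (intro mtrace_unique_quotient[OF \<chi> \<chi>' _ char_functional_comp[OF g(1) f(1)] _ _ uniq])
qed

text \<open>The one-dimensional module of \<chi>, realized by functions supported at 0 because
  \<open>simple_proj\<close> asks for a simple module in the universe of
  \<open>umodule\<close>.\<close>

definition char_module :: "('a \<Rightarrow> complex) \<Rightarrow> 'a umodule"
  where "char_module \<chi> = \<lparr>carrier = {f. \<forall>n>0. f n = 0}, monoid.mult = undefined, monoid.one = undefined,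
     ring.zero = (\<lambda>_. 0), ring.add = (\<lambda>f g n. f n + g n), smult = (\<lambda>a f n. \<chi> a * f n)\<rparr>"

lemma char_module_left_module:
  assumes \<chi>: "character \<chi>" shows "left_module A (char_module \<chi>)"
proof -
  have "abelian_group (char_module \<chi>)"
  proof (rule abelian_groupI)
    fix f assume "f \<in> carrier (char_module \<chi>)"
    then show "\<exists>g\<in>carrier (char_module \<chi>). g \<oplus>\<^bsub>char_module \<chi>\<^esub> f = \<zero>\<^bsub>char_module \<chi>\<^esub>"
      by (intro bexI[of _ "\<lambda>n. - f n"]) (auto simp: char_module_def)
  qed (auto simp: char_module_def algebra_simps)
  then show ?thesis
    by (intro left_module.intro left_module_axioms.intro ring_axioms)
      (auto simp: char_module_def characterD[OF \<chi>] algebra_simps)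
qed

lemma char_module_one_dim:
  assumes \<chi>: "character \<chi>" shows "one_dim A (char_module \<chi>)"
  unfolding one_dim_def
proof (intro conjI char_module_left_module[OF \<chi>] bexI[of _ "\<lambda>n. if n = 0 then 1 else 0"] ballI)
  fix f assume f: "f \<in> carrier (char_module \<chi>)"
  show "\<exists>z. f = sc z \<odot>\<^bsub>char_module \<chi>\<^esub> (\<lambda>n. if n = 0 then 1 else 0)"
    using f by (intro exI[of _ "f 0"] ext) (auto simp: char_module_def characterD[OF \<chi>])
qed (auto simp: char_module_def fun_eq_iff)

lemma char_module_acts: "character \<chi> \<Longrightarrow> \<forall>a\<in>carrier A. acts_by A (char_module \<chi>) a (\<chi> a)"
  by (auto simp: acts_by_def char_module_def characterD)

lemma char_module_simple:
  assumes \<chi>: "character \<chi>"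
  shows "maximal_submodule A (char_module \<chi>) {\<zero>\<^bsub>char_module \<chi>\<^esub>}"
proof -
  have "char_functional \<chi> (char_module \<chi>) (\<lambda>f. f 0)"
    by (auto simp: char_functional_def char_module_def)
  moreover have "(\<lambda>n. if n = 0 then 1 else 0) \<in> carrier (char_module \<chi>)" by (auto simp: char_module_def)
  ultimately have "maximal_submodule A (char_module \<chi>) {f \<in> carrier (char_module \<chi>). f 0 = 0}"
    by (intro char_kernel_maximal[OF char_module_left_module[OF \<chi>] \<chi>]) auto
  moreover have "{f \<in> carrier (char_module \<chi>). f 0 = 0} = {\<zero>\<^bsub>char_module \<chi>\<^esub>}"
    by (auto simp: char_module_def fun_eq_iff) (metis neq0_conv)
  ultimately show ?thesis by simp
qed

text \<open>If a second maximal submodule \<open>N\<close> existed, then \<open>g\<close> would not vanish on it, and projectivity would give an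
  endomorphism \<open>h\<close> of \<open>M\<close> with image in \<open>N\<close> and \<open>g \<circ> h = g\<close>, which is neither nilpotent nor surjective.\<close>

lemma simple_projI:
  assumes proj: "fd_projective A M" and ind: "indecomposable A M" and \<chi>: "character \<chi>"
    and g: "char_functional \<chi> M g" and x0: "x0 \<in> carrier M" "g x0 \<noteq> 0"
  shows "simple_proj \<chi> M"
proof -
  obtain k i p where d: "proj_data M k i p" and fin: "fin_dim A M"
    using proj unfolding fd_projective_iff by blast
  have M: "left_module A M" and i: "i \<in> lmod_hom A M (free_lmod A k)"
    and p: "p \<in> lmod_hom A (free_lmod A k) M" and ip: "\<And>x. x \<in> carrier M \<Longrightarrow> p (i x) = x"
    using d by (auto simp: proj_data_def)
  interpret M: left_module A M by fact
  interpret F: left_module A "free_lmod A k" by (rule free_lmod_left_module) (rule ring_axioms)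
  let ?N = "{x \<in> carrier M. g x = 0}"
  have max: "maximal_submodule A M ?N" by (rule char_kernel_maximal[OF M \<chi> g x0])
  have "N = ?N" if N: "maximal_submodule A M N" for N
  proof (rule ccontr)
    assume ne: "N \<noteq> ?N"
    have sN: "submodule N A M" using N unfolding maximal_submodule_def by blast
    note N' = M.is_submoduleD[OF sN]
    have "\<not> N \<subseteq> ?N"
      using N max ne unfolding maximal_submodule_def by blast
    then obtain y where y: "y \<in> N" "g y \<noteq> 0" using N'(1) by blast
    then have yc: "y \<in> carrier M" using N'(1) by blast
    \<comment> \<open>Below, \<open>h0\<close> sends the \<open>a\<close>-th unit vector to
      \<open>co a\<close> times \<open>y\<close>. This scaling makes \<open>g \<circ> h0\<close> and
      \<open>g \<circ> p\<close> agree on unit vectors, hence everywhere, while the image of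
      \<open>h0\<close> lies in \<open>N\<close>.\<close>
    define co where "co a = sc (g (p (unit_vec A k a)) / g y)" for a
    define b where "b x = (\<Oplus>a\<in>{..<k}. x a \<otimes> co a)" for x
    have co: "co a \<in> carrier A" for a by (simp add: co_def)
    have xa: "x a \<in> carrier A" if "x \<in> carrier (free_lmod A k)" "a \<in> {..<k}" for x a
      using free_lmod_closed[OF that(1)] that(2) by simp
    have b_closed: "b x \<in> carrier A" if "x \<in> carrier (free_lmod A k)" for x
      unfolding b_def using xa[OF that] co by (intro finsum_closed) auto
    have b_add: "b (x \<oplus>\<^bsub>free_lmod A k\<^esub> x') = b x \<oplus> b x'"
      if x: "x \<in> carrier (free_lmod A k)" "x' \<in> carrier (free_lmod A k)" for x x'
    proof -
      have "b (x \<oplus>\<^bsub>free_lmod A k\<^esub> x') = (\<Oplus>a\<in>{..<k}. (x a \<otimes> co a) \<oplus> (x' a \<otimes> co a))"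
        unfolding b_def using xa[OF x(1)] xa[OF x(2)] co
        by (intro finsum_cong') (auto simp: free_lmod_apply l_distr)
      also have "\<dots> = b x \<oplus> b x'"
        unfolding b_def using xa[OF x(1)] xa[OF x(2)] co by (intro finsum_addf) auto
      finally show ?thesis .
    qed
    have b_smult: "b (a \<odot>\<^bsub>free_lmod A k\<^esub> x) = a \<otimes> b x"
      if a: "a \<in> carrier A" and x: "x \<in> carrier (free_lmod A k)" for a x
    proof -
      have "b (a \<odot>\<^bsub>free_lmod A k\<^esub> x) = (\<Oplus>c\<in>{..<k}. a \<otimes> (x c \<otimes> co c))"
        unfolding b_def using xa[OF x] co a by (intro finsum_cong') (auto simp: free_lmod_apply m_assoc)
      also have "\<dots> = a \<otimes> b x"
        unfolding b_def using xa[OF x] co a by (intro finsum_rdistr[symmetric]) auto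
      finally show ?thesis .
    qed
    define h0 where "h0 x = b x \<odot>\<^bsub>M\<^esub> y" for x
    have h0: "h0 \<in> lmod_hom A (free_lmod A k) M"
      unfolding lmod_hom_def h0_def
      using yc by (auto simp: b_add b_smult b_closed M.smult_closed M.smult_l_distr M.smult_assoc)
    define h where "h = h0 \<circ> i"
    have h: "h \<in> lmod_hom A M M" unfolding h_def by (rule lmod_hom_comp[OF i h0])
    have unit: "g (h0 (unit_vec A k a)) = g (p (unit_vec A k a))" if "a < k" for a
    proof -
      have "b (unit_vec A k a) = (\<Oplus>c\<in>{..<k}. if a = c then co c else \<zero>)"
        unfolding b_def using co by (intro finsum_cong') (auto simp: unit_vec_def)
      also have "\<dots> = co a" using that co by (intro add.finprod_singleton) auto
      finally show ?thesis using y yc by (simp add: h0_def co_def char_functional_scale[OF \<chi> g])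
    qed
    have gh: "g (h x) = g x" if x: "x \<in> carrier M" for x
    proof -
      have ix: "i x \<in> carrier (free_lmod A k)" using lmod_homD(1)[OF i x] .
      have "g (h x) = (\<Sum>a<k. \<chi> (i x a) * g (h0 (unit_vec A k a)))"
        using char_functional_free[OF \<chi> char_functional_comp[OF g h0] ix] by (simp add: h_def)
      also have "\<dots> = (\<Sum>a<k. \<chi> (i x a) * g (p (unit_vec A k a)))" using unit by simp
      also have "\<dots> = g (p (i x))"
        using char_functional_free[OF \<chi> char_functional_comp[OF g p] ix] by simp
      finally show ?thesis using ip x by simp
    qed
    have ghm: "g ((h ^^ m) x) = g x \<and> (h ^^ m) x \<in> carrier M" if "x \<in> carrier M" for m x
    proof (induction m)
      case (Suc m)
      then show ?case using gh lmod_homD(1)[OF h] by simp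
    qed (use that in simp)
    from fitting[OF M fin ind h] show False
    proof
      assume "\<exists>m. \<forall>x\<in>carrier M. (h ^^ m) x = \<zero>\<^bsub>M\<^esub>"
      then obtain m where "(h ^^ m) x0 = \<zero>\<^bsub>M\<^esub>" using x0 by blast
      then show False using ghm[OF x0(1), of m] char_functional_zero[OF M g] x0(2) by simp
    next
      assume onto: "h ` carrier M = carrier M"
      have "h x \<in> N" if "x \<in> carrier M" for x
        unfolding h_def h0_def comp_def using N'(4)[OF b_closed[OF lmod_homD(1)[OF i that]] y(1)] .
      then have "h ` carrier M \<subseteq> N" by (rule image_subsetI)
      then have "N = carrier M" unfolding onto using N'(1) by (rule subset_antisym[rotated])
      then show False using N unfolding maximal_submodule_def by blast
    qed
  qed
  with max have uniq: "\<exists>!N. maximal_submodule A M N" by (rule ex1I)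
  define f where "f x = (\<lambda>n::nat. if n = 0 then g x else 0)" for x
  have f: "f \<in> lmod_hom A M (char_module \<chi>)"
    unfolding lmod_hom_def by (auto simp: f_def char_module_def char_functionalD[OF g] fun_eq_iff)
  have onto: "f ` carrier M = carrier (char_module \<chi>)"
  proof (intro equalityI subsetI)
    fix w assume w: "w \<in> carrier (char_module \<chi>)"
    let ?x = "sc (w 0 / g x0) \<odot>\<^bsub>M\<^esub> x0"
    have "f ?x = w"
    proof
      fix n
      show "f ?x n = w n"
        using w x0 by (cases n) (auto simp: f_def char_module_def char_functional_scale[OF \<chi> g])
    qed
    moreover have "?x \<in> carrier M" using x0 by (simp add: M.smult_closed)
    ultimately show "w \<in> f ` carrier M" by (intro image_eqI[of w f ?x]) simp_all
  qed (use lmod_homD(1)[OF f] in auto)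
  have "has_unique_simple_quotient A M (char_module \<chi>)"
    unfolding has_unique_simple_quotient_def
    by (intro conjI uniq char_module_simple[OF \<chi>] bexI[of _ f] onto f)
  then show ?thesis
    unfolding simple_proj_def
    by (intro conjI proj ind exI[of _ "char_module \<chi>"] char_module_one_dim[OF \<chi>] char_module_acts[OF \<chi>])
qed

subsection \<open>Linear maps on the Grothendieck group\<close>

lemma K0_rels_subspace: "formal.subspace (K0_rels B)"
  unfolding K0_rels_def by (rule formal.subspace_span)

lemma K0_coset_eq: "x - y \<in> K0_rels B \<Longrightarrow> K0_coset B x = K0_coset B y"
  unfolding K0_coset_def
  using formal.subspace_add[OF K0_rels_subspace, of _ B "x - y"]
    formal.subspace_diff[OF K0_rels_subspace, of _ B "x - y"]
  by (intro Collect_cong iffI) (fastforce simp: algebra_simps)+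

text \<open>The trace is constant on isomorphism classes, so the chosen representative does not
  matter, and it is additive on direct sums; hence its linear extension kills every defining
  relation.\<close>

lemma lin_ext_K0_rels:
  assumes \<chi>: "character \<chi>" and x: "x \<in> K0_rels A"
  shows "lin_ext (\<lambda>c. mtrace \<chi> (SOME L. L \<in> c)) x = 0"
proof -
  let ?t = "\<lambda>c :: 'a umodule set. mtrace \<chi> (SOME L. L \<in> c)"
  have cls: "?t (iso_class A M) = mtrace \<chi> M"
    if d: "proj_data M k i p" and L: "left_module A L" "lmod_iso A M L" for M k i p and L :: "'a umodule"
  proof -
    have "(SOME L. L \<in> iso_class A M) \<in> iso_class A M"       using L by (intro someI[of "\<lambda>L. L \<in> iso_class A M" L]) (simp add: iso_class_def)
    moreover define L0 where "L0 = (SOME L. L \<in> iso_class A M)"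
    ultimately have "left_module A L0" "lmod_iso A M L0" by (simp_all add: iso_class_def)
    then show ?thesis using mtrace_iso(1)[OF \<chi> d, of L0] by (simp add: L0_def)
  qed
  have "formal.subspace {x. lin_ext ?t x = 0}"
    by (rule formal.subspaceI) auto
  moreover have "lin_ext ?t (Poly_Mapping.single (iso_class A (dsum M N)) 1
        - Poly_Mapping.single (iso_class A M) 1 - Poly_Mapping.single (iso_class A N) 1) = 0"
    if M: "fd_projective A M" and N: "fd_projective A N" for M N :: "'a umodule"
  proof -
    obtain k i p where dM: "proj_data M k i p" using M unfolding fd_projective_iff by blast
    obtain l j q where dN: "proj_data N l j q" using N unfolding fd_projective_iff by blast
    have lm: "left_module A M" "left_module A N" using dM dN by (auto simp: proj_data_def)
    \<comment> \<open>Interleaving two functions in the even and odd places embeds the direct sum in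
      the universe. Its isomorphism class is therefore nonempty, and the choice of a representative
      is meaningful.\<close>
    define e :: "(nat \<Rightarrow> complex) \<times> (nat \<Rightarrow> complex) \<Rightarrow> nat \<Rightarrow> complex"
      where "e = (\<lambda>(f, g) n. if even n then f (n div 2) else g (n div 2))"
    have "inj e"
    proof (rule injI)
      fix x y assume eq: "e x = e y"
      have "fst x m = fst y m" "snd x m = snd y m" for m
        using fun_cong[OF eq, of "2 * m"] fun_cong[OF eq, of "2 * m + 1"] by (auto simp: e_def split_beta)
      then show "x = y" by (simp add: prod_eq_iff fun_eq_iff)
    qed
    then have "inj_on e (carrier (dsum M N))" by (rule inj_on_subset) simp
    then obtain L :: "'a umodule" where L: "left_module A L" "lmod_iso A (dsum M N) L"
      using umodule_copy[OF dsum_left_module[OF lm]] by blast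
    obtain k' i' p' where d: "proj_data (dsum M N) k' i' p'" using proj_data_dsum(1)[OF \<chi> dM dN] by blast
    show ?thesis
      using cls[OF d L] cls[OF dM lm(1) lmod_iso_refl] cls[OF dN lm(2) lmod_iso_refl] proj_data_dsum(2)[OF \<chi> dM dN]
      by (simp add: lin_ext_diff)
  qed
  ultimately have "K0_rels A \<subseteq> {x. lin_ext ?t x = 0}"
    unfolding K0_rels_def by (intro formal.span_minimal) auto
  then show ?thesis using x by blast
qed

lemma fd_projective_copy:
  fixes P :: "('a, 'v) module"
  assumes "fd_projective A P"
  obtains L :: "'a umodule" where "fd_projective A L" "lmod_iso A P L"
proof -
  have P: "left_module A P" "fin_dim A P" using assms unfolding fd_projective_def by auto
  obtain k i p where d: "proj_data P k i p" using assms unfolding fd_projective_iff by blast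
  obtain j :: "'v \<Rightarrow> nat \<Rightarrow> complex" where "inj_on j (carrier P)" using fin_dim_inj[OF P] by blast
  then obtain L :: "'a umodule" where L: "left_module A L" "lmod_iso A P L" using umodule_copy[OF P(1)] by blast
  obtain f f' where f: "f \<in> lmod_hom A P L" "f' \<in> lmod_hom A L P"
    "\<And>x. x \<in> carrier P \<Longrightarrow> f' (f x) = x" "\<And>y. y \<in> carrier L \<Longrightarrow> f (f' y) = y"
    by (rule lmod_isoE[OF P(1) L(2)]) (rule that)
  have "f ` carrier P = carrier L"
    using lmod_homD(1)[OF f(1)] lmod_homD(1)[OF f(2)] f(4) by (metis image_eqI image_subsetI subsetI subset_antisym)
  then have "fin_dim A L" by (rule fin_dim_image[OF P(1) L(1) f(1) _ P(2)])
  then have "fd_projective A L" unfolding fd_projective_iff using proj_data_iso[OF d L(1) f(1,2,4)] by blast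
  then show thesis using L(2) by (rule that)
qed

lemma internal_dsum:
  assumes M: "fd_projective A M" and N: "submodule N A M" "submodule N' A M"
    and int: "N \<inter> N' = {\<zero>\<^bsub>M\<^esub>}" and sum: "N <+>\<^bsub>M\<^esub> N' = carrier M"
  shows "fd_projective A (M\<lparr>carrier := N\<rparr>)" "fd_projective A (M\<lparr>carrier := N'\<rparr>)"
    "lmod_iso A M (dsum (M\<lparr>carrier := N\<rparr>) (M\<lparr>carrier := N'\<rparr>))"
proof -
  obtain k i p where d: "proj_data M k i p" and fin: "fin_dim A M"
    using M unfolding fd_projective_iff by blast
  have lM: "left_module A M" and i: "i \<in> lmod_hom A M (free_lmod A k)"
    and p: "p \<in> lmod_hom A (free_lmod A k) M" and ip: "\<And>x. x \<in> carrier M \<Longrightarrow> p (i x) = x"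
    using d by (auto simp: proj_data_def)
  interpret M: left_module A M by fact
  note N1 = M.is_submoduleD[OF N(1)] and N2 = M.is_submoduleD[OF N(2)]
  let ?M1 = "M\<lparr>carrier := N\<rparr>" and ?M2 = "M\<lparr>carrier := N'\<rparr>"
  note l1 = M.submodule_left_module[OF N(1)] and l2 = M.submodule_left_module[OF N(2)]
  have uniq: "x = x' \<and> y = y'"
    if "x \<in> N" "x' \<in> N" "y \<in> N'" "y' \<in> N'" "x \<oplus>\<^bsub>M\<^esub> y = x' \<oplus>\<^bsub>M\<^esub> y'" for x x' y y'
  proof -
    have c: "x \<in> carrier M" "x' \<in> carrier M" "y \<in> carrier M" "y' \<in> carrier M" using that N1(1) N2(1) by auto
    have "x \<oplus>\<^bsub>M\<^esub> \<ominus>\<^bsub>M\<^esub> x' = (x \<oplus>\<^bsub>M\<^esub> y) \<oplus>\<^bsub>M\<^esub> \<ominus>\<^bsub>M\<^esub> y \<oplus>\<^bsub>M\<^esub> \<ominus>\<^bsub>M\<^esub> x'"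
      using c by (simp add: M.M.a_assoc M.M.r_neg)
    also have "\<dots> = y' \<oplus>\<^bsub>M\<^esub> \<ominus>\<^bsub>M\<^esub> y"
    proof -
      have "(x' \<oplus>\<^bsub>M\<^esub> y') \<oplus>\<^bsub>M\<^esub> \<ominus>\<^bsub>M\<^esub> y \<oplus>\<^bsub>M\<^esub> \<ominus>\<^bsub>M\<^esub> x' = (x' \<oplus>\<^bsub>M\<^esub> \<ominus>\<^bsub>M\<^esub> x') \<oplus>\<^bsub>M\<^esub> (y' \<oplus>\<^bsub>M\<^esub> \<ominus>\<^bsub>M\<^esub> y)"
        using c by (simp add: M.M.a_ac)
      then show ?thesis unfolding that(5) using c by (simp add: M.M.r_neg)
    qed
    finally have eq: "x \<oplus>\<^bsub>M\<^esub> \<ominus>\<^bsub>M\<^esub> x' = y' \<oplus>\<^bsub>M\<^esub> \<ominus>\<^bsub>M\<^esub> y" .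
    have "x \<oplus>\<^bsub>M\<^esub> \<ominus>\<^bsub>M\<^esub> x' \<in> N" "y' \<oplus>\<^bsub>M\<^esub> \<ominus>\<^bsub>M\<^esub> y \<in> N'"
      using that N1(3,5) N2(3,5) by auto
    then have "x \<oplus>\<^bsub>M\<^esub> \<ominus>\<^bsub>M\<^esub> x' = \<zero>\<^bsub>M\<^esub>" "y' \<oplus>\<^bsub>M\<^esub> \<ominus>\<^bsub>M\<^esub> y = \<zero>\<^bsub>M\<^esub>" using eq int by auto
    then show ?thesis using c by (metis M.M.minus_equality M.M.minus_minus M.M.a_inv_closed)
  qed
  define f where "f = (\<lambda>(x, y). x \<oplus>\<^bsub>M\<^esub> y)"
  have f: "f \<in> lmod_hom A (dsum ?M1 ?M2) M"
    unfolding lmod_hom_def using N1(1) N2(1)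
    by (auto simp: f_def dsum_def subset_iff M.M.a_ac M.smult_r_distr)
  have bij: "bij_betw f (carrier (dsum ?M1 ?M2)) (carrier M)"
    unfolding bij_betw_def
  proof
    show "inj_on f (carrier (dsum ?M1 ?M2))"
      by (rule inj_onI) (use uniq in \<open>auto simp: f_def dsum_def\<close>)
    show "f ` carrier (dsum ?M1 ?M2) = carrier M"
      unfolding sum[symmetric] set_add_def' by (auto simp: f_def dsum_def image_iff)
  qed
  have ld: "left_module A (dsum ?M1 ?M2)" by (rule dsum_left_module[OF l1 l2])
  have "lmod_iso A (dsum ?M1 ?M2) M" unfolding lmod_iso_def using f bij by blast
  then show "lmod_iso A M (dsum ?M1 ?M2)" by (rule lmod_iso_sym[OF ld])
  obtain f' where f': "f' \<in> lmod_hom A M (dsum ?M1 ?M2)" "\<And>x. x \<in> carrier (dsum ?M1 ?M2) \<Longrightarrow> f' (f x) = x"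
    "\<And>y. y \<in> carrier M \<Longrightarrow> f (f' y) = y"
    using lmod_iso_inverse[OF ld f bij] by blast
  have fst: "fst \<in> lmod_hom A (dsum ?M1 ?M2) ?M1" and snd: "snd \<in> lmod_hom A (dsum ?M1 ?M2) ?M2"
    by (auto simp: lmod_hom_def dsum_def)
  \<comment> \<open>A retraction \<open>q\<close> of \<open>M\<close> onto a submodule passes the
    presentation on: \<open>i\<close> is restricted and \<open>p\<close> is followed by
    \<open>q\<close>.\<close>
  have *: "fd_projective A (M\<lparr>carrier := U\<rparr>)"
    if U: "submodule U A M" and q: "q \<in> lmod_hom A M (M\<lparr>carrier := U\<rparr>)" and qU: "\<And>x. x \<in> U \<Longrightarrow> q x = x" for U q
  proof -
    note U' = M.is_submoduleD[OF U] and lU = M.submodule_left_module[OF U]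
    have "q ` carrier M = carrier (M\<lparr>carrier := U\<rparr>)"
    proof (intro equalityI subsetI)
      fix x assume "x \<in> carrier (M\<lparr>carrier := U\<rparr>)"
      then have "x = q x" "x \<in> carrier M" using qU U'(1) by auto
      then show "x \<in> q ` carrier M" by blast
    qed (use lmod_homD(1)[OF q] in auto)
    then have "fin_dim A (M\<lparr>carrier := U\<rparr>)" by (rule fin_dim_image[OF lM lU q _ fin])
    moreover have "i \<in> lmod_hom A (M\<lparr>carrier := U\<rparr>) (free_lmod A k)"
      using i subsetD[OF U'(1)] by (auto simp: lmod_hom_def)
    moreover have "q \<circ> p \<in> lmod_hom A (free_lmod A k) (M\<lparr>carrier := U\<rparr>)" by (rule lmod_hom_comp[OF p q])
    moreover have "(q \<circ> p) (i x) = x" if "x \<in> carrier (M\<lparr>carrier := U\<rparr>)" for x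
      using that ip qU U'(1) by auto
    ultimately show ?thesis unfolding fd_projective_iff proj_data_def using lU by blast
  qed
  have f'1: "f' x = (x, \<zero>\<^bsub>M\<^esub>)" if "x \<in> N" for x
  proof -
    have "x \<in> carrier M" using that N1(1) by blast
    then have "x = f (x, \<zero>\<^bsub>M\<^esub>)" "(x, \<zero>\<^bsub>M\<^esub>) \<in> carrier (dsum ?M1 ?M2)"
      using that N2(2) by (auto simp: f_def dsum_def)
    then show ?thesis using f'(2) by metis
  qed
  have f'2: "f' x = (\<zero>\<^bsub>M\<^esub>, x)" if "x \<in> N'" for x
  proof -
    have "x \<in> carrier M" using that N2(1) by blast
    then have "x = f (\<zero>\<^bsub>M\<^esub>, x)" "(\<zero>\<^bsub>M\<^esub>, x) \<in> carrier (dsum ?M1 ?M2)"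
      using that N1(2) by (auto simp: f_def dsum_def)
    then show ?thesis using f'(2) by metis
  qed
  show "fd_projective A ?M1" by (rule *[OF N(1) lmod_hom_comp[OF f'(1) fst]]) (simp add: f'1)
  show "fd_projective A ?M2" by (rule *[OF N(2) lmod_hom_comp[OF f'(1) snd]]) (simp add: f'2)
qed

end

text \<open>What each of the two algebras has to supply: finitely many distinct characters such that
  every nonzero projective module has a nonzero functional for one of them. The values of
  \<open>K0_map\<close> are computed from this.\<close>

locale char_family = complex_algebra A for A :: "(complex, 'a) module" (structure) +
  fixes Idx :: "'i set" and \<chi> :: "'i \<Rightarrow> 'a \<Rightarrow> complex"
  assumes finite_Idx: "finite Idx"
    and characters: "k \<in> Idx \<Longrightarrow> character (\<chi> k)"
    and distinct_chars: "\<lbrakk>k \<in> Idx; l \<in> Idx; \<forall>a\<in>carrier A. \<chi> k a = \<chi> l a\<rbrakk> \<Longrightarrow> k = l"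
    and functional_exists: "\<lbrakk>fd_projective A (M :: 'a umodule); carrier M \<noteq> {\<zero>\<^bsub>M\<^esub>}\<rbrakk> \<Longrightarrow>
      \<exists>k\<in>Idx. \<exists>g. char_functional (\<chi> k) M g \<and> (\<exists>x\<in>carrier M. g x \<noteq> 0)"
begin

text \<open>The expected value of a linear map: the trace against \<open>\<chi> k\<close> counts the
  summands of \<open>M\<close> that are covers of this character, and \<open>R k\<close> is the
  value prescribed on them.\<close>

definition trace_sum :: "('i \<Rightarrow> 'k \<Rightarrow>\<^sub>0 complex) \<Rightarrow> ('a, 'v) module \<Rightarrow> 'k \<Rightarrow>\<^sub>0 complex"
  where "trace_sum R M = (\<Sum>k\<in>Idx. mtrace (\<chi> k) M *\<^sub>k R k)"

lemma trace_sum_simple_proj: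
  assumes "k \<in> Idx" "simple_proj (\<chi> k) M"
  shows "trace_sum R M = R k"
proof -
  have "trace_sum R M = (\<Sum>l\<in>Idx. if l = k then R k else 0)"
    unfolding trace_sum_def
  proof (intro sum.cong refl)
    fix l assume "l \<in> Idx"
    then show "mtrace (\<chi> l) M *\<^sub>k R l = (if l = k then R k else 0)"
      using mtrace_simple_proj[OF characters[OF assms(1)] characters assms(2), of l] distinct_chars[OF \<open>l \<in> Idx\<close> assms(1)]
      by auto
  qed
  then show ?thesis using finite_Idx assms(1) by simp
qed

lemma trace_sum_iso:
  assumes "fd_projective A M" "left_module A N" "lmod_iso A M N"
  shows "trace_sum R N = trace_sum R M"
proof -
  obtain k i p where d: "proj_data M k i p" using assms(1) unfolding fd_projective_iff by blast
  have "mtrace (\<chi> m) N = mtrace (\<chi> m) M" if "m \<in> Idx" for m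
    using mtrace_iso(1)[OF characters[OF that] d assms(2,3)] by simp
  then show ?thesis unfolding trace_sum_def by simp
qed

text \<open>The witness for the choice in \<open>K0_map\<close>: the traces descend to the quotient
  and combine to a linear map with the prescribed values.\<close>

lemma K0_linear_exists:
  fixes R :: "'i \<Rightarrow> 'k \<Rightarrow>\<^sub>0 complex"
  shows "\<exists>g. K0_linear A g \<and> (\<forall>(M :: 'a umodule) y. (\<exists>k\<in>Idx. simple_proj (\<chi> k) M \<and> y = R k) \<longrightarrow> g (K0_class A M) = y)"
proof -
  let ?t = "\<lambda>k (c :: 'a umodule set). mtrace (\<chi> k) (SOME L. L \<in> c)"
  define \<Phi> where "\<Phi> x = (\<Sum>k\<in>Idx. lin_ext (?t k) x *\<^sub>k R k)" for x
  have add: "\<Phi> (x + y) = \<Phi> x + \<Phi> y" for x y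
    by (simp add: \<Phi>_def formal.scale_left_distrib sum.distrib)
  have scale: "\<Phi> (z *\<^sub>k x) = z *\<^sub>k \<Phi> x" for z x
    by (simp add: \<Phi>_def cscale_sum)
  have rels: "\<Phi> x = 0" if "x \<in> K0_rels A" for x
    unfolding \<Phi>_def using lin_ext_K0_rels[OF characters that] by (intro sum.neutral) auto
  define g where "g C = \<Phi> (SOME x. x \<in> C)" for C
  have g: "g (K0_coset A x) = \<Phi> x" for x
  proof -
    have "x \<in> K0_coset A x" unfolding K0_coset_def using formal.subspace_0[OF K0_rels_subspace] by simp
    then have "(SOME y. y \<in> K0_coset A x) \<in> K0_coset A x" by (rule someI)
    then have "\<Phi> ((SOME y. y \<in> K0_coset A x) - x) = 0" unfolding K0_coset_def by (intro rels) simp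
    then show ?thesis using add[of "(SOME y. y \<in> K0_coset A x) - x" x] by (simp add: g_def)
  qed
  have "g (K0_class A M) = R k" if k: "k \<in> Idx" and M: "simple_proj (\<chi> k) M" for k and M :: "'a umodule"
  proof -
    obtain l i p where d: "proj_data M l i p" using M unfolding simple_proj_def fd_projective_iff by blast
    have "M \<in> iso_class A M" using d by (simp add: iso_class_def lmod_iso_refl proj_data_def)
    then have "(SOME L. L \<in> iso_class A M) \<in> iso_class A M" by (rule someI)
    moreover define L0 where "L0 = (SOME L. L \<in> iso_class A M)"
    ultimately have L0: "left_module A L0" "lmod_iso A M L0" by (simp_all add: iso_class_def)
    have "mtrace (\<chi> m) L0 = mtrace (\<chi> m) M" if "m \<in> Idx" for m
      using mtrace_iso(1)[OF characters[OF that] d L0] by simp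
    then have "g (K0_class A M) = trace_sum R M"
      unfolding K0_class_def g \<Phi>_def trace_sum_def lin_ext_single L0_def[symmetric] by (simp cong: sum.cong)
    then show ?thesis using trace_sum_simple_proj[OF k M, of R] by simp
  qed
  moreover have "K0_linear A g" unfolding K0_linear_def by (simp add: g add scale)
  ultimately show ?thesis by blast
qed

lemma K0_linear_class_dsum:
  fixes M N :: "'a umodule"
  assumes g: "K0_linear A g" and M: "fd_projective A M" and N: "fd_projective A N"
    and L: "iso_class A L = iso_class A (dsum M N)"
  shows "g (K0_class A L) = g (K0_class A M) + g (K0_class A N)"
proof -
  let ?x = "Poly_Mapping.single (iso_class A M) 1" and ?y = "Poly_Mapping.single (iso_class A N) (1 :: complex)"
  have "Poly_Mapping.single (iso_class A L) 1 - (?x + ?y) \<in> K0_rels A"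
    unfolding K0_rels_def L diff_diff_eq[symmetric] by (rule formal.span_base) (use M N in blast)
  then have "K0_class A L = K0_coset A (?x + ?y)" unfolding K0_class_def by (rule K0_coset_eq)
  moreover have "?x \<in> K0_formal A" "?y \<in> K0_formal A"
    unfolding K0_formal_def using M N by (blast intro: formal.span_base)+
  ultimately show ?thesis using g unfolding K0_linear_def K0_class_def by simp
qed

text \<open>Induction on the size of a summand. A decomposable module splits into two smaller ones;
  an indecomposable one has a nonzero functional for some \<open>\<chi> k\<close> and is therefore
  its cover by \<open>simple_projI\<close>, so that its value is prescribed.\<close>

theorem K0_linear_value:
  fixes P :: "('a, 'v) module" and R :: "'i \<Rightarrow> 'k \<Rightarrow>\<^sub>0 complex"
  assumes g: "K0_linear A g"
    and spec: "\<And>k (M :: 'a umodule). k \<in> Idx \<Longrightarrow> simple_proj (\<chi> k) M \<Longrightarrow> g (K0_class A M) = R k"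
    and P: "fd_projective A P"
  shows "g (K0_class A P) = trace_sum R P"
proof -
  obtain L :: "'a umodule" where L: "fd_projective A L" "lmod_iso A P L" using fd_projective_copy[OF P] by blast
  have lP: "left_module A P" and lL: "left_module A L" and fin: "fin_dim A L"
    using P L by (auto simp: fd_projective_def)
  interpret L: left_module A L by fact
  obtain \<mu> where \<mu>: "\<And>U V. submodule U A L \<Longrightarrow> submodule V A L \<Longrightarrow> U \<subset> V \<Longrightarrow> \<mu> U < (\<mu> V :: nat)"
    using submodule_measure[OF lL fin] by blast
  have dsum_case: "g (K0_class A M) = trace_sum R M"
    if M: "fd_projective A M" and N: "submodule N A M" "submodule N' A M"
      and int: "N \<inter> N' = {\<zero>\<^bsub>M\<^esub>}" and sum: "N <+>\<^bsub>M\<^esub> N' = carrier M"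
      and IH: "g (K0_class A (M\<lparr>carrier := N\<rparr>)) = trace_sum R (M\<lparr>carrier := N\<rparr>)"
        "g (K0_class A (M\<lparr>carrier := N'\<rparr>)) = trace_sum R (M\<lparr>carrier := N'\<rparr>)"
    for M :: "'a umodule" and N N'
  proof -
    note d = internal_dsum[OF M N int sum]
    have lM: "left_module A M" using M by (simp add: fd_projective_def)
    have "g (K0_class A M) = trace_sum R (M\<lparr>carrier := N\<rparr>) + trace_sum R (M\<lparr>carrier := N'\<rparr>)"
      using K0_linear_class_dsum[OF g d(1,2) iso_class_eq[OF lM d(3)]] IH by simp
    also have "\<dots> = trace_sum R (dsum (M\<lparr>carrier := N\<rparr>) (M\<lparr>carrier := N'\<rparr>))"
    proof -
      obtain k i p l j q where "proj_data (M\<lparr>carrier := N\<rparr>) k i p" "proj_data (M\<lparr>carrier := N'\<rparr>) l j q"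
        using d(1,2) unfolding fd_projective_iff by blast
      then have "mtrace (\<chi> m) (dsum (M\<lparr>carrier := N\<rparr>) (M\<lparr>carrier := N'\<rparr>))
          = mtrace (\<chi> m) (M\<lparr>carrier := N\<rparr>) + mtrace (\<chi> m) (M\<lparr>carrier := N'\<rparr>)" if "m \<in> Idx" for m
        using proj_data_dsum(2)[OF characters[OF that]] by blast
      then show ?thesis
        unfolding trace_sum_def by (simp add: sum.distrib[symmetric] formal.scale_left_distrib)
    qed
    also have "\<dots> = trace_sum R M"
      using d(1,2) by (intro trace_sum_iso[OF M dsum_left_module d(3)]) (auto simp: fd_projective_def)
    finally show ?thesis .
  qed
  \<comment> \<open>All summands are kept as submodules of the one copy \<open>L\<close>, so that
    the single measure \<mu> compares them.\<close>
  have "g (K0_class A (L\<lparr>carrier := U\<rparr>)) = trace_sum R (L\<lparr>carrier := U\<rparr>)"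
    if "submodule U A L" "fd_projective A (L\<lparr>carrier := U\<rparr>)" for U
    using that
  proof (induction U rule: measure_induct_rule[of \<mu>])
    case (less U)
    let ?M = "L\<lparr>carrier := U\<rparr>"
    have lM: "left_module A ?M" using less.prems by (simp add: fd_projective_def)
    interpret M: left_module A ?M by fact
    note U = L.is_submoduleD[OF less.prems(1)]
    consider "U = {\<zero>\<^bsub>L\<^esub>}" | "U \<noteq> {\<zero>\<^bsub>L\<^esub>}" "indecomposable A ?M"
      | "U \<noteq> {\<zero>\<^bsub>L\<^esub>}" "\<not> indecomposable A ?M" by blast
    then show ?case
    proof cases
      \<comment> \<open>The zero module is the direct sum of two copies of itself, so both sides
        equal their own doubles and vanish.\<close>
      case 1
      have s: "submodule {\<zero>\<^bsub>L\<^esub>} A ?M" using M.zero_submodule by simp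
      have int: "{\<zero>\<^bsub>L\<^esub>} \<inter> {\<zero>\<^bsub>L\<^esub>} = {\<zero>\<^bsub>?M\<^esub>}" by simp
      have sum: "{\<zero>\<^bsub>L\<^esub>} <+>\<^bsub>?M\<^esub> {\<zero>\<^bsub>L\<^esub>} = carrier ?M" using 1 by (simp add: set_add_def')
      note d = internal_dsum[OF less.prems(2) s s int sum]
      have M0: "?M\<lparr>carrier := {\<zero>\<^bsub>L\<^esub>}\<rparr> = ?M" using 1 by simp
      have "g (K0_class A ?M) = g (K0_class A ?M) + g (K0_class A ?M)"
        using K0_linear_class_dsum[OF g d(1,2) iso_class_eq[OF lM d(3)]] unfolding M0 .
      moreover have "trace_sum R ?M = 0"
      proof -
        obtain k i p where dat: "proj_data ?M k i p" using less.prems(2) unfolding fd_projective_iff by blast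
        have "mtrace (\<chi> m) ?M = mtrace (\<chi> m) ?M + mtrace (\<chi> m) ?M" if "m \<in> Idx" for m
          using mtrace_iso(1)[OF characters[OF that] dat dsum_left_module[OF lM lM]] d(3)
            proj_data_dsum(2)[OF characters[OF that] dat dat] unfolding M0 by simp
        then show ?thesis unfolding trace_sum_def by (intro sum.neutral) simp
      qed
      ultimately show ?thesis by simp
    next
      case 2
      then obtain k h where k: "k \<in> Idx" "char_functional (\<chi> k) ?M h" "\<exists>x\<in>carrier ?M. h x \<noteq> 0"
        using functional_exists[OF less.prems(2)] by auto
      then have sp: "simple_proj (\<chi> k) ?M"
        using simple_projI[OF less.prems(2) 2(2) characters[OF k(1)] k(2)] by blast
      show ?thesis using spec[OF k(1) sp] trace_sum_simple_proj[OF k(1) sp, of R] by simp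
    next
      case 3
      then obtain N N' where N: "submodule N A ?M" "submodule N' A ?M" "N \<inter> N' = {\<zero>\<^bsub>?M\<^esub>}"
        "N <+>\<^bsub>?M\<^esub> N' = carrier ?M" "N \<noteq> {\<zero>\<^bsub>?M\<^esub>}" "N' \<noteq> {\<zero>\<^bsub>?M\<^esub>}"
        unfolding indecomposable_def by auto
      note d = internal_dsum[OF less.prems(2) N(1-4)]
      note N1 = M.is_submoduleD[OF N(1)] and N2 = M.is_submoduleD[OF N(2)]
      have strict: "N \<subset> U" "N' \<subset> U"
      proof -
        show "N \<subset> U" using N1(1) N2(1,2) N(3,6) by auto
        show "N' \<subset> U" using N2(1) N1(1,2) N(3,5) by auto
      qed
      have sub: "submodule N A L" "submodule N' A L"
        using N1 N2 U(1) by (auto intro!: L.is_submoduleI)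
      have "g (K0_class A (?M\<lparr>carrier := N\<rparr>)) = trace_sum R (?M\<lparr>carrier := N\<rparr>)"
        "g (K0_class A (?M\<lparr>carrier := N'\<rparr>)) = trace_sum R (?M\<lparr>carrier := N'\<rparr>)"
        using less.IH[OF \<mu>[OF sub(1) less.prems(1) strict(1)] sub(1)] less.IH[OF \<mu>[OF sub(2) less.prems(1) strict(2)] sub(2)]
          d(1,2) by simp_all
      then show ?thesis by (rule dsum_case[OF less.prems(2) N(1-4)])
    qed
  qed
  from this[OF L.carrier_submodule] have "g (K0_class A L) = trace_sum R L" using L(1) by simp
  moreover have "K0_class A P = K0_class A L" unfolding K0_class_def iso_class_eq[OF lP L(2)] ..
  ultimately show ?thesis using trace_sum_iso[OF P lL L(2), of R] by simp
qed

corollary K0_map_value: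
  fixes P :: "('a, 'v) module" and R :: "'i \<Rightarrow> 'k \<Rightarrow>\<^sub>0 complex"
  assumes "fd_projective A P"
  shows "K0_map A (\<lambda>M y. \<exists>k\<in>Idx. simple_proj (\<chi> k) M \<and> y = R k) (K0_class A P) = trace_sum R P"
proof -
  let ?Q = "\<lambda>g. K0_linear A g \<and> (\<forall>(M :: 'a umodule) y. (\<exists>k\<in>Idx. simple_proj (\<chi> k) M \<and> y = R k) \<longrightarrow> g (K0_class A M) = y)"
  let ?g = "K0_map A (\<lambda>M y. \<exists>k\<in>Idx. simple_proj (\<chi> k) M \<and> y = R k)"
  have "?Q ?g" unfolding K0_map_def by (rule someI_ex[OF K0_linear_exists])
  then show ?thesis using assms by (intro K0_linear_value) blast+
qed

end

subsection \<open>The presented algebra\<close>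

locale aks_algebra =
  fixes n r :: nat and u :: "nat \<Rightarrow> complex"
  assumes r_pos: "1 \<le> r" and u_inj: "inj_on u {1..r}"
begin

abbreviation "F \<equiv> AKS_free n"
abbreviation "FC \<equiv> carrier (AKS_free n)"
abbreviation "J \<equiv> AKS_ideal n r u"
abbreviation "AA \<equiv> AKS n r u"
abbreviation "t i \<equiv> letter (T i)"
abbreviation "x j \<equiv> letter (Xi j)"
abbreviation q :: "(gen list \<Rightarrow>\<^sub>0 complex) \<Rightarrow> (gen list \<Rightarrow>\<^sub>0 complex) set"
  where "q p \<equiv> J +>\<^bsub>F\<^esub> p"

lemma F_simps: "monoid.mult F = (*)" "monoid.one F = 1" "ring.zero F = 0" "ring.add F = (+)" "smult F = cscale"
  by (simp_all add: AKS_free_def)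

lemma FC_def: "FC = words (T ` {1..<n} \<union> Xi ` {1..n})"
  by (simp add: AKS_free_def words_def)

lemma FC_zero [simp]: "0 \<in> FC" and FC_one [simp]: "1 \<in> FC"
  and FC_add [simp]: "p \<in> FC \<Longrightarrow> p' \<in> FC \<Longrightarrow> p + p' \<in> FC"
  and FC_cscale [simp]: "p \<in> FC \<Longrightarrow> z *\<^sub>k p \<in> FC"
  and FC_uminus [simp]: "p \<in> FC \<Longrightarrow> - p \<in> FC"
  and FC_mult [simp]: "p \<in> FC \<Longrightarrow> p' \<in> FC \<Longrightarrow> p * p' \<in> FC"
  and FC_t [simp]: "1 \<le> i \<Longrightarrow> i < n \<Longrightarrow> t i \<in> FC"
  and FC_x [simp]: "1 \<le> j \<Longrightarrow> j \<le> n \<Longrightarrow> x j \<in> FC"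
  unfolding FC_def by (auto intro: words_zero words_one words_add words_cscale words_uminus words_mult words_letter)

lemma FC_diff [simp]: "p \<in> FC \<Longrightarrow> p' \<in> FC \<Longrightarrow> p - p' \<in> FC"
  using FC_add[of p "- p'"] by simp

lemma FC_sum [simp]: "(\<And>b. b \<in> B \<Longrightarrow> f b \<in> FC) \<Longrightarrow> sum f B \<in> FC"
  by (induction B rule: infinite_finite_induct) auto

lemma FC_prod_list [simp]: "(\<And>b. b \<in> set ls \<Longrightarrow> f b \<in> FC) \<Longrightarrow> prod_list (map f ls) \<in> FC"
  by (induction ls) auto

lemma FC_lag [simp]: "p \<in> FC \<Longrightarrow> lag u r k p \<in> FC"
  unfolding lag_def by (rule FC_prod_list) simp

lemma F_ring: "ring F"
proof (rule ringI)
  show "abelian_group F"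
  proof (rule abelian_groupI)
    show "\<exists>y\<in>FC. y \<oplus>\<^bsub>F\<^esub> p = \<zero>\<^bsub>F\<^esub>" if "p \<in> FC" for p
      using that by (intro bexI[of _ "- p"]) (simp_all add: F_simps)
  qed (simp_all add: F_simps algebra_simps)
  show "monoid F" by (rule monoidI) (simp_all add: F_simps mult.assoc)
qed (simp_all add: F_simps algebra_simps)

lemma F_minus: "p \<in> FC \<Longrightarrow> p' \<in> FC \<Longrightarrow> p \<ominus>\<^bsub>F\<^esub> p' = p - p'"
proof -
  interpret F: ring F by (rule F_ring)
  assume p: "p \<in> FC" "p' \<in> FC"
  have "\<ominus>\<^bsub>F\<^esub> p' = - p'" by (rule F.minus_equality) (simp_all add: p F_simps)
  then show ?thesis by (simp add: a_minus_def F_simps)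
qed

lemma relators_subset: "AKS_relators n r u \<subseteq> FC"
  unfolding AKS_relators_def Let_def
  by (auto intro!: FC_mult FC_diff FC_add FC_one FC_sum FC_cscale FC_lag FC_prod_list simp del: upt_Suc)

lemma J_ideal: "ideal J F"
  unfolding AKS_ideal_def using F_ring relators_subset by (rule ring.genideal_ideal)

lemma J_subset: "p \<in> J \<Longrightarrow> p \<in> FC"
proof -
  interpret J: ideal J F by (rule J_ideal)
  show "p \<in> J \<Longrightarrow> p \<in> FC" using J.a_subset by blast
qed

lemma J_zero [simp]: "0 \<in> J"
  and J_add: "p \<in> J \<Longrightarrow> p' \<in> J \<Longrightarrow> p + p' \<in> J"
  and J_mult_left: "p \<in> J \<Longrightarrow> p' \<in> FC \<Longrightarrow> p' * p \<in> J"
  and J_mult_right: "p \<in> J \<Longrightarrow> p' \<in> FC \<Longrightarrow> p * p' \<in> J"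
proof -
  interpret J: ideal J F by (rule J_ideal)
  show "0 \<in> J" using additive_subgroup.zero_closed[OF J.is_additive_subgroup] by (simp add: F_simps)
  show "p \<in> J \<Longrightarrow> p' \<in> J \<Longrightarrow> p + p' \<in> J"
    using additive_subgroup.a_closed[OF J.is_additive_subgroup] by (simp add: F_simps)
  show "p \<in> J \<Longrightarrow> p' \<in> FC \<Longrightarrow> p' * p \<in> J" using J.I_l_closed by (simp add: F_simps)
  show "p \<in> J \<Longrightarrow> p' \<in> FC \<Longrightarrow> p * p' \<in> J" using J.I_r_closed by (simp add: F_simps)
qed

lemma J_cscale: "p \<in> J \<Longrightarrow> z *\<^sub>k p \<in> J"
  using J_mult_left[of p "z *\<^sub>k 1"] by simp

lemma J_uminus: "p \<in> J \<Longrightarrow> - p \<in> J"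
  using J_cscale[of p "- 1"] by (simp add: formal.scale_minus_left)

lemma J_relator: "p \<in> AKS_relators n r u \<Longrightarrow> p \<in> J"
  unfolding AKS_ideal_def using ring.genideal_self[OF F_ring relators_subset] by blast

text \<open>Equality in the presented algebra, stated for representatives, so that calculations take
  place in the ring of formal combinations instead of between cosets.\<close>

definition cong :: "(gen list \<Rightarrow>\<^sub>0 complex) \<Rightarrow> (gen list \<Rightarrow>\<^sub>0 complex) \<Rightarrow> bool"  (infix \<open>\<asymp>\<close> 50)
  where "p \<asymp> p' \<longleftrightarrow> p - p' \<in> J"

lemma cong_refl [simp]: "p \<asymp> p"
  by (simp add: cong_def)

lemma cong_sym: "p \<asymp> p' \<Longrightarrow> p' \<asymp> p"
  using J_uminus[of "p - p'"] by (simp add: cong_def)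

lemma cong_trans [trans]: "p \<asymp> p' \<Longrightarrow> p' \<asymp> p'' \<Longrightarrow> p \<asymp> p''"
  using J_add[of "p - p'" "p' - p''"] by (simp add: cong_def)

lemma cong_eq_trans [trans]: "p \<asymp> p' \<Longrightarrow> p' = p'' \<Longrightarrow> p \<asymp> p''" "p = p' \<Longrightarrow> p' \<asymp> p'' \<Longrightarrow> p \<asymp> p''"
  by simp_all

lemma cong_add: "p \<asymp> p' \<Longrightarrow> s \<asymp> s' \<Longrightarrow> p + s \<asymp> p' + s'"
  using J_add[of "p - p'" "s - s'"] by (simp add: cong_def algebra_simps)

lemma cong_uminus: "p \<asymp> p' \<Longrightarrow> - p \<asymp> - p'"
  using J_uminus[of "p - p'"] by (simp add: cong_def algebra_simps)

lemma cong_diff: "p \<asymp> p' \<Longrightarrow> s \<asymp> s' \<Longrightarrow> p - s \<asymp> p' - s'"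
  using cong_add[of p p' "- s" "- s'"] cong_uminus by simp

lemma cong_cscale: "p \<asymp> p' \<Longrightarrow> z *\<^sub>k p \<asymp> z *\<^sub>k p'"
  using J_cscale[of "p - p'" z] by (simp add: cong_def formal.scale_right_diff_distrib)

lemma cong_mult_left: "p \<asymp> p' \<Longrightarrow> s \<in> FC \<Longrightarrow> s * p \<asymp> s * p'"
  using J_mult_left[of "p - p'" s] by (simp add: cong_def algebra_simps)

lemma cong_mult_right: "p \<asymp> p' \<Longrightarrow> s \<in> FC \<Longrightarrow> p * s \<asymp> p' * s"
  using J_mult_right[of "p - p'" s] by (simp add: cong_def algebra_simps)

lemma cong_sum: "(\<And>b. b \<in> B \<Longrightarrow> f b \<asymp> g b) \<Longrightarrow> sum f B \<asymp> sum g B"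
  by (induction B rule: infinite_finite_induct) (auto intro: cong_add)

lemma q_eq_iff: "p \<in> FC \<Longrightarrow> p' \<in> FC \<Longrightarrow> q p = q p' \<longleftrightarrow> p \<asymp> p'"
  using ring.quotient_eq_iff_same_a_r_cos[OF F_ring J_ideal, of p p'] by (simp add: F_minus cong_def)

lemma AA_carrier: "carrier AA = q ` FC"
  by (auto simp: AKS_def Let_def FactRing_def A_RCOSETS_def' RCOSETS_def a_r_coset_def)

lemma AA_simps:
  assumes "p \<in> FC" "p' \<in> FC"
  shows "q p \<oplus>\<^bsub>AA\<^esub> q p' = q (p + p')" "q p \<otimes>\<^bsub>AA\<^esub> q p' = q (p * p')"
proof -
  interpret J: ideal J F by (rule J_ideal)
  show "q p \<oplus>\<^bsub>AA\<^esub> q p' = q (p + p')"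
    using J.a_rcos_sum[OF assms] by (simp add: AKS_def Let_def FactRing_def F_simps)
  show "q p \<otimes>\<^bsub>AA\<^esub> q p' = q (p * p')"
    using J.rcoset_mult_add[OF assms] by (simp add: AKS_def Let_def FactRing_def F_simps)
qed

lemma AA_one: "\<one>\<^bsub>AA\<^esub> = q 1"
  by (simp add: AKS_def Let_def FactRing_def F_simps)

lemma AA_zero: "\<zero>\<^bsub>AA\<^esub> = q 0"
proof -
  interpret J: ideal J F by (rule J_ideal)
  have "q 0 = J" using J.a_rcos_const[of 0] by (simp add: F_simps)
  then show ?thesis by (simp add: AKS_def Let_def FactRing_def)
qed

lemma q_memD:
  assumes "p \<in> FC" "b \<in> q p" shows "b \<in> FC" "q b = q p"
proof -
  interpret J: ideal J F by (rule J_ideal)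
  show b: "b \<in> FC" using J.a_elemrcos_carrier[OF assms] .
  obtain j where "j \<in> J" "b = j + p" using assms(2) by (auto simp: a_r_coset_def' F_simps)
  then show "q b = q p" using assms(1) b by (simp add: q_eq_iff cong_def)
qed

text \<open>The union in the definition of \<open>AKS\<close> runs over the members of one coset,
  and all of them give the same coset after scaling.\<close>

lemma AA_smult:
  assumes "p \<in> FC" shows "z \<odot>\<^bsub>AA\<^esub> q p = q (z *\<^sub>k p)"
proof -
  interpret J: ideal J F by (rule J_ideal)
  have "z \<odot>\<^bsub>AA\<^esub> q p = (\<Union>b\<in>q p. q (z *\<^sub>k b))" by (simp add: AKS_def Let_def F_simps)
  also have "\<dots> = q (z *\<^sub>k p)"
  proof -
    have "q (z *\<^sub>k b) = q (z *\<^sub>k p)" if "b \<in> q p" for b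
      using q_memD[OF assms that] assms by (simp add: q_eq_iff cong_cscale)
    moreover have "p \<in> q p" using J.a_rcos_self[OF assms] .
    ultimately show ?thesis by blast
  qed
  finally show ?thesis .
qed

lemma AA_sc: "z \<odot>\<^bsub>AA\<^esub> \<one>\<^bsub>AA\<^esub> = q (z *\<^sub>k 1)"
  by (simp add: AA_one AA_smult)

lemma AA_ring: "ring AA"
proof (rule ringI)
  show "abelian_group AA"
  proof (rule abelian_groupI)
    fix a assume "a \<in> carrier AA"
    then obtain p where "p \<in> FC" "a = q p" by (auto simp: AA_carrier)
    then show "\<exists>b\<in>carrier AA. b \<oplus>\<^bsub>AA\<^esub> a = \<zero>\<^bsub>AA\<^esub>"
      by (intro bexI[of _ "q (- p)"]) (auto simp: AA_carrier AA_simps AA_zero)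
  qed (auto simp: AA_carrier AA_simps AA_zero algebra_simps)
  show "monoid AA" by (rule monoidI) (auto simp: AA_carrier AA_simps AA_one mult.assoc)
qed (auto simp: AA_carrier AA_simps algebra_simps)

sublocale AA: complex_algebra AA
  by (intro complex_algebra.intro complex_algebra_axioms.intro AA_ring)
    (auto simp: AA_smult AA_simps AA_carrier AA_one formal.scale_left_distrib mult.commute)

subsection \<open>Weight idempotents\<close>

definition colorings :: "(nat \<Rightarrow> nat) set"
  where "colorings = {1..n} \<rightarrow>\<^sub>E {1..r}"

definition swap_at :: "nat \<Rightarrow> (nat \<Rightarrow> nat) \<Rightarrow> nat \<Rightarrow> nat"
  where "swap_at i c = c(i := c (Suc i), Suc i := c i)"

text \<open>The idempotent that projects onto the vectors on which \<open>\<xi>\<^sub>j\<close> acts by \<open>u (c j)\<close>, for all \<open>j\<close>.\<close>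

definition wt :: "(nat \<Rightarrow> nat) \<Rightarrow> gen list \<Rightarrow>\<^sub>0 complex"
  where "wt c = prod_list (map (\<lambda>j. lag u r (c j) (x j)) [1..<Suc n])"

lemma finite_colorings: "finite colorings"
  unfolding colorings_def by (intro finite_PiE) auto

lemma coloringsD: "c \<in> colorings \<Longrightarrow> 1 \<le> j \<Longrightarrow> j \<le> n \<Longrightarrow> c j \<in> {1..r}"
  unfolding colorings_def by (auto dest: PiE_mem)

lemma colorings_eqI: "c \<in> colorings \<Longrightarrow> d \<in> colorings \<Longrightarrow> (\<And>j. 1 \<le> j \<Longrightarrow> j \<le> n \<Longrightarrow> c j = d j) \<Longrightarrow> c = d"
  unfolding colorings_def by (rule PiE_ext) auto

lemma swap_at_colorings: "c \<in> colorings \<Longrightarrow> 1 \<le> i \<Longrightarrow> i < n \<Longrightarrow> swap_at i c \<in> colorings"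
  unfolding colorings_def swap_at_def PiE_def by (auto simp: extensional_def Pi_iff)

lemma swap_at_swap_at [simp]: "swap_at i (swap_at i c) = c"
  by (auto simp: swap_at_def)

lemma swap_at_apply [simp]: "swap_at i c i = c (Suc i)" "swap_at i c (Suc i) = c i"
  by (auto simp: swap_at_def)

lemma swap_at_other [simp]: "j \<noteq> i \<Longrightarrow> j \<noteq> Suc i \<Longrightarrow> swap_at i c j = c j"
  by (auto simp: swap_at_def)

lemma FC_wt [simp]: "wt c \<in> FC"
  unfolding wt_def by (rule FC_prod_list) auto

lemma rel_quad:
  assumes "1 \<le> i" "i < n" shows "t i * t i \<asymp> - t i"
proof -
  have "t i * (t i + 1) \<in> AKS_relators n r u"
    unfolding AKS_relators_def Let_def
    by (rule UnI1, rule UnI1, rule UnI1, rule UnI1, rule UnI1, rule UnI1, rule UnI1, intro CollectI exI[of _ i] conjI refl) (use assms in \<open>simp_all\<close>)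
  from J_relator[OF this] show ?thesis by (simp add: cong_def algebra_simps)
qed

lemma rel_braid:
  assumes "1 \<le> i" "Suc i < n"
  shows "t i * t (Suc i) * t i \<asymp> t (Suc i) * t i * t (Suc i)"
proof -
  have "t i * t (i + 1) * t i - t (i + 1) * t i * t (i + 1) \<in> AKS_relators n r u"
    unfolding AKS_relators_def Let_def
    by (rule UnI1, rule UnI1, rule UnI1, rule UnI1, rule UnI1, rule UnI1, rule UnI2, intro CollectI exI[of _ i] conjI refl) (use assms in \<open>simp_all\<close>)
  from J_relator[OF this] show ?thesis by (simp add: cong_def)
qed

lemma rel_comm:
  assumes "1 \<le> i" "i < n" "1 \<le> j" "j < n" "i + 2 \<le> j \<or> j + 2 \<le> i"
  shows "t i * t j \<asymp> t j * t i"
proof -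
  have "t i * t j - t j * t i \<in> AKS_relators n r u"
    unfolding AKS_relators_def Let_def
    by (rule UnI1, rule UnI1, rule UnI1, rule UnI1, rule UnI1, rule UnI2, intro CollectI exI[of _ i] exI[of _ j] conjI refl) (use assms in \<open>simp_all\<close>)
  from J_relator[OF this] show ?thesis by (simp add: cong_def)
qed

lemma rel_poly:
  assumes "1 \<le> j" "j \<le> n"
  shows "prod_list (map (\<lambda>l. x j - u l *\<^sub>k 1) [1..<Suc r]) \<asymp> 0"
proof -
  have "prod_list (map (\<lambda>l. x j - u l *\<^sub>k 1) [1..<Suc r]) \<in> AKS_relators n r u"
    unfolding AKS_relators_def Let_def
    by (rule UnI1, rule UnI1, rule UnI1, rule UnI1, rule UnI2, intro CollectI exI[of _ j] conjI refl) (use assms in \<open>simp_all\<close>)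
  from J_relator[OF this] show ?thesis unfolding cong_def diff_zero .
qed

lemma rel_xx:
  assumes "1 \<le> i" "i \<le> n" "1 \<le> j" "j \<le> n" shows "x i * x j \<asymp> x j * x i"
proof -
  have "x i * x j - x j * x i \<in> AKS_relators n r u"
    unfolding AKS_relators_def Let_def
    by (rule UnI1, rule UnI1, rule UnI1, rule UnI2, intro CollectI exI[of _ i] exI[of _ j] conjI refl) (use assms in \<open>simp_all\<close>)
  from J_relator[OF this] show ?thesis by (simp add: cong_def)
qed

definition corr :: "nat \<Rightarrow> gen list \<Rightarrow>\<^sub>0 complex"
  where "corr i = (\<Sum>(a, b) \<in> {(a, b). 1 \<le> a \<and> a < b \<and> b \<le> r}.
            (u b - u a) *\<^sub>k (lag u r a (x i) * lag u r b (x (i + 1))))"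

lemma rel_tx:
  assumes "1 \<le> i" "i < n" shows "t i * x i \<asymp> x (Suc i) * t i + corr i"
proof -
  have "t i * x i - (x (i + 1) * t i + corr i) \<in> AKS_relators n r u"
    unfolding corr_def AKS_relators_def Let_def
    by (rule UnI1, rule UnI1, rule UnI2, intro CollectI exI[of _ i] conjI refl) (use assms in \<open>simp_all\<close>)
  from J_relator[OF this] show ?thesis by (simp add: cong_def)
qed

lemma rel_txx:
  assumes "1 \<le> i" "i < n" shows "t i * (x (Suc i) + x i) \<asymp> (x (Suc i) + x i) * t i"
proof -
  have "t i * (x (i + 1) + x i) - (x (i + 1) + x i) * t i \<in> AKS_relators n r u"
    unfolding AKS_relators_def Let_def
    by (rule UnI1, rule UnI2, intro CollectI exI[of _ i] conjI refl) (use assms in \<open>simp_all\<close>)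
  from J_relator[OF this] show ?thesis by (simp add: cong_def)
qed

lemma rel_tx_comm:
  assumes "1 \<le> i" "i < n" "1 \<le> j" "j \<le> n" "j \<noteq> i" "j \<noteq> Suc i"
  shows "t i * x j \<asymp> x j * t i"
proof -
  have "t i * x j - x j * t i \<in> AKS_relators n r u"
    unfolding AKS_relators_def Let_def
    by ( rule UnI2, intro CollectI exI[of _ i] exI[of _ j] conjI refl) (use assms in \<open>simp_all\<close>)
  from J_relator[OF this] show ?thesis by (simp add: cong_def)
qed

section \<open>Joint eigenvectors of the commuting elements xi_j, and how the T_i permute their
  weights\<close>

definition weighted :: "(nat \<Rightarrow> nat) \<Rightarrow> (gen list \<Rightarrow>\<^sub>0 complex) \<Rightarrow> bool"
  where "weighted c y \<longleftrightarrow> y \<in> FC \<and> (\<forall>j\<in>{1..n}. x j * y \<asymp> u (c j) *\<^sub>k y)"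

text \<open>On an eigenvector a polynomial in \<open>p\<close> is evaluated factor by factor at the
  eigenvalue, which reduces the claim to \<open>lag_scalar\<close>.\<close>

lemma lag_eigen:
  assumes y: "y \<in> FC" and p: "p \<in> FC" and e: "p * y \<asymp> u m *\<^sub>k y" and k: "k \<in> {1..r}" and m: "m \<in> {1..r}"
  shows "lag u r k p * y \<asymp> (if m = k then 1 else 0) *\<^sub>k y"
proof -
  have "prod_list (map (\<lambda>l. z l *\<^sub>k (p - u l *\<^sub>k 1)) ls) * y \<asymp> (\<Prod>l\<leftarrow>ls. z l * (u m - u l)) *\<^sub>k y" for z ls
  proof (induction ls)
    case (Cons l ls)
    have 1: "(p - u l *\<^sub>k 1) * y \<asymp> (u m - u l) *\<^sub>k y"
      using cong_diff[OF e, of "u l *\<^sub>k y" "u l *\<^sub>k y"]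
      by (simp add: left_diff_distrib formal.scale_left_diff_distrib)
    have "prod_list (map (\<lambda>l. z l *\<^sub>k (p - u l *\<^sub>k 1)) (l # ls)) * y
        = (z l *\<^sub>k (p - u l *\<^sub>k 1)) * (prod_list (map (\<lambda>l. z l *\<^sub>k (p - u l *\<^sub>k 1)) ls) * y)"
      by (simp add: mult.assoc)
    also have "\<dots> \<asymp> (z l *\<^sub>k (p - u l *\<^sub>k 1)) * ((\<Prod>l\<leftarrow>ls. z l * (u m - u l)) *\<^sub>k y)"
      by (rule cong_mult_left[OF Cons]) (simp add: p)
    also have "\<dots> = ((\<Prod>l\<leftarrow>ls. z l * (u m - u l)) * z l) *\<^sub>k ((p - u l *\<^sub>k 1) * y)"
      by simp
    also have "\<dots> \<asymp> ((\<Prod>l\<leftarrow>ls. z l * (u m - u l)) * z l) *\<^sub>k ((u m - u l) *\<^sub>k y)"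
      by (rule cong_cscale[OF 1])
    also have "\<dots> = (\<Prod>l\<leftarrow>l # ls. z l * (u m - u l)) *\<^sub>k y" by (simp add: ac_simps)
    finally show ?case .
  qed simp
  from this[of "\<lambda>l. 1 / (u k - u l)" "filter (\<lambda>l. l \<noteq> k) [1..<Suc r]"] show ?thesis
    unfolding lag_scalar[OF u_inj k m] lag_def .
qed

lemma lag_commute:
  assumes y: "y \<in> FC" and p: "p \<in> FC" and e: "y * p \<asymp> p * y"
  shows "y * lag u r k p \<asymp> lag u r k p * y"
proof -
  have "y * prod_list (map (\<lambda>l. z l *\<^sub>k (p - u l *\<^sub>k 1)) ls) \<asymp> prod_list (map (\<lambda>l. z l *\<^sub>k (p - u l *\<^sub>k 1)) ls) * y" for z ls
  proof (induction ls)
    case (Cons l ls)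
    let ?f = "z l *\<^sub>k (p - u l *\<^sub>k 1)" and ?P = "prod_list (map (\<lambda>l. z l *\<^sub>k (p - u l *\<^sub>k 1)) ls)"
    have P: "?P \<in> FC" using p by (intro FC_prod_list) simp
    have "y * (p - u l *\<^sub>k 1) \<asymp> (p - u l *\<^sub>k 1) * y"
      using cong_diff[OF e, of "u l *\<^sub>k y" "u l *\<^sub>k y"] by (simp add: left_diff_distrib right_diff_distrib)
    then have 1: "y * ?f \<asymp> ?f * y" using cong_cscale by simp
    have "y * (?f * ?P) = y * ?f * ?P" by (simp add: mult.assoc)
    also have "\<dots> \<asymp> ?f * y * ?P" by (rule cong_mult_right[OF 1 P])
    also have "\<dots> = ?f * (y * ?P)" by (simp add: mult.assoc)
    also have "\<dots> \<asymp> ?f * (?P * y)" by (rule cong_mult_left[OF Cons]) (simp add: p)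
    finally show ?case by (simp add: mult.assoc)
  qed simp
  then show ?thesis unfolding lag_def .
qed

lemma lag_weight: "1 \<le> j \<Longrightarrow> j \<le> n \<Longrightarrow> k \<in> {1..r} \<Longrightarrow> x j * lag u r k (x j) \<asymp> u k *\<^sub>k lag u r k (x j)"
proof -
  assume j: "1 \<le> j" "j \<le> n" and k: "k \<in> {1..r}"
  obtain z where "(x j - u k *\<^sub>k 1) * lag u r k (x j) = z *\<^sub>k prod_list (map (\<lambda>l. x j - u l *\<^sub>k 1) [1..<Suc r])"
    using lag_annihilate[OF k] by blast
  then have "(x j - u k *\<^sub>k 1) * lag u r k (x j) \<asymp> 0" using cong_cscale[OF rel_poly[OF j]] by simp
  then show ?thesis by (simp add: cong_def left_diff_distrib)
qed

lemma x_wt_partial: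
  assumes i: "1 \<le> i" "i \<le> n" and ls: "set ls \<subseteq> {1..n}"
  shows "x i * prod_list (map (\<lambda>j. lag u r (c j) (x j)) ls) \<asymp> prod_list (map (\<lambda>j. lag u r (c j) (x j)) ls) * x i"
  using ls
proof (induction ls)
  case (Cons j ls)
  let ?f = "lag u r (c j) (x j)" and ?P = "prod_list (map (\<lambda>j. lag u r (c j) (x j)) ls)"
  have j: "1 \<le> j" "j \<le> n" using Cons.prems by auto
  have P: "?P \<in> FC" using Cons.prems by (intro FC_prod_list) auto
  have 1: "x i * ?f \<asymp> ?f * x i" using i j by (intro lag_commute rel_xx) auto
  have "x i * (?f * ?P) = x i * ?f * ?P" by (simp add: mult.assoc)
  also have "\<dots> \<asymp> ?f * x i * ?P" by (rule cong_mult_right[OF 1 P])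
  also have "\<dots> = ?f * (x i * ?P)" by (simp add: mult.assoc)
  also have "\<dots> \<asymp> ?f * (?P * x i)" using Cons j by (intro cong_mult_left) auto
  finally show ?case by (simp add: mult.assoc)
qed simp

lemma wt_commute_x: "1 \<le> j \<Longrightarrow> j \<le> n \<Longrightarrow> x j * wt c \<asymp> wt c * x j"
  unfolding wt_def by (rule x_wt_partial) auto

lemma wt_weighted:
  assumes c: "c \<in> colorings"
  shows "weighted c (wt c)"
  unfolding weighted_def
proof (intro conjI ballI)
  fix i assume i: "i \<in> {1..n}"
  have "x i * prod_list (map (\<lambda>j. lag u r (c j) (x j)) ls) \<asymp> u (c i) *\<^sub>k prod_list (map (\<lambda>j. lag u r (c j) (x j)) ls)"
    if "set ls \<subseteq> {1..n}" "i \<in> set ls" for ls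
    using that
  proof (induction ls)
    case (Cons j ls)
    let ?f = "lag u r (c j) (x j)" and ?P = "prod_list (map (\<lambda>j. lag u r (c j) (x j)) ls)"
    have j: "1 \<le> j" "j \<le> n" using Cons.prems by auto
    have P: "?P \<in> FC" using Cons.prems by (intro FC_prod_list) auto
    show ?case
    proof (cases "j = i")
      case True
      have "x i * ?f \<asymp> u (c i) *\<^sub>k ?f" unfolding True using j coloringsD[OF c j] True by (intro lag_weight) auto
      from cong_mult_right[OF this P] show ?thesis using True by (simp add: mult.assoc)
    next
      case False
      have 1: "x i * ?f \<asymp> ?f * x i" using i j by (intro lag_commute rel_xx) auto
      have "x i * (?f * ?P) = x i * ?f * ?P" by (simp add: mult.assoc)
      also have "\<dots> \<asymp> ?f * x i * ?P" by (rule cong_mult_right[OF 1 P])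
      also have "\<dots> = ?f * (x i * ?P)" by (simp add: mult.assoc)
      also have "\<dots> \<asymp> ?f * (u (c i) *\<^sub>k ?P)" using Cons j False by (intro cong_mult_left) auto
      finally show ?thesis by simp
    qed
  qed simp
  from this[of "[1..<Suc n]"] i show "x i * wt c \<asymp> u (c i) *\<^sub>k wt c"
    unfolding wt_def by (simp del: upt_Suc add: atLeastLessThanSuc_atLeastAtMost)
qed simp

lemma wt_apply_weighted:
  assumes c: "c \<in> colorings" and d: "d \<in> colorings" and y: "weighted c y"
  shows "wt d * y \<asymp> (if d = c then 1 else 0) *\<^sub>k y"
proof -
  have yF: "y \<in> FC" using y by (simp add: weighted_def)
  have "prod_list (map (\<lambda>j. lag u r (d j) (x j)) ls) * y \<asymp> (if \<forall>j\<in>set ls. d j = c j then 1 else 0) *\<^sub>k y"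
    if "set ls \<subseteq> {1..n}" for ls
    using that
  proof (induction ls)
    case (Cons j ls)
    let ?f = "lag u r (d j) (x j)" and ?P = "prod_list (map (\<lambda>j. lag u r (d j) (x j)) ls)"
    have j: "1 \<le> j" "j \<le> n" using Cons.prems by auto
    let ?b = "(if \<forall>j\<in>set ls. d j = c j then 1 else 0) :: complex"
    have 1: "?f * y \<asymp> (if c j = d j then 1 else 0) *\<^sub>k y"
      using y j coloringsD[OF c j] coloringsD[OF d j] by (intro lag_eigen yF) (auto simp: weighted_def)
    have "?f * ?P * y = ?f * (?P * y)" by (simp add: mult.assoc)
    also have "\<dots> \<asymp> ?f * (?b *\<^sub>k y)" using Cons j by (intro cong_mult_left) auto
    also have "\<dots> = ?b *\<^sub>k (?f * y)" by simp
    also have "\<dots> \<asymp> ?b *\<^sub>k ((if c j = d j then 1 else 0) *\<^sub>k y)" by (rule cong_cscale[OF 1])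
    also have "\<dots> = (if \<forall>j\<in>set (j # ls). d j = c j then 1 else 0) *\<^sub>k y" by auto
    finally show ?case by simp
  qed simp
  from this[of "[1..<Suc n]"] have "wt d * y \<asymp> (if \<forall>j\<in>{1..n}. d j = c j then 1 else 0) *\<^sub>k y"
    unfolding wt_def by (simp del: upt_Suc add: atLeastLessThanSuc_atLeastAtMost)
  moreover have "(\<forall>j\<in>{1..n}. d j = c j) \<longleftrightarrow> d = c" using colorings_eqI[OF d c] by auto
  ultimately show ?thesis by simp
qed

lemma wt_wt:
  assumes "c \<in> colorings" "d \<in> colorings"
  shows "wt d * wt c \<asymp> (if d = c then 1 else 0) *\<^sub>k wt c"
  by (rule wt_apply_weighted[OF assms wt_weighted[OF assms(1)]])

text \<open>Expanding the product over \<open>j\<close> of the sums in \<open>sum_lag\<close> gives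
  one summand \<open>wt c\<close> for every coloring, so this is an equality in the free algebra and
  not only modulo the relations.\<close>

lemma sum_wt: "(\<Sum>c\<in>colorings. wt c) = 1"
proof -
  have "(\<Sum>c\<in>{1..m} \<rightarrow>\<^sub>E {1..r}. prod_list (map (\<lambda>j. lag u r (c j) (x j)) [1..<Suc m])) = 1" for m
  proof (induction m)
    case (Suc m)
    let ?P = "\<lambda>c. prod_list (map (\<lambda>j. lag u r (c j) (x j)) [1..<Suc m])"
    have set: "{1..Suc m} \<rightarrow>\<^sub>E {1..r} = (\<lambda>(k, c). c(Suc m := k)) ` ({1..r} \<times> ({1..m} \<rightarrow>\<^sub>E {1..r}))"
      using PiE_insert_eq[of "Suc m" "{1..m}" "\<lambda>_. {1..r}"] by (simp add: atLeastAtMostSuc_conv)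
    have inj: "inj_on (\<lambda>(k, c). c(Suc m := k)) ({1..r} \<times> ({1..m} \<rightarrow>\<^sub>E {1..r}))"
      by (rule inj_combinator) simp
    have P: "?P (c(Suc m := k)) = ?P c" for c k
      by (intro arg_cong[of _ _ prod_list] map_cong refl) auto
    have "(\<Sum>c\<in>{1..Suc m} \<rightarrow>\<^sub>E {1..r}. prod_list (map (\<lambda>j. lag u r (c j) (x j)) [1..<Suc (Suc m)]))
        = (\<Sum>c\<in>{1..Suc m} \<rightarrow>\<^sub>E {1..r}. ?P c * lag u r (c (Suc m)) (x (Suc m)))"
      by (simp add: mult.assoc)
    also have "\<dots> = (\<Sum>(k, c)\<in>{1..r} \<times> ({1..m} \<rightarrow>\<^sub>E {1..r}). ?P c * lag u r k (x (Suc m)))"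
      unfolding set sum.reindex[OF inj] by (intro sum.cong refl) (simp only: comp_def split_beta P fun_upd_same)
    also have "\<dots> = (\<Sum>k\<in>{1..r}. (\<Sum>c\<in>{1..m} \<rightarrow>\<^sub>E {1..r}. ?P c) * lag u r k (x (Suc m)))"
      unfolding sum.cartesian_product[symmetric] by (simp only: sum_distrib_right)
    also have "\<dots> = 1" unfolding Suc using sum_lag[OF r_pos u_inj, of "x (Suc m)"] by simp
    finally show ?case .
  qed simp
  then show ?thesis unfolding colorings_def wt_def .
qed

text \<open>On a vector of weight \<open>c\<close> only the summand with
  \<open>(a, b) = (c i, c (Suc i))\<close> survives, and the sum contains it exactly if
  \<open>c i < c (Suc i)\<close>.\<close>

lemma corr_eigen:
  assumes i: "1 \<le> i" "i < n" and c: "c \<in> colorings" and y: "weighted c y"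
  shows "corr i * y \<asymp> (if c i < c (Suc i) then u (c (Suc i)) - u (c i) else 0) *\<^sub>k y"
proof -
  have yF: "y \<in> FC" using y by (simp add: weighted_def)
  let ?B = "{(a, b). 1 \<le> a \<and> a < b \<and> b \<le> r}"
  have fin: "finite ?B" by (rule finite_subset[of _ "{1..r} \<times> {1..r}"]) auto
  have ci: "c i \<in> {1..r}" "c (Suc i) \<in> {1..r}" using coloringsD[OF c] i by auto
  have term_eq: "(u b - u a) *\<^sub>k (lag u r a (x i) * lag u r b (x (i + 1))) * y
      \<asymp> (if (a, b) = (c i, c (Suc i)) then u b - u a else 0) *\<^sub>k y" if "(a, b) \<in> ?B" for a b
  proof -
    have ab: "a \<in> {1..r}" "b \<in> {1..r}" using that by auto
    have 1: "lag u r a (x i) * y \<asymp> (if c i = a then 1 else 0) *\<^sub>k y"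
      using y i ci ab by (intro lag_eigen yF) (auto simp: weighted_def)
    have 2: "lag u r b (x (Suc i)) * y \<asymp> (if c (Suc i) = b then 1 else 0) *\<^sub>k y"
      using y i ci ab by (intro lag_eigen yF) (auto simp: weighted_def)
    have "lag u r a (x i) * (lag u r b (x (Suc i)) * y) \<asymp> lag u r a (x i) * ((if c (Suc i) = b then 1 else 0) *\<^sub>k y)"
      using i by (intro cong_mult_left[OF 2]) auto
    also have "\<dots> = (if c (Suc i) = b then 1 else 0) *\<^sub>k (lag u r a (x i) * y)" by simp
    also have "\<dots> \<asymp> (if c (Suc i) = b then 1 else 0) *\<^sub>k ((if c i = a then 1 else 0) *\<^sub>k y)"
      by (rule cong_cscale[OF 1])
    finally have "(u b - u a) *\<^sub>k (lag u r a (x i) * (lag u r b (x (Suc i)) * y))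
        \<asymp> (u b - u a) *\<^sub>k (if c (Suc i) = b then 1 else 0) *\<^sub>k ((if c i = a then 1 else 0) *\<^sub>k y)"
      by (rule cong_cscale)
    then show ?thesis by (auto simp: mult.assoc)
  qed
  have "corr i * y = (\<Sum>(a, b)\<in>?B. (u b - u a) *\<^sub>k (lag u r a (x i) * lag u r b (x (i + 1))) * y)"
    unfolding corr_def sum_distrib_right by (simp add: split_beta)
  also have "\<dots> \<asymp> (\<Sum>(a, b)\<in>?B. (if (a, b) = (c i, c (Suc i)) then u b - u a else 0) *\<^sub>k y)"
    by (rule cong_sum) (use term_eq in auto)
  also have "\<dots> = (\<Sum>(a, b)\<in>?B. if (a, b) = (c i, c (Suc i)) then u b - u a else 0) *\<^sub>k y"
    unfolding formal.scale_sum_left by (intro sum.cong refl) (auto split: if_splits)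
  also have "(\<Sum>(a, b)\<in>?B. if (a, b) = (c i, c (Suc i)) then u b - u a else 0)
      = (\<Sum>ab\<in>?B. if ab = (c i, c (Suc i)) then u (c (Suc i)) - u (c i) else 0)"
    by (intro sum.cong refl) (auto split: if_splits)
  also have "\<dots> = (if c i < c (Suc i) then u (c (Suc i)) - u (c i) else 0)"
    using fin ci by auto
  finally show ?thesis .
qed

text \<open>T_i corrected by a scalar is an intertwiner. The relation between T_i and xi_i
  determines the action of xi_(i+1), and the choice of \<open>b\<close> absorbs the correction term;
  the relation for the sum xi_(i+1) + xi_i then gives the action of xi_i.\<close>

lemma t_weighted:
  assumes i: "1 \<le> i" "i < n" and c: "c \<in> colorings" and y: "weighted c y"
  defines "b \<equiv> if c i < c (Suc i) then 1 else 0"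
  shows "weighted (swap_at i c) (t i * y + b *\<^sub>k y)"
proof -
  have yF: "y \<in> FC" and ev: "\<And>j. 1 \<le> j \<Longrightarrow> j \<le> n \<Longrightarrow> x j * y \<asymp> u (c j) *\<^sub>k y"
    using y by (auto simp: weighted_def)
  have F: "t i \<in> FC" "x i \<in> FC" "x (Suc i) \<in> FC" using i by auto
  let ?z = "t i * y + b *\<^sub>k y"
  have corr: "corr i * y \<asymp> (b * (u (c (Suc i)) - u (c i))) *\<^sub>k y"
    using corr_eigen[OF i c y] by (simp add: b_def split: if_splits)
  have tx: "t i * (x j * y) \<asymp> u (c j) *\<^sub>k (t i * y)" if "1 \<le> j" "j \<le> n" for j
    using cong_mult_left[OF ev[OF that] F(1)] by simp
  have "u (c i) *\<^sub>k (t i * y) \<asymp> t i * (x i * y)" using i by (intro cong_sym[OF tx]) auto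
  also have "\<dots> = t i * x i * y" by (simp add: mult.assoc)
  also have "\<dots> \<asymp> (x (Suc i) * t i + corr i) * y" by (rule cong_mult_right[OF rel_tx[OF i] yF])
  also have "\<dots> = x (Suc i) * (t i * y) + corr i * y" by (simp add: algebra_simps)
  also have "\<dots> \<asymp> x (Suc i) * (t i * y) + (b * (u (c (Suc i)) - u (c i))) *\<^sub>k y"
    by (rule cong_add[OF cong_refl corr])
  finally have "u (c i) *\<^sub>k (t i * y) \<asymp> x (Suc i) * (t i * y) + (b * (u (c (Suc i)) - u (c i))) *\<^sub>k y" .
  from cong_diff[OF cong_sym[OF this] cong_refl, of "(b * (u (c (Suc i)) - u (c i))) *\<^sub>k y"]
  have 1: "x (Suc i) * (t i * y) \<asymp> u (c i) *\<^sub>k (t i * y) - (b * (u (c (Suc i)) - u (c i))) *\<^sub>k y"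
    by simp
  have "x (Suc i) * ?z = x (Suc i) * (t i * y) + b *\<^sub>k (x (Suc i) * y)" by (simp add: algebra_simps)
  also have "\<dots> \<asymp> (u (c i) *\<^sub>k (t i * y) - (b * (u (c (Suc i)) - u (c i))) *\<^sub>k y) + b *\<^sub>k (u (c (Suc i)) *\<^sub>k y)"
    using i by (intro cong_add[OF 1 cong_cscale[OF ev]]) auto
  also have "\<dots> = u (c i) *\<^sub>k ?z"
    by (simp add: formal.scale_right_distrib formal.scale_left_diff_distrib algebra_simps)
  finally have S: "x (Suc i) * ?z \<asymp> u (c i) *\<^sub>k ?z" .
  have "(x (Suc i) + x i) * ?z = (x (Suc i) + x i) * t i * y + b *\<^sub>k ((x (Suc i) + x i) * y)"
    by (simp add: algebra_simps)
  also have "\<dots> \<asymp> t i * (x (Suc i) + x i) * y + b *\<^sub>k ((x (Suc i) + x i) * y)"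
    by (intro cong_add[OF _ cong_refl] cong_mult_right[OF cong_sym[OF rel_txx[OF i]] yF])
  also have "\<dots> = (t i * (x (Suc i) * y) + t i * (x i * y)) + b *\<^sub>k (x (Suc i) * y + x i * y)"
    by (simp add: algebra_simps)
  also have "\<dots> \<asymp> (u (c (Suc i)) *\<^sub>k (t i * y) + u (c i) *\<^sub>k (t i * y)) + b *\<^sub>k (u (c (Suc i)) *\<^sub>k y + u (c i) *\<^sub>k y)"
    using i by (intro cong_add cong_cscale tx ev) auto
  also have "\<dots> = u (c (Suc i)) *\<^sub>k ?z + u (c i) *\<^sub>k ?z"
    by (simp add: formal.scale_right_distrib algebra_simps)
  finally have "(x (Suc i) + x i) * ?z \<asymp> u (c (Suc i)) *\<^sub>k ?z + u (c i) *\<^sub>k ?z" .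
  from cong_diff[OF this S] have s: "x i * ?z \<asymp> u (c (Suc i)) *\<^sub>k ?z"
    by (simp add: distrib_right)
  show ?thesis
    unfolding weighted_def
  proof (intro conjI ballI)
    show "?z \<in> FC" using yF F by simp
    fix j assume j: "j \<in> {1..n}"
    consider "j = i" | "j = Suc i" | "j \<noteq> i" "j \<noteq> Suc i" by blast
    then show "x j * ?z \<asymp> u (swap_at i c j) *\<^sub>k ?z"
    proof cases
      case 3
      have j': "1 \<le> j" "j \<le> n" using j by auto
      have "x j * ?z = x j * t i * y + b *\<^sub>k (x j * y)" by (simp add: algebra_simps)
      also have "\<dots> \<asymp> t i * x j * y + b *\<^sub>k (u (c j) *\<^sub>k y)"
        by (intro cong_add cong_cscale ev j' cong_mult_right[OF cong_sym[OF rel_tx_comm[OF i j' 3]] yF])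
      also have "\<dots> = t i * (x j * y) + b *\<^sub>k (u (c j) *\<^sub>k y)" by (simp add: mult.assoc)
      also have "\<dots> \<asymp> u (c j) *\<^sub>k (t i * y) + b *\<^sub>k (u (c j) *\<^sub>k y)"
        by (intro cong_add[OF tx[OF j'] cong_refl])
      also have "\<dots> = u (swap_at i c j) *\<^sub>k ?z"
        using 3 by (simp add: formal.scale_right_distrib algebra_simps)
      finally show ?thesis .
    qed (use S s in auto)
  qed
qed

definition ascb :: "nat \<Rightarrow> (nat \<Rightarrow> nat) \<Rightarrow> complex"
  where "ascb i c = (if c i < c (Suc i) then 1 else 0)"

text \<open>Insert \<open>sum_wt\<close> on the right. By \<open>t_weighted\<close>, each
  \<open>t i * wt c\<close> is a vector of weight \<open>swap_at i c\<close> minus a multiple of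
  \<open>wt c\<close>, and \<open>wt d\<close> selects \<open>c = swap_at i d\<close> from the
  former and \<open>c = d\<close> from the latter. In this way an idempotent to the left of T_i is
  moved to the right.\<close>

lemma wt_t:
  assumes i: "1 \<le> i" "i < n" and d: "d \<in> colorings"
  shows "wt d * t i \<asymp> t i * wt (swap_at i d) + ascb i (swap_at i d) *\<^sub>k wt (swap_at i d) - ascb i d *\<^sub>k wt d"
proof -
  have F: "t i \<in> FC" using i by simp
  let ?z = "\<lambda>c. t i * wt c + ascb i c *\<^sub>k wt c"
  have term_eq: "wt d * (t i * wt c) \<asymp> (if c = swap_at i d then ?z c else 0) - (if c = d then ascb i d *\<^sub>k wt d else 0)"
    if c: "c \<in> colorings" for c
  proof -
    have "wt d * ?z c \<asymp> (if d = swap_at i c then 1 else 0) *\<^sub>k ?z c"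
      using wt_apply_weighted[OF swap_at_colorings[OF c i] d t_weighted[OF i c wt_weighted[OF c]]]
      by (simp add: ascb_def)
    moreover have "ascb i c *\<^sub>k (wt d * wt c) \<asymp> ascb i c *\<^sub>k ((if d = c then 1 else 0) *\<^sub>k wt c)"
      by (rule cong_cscale[OF wt_wt[OF c d]])
    ultimately have "wt d * ?z c - ascb i c *\<^sub>k (wt d * wt c)
        \<asymp> (if d = swap_at i c then 1 else 0) *\<^sub>k ?z c - ascb i c *\<^sub>k ((if d = c then 1 else 0) *\<^sub>k wt c)"
      by (rule cong_diff)
    moreover have "wt d * ?z c - ascb i c *\<^sub>k (wt d * wt c) = wt d * (t i * wt c)" by (simp add: algebra_simps)
    moreover have "d = swap_at i c \<longleftrightarrow> c = swap_at i d" by auto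
    ultimately show ?thesis by (auto split: if_splits)
  qed
  have "wt d * t i = wt d * (t i * (\<Sum>c\<in>colorings. wt c))" by (simp add: sum_wt)
  also have "\<dots> = (\<Sum>c\<in>colorings. wt d * (t i * wt c))" by (simp only: sum_distrib_left)
  also have "\<dots> \<asymp> (\<Sum>c\<in>colorings. (if c = swap_at i d then ?z c else 0) - (if c = d then ascb i d *\<^sub>k wt d else 0))"
    by (rule cong_sum[OF term_eq])
  also have "\<dots> = ?z (swap_at i d) - ascb i d *\<^sub>k wt d"
    using finite_colorings d swap_at_colorings[OF d i] by (simp add: sum_subtractf)
  finally show ?thesis .
qed

lemma wt_x:
  assumes j: "1 \<le> j" "j \<le> n" and d: "d \<in> colorings"
  shows "wt d * x j \<asymp> u (d j) *\<^sub>k wt d"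
proof -
  have "wt d * x j \<asymp> x j * wt d" by (rule cong_sym[OF wt_commute_x[OF j]])
  also have "\<dots> \<asymp> u (d j) *\<^sub>k wt d" using wt_weighted[OF d] j by (simp add: weighted_def)
  finally show ?thesis .
qed

end

subsection \<open>Freeness over the 0-Hecke algebra\<close>

context aks_algebra
begin

lemma ascb_simps: "c i < c (Suc i) \<Longrightarrow> ascb i c = 1" "c (Suc i) \<le> c i \<Longrightarrow> ascb i c = 0"
  by (auto simp: ascb_def)

text \<open>Families, indexed by the colorings, of linear functionals on the algebra. They carry the module
  coinduced from the module of functionals over the 0-Hecke algebra, on which \<open>T\<^sub>i\<close> acts through right
  multiplication of the argument.\<close>

definition fam :: "((nat \<Rightarrow> nat) \<Rightarrow> (gen list \<Rightarrow>\<^sub>0 complex) \<Rightarrow> complex) \<Rightarrow> bool"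
  where "fam f \<longleftrightarrow> (\<forall>d. \<forall>z\<in>FC. \<forall>z'\<in>FC. f d (z + z') = f d z + f d z') \<and>
    (\<forall>d k. \<forall>z\<in>FC. f d (k *\<^sub>k z) = k * f d z) \<and> (\<forall>d. \<forall>z\<in>J. f d z = 0) \<and>
    (\<forall>d z. d \<notin> colorings \<or> z \<notin> FC \<longrightarrow> f d z = 0)"

lemma famD:
  assumes "fam f"
  shows "z \<in> FC \<Longrightarrow> z' \<in> FC \<Longrightarrow> f d (z + z') = f d z + f d z'"
    "z \<in> FC \<Longrightarrow> f d (k *\<^sub>k z) = k * f d z" "z \<in> J \<Longrightarrow> f d z = 0"
    "d \<notin> colorings \<Longrightarrow> f d z = 0" "z \<notin> FC \<Longrightarrow> f d z = 0"
  using assms by (auto simp: fam_def)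

lemma fam_uminus: "fam f \<Longrightarrow> z \<in> FC \<Longrightarrow> f d (- z) = - f d z"
  using famD(2)[of f z d "-1"] by (simp add: formal.scale_minus_left)

lemma fam_cong: "fam f \<Longrightarrow> z \<in> FC \<Longrightarrow> z' \<in> FC \<Longrightarrow> z \<asymp> z' \<Longrightarrow> f d z = f d z'"
  using famD(1)[of f z "- z'" d] famD(3)[of f "z - z'" d] fam_uminus[of f z' d] by (simp add: cong_def)

text \<open>Regard \<open>f d\<close> as the value at \<open>wt d\<close> of an H_n(0)-homomorphism
  from the algebra. Such homomorphisms are acted on through right multiplication of their argument,
  and the two formulas are \<open>wt_t\<close> and \<open>wt_x\<close> read in this way.\<close>

fun gen_op :: "gen \<Rightarrow> ((nat \<Rightarrow> nat) \<Rightarrow> (gen list \<Rightarrow>\<^sub>0 complex) \<Rightarrow> complex) \<Rightarrow> (nat \<Rightarrow> nat) \<Rightarrow> (gen list \<Rightarrow>\<^sub>0 complex) \<Rightarrow> complex"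
  where
    "gen_op (T i) f = (\<lambda>d z. if d \<in> colorings \<and> z \<in> FC then f (swap_at i d) (z * t i) - ascb i d * f d z
      + ascb i (swap_at i d) * f (swap_at i d) z else 0)"
  | "gen_op (Xi j) f = (\<lambda>d z. u (d j) * f d z)"

abbreviation "word_op w f \<equiv> foldr gen_op w f"

definition rep :: "(gen list \<Rightarrow>\<^sub>0 complex) \<Rightarrow> ((nat \<Rightarrow> nat) \<Rightarrow> (gen list \<Rightarrow>\<^sub>0 complex) \<Rightarrow> complex)
    \<Rightarrow> (nat \<Rightarrow> nat) \<Rightarrow> (gen list \<Rightarrow>\<^sub>0 complex) \<Rightarrow> complex"
  where "rep p f = (\<lambda>d z. lin_ext (\<lambda>w. word_op w f d z) p)"

lemma gen_op_add: "gen_op a (\<lambda>d z. f d z + g d z) = (\<lambda>d z. gen_op a f d z + gen_op a g d z)"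
  by (cases a) (auto simp: fun_eq_iff algebra_simps)

lemma gen_op_scale: "gen_op a (\<lambda>d z. k * f d z) = (\<lambda>d z. k * gen_op a f d z)"
  by (cases a) (auto simp: fun_eq_iff algebra_simps)

lemma word_op_add: "word_op w (\<lambda>d z. f d z + g d z) = (\<lambda>d z. word_op w f d z + word_op w g d z)"
  by (induction w) (simp_all add: gen_op_add)

lemma word_op_scale: "word_op w (\<lambda>d z. k * f d z) = (\<lambda>d z. k * word_op w f d z)"
  by (induction w) (simp_all add: gen_op_scale)

lemma rep_add [simp]: "rep (p + p') f d z = rep p f d z + rep p' f d z"
  and rep_cscale [simp]: "rep (k *\<^sub>k p) f d z = k * rep p f d z"
  and rep_single: "rep (Poly_Mapping.single w k) f d z = k * word_op w f d z"
  and rep_zero [simp]: "rep 0 f d z = 0"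
  by (simp_all add: rep_def)

lemma rep_one [simp]: "rep 1 f d z = f d z"
proof -
  have "rep (Poly_Mapping.single [] 1) f d z = f d z" by (simp add: rep_single)
  then show ?thesis by (metis single_one zero_list_def)
qed

lemma rep_letter [simp]: "rep (letter a) f = gen_op a f"
  by (intro ext) (simp add: letter_def rep_single)

lemma rep_diff [simp]: "rep (p - p') f d z = rep p f d z - rep p' f d z"
  by (simp add: rep_def lin_ext_diff)

lemma rep_sum: "rep (\<Sum>b\<in>B. p b) f d z = (\<Sum>b\<in>B. rep (p b) f d z)"
  by (induction B rule: infinite_finite_induct) simp_all

lemma rep_mult [simp]: "rep (p * p') f = rep p (rep p' f)"
proof (induction p rule: poly_mapping_linear_induct)
  case (single v a)
  show ?case
  proof (induction p' rule: poly_mapping_linear_induct)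
    case (single w b)
    have "rep (Poly_Mapping.single w b) f = (\<lambda>d z. b * word_op w f d z)" by (intro ext) (simp add: rep_single)
    then show ?case
      by (intro ext) (simp add: mult_single rep_single word_op_scale plus_list_def)
  next
    case (add p p')
    have "rep (p + p') f = (\<lambda>d z. rep p f d z + rep p' f d z)" by (intro ext) simp
    then show ?case using add
      by (intro ext) (simp add: distrib_left rep_single word_op_add)
  qed
next
  case (add p s)
  then show ?case by (intro ext) (simp add: distrib_right)
qed

lemma fam_gen_op:
  assumes f: "fam f" and a: "a \<in> T ` {1..<n} \<union> Xi ` {1..n}"
  shows "fam (gen_op a f)"
proof -
  consider i where "a = T i" "1 \<le> i" "i < n" | j where "a = Xi j" using a by auto
  then show ?thesis
  proof cases
    case 1
    have ti: "t i \<in> FC" using 1 by simp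
    show ?thesis
      unfolding fam_def 1(1) gen_op.simps
      using J_mult_right[OF _ ti] J_subset
      by (auto simp: famD[OF f] ti distrib_right algebra_simps)
  next
    case 2
    show ?thesis unfolding fam_def 2 gen_op.simps by (auto simp: famD[OF f] algebra_simps)
  qed
qed

lemma fam_rep:
  assumes f: "fam f" and p: "p \<in> FC"
  shows "fam (rep p f)"
proof -
  have w: "fam (word_op w f)" if "set w \<subseteq> T ` {1..<n} \<union> Xi ` {1..n}" for w
    using that by (induction w) (auto intro!: fam_gen_op f)
  have "fam (\<lambda>d z. \<Sum>w\<in>K. k w * word_op w f d z)"
    if "finite K" "\<And>w. w \<in> K \<Longrightarrow> fam (word_op w f)" for K k
    using that
  proof (induction K rule: finite_induct)
    case (insert w K)
    then have "fam (word_op w f)" "fam (\<lambda>d z. \<Sum>w\<in>K. k w * word_op w f d z)" by auto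
    then show ?case using insert(1,2) by (auto simp: fam_def algebra_simps)
  qed (simp add: fam_def)
  from this[of "Poly_Mapping.keys p"] show ?thesis
    unfolding rep_def lin_ext_def using w p by (auto simp: FC_def words_def)
qed

lemma rep_quad:
  assumes f: "fam f" and i: "1 \<le> i" "i < n" and d: "d \<in> colorings" and z: "z \<in> FC"
  shows "rep (t i * (t i + 1)) f d z = 0"
proof -
  have F: "t i \<in> FC" "swap_at i d \<in> colorings" using i swap_at_colorings[OF d i] by auto
  have tt: "f e (z * (t i * t i)) = - f e (z * t i)" for e
  proof -
    have "z * (t i * t i) \<asymp> - (z * t i)" using cong_mult_left[OF rel_quad[OF i] z] by simp
    then have "f e (z * (t i * t i)) = f e (- (z * t i))" using z F by (intro fam_cong[OF f]) auto
    then show ?thesis using z F by (simp add: fam_uminus[OF f])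
  qed
  have eq: "swap_at i d = d" if "d i = d (Suc i)" using that by (auto simp: swap_at_def)
  consider "d i < d (Suc i)" | "d i = d (Suc i)" | "d (Suc i) < d i" by linarith
  then show ?thesis
    by cases (use d z F in \<open>simp_all add: ascb_simps tt eq algebra_simps\<close>)
qed

lemma rep_comm_t:
  assumes f: "fam f" and i: "1 \<le> i" "i < n" and j: "1 \<le> j" "j < n" and ij: "i + 2 \<le> j \<or> j + 2 \<le> i"
    and d: "d \<in> colorings" and z: "z \<in> FC"
  shows "rep (t i * t j - t j * t i) f d z = 0"
proof -
  have F: "t i \<in> FC" "t j \<in> FC" "swap_at i d \<in> colorings" "swap_at j d \<in> colorings"
    using i j swap_at_colorings[OF d] by auto
  have tt: "f e (z * (t j * t i)) = f e (z * (t i * t j))" for e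
  proof (rule fam_cong[OF f])
    have "j + 2 \<le> i \<or> i + 2 \<le> j" using ij by blast
    from cong_mult_left[OF rel_comm[OF j i this] z] show "z * (t j * t i) \<asymp> z * (t i * t j)" .
  qed (use z F in auto)
  have s: "swap_at i (swap_at j d) = swap_at j (swap_at i d)" using ij by (auto simp: swap_at_def fun_eq_iff)
  have a: "ascb i (swap_at j e) = ascb i e" "ascb j (swap_at i e) = ascb j e" for e
    using ij by (auto simp: ascb_def swap_at_def)
  have a': "ascb j (swap_at j (swap_at i e)) = ascb j (swap_at j e)" for e
    using ij by (auto simp: ascb_def swap_at_def)
  show ?thesis using d z F by (simp add: a a' s tt algebra_simps)
qed

text \<open>Only the colors at three consecutive positions matter. For each of their possible orders
  both sides become combinations of values of \<open>f\<close> at products with the T_i, which agree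
  by the relations of H_n(0).\<close>

lemma rep_braid:
  assumes f: "fam f" and i: "1 \<le> i" "Suc i < n" and d: "d \<in> colorings" and z: "z \<in> FC"
  shows "rep (t i * t (i + 1) * t i - t (i + 1) * t i * t (i + 1)) f d z = 0"
proof -
  define j where "j = Suc i"
  define D where "D a b c = d(i := a, j := b, Suc j := c)" for a b c
  have si: "swap_at i (D a b c) = D b a c" and sj: "swap_at j (D a b c) = D a c b" for a b c
    by (auto simp: D_def swap_at_def j_def fun_eq_iff)
  have ai: "ascb i (D a b c) = (if a < b then 1 else 0)" and aj: "ascb j (D a b c) = (if b < c then 1 else 0)" for a b c
    by (auto simp: D_def ascb_def j_def)
  have dD: "d = D (d i) (d j) (d (Suc j))" by (auto simp: D_def)
  have r: "d i \<in> {1..r}" "d j \<in> {1..r}" "d (Suc j) \<in> {1..r}" using coloringsD[OF d] i by (auto simp: j_def)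
  have DC: "D a b c \<in> colorings" if "a \<in> {1..r}" "b \<in> {1..r}" "c \<in> {1..r}" for a b c
    using d that i unfolding D_def colorings_def PiE_def by (auto simp: extensional_def Pi_iff j_def)
  have F: "t i \<in> FC" "t j \<in> FC" using i by (auto simp: j_def)
  have j': "1 \<le> j" "j < n" and i': "i < n" using i by (auto simp: j_def)
  have mf: "f e (v * a * w) = - f e (v * b * w)" if "a \<asymp> - b" "v \<in> FC" "w \<in> FC" "a \<in> FC" "b \<in> FC" for e v w a b
  proof -
    have "v * a * w \<asymp> - (v * b * w)"
      using cong_mult_right[OF cong_mult_left[OF that(1,2)] that(3)] by (simp add: mult.assoc)
    then have "f e (v * a * w) = f e (- (v * b * w))" using that by (intro fam_cong[OF f]) auto
    then show ?thesis using that by (simp add: fam_uminus[OF f])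
  qed
  note q1 = rel_quad[OF i(1) i'] and q2 = rel_quad[OF j']
  \<comment> \<open>Functionals in a family vanish on \<open>J\<close>, so squares of generators can
    be reduced inside their arguments; these are the words that occur in the braid
    computation.\<close>
  have ii: "f e (v * (t i * t i)) = - f e (v * t i)" "f e (v * (t j * t j)) = - f e (v * t j)"
    "f e (v * (t i * (t i * t j))) = - f e (v * (t i * t j))" "f e (v * (t j * (t j * t i))) = - f e (v * (t j * t i))"
    "f e (v * (t j * (t i * t i))) = - f e (v * (t j * t i))" "f e (v * (t i * (t j * t j))) = - f e (v * (t i * t j))"
    if v: "v \<in> FC" for e v
    using mf[OF q1 v FC_one, of e] mf[OF q2 v FC_one, of e] mf[OF q1 v F(2), of e] mf[OF q2 v F(1), of e]
      mf[OF q1 FC_mult[OF v F(2)] FC_one, of e] mf[OF q2 FC_mult[OF v F(1)] FC_one, of e] F v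
    by (simp_all add: mult.assoc)
  have br: "f e (z * (t j * (t i * t j))) = f e (z * (t i * (t j * t i)))" for e
  proof (rule fam_cong[OF f])
    from cong_mult_left[OF cong_sym[OF rel_braid[OF i]] z]
    show "z * (t j * (t i * t j)) \<asymp> z * (t i * (t j * t i))" by (simp add: mult.assoc j_def)
  qed (use z F in auto)
  have "rep (t i * t j * t i - t j * t i * t j) f (D a b c) z = 0"
    if "a \<in> {1..r}" "b \<in> {1..r}" "c \<in> {1..r}" for a b c
  proof -
    have "gen_op (T i) (gen_op (T j) (gen_op (T i) f)) (D a b c) z = gen_op (T j) (gen_op (T i) (gen_op (T j) f)) (D a b c) z"
      using z F that
      by (cases a b rule: linorder_cases; cases b c rule: linorder_cases; cases a c rule: linorder_cases)
        (simp_all add: DC si sj ai aj ii br algebra_simps)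
    then show ?thesis by (simp only: rep_diff rep_mult rep_letter right_minus_eq)
  qed
  from this[OF r] have "rep (t i * t j * t i - t j * t i * t j) f d z = 0" unfolding dD[symmetric] .
  moreover have "i + 1 = j" by (simp add: j_def)
  ultimately show ?thesis by (simp only:)
qed

lemma rep_linear_factors:
  "rep (prod_list (map (\<lambda>l. k l *\<^sub>k (x j - u l *\<^sub>k 1)) ls)) f d z = (\<Prod>l\<leftarrow>ls. k l * (u (d j) - u l)) * f d z"
  by (induction ls arbitrary: d z) (simp_all add: algebra_simps)

lemma rep_lag:
  assumes "d \<in> colorings" "1 \<le> j" "j \<le> n" "k \<in> {1..r}"
  shows "rep (lag u r k (x j)) f d z = (if d j = k then f d z else 0)"
  unfolding lag_def rep_linear_factors using lag_scalar[OF u_inj assms(4) coloringsD[OF assms(1-3)]] by simp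

lemma rep_tx:
  assumes f: "fam f" and i: "1 \<le> i" "i < n" and d: "d \<in> colorings" and z: "z \<in> FC"
  shows "rep (t i * x i - (x (i + 1) * t i + corr i)) f d z = 0"
proof -
  let ?B = "{(a, b). 1 \<le> a \<and> a < b \<and> b \<le> r}"
  have fin: "finite ?B" by (rule finite_subset[of _ "{1..r} \<times> {1..r}"]) auto
  have di: "d i \<in> {1..r}" "d (Suc i) \<in> {1..r}" using coloringsD[OF d] i by auto
  have "rep (corr i) f d z = (\<Sum>ab\<in>?B. if ab = (d i, d (Suc i)) then (u (d (Suc i)) - u (d i)) * f d z else 0)"
    unfolding corr_def rep_sum
  proof (intro sum.cong refl)
    fix ab assume "ab \<in> ?B"
    then obtain a b where ab: "ab = (a, b)" "a \<in> {1..r}" "b \<in> {1..r}" by auto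
    have "rep (lag u r a (x i) * lag u r b (x (i + 1))) f d z
        = (if d i = a then rep (lag u r b (x (i + 1))) f d z else 0)"
      unfolding rep_mult using i by (intro rep_lag d ab) auto
    also have "rep (lag u r b (x (i + 1))) f d z = (if d (i + 1) = b then f d z else 0)"
      using i by (intro rep_lag d ab) auto
    finally show "rep (case ab of (a, b) \<Rightarrow> (u b - u a) *\<^sub>k (lag u r a (x i) * lag u r b (x (i + 1)))) f d z
        = (if ab = (d i, d (Suc i)) then (u (d (Suc i)) - u (d i)) * f d z else 0)"
      using ab(1) by auto
  qed
  also have "\<dots> = ascb i d * (u (d (Suc i)) - u (d i)) * f d z"
    using fin di by (auto simp: ascb_def)
  finally have c: "rep (corr i) f d z = ascb i d * (u (d (Suc i)) - u (d i)) * f d z" .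
  have eq: "swap_at i d = d" if "d i = d (Suc i)" using that by (auto simp: swap_at_def)
  have F: "t i \<in> FC" "swap_at i d \<in> colorings" using i swap_at_colorings[OF d i] by auto
  consider "d i < d (Suc i)" | "d i = d (Suc i)" | "d (Suc i) < d i" by linarith
  then show ?thesis
    by cases (use d z F in \<open>simp_all add: c ascb_simps eq algebra_simps\<close>)
qed

lemma rep_txx:
  assumes i: "1 \<le> i" "i < n" and d: "d \<in> colorings" and z: "z \<in> FC"
  shows "rep (t i * (x (i + 1) + x i) - (x (i + 1) + x i) * t i) f d z = 0"
  using d z swap_at_colorings[OF d i] by (simp add: algebra_simps)

lemma rep_tx_comm:
  assumes i: "1 \<le> i" "i < n" and j: "j \<noteq> i" "j \<noteq> i + 1" and d: "d \<in> colorings" and z: "z \<in> FC"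
  shows "rep (t i * x j - x j * t i) f d z = 0"
  using d z j swap_at_colorings[OF d i] by (simp add: algebra_simps)

lemma rep_relator:
  assumes f: "fam f" and p: "p \<in> AKS_relators n r u"
  shows "rep p f d z = 0"
proof (cases "d \<in> colorings \<and> z \<in> FC")
  case False
  have "p \<in> FC" using relators_subset p by blast
  then show ?thesis using fam_rep[OF f] famD(4,5) False by blast
next
  case True
  then have dz: "d \<in> colorings" "z \<in> FC" by auto
  from p show ?thesis
    unfolding AKS_relators_def Let_def Un_iff mem_Collect_eq
  proof (elim disjE exE conjE)
    fix i assume "p = t i * (t i + 1)" "i \<in> {1..<n}"
    then show ?thesis using rep_quad[OF f _ _ dz] by auto
  next
    fix i assume "p = t i * t (i + 1) * t i - t (i + 1) * t i * t (i + 1)" "i \<in> {1..<n}" "i + 1 \<in> {1..<n}"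
    then show ?thesis using rep_braid[OF f _ _ dz, of i] by auto
  next
    fix i j assume "p = t i * t j - t j * t i" "i \<in> {1..<n}" "j \<in> {1..<n}" "i + 2 \<le> j"
    then show ?thesis using rep_comm_t[OF f _ _ _ _ _ dz, of i j] by auto
  next
    fix i j assume "p = t i * t j - t j * t i" "i \<in> {1..<n}" "j \<in> {1..<n}" "j + 2 \<le> i"
    then show ?thesis using rep_comm_t[OF f _ _ _ _ _ dz, of i j] by auto
  next
    fix j assume p: "p = prod_list (map (\<lambda>l. x j - u l *\<^sub>k 1) [1..<Suc r])" and j: "j \<in> {1..n}"
    have "d j \<in> set [1..<Suc r]" using coloringsD[OF dz(1), of j] j by auto
    then have "(\<Prod>l\<leftarrow>[1..<Suc r]. 1 * (u (d j) - u l)) = 0"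
      by (auto simp: prod_list_zero_iff image_iff simp del: upt_Suc)
    then show ?thesis using rep_linear_factors[of "\<lambda>_. 1" j "[1..<Suc r]" f d z] unfolding p
      by (simp del: upt_Suc)
  next
    fix i j assume "p = x i * x j - x j * x i"
    then show ?thesis by simp
  next
    fix i assume "p = t i * x i - (x (i + 1) * t i + (\<Sum>(a, b) \<in> {(a, b). 1 \<le> a \<and> a < b \<and> b \<le> r}.
            (u b - u a) *\<^sub>k (lag u r a (x i) * lag u r b (x (i + 1)))))" "i \<in> {1..<n}"
    then show ?thesis using rep_tx[OF f _ _ dz, of i] unfolding corr_def by auto
  next
    fix i assume "p = t i * (x (i + 1) + x i) - (x (i + 1) + x i) * t i" "i \<in> {1..<n}"
    then show ?thesis using rep_txx[OF _ _ dz, of i f] by auto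
  next
    fix i j assume "p = t i * x j - x j * t i" "i \<in> {1..<n}" "j \<noteq> i" "j \<noteq> i + 1"
    then show ?thesis using rep_tx_comm[OF _ _ _ _ dz, of i j f] by auto
  qed
qed

text \<open>The elements that act as zero on all families form a two-sided ideal. Closure under
  right multiples needs the quantification over all families, together with
  \<open>fam_rep\<close>.\<close>

lemma rep_J:
  assumes f: "fam f" and p: "p \<in> J"
  shows "rep p f d z = 0"
proof -
  define K where "K = {p \<in> FC. \<forall>f. fam f \<longrightarrow> (\<forall>d z. rep p f d z = 0)}"
  have op0: "word_op w (\<lambda>d z. 0) = (\<lambda>d z. 0)" for w
    using word_op_scale[of w 0 "\<lambda>_ _. 0"] by simp
  have rep0: "rep p (\<lambda>d z. 0) = (\<lambda>d z. 0)" for p by (simp add: rep_def op0 lin_ext_def)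
  have "ideal K F"
  proof (rule idealI)
    interpret R: ring F by (rule F_ring)
    have "- p \<in> K" if "p \<in> K" for p
      using that rep_diff[of 0 p] unfolding K_def by auto
    moreover have "\<ominus>\<^bsub>F\<^esub> p = - p" if "p \<in> FC" for p using F_minus[OF FC_zero that] that
      by (simp add: a_minus_def F_simps R.minus_equality)
    ultimately show "subgroup K (add_monoid F)"
      by (intro R.add.subgroupI) (auto simp: K_def F_simps a_inv_def[symmetric])
  next
    fix a p assume a: "a \<in> K" and p: "p \<in> FC"
    show "p \<otimes>\<^bsub>F\<^esub> a \<in> K"
    proof -
      have "rep (p * a) f d z = 0" if "fam f" for f d z
      proof -
        have "rep a f = (\<lambda>d z. 0)" using a that by (intro ext) (auto simp: K_def)
        then show ?thesis by (simp add: rep0)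
      qed
      then show ?thesis using a p by (simp add: K_def F_simps)
    qed
    show "a \<otimes>\<^bsub>F\<^esub> p \<in> K"
      using a p fam_rep[OF _ p] by (simp add: K_def F_simps)
  qed (rule F_ring)
  moreover have "AKS_relators n r u \<subseteq> K" using relators_subset rep_relator unfolding K_def by blast
  ultimately have "J \<subseteq> K" unfolding AKS_ideal_def by (rule ring.genideal_minimal[OF F_ring])
  then show ?thesis using f p unfolding K_def by blast
qed

section \<open>Words in the T_i, and independence of the weight idempotents over them\<close>

definition FT :: "(gen list \<Rightarrow>\<^sub>0 complex) set"
  where "FT = words (T ` {1..<n})"

lemma FT_subset: "FT \<subseteq> FC"
  unfolding FT_def FC_def by (rule words_mono) blast

lemma FT_FC: "p \<in> FT \<Longrightarrow> p \<in> FC"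
  using FT_subset by blast

lemma FT_zero [simp]: "0 \<in> FT" and FT_one [simp]: "1 \<in> FT"
  and FT_add [simp]: "p \<in> FT \<Longrightarrow> p' \<in> FT \<Longrightarrow> p + p' \<in> FT"
  and FT_cscale [simp]: "p \<in> FT \<Longrightarrow> z *\<^sub>k p \<in> FT"
  and FT_uminus [simp]: "p \<in> FT \<Longrightarrow> - p \<in> FT"
  and FT_mult [simp]: "p \<in> FT \<Longrightarrow> p' \<in> FT \<Longrightarrow> p * p' \<in> FT"
  and FT_t [simp]: "1 \<le> i \<Longrightarrow> i < n \<Longrightarrow> t i \<in> FT"
  unfolding FT_def by (auto intro: words_zero words_one words_add words_cscale words_uminus words_mult words_letter)

text \<open>Summation over the colorings is the homomorphism of \<open>H\<^sub>n(0)\<close>-modules from a coinduced module to the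
  module it is coinduced from.\<close>

lemma sum_gen_op:
  assumes i: "1 \<le> i" "i < n" and z: "z \<in> FC"
  shows "(\<Sum>d\<in>colorings. gen_op (T i) f d z) = (\<Sum>d\<in>colorings. f d (z * t i))"
proof -
  have bij: "bij_betw (swap_at i) colorings colorings"
    by (rule bij_betw_byWitness[where f' = "swap_at i"]) (use swap_at_colorings i in auto)
  have "(\<Sum>d\<in>colorings. gen_op (T i) f d z) = (\<Sum>d\<in>colorings. f (swap_at i d) (z * t i))
      - (\<Sum>d\<in>colorings. ascb i d * f d z) + (\<Sum>d\<in>colorings. ascb i (swap_at i d) * f (swap_at i d) z)"
    using z by (simp add: sum.distrib sum_subtractf)
  also have "(\<Sum>d\<in>colorings. ascb i (swap_at i d) * f (swap_at i d) z) = (\<Sum>d\<in>colorings. ascb i d * f d z)"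
    by (rule sum.reindex_bij_betw[OF bij, of "\<lambda>d. ascb i d * f d z"])
  also have "(\<Sum>d\<in>colorings. f (swap_at i d) (z * t i)) = (\<Sum>d\<in>colorings. f d (z * t i))"
    by (rule sum.reindex_bij_betw[OF bij, of "\<lambda>d. f d (z * t i)"])
  finally show ?thesis by simp
qed

text \<open>By \<open>sum_gen_op\<close> the outermost letter moves into the argument first, so
  right multiplication there reproduces the letters of \<open>h\<close> in their order.\<close>

lemma sum_rep:
  assumes f: "fam f" and h: "h \<in> FT" and z: "z \<in> FC"
  shows "(\<Sum>d\<in>colorings. rep h f d z) = (\<Sum>d\<in>colorings. f d (z * h))"
  using h[unfolded FT_def] z
proof (induction h arbitrary: z rule: words_induct)
  case zero
  then show ?case by (simp add: famD(3)[OF f])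
next
  case (letter a p)
  then obtain i where i: "a = T i" "1 \<le> i" "i < n" by auto
  have "(\<Sum>d\<in>colorings. rep (letter a * p) f d z) = (\<Sum>d\<in>colorings. gen_op (T i) (rep p f) d z)"
    by (simp add: i)
  also have "\<dots> = (\<Sum>d\<in>colorings. rep p f d (z * t i))" by (rule sum_gen_op[OF i(2,3) letter.prems])
  also have "\<dots> = (\<Sum>d\<in>colorings. f d (z * t i * p))" using letter i by (intro letter.IH) auto
  finally show ?case by (simp add: i mult.assoc)
next
  case (add p p')
  then have "p \<in> FC" "p' \<in> FC" using FT_FC by (auto simp: FT_def)
  then show ?case using add by (simp add: sum.distrib distrib_left famD(1)[OF f])
next
  case (scale k p)
  then have "p \<in> FC" using FT_FC by (auto simp: FT_def)
  then show ?case using scale by (simp add: sum_distrib_left[symmetric] famD(2)[OF f])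
qed simp

lemma rep_wt:
  assumes c: "c \<in> colorings" and d: "d \<in> colorings"
  shows "rep (wt c) f d z = (if c = d then f d z else 0)"
proof -
  have "rep (prod_list (map (\<lambda>j. lag u r (c j) (x j)) ls)) f d z = (if \<forall>j\<in>set ls. d j = c j then f d z else 0)"
    if "set ls \<subseteq> {1..n}" for ls
    using that
  proof (induction ls)
    case (Cons j ls)
    have j: "1 \<le> j" "j \<le> n" using Cons.prems by auto
    have "rep (prod_list (map (\<lambda>j. lag u r (c j) (x j)) (j # ls))) f d z
        = (if d j = c j then rep (prod_list (map (\<lambda>j. lag u r (c j) (x j)) ls)) f d z else 0)"
      by (simp add: rep_lag[OF d j coloringsD[OF c j]])
    then show ?case using Cons by auto
  qed simp
  from this[of "[1..<Suc n]"] have "rep (wt c) f d z = (if \<forall>j\<in>{1..n}. d j = c j then f d z else 0)"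
    unfolding wt_def by (simp del: upt_Suc add: atLeastLessThanSuc_atLeastAtMost)
  moreover have "(\<forall>j\<in>{1..n}. d j = c j) \<longleftrightarrow> c = d" using colorings_eqI[OF d c] by auto
  ultimately show ?thesis by simp
qed

lemma J_subspace: "formal.subspace J"
  by (rule formal.subspaceI) (auto intro: J_add J_cscale)

text \<open>A basis of \<open>J\<close> stays independent when \<open>y\<close> is added; the
  functional is 1 at \<open>y\<close> and 0 on that basis.\<close>

lemma separating_functional:
  assumes "y \<notin> J"
  obtains \<phi> :: "(gen list \<Rightarrow>\<^sub>0 complex) \<Rightarrow> complex" where "\<And>a b. \<phi> (a + b) = \<phi> a + \<phi> b"
    "\<And>k a. \<phi> (k *\<^sub>k a) = k * \<phi> a" "\<And>a. a \<in> J \<Longrightarrow> \<phi> a = 0" "\<phi> y \<noteq> 0"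
proof -
  interpret vp: vector_space_pair "cscale :: complex \<Rightarrow> (gen list \<Rightarrow>\<^sub>0 complex) \<Rightarrow> _" "(*) :: complex \<Rightarrow> complex \<Rightarrow> complex"
    by unfold_locales (auto simp: algebra_simps)
  obtain B where B: "B \<subseteq> J" "formal.independent B" "J \<subseteq> formal.span B"
    using formal.maximal_independent_subset[of J] by blast
  have span: "formal.span B = J" using formal.span_minimal[OF B(1) J_subspace] B(3) by blast
  then have ind: "formal.independent (insert y B)" using formal.independent_insertI[of y B] assms B(2) by simp
  obtain \<phi> where \<phi>: "Vector_Spaces.linear cscale (*) \<phi>" "\<forall>b\<in>insert y B. \<phi> b = (if b = y then 1 else 0 :: complex)"
    using vp.linear_independent_extend[OF ind, of "\<lambda>b. if b = y then 1 else 0"] by blast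
  interpret l: Vector_Spaces.linear cscale "(*) :: complex \<Rightarrow> complex \<Rightarrow> complex" \<phi> by fact
  have "\<phi> a = 0" if "a \<in> J" for a
  proof (rule l.eq_0_on_span)
    show "a \<in> formal.span B" using that span by simp
    show "\<phi> b = 0" if "b \<in> B" for b using \<phi>(2) that B(1) assms by auto
  qed
  then show thesis using \<phi>(2) by (intro that[of \<phi>]) (auto simp: l.add l.scale)
qed

text \<open>Otherwise a functional \<phi> that vanishes on \<open>J\<close> is nonzero at
  \<open>h c\<close>. Placed in the component \<open>c\<close> it forms a family on which
  \<open>wt c\<close> acts as the identity and the other idempotents act as zero, so
  \<open>h c\<close> kills this family. But the sum of the components of its action, evaluated at 1,
  is the value of \<phi> at \<open>h c\<close>.\<close>

lemma wt_independent:
  assumes h: "\<And>c. c \<in> colorings \<Longrightarrow> h c \<in> FT" and zero: "(\<Sum>c\<in>colorings. h c * wt c) \<in> J" and c: "c \<in> colorings"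
  shows "h c \<in> J"
proof (rule ccontr)
  assume "h c \<notin> J"
  then obtain \<phi> :: "(gen list \<Rightarrow>\<^sub>0 complex) \<Rightarrow> complex" where \<phi>: "\<And>a b. \<phi> (a + b) = \<phi> a + \<phi> b"
    "\<And>k a. \<phi> (k *\<^sub>k a) = k * \<phi> a" "\<And>a. a \<in> J \<Longrightarrow> \<phi> a = 0" "\<phi> (h c) \<noteq> 0"
    by (rule separating_functional) (rule that)
  define f where "f d z = (if d = c \<and> z \<in> FC then \<phi> z else 0)" for d z
  have f: "fam f" using c \<phi> unfolding fam_def f_def by auto
  have w: "rep (wt c') f = (if c' = c then f else (\<lambda>d z. 0))" if "c' \<in> colorings" for c'
  proof (intro ext)
    fix d z
    show "rep (wt c') f d z = (if c' = c then f else (\<lambda>d z. 0)) d z"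
    proof (cases "d \<in> colorings")
      case True
      then show ?thesis by (auto simp: rep_wt[OF that True] f_def)
    next
      case False
      then show ?thesis using famD(4)[OF fam_rep[OF f FC_wt] False] famD(4)[OF f False] by simp
    qed
  qed
  have op0: "word_op w (\<lambda>d z. 0) = (\<lambda>d z. 0)" for w
    using word_op_scale[of w 0 "\<lambda>_ _. 0"] by simp
  have rep0: "rep p (\<lambda>d z. 0) = (\<lambda>d z. 0)" for p by (simp add: rep_def op0 lin_ext_def)
  have "0 = rep (\<Sum>c'\<in>colorings. h c' * wt c') f d z" for d z using rep_J[OF f zero] by simp
  also have "\<dots> d z = (\<Sum>c'\<in>colorings. if c' = c then rep (h c) f d z else 0)" for d z
    unfolding rep_sum by (intro sum.cong refl) (auto simp: w rep0)
  also have "\<dots> d z = rep (h c) f d z" for d z using c finite_colorings by simp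
  finally have "rep (h c) f d z = 0" for d z by simp
  then have "0 = (\<Sum>d\<in>colorings. rep (h c) f d 1)" by simp
  also have "\<dots> = (\<Sum>d\<in>colorings. f d (1 * h c))" by (rule sum_rep[OF f h[OF c] FC_one])
  also have "\<dots> = \<phi> (h c)" using c finite_colorings FT_FC[OF h[OF c]] by (simp add: f_def)
  finally show False using \<phi>(4) by simp
qed

text \<open>The combinations on the right contain 1 by \<open>sum_wt\<close>, and by
  \<open>wt_t\<close> and \<open>wt_x\<close> they are stable under right multiplication by the
  generators.\<close>

lemma wt_span:
  assumes "p \<in> FC"
  shows "\<exists>h. (\<forall>c. h c \<in> FT) \<and> p \<asymp> (\<Sum>c\<in>colorings. h c * wt c)"
proof -
  define P where "P p \<longleftrightarrow> p \<in> FC \<and> (\<exists>h. (\<forall>c. h c \<in> FT) \<and> p \<asymp> (\<Sum>c\<in>colorings. h c * wt c))" for p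
  have add: "P (p + p')" if pp: "P p" "P p'" for p p'
  proof -
    obtain h h' where "\<forall>c. h c \<in> FT" "p \<asymp> (\<Sum>c\<in>colorings. h c * wt c)"
      "\<forall>c. h' c \<in> FT" "p' \<asymp> (\<Sum>c\<in>colorings. h' c * wt c)" using pp unfolding P_def by blast
    then show ?thesis using pp unfolding P_def
      by (intro conjI exI[of _ "\<lambda>c. h c + h' c"]) (auto simp: distrib_right sum.distrib intro: cong_add)
  qed
  have left: "P (s * p)" if p: "P p" and s: "s \<in> FT" for p s
  proof -
    obtain h where h: "\<forall>c. h c \<in> FT" "p \<asymp> (\<Sum>c\<in>colorings. h c * wt c)" using p unfolding P_def by blast
    then show ?thesis using p s cong_mult_left[OF h(2) FT_FC[OF s]] FT_FC[OF s] unfolding P_def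
      by (intro conjI exI[of _ "\<lambda>c. s * h c"]) (auto simp: sum_distrib_left mult.assoc)
  qed
  have wt: "P (wt d)" if "d \<in> colorings" for d
  proof -
    have "(\<Sum>c\<in>colorings. (if c = d then 1 else 0) * wt c) = (\<Sum>c\<in>colorings. if c = d then wt c else 0)"
      by (intro sum.cong) auto
    also have "\<dots> = wt d" using finite_colorings that by simp
    finally have "wt d \<asymp> (\<Sum>c\<in>colorings. (if c = d then 1 else 0) * wt c)" by simp
    then show ?thesis unfolding P_def by (intro conjI exI[of _ "\<lambda>c. if c = d then 1 else 0"]) auto
  qed
  have sum: "P (sum f B)" if "\<And>b. b \<in> B \<Longrightarrow> P (f b)" "finite B" for f and B :: "(nat \<Rightarrow> nat) set"
  proof -
    have z: "P 0" unfolding P_def by (intro conjI exI[of _ "\<lambda>c. 0"]) auto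
    show ?thesis using that(2,1) by (induction B rule: finite_induct) (auto intro: add z)
  qed
  have cong: "P p'" if "P p" "p' \<asymp> p" "p' \<in> FC" for p p'
    using that cong_trans unfolding P_def by blast
  have scale: "P (k *\<^sub>k p)" if "P p" for k p using left[OF that, of "k *\<^sub>k 1"] by simp
  have gen: "P (wt d * letter a)" if d: "d \<in> colorings" and a: "a \<in> T ` {1..<n} \<union> Xi ` {1..n}" for d a
  proof -
    consider i where "a = T i" "1 \<le> i" "i < n" | j where "a = Xi j" "1 \<le> j" "j \<le> n" using a by auto
    then show ?thesis
    proof cases
      case 1
      have sd: "swap_at i d \<in> colorings" by (rule swap_at_colorings[OF d 1(2,3)])
      have "P (t i * wt (swap_at i d) + ascb i (swap_at i d) *\<^sub>k wt (swap_at i d) + (- ascb i d) *\<^sub>k wt d)"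
        using 1 sd d by (intro add scale left wt) auto
      moreover have "wt d * t i \<asymp> t i * wt (swap_at i d) + ascb i (swap_at i d) *\<^sub>k wt (swap_at i d) + (- ascb i d) *\<^sub>k wt d"
        using wt_t[OF 1(2,3) d] by (simp add: formal.scale_minus_left)
      ultimately show ?thesis unfolding 1(1) by (rule cong) (use 1 in simp)
    next
      case 2
      show ?thesis unfolding 2(1)
        by (rule cong[OF scale[OF wt[OF d]] wt_x[OF 2(2,3) d]]) (use 2 in auto)
    qed
  qed
  have right: "P (s * letter a)" if s: "P s" and a: "a \<in> T ` {1..<n} \<union> Xi ` {1..n}" for s a
  proof -
    obtain h where h: "\<forall>c. h c \<in> FT" "s \<asymp> (\<Sum>c\<in>colorings. h c * wt c)" using s unfolding P_def by blast
    have aF: "letter a \<in> FC" using a by auto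
    have "P (\<Sum>c\<in>colorings. h c * (wt c * letter a))"
      using a h(1) by (intro sum left gen finite_colorings) auto
    then show ?thesis
    proof (rule cong)
      show "s * letter a \<asymp> (\<Sum>c\<in>colorings. h c * (wt c * letter a))"
        using cong_mult_right[OF h(2) aF] by (simp add: sum_distrib_right mult.assoc)
      show "s * letter a \<in> FC" using s aF by (simp add: P_def)
    qed
  qed
  \<comment> \<open>The induction removes letters at the left end of \<open>p\<close>; they are
    collected in the factor \<open>s\<close>, which is therefore kept general.\<close>
  have "P (s * p)" if "P s" for s
    using assms[unfolded FC_def] that
  proof (induction p arbitrary: s rule: words_induct)
    case zero
    then show ?case using scale[of s 0] by simp
  next
    case (letter a p)
    then show ?case using letter.IH[OF right] by (simp add: mult.assoc)
  qed (simp_all add: distrib_left add scale)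
  moreover have "P 1" unfolding sum_wt[symmetric] by (intro sum wt finite_colorings)
  ultimately have "P (1 * p)" by blast
  then show ?thesis unfolding P_def by simp
qed

end

subsection \<open>Restriction to the 0-Hecke algebra\<close>

context aks_algebra
begin

abbreviation "HH \<equiv> Hecke0 n r u"

lemma HH_simps [simp]:
  "monoid.mult HH = monoid.mult AA" "monoid.one HH = monoid.one AA" "ring.zero HH = ring.zero AA"
  "ring.add HH = ring.add AA" "smult HH = smult AA"
  by (simp_all add: Hecke0_def)

lemma AA_uminus: "p \<in> FC \<Longrightarrow> \<ominus>\<^bsub>AA\<^esub> q p = q (- p)"
  by (rule AA.minus_equality) (auto simp: AA_simps AA_zero AA_carrier)

lemma HH_gens: "range (\<lambda>z. z \<odot>\<^bsub>AA\<^esub> \<one>\<^bsub>AA\<^esub>) \<union> (\<lambda>i. AKS_gen n r u (T i)) ` {1..<n} \<subseteq> carrier AA"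
  by (auto simp: AA_sc AKS_gen_def AA_carrier)

lemma HH_carrier: "carrier HH = q ` FT"
proof (intro equalityI subsetI)
  fix a assume "a \<in> carrier HH"
  then have "a \<in> generate_ring AA (range (\<lambda>z. z \<odot>\<^bsub>AA\<^esub> \<one>\<^bsub>AA\<^esub>) \<union> (\<lambda>i. AKS_gen n r u (T i)) ` {1..<n})"
    by (simp add: Hecke0_def)
  then show "a \<in> q ` FT"
  proof induction
    case one
    show ?case by (auto simp: AA_one)
  next
    case (incl h)
    then show ?case by (auto simp: AA_sc AKS_gen_def)
  next
    case (a_inv h)
    then obtain p where "p \<in> FT" "h = q p" by blast
    then show ?case by (intro image_eqI[of _ _ "- p"]) (auto simp: AA_uminus FT_FC)
  next
    case (eng_add h1 h2)
    then obtain p p' where "p \<in> FT" "h1 = q p" "p' \<in> FT" "h2 = q p'" by blast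
    then show ?case by (intro image_eqI[of _ _ "p + p'"]) (auto simp: AA_simps FT_FC)
  next
    case (eng_mult h1 h2)
    then obtain p p' where "p \<in> FT" "h1 = q p" "p' \<in> FT" "h2 = q p'" by blast
    then show ?case by (intro image_eqI[of _ _ "p * p'"]) (auto simp: AA_simps FT_FC)
  qed
next
  fix a assume "a \<in> q ` FT"
  then obtain p where p: "p \<in> FT" "a = q p" by blast
  let ?G = "generate_ring AA (range (\<lambda>z. z \<odot>\<^bsub>AA\<^esub> \<one>\<^bsub>AA\<^esub>) \<union> (\<lambda>i. AKS_gen n r u (T i)) ` {1..<n})"
  have sc: "q (z *\<^sub>k 1) \<in> ?G" for z unfolding AA_sc[symmetric] by (rule generate_ring.incl) blast
  have "q p \<in> ?G \<and> p \<in> FC"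
    using p(1)[unfolded FT_def]
  proof (induction p rule: words_induct)
    case zero
    show ?case using sc[of 0] by simp
  next
    case one
    show ?case using sc[of 1] by simp
  next
    case (letter b p)
    then obtain i where i: "b = T i" "1 \<le> i" "i < n" by auto
    have "q (t i) \<in> ?G" unfolding AKS_gen_def[symmetric] using i by (intro generate_ring.incl) auto
    then have "q (t i) \<otimes>\<^bsub>AA\<^esub> q p \<in> ?G" using letter by (intro generate_ring.eng_mult) auto
    then show ?case using letter i by (simp add: AA_simps)
  next
    case (add p p')
    then have "q p \<oplus>\<^bsub>AA\<^esub> q p' \<in> ?G" by (intro generate_ring.eng_add) auto
    then show ?case using add by (simp add: AA_simps)
  next
    case (scale z p)
    then have "q (z *\<^sub>k 1) \<otimes>\<^bsub>AA\<^esub> q p \<in> ?G" by (intro generate_ring.eng_mult sc) auto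
    then show ?case using scale by (simp add: AA_simps)
  qed
  then show "a \<in> carrier HH" using p(2) by (simp add: Hecke0_def)
qed

lemma HH_subset: "a \<in> carrier HH \<Longrightarrow> a \<in> carrier AA"
  by (auto simp: HH_carrier AA_carrier FT_FC)

lemma HH_ring: "ring HH"
  unfolding Hecke0_def by (rule ring.generate_ring_is_ring[OF AA_ring HH_gens])

sublocale HH: complex_algebra HH
proof (intro complex_algebra.intro complex_algebra_axioms.intro HH_ring)
  show "z \<odot>\<^bsub>HH\<^esub> \<one>\<^bsub>HH\<^esub> \<in> carrier HH" for z by (auto simp: AA_sc HH_carrier)
  show "a \<in> carrier HH \<Longrightarrow> z \<odot>\<^bsub>HH\<^esub> \<one>\<^bsub>HH\<^esub> \<otimes>\<^bsub>HH\<^esub> a = a \<otimes>\<^bsub>HH\<^esub> (z \<odot>\<^bsub>HH\<^esub> \<one>\<^bsub>HH\<^esub>)" for a z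
    unfolding HH_simps by (rule AA.scalar_central[OF HH_subset])
qed (simp_all add: AA.scalar_add AA.scalar_mult AA.scalar_one)

lemma HH_left_module: "left_module AA M \<Longrightarrow> left_module HH M"
  using HH_ring HH_subset
  by (auto simp: left_module_def left_module_axioms_def)

lemma HH_lmod_hom: "f \<in> lmod_hom AA M N \<Longrightarrow> f \<in> lmod_hom HH M N"
  using HH_subset by (auto simp: lmod_hom_def)

lemma HH_fin_dim: "fin_dim HH M \<longleftrightarrow> fin_dim AA M"
  by (simp add: fin_dim_def)

lemma HH_character: "AA.character \<chi> \<Longrightarrow> HH.character \<chi>"
  by (auto simp: AA.character_def HH.character_def HH_subset)

text \<open>The coordinates with respect to the basis \<open>wt\<close> of the algebra over its subalgebra \<open>H\<^sub>n(0)\<close>.\<close>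

definition coord :: "(gen list \<Rightarrow>\<^sub>0 complex) set \<Rightarrow> (nat \<Rightarrow> nat) \<Rightarrow> gen list \<Rightarrow>\<^sub>0 complex"
  where "coord a = (SOME h. (\<forall>c. h c \<in> FT) \<and> a = q (\<Sum>c\<in>colorings. h c * wt c))"

text \<open>The elements \<open>coord a c\<close> are chosen, but their cosets are not affected by
  the choice, by \<open>wt_independent\<close>; this makes \<open>psi\<close> linear over
  H_n(0).\<close>

definition psi :: "(gen list \<Rightarrow>\<^sub>0 complex) set \<Rightarrow> (nat \<Rightarrow> nat) \<Rightarrow> (gen list \<Rightarrow>\<^sub>0 complex) set"
  where "psi a c = q (coord a c)"

lemma FC_wt_sum [simp]: "(\<And>c. c \<in> colorings \<Longrightarrow> h c \<in> FT) \<Longrightarrow> (\<Sum>c\<in>colorings. h c * wt c) \<in> FC"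
  by (rule FC_sum) (simp add: FT_FC)

lemma FT_diff [simp]: "p \<in> FT \<Longrightarrow> p' \<in> FT \<Longrightarrow> p - p' \<in> FT"
  using FT_add[of p "- p'"] by simp

lemma coord:
  assumes "a \<in> carrier AA"
  shows "coord a c \<in> FT" "a = q (\<Sum>c\<in>colorings. coord a c * wt c)"
proof -
  obtain p where p: "p \<in> FC" "a = q p" using assms by (auto simp: AA_carrier)
  obtain h where h: "\<forall>c. h c \<in> FT" "p \<asymp> (\<Sum>c\<in>colorings. h c * wt c)" using wt_span[OF p(1)] by blast
  then have "a = q (\<Sum>c\<in>colorings. h c * wt c)" using p by (simp add: q_eq_iff)
  then have "\<exists>h. (\<forall>c. h c \<in> FT) \<and> a = q (\<Sum>c\<in>colorings. h c * wt c)" using h(1) by blast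
  from someI_ex[OF this, folded coord_def] show "coord a c \<in> FT" "a = q (\<Sum>c\<in>colorings. coord a c * wt c)" by auto
qed

lemma psi_eq:
  assumes h: "\<And>c. h c \<in> FT" and c: "c \<in> colorings"
  shows "psi (q (\<Sum>c\<in>colorings. h c * wt c)) c = q (h c)"
proof -
  let ?a = "q (\<Sum>c\<in>colorings. h c * wt c)"
  have a: "?a \<in> carrier AA" using h by (auto simp: AA_carrier)
  have "(\<Sum>c\<in>colorings. coord ?a c * wt c) \<asymp> (\<Sum>c\<in>colorings. h c * wt c)"
    using coord(2)[OF a] coord(1)[OF a] h by (simp add: q_eq_iff[symmetric])
  moreover have "(\<Sum>c\<in>colorings. (coord ?a c + - h c) * wt c)
      = (\<Sum>c\<in>colorings. coord ?a c * wt c) - (\<Sum>c\<in>colorings. h c * wt c)"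
    by (simp add: left_diff_distrib sum_subtractf)
  ultimately have "(\<Sum>c\<in>colorings. (coord ?a c + - h c) * wt c) \<in> J" unfolding cong_def by (simp only:)
  then have "coord ?a c + - h c \<in> J" by (rule wt_independent[rotated]) (use coord(1)[OF a] h c in auto)
  then show ?thesis
    unfolding psi_def using coord(1)[OF a] h by (subst q_eq_iff) (auto simp: cong_def FT_FC)
qed

lemma psi_closed: "a \<in> carrier AA \<Longrightarrow> psi a c \<in> carrier HH"
  by (auto simp: psi_def HH_carrier coord)

lemma psi_add:
  assumes a: "a \<in> carrier AA" "b \<in> carrier AA" and c: "c \<in> colorings"
  shows "psi (a \<oplus>\<^bsub>AA\<^esub> b) c = psi a c \<oplus>\<^bsub>AA\<^esub> psi b c"
proof -
  have "a \<oplus>\<^bsub>AA\<^esub> b = q (\<Sum>c\<in>colorings. coord a c * wt c) \<oplus>\<^bsub>AA\<^esub> q (\<Sum>c\<in>colorings. coord b c * wt c)"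
    using coord(2)[OF a(1)] coord(2)[OF a(2)] by simp
  also have "\<dots> = q (\<Sum>c\<in>colorings. (coord a c + coord b c) * wt c)"
    using coord(1)[OF a(1)] coord(1)[OF a(2)] by (simp add: AA_simps distrib_right sum.distrib)
  finally have "psi (a \<oplus>\<^bsub>AA\<^esub> b) c = q (coord a c + coord b c)"
    using coord(1)[OF a(1)] coord(1)[OF a(2)] c by (simp add: psi_eq)
  then show ?thesis unfolding psi_def using coord(1)[OF a(1)] coord(1)[OF a(2)] by (simp add: AA_simps FT_FC)
qed

lemma psi_mult:
  assumes a: "a \<in> carrier AA" and b: "b \<in> carrier HH" and c: "c \<in> colorings"
  shows "psi (b \<otimes>\<^bsub>AA\<^esub> a) c = b \<otimes>\<^bsub>AA\<^esub> psi a c"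
proof -
  obtain p where p: "p \<in> FT" "b = q p" using b by (auto simp: HH_carrier)
  have "b \<otimes>\<^bsub>AA\<^esub> a = q p \<otimes>\<^bsub>AA\<^esub> q (\<Sum>c\<in>colorings. coord a c * wt c)"
    using coord(2)[OF a] p by simp
  also have "\<dots> = q (\<Sum>c\<in>colorings. (p * coord a c) * wt c)"
    using coord(1)[OF a] p by (simp add: AA_simps FT_FC sum_distrib_left mult.assoc)
  finally have "psi (b \<otimes>\<^bsub>AA\<^esub> a) c = q (p * coord a c)"
    using coord(1)[OF a] p c by (simp add: psi_eq)
  then show ?thesis unfolding psi_def using coord(1)[OF a] p by (simp add: AA_simps FT_FC)
qed

lemma finsum_q:
  assumes "finite K" "\<And>m. m \<in> K \<Longrightarrow> f m \<in> FC"
  shows "(\<Oplus>\<^bsub>AA\<^esub>m\<in>K. q (f m)) = q (\<Sum>m\<in>K. f m)"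
  using assms
proof (induction K rule: finite_induct)
  case empty
  show ?case by (simp add: AA_zero)
next
  case (insert m K)
  then have "(\<Oplus>\<^bsub>AA\<^esub>m\<in>insert m K. q (f m)) = q (f m) \<oplus>\<^bsub>AA\<^esub> (\<Oplus>\<^bsub>AA\<^esub>m\<in>K. q (f m))"
    by (intro AA.finsum_insert) (auto simp: AA_carrier)
  then show ?case using insert by (simp add: AA_simps)
qed

text \<open>A free module of rank \<open>k\<close> over the algebra is free of rank
  \<open>k * N\<close> over H_n(0), with basis vectors the products of a weight idempotent and a
  unit vector. The double sum is the trace of the same idempotent in this larger basis.\<close>

lemma HH_proj_data:
  assumes d: "AA.proj_data P k i p"
  shows "\<exists>k' i' p'. HH.proj_data P k' i' p' \<and> (\<forall>\<chi>. HH.data_trace \<chi> k' i' p'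
    = (\<Sum>a<k. \<Sum>c\<in>colorings. \<chi> (psi (q (wt c) \<otimes>\<^bsub>AA\<^esub> i (p (unit_vec AA k a)) a) c)))"
proof -
  have P: "left_module AA P" and i: "i \<in> lmod_hom AA P (free_lmod AA k)"
    and p: "p \<in> lmod_hom AA (free_lmod AA k) P" and ip: "\<And>x. x \<in> carrier P \<Longrightarrow> p (i x) = x"
    using d by (auto simp: AA.proj_data_def)
  interpret FA: left_module AA "free_lmod AA k" by (rule free_lmod_left_module) (rule AA_ring)
  interpret FH: left_module HH "free_lmod HH m" for m by (rule free_lmod_left_module) (rule HH_ring)
  define N where "N = card colorings"
  obtain e where e: "bij_betw e {0..<N} colorings"
    unfolding N_def using ex_bij_betw_nat_finite[OF finite_colorings] by blast
  have eC: "e m \<in> colorings" if "m < N" for m using e that by (auto simp: bij_betw_def)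
  \<comment> \<open>The coordinate \<open>a * N + m\<close> stands for the unit vector
    \<open>a\<close> and the coloring \<open>e m\<close>; quotient and remainder decode it.\<close>
  have dm: "(a * N + m) div N = a" "(a * N + m) mod N = m" if "m < N" for a m using that by auto
  have lt: "a * N + m < k * N" if "a < k" "m < N" for a m
  proof -
    have "a * N + m < Suc a * N" using that by simp
    also have "\<dots> \<le> k * N" using that by (intro mult_le_mono1) simp
    finally show ?thesis .
  qed
  have div_mod: "b div N < k" "b mod N < N" if "b < k * N" for b
  proof -
    have "0 < N" using that by (cases N) auto
    then show "b mod N < N" by simp
    show "b div N < k" using that by (simp add: less_mult_imp_div_less)
  qed
  define w where "w m = q (wt (e m))" for m
  have w: "w m \<in> carrier AA" for m by (auto simp: w_def AA_carrier)
  define i' where "i' x = (\<lambda>b\<in>{..<k * N}. psi (i x (b div N)) (e (b mod N)))" for x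
  \<comment> \<open>\<open>om\<close> reassembles \<open>k\<close> elements of the algebra from
    their coordinates over H_n(0), so it undoes the coordinate expansion in
    \<open>i'\<close>.\<close>
  define om where "om y = (\<lambda>a\<in>{..<k}. \<Oplus>\<^bsub>AA\<^esub>m\<in>{..<N}. y (a * N + m) \<otimes>\<^bsub>AA\<^esub> w m)" for y
  have ic: "i x a \<in> carrier AA" if "x \<in> carrier P" "a < k" for x a
    by (rule free_lmod_closed[OF lmod_homD(1)[OF i that(1)] that(2)])
  have i': "i' \<in> lmod_hom HH P (free_lmod HH (k * N))"
  proof (rule HH.lmod_hom_freeI[OF HH_left_module[OF P]])
    fix x assume "x \<in> carrier P"
    then show "i' x \<in> carrier (free_lmod HH (k * N))"
      using psi_closed ic div_mod unfolding free_lmod_def i'_def by auto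
  next
    fix x y b assume x: "x \<in> carrier P" "y \<in> carrier P" and b: "b < k * N"
    have "i (x \<oplus>\<^bsub>P\<^esub> y) (b div N) = i x (b div N) \<oplus>\<^bsub>AA\<^esub> i y (b div N)"
      by (simp add: lmod_homD(2)[OF i x] free_lmod_apply[OF div_mod(1)[OF b]])
    then show "i' (x \<oplus>\<^bsub>P\<^esub> y) b = i' x b \<oplus>\<^bsub>HH\<^esub> i' y b"
      using x b by (simp add: i'_def psi_add ic div_mod eC)
  next
    fix a x b assume a: "a \<in> carrier HH" and x: "x \<in> carrier P" and b: "b < k * N"
    have "i (a \<odot>\<^bsub>P\<^esub> x) (b div N) = a \<otimes>\<^bsub>AA\<^esub> i x (b div N)"
      by (simp add: lmod_homD(3)[OF i HH_subset[OF a] x] free_lmod_apply[OF div_mod(1)[OF b]])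
    then show "i' (a \<odot>\<^bsub>P\<^esub> x) b = a \<otimes>\<^bsub>HH\<^esub> i' x b"
      using a x b by (simp add: i'_def psi_mult ic div_mod eC)
  qed
  have yc: "y (a * N + m) \<in> carrier AA" if "y \<in> carrier (free_lmod HH (k * N))" "a < k" "m < N" for y a m
    using free_lmod_closed[OF that(1) lt[OF that(2,3)]] by (rule HH_subset)
  have om_closed: "om y \<in> carrier (free_lmod AA k)" if "y \<in> carrier (free_lmod HH (k * N))" for y
    unfolding om_def free_lmod_def using yc[OF that] w by (auto intro!: AA.finsum_closed)
  have om_apply: "om y a = (\<Oplus>\<^bsub>AA\<^esub>m\<in>{..<N}. y (a * N + m) \<otimes>\<^bsub>AA\<^esub> w m)" if "a < k" for y a
    using that by (simp add: om_def)
  have om: "om \<in> lmod_hom HH (free_lmod HH (k * N)) (free_lmod AA k)"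
    unfolding lmod_hom_def
  proof (intro CollectI conjI ballI funcsetI om_closed)
    fix y z assume yz: "y \<in> carrier (free_lmod HH (k * N))" "z \<in> carrier (free_lmod HH (k * N))"
    show "om (y \<oplus>\<^bsub>free_lmod HH (k * N)\<^esub> z) = om y \<oplus>\<^bsub>free_lmod AA k\<^esub> om z"
    proof (rule free_lmod_eqI[OF om_closed[OF FH.M.a_closed[OF yz]] FA.M.a_closed[OF om_closed[OF yz(1)] om_closed[OF yz(2)]]])
      fix a assume a: "a < k"
      have "om (y \<oplus>\<^bsub>free_lmod HH (k * N)\<^esub> z) a
          = (\<Oplus>\<^bsub>AA\<^esub>m\<in>{..<N}. (y (a * N + m) \<otimes>\<^bsub>AA\<^esub> w m) \<oplus>\<^bsub>AA\<^esub> (z (a * N + m) \<otimes>\<^bsub>AA\<^esub> w m))"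
        unfolding om_apply[OF a] using yc[OF yz(1) a] yc[OF yz(2) a] w a lt
        by (intro AA.finsum_cong') (auto simp: free_lmod_apply AA.l_distr)
      also have "\<dots> = om y a \<oplus>\<^bsub>AA\<^esub> om z a"
        unfolding om_apply[OF a] using yc[OF yz(1) a] yc[OF yz(2) a] w by (intro AA.finsum_addf) auto
      finally show "om (y \<oplus>\<^bsub>free_lmod HH (k * N)\<^esub> z) a = (om y \<oplus>\<^bsub>free_lmod AA k\<^esub> om z) a"
        by (simp add: free_lmod_apply[OF a])
    qed
  next
    fix h y assume h: "h \<in> carrier HH" and y: "y \<in> carrier (free_lmod HH (k * N))"
    show "om (h \<odot>\<^bsub>free_lmod HH (k * N)\<^esub> y) = h \<odot>\<^bsub>free_lmod AA k\<^esub> om y"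
    proof (rule free_lmod_eqI[OF om_closed[OF FH.smult_closed[OF h y]] FA.smult_closed[OF HH_subset[OF h] om_closed[OF y]]])
      fix a assume a: "a < k"
      have "om (h \<odot>\<^bsub>free_lmod HH (k * N)\<^esub> y) a = (\<Oplus>\<^bsub>AA\<^esub>m\<in>{..<N}. h \<otimes>\<^bsub>AA\<^esub> (y (a * N + m) \<otimes>\<^bsub>AA\<^esub> w m))"
        unfolding om_apply[OF a] using yc[OF y a] w a lt HH_subset[OF h]
        by (intro AA.finsum_cong') (auto simp: free_lmod_apply AA.m_assoc)
      also have "\<dots> = h \<otimes>\<^bsub>AA\<^esub> om y a"
        unfolding om_apply[OF a] using yc[OF y a] w HH_subset[OF h] by (intro AA.finsum_rdistr[symmetric]) auto
      finally show "om (h \<odot>\<^bsub>free_lmod HH (k * N)\<^esub> y) a = (h \<odot>\<^bsub>free_lmod AA k\<^esub> om y) a"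
        by (simp add: free_lmod_apply[OF a])
    qed
  qed
  have recon: "(\<Oplus>\<^bsub>AA\<^esub>m\<in>{..<N}. psi a (e m) \<otimes>\<^bsub>AA\<^esub> w m) = a" if a: "a \<in> carrier AA" for a
  proof -
    have "(\<Oplus>\<^bsub>AA\<^esub>m\<in>{..<N}. psi a (e m) \<otimes>\<^bsub>AA\<^esub> w m) = (\<Oplus>\<^bsub>AA\<^esub>m\<in>{..<N}. q (coord a (e m) * wt (e m)))"
      using coord(1)[OF a] by (intro AA.finsum_cong') (auto simp: psi_def w_def AA_simps FT_FC AA_carrier)
    also have "\<dots> = q (\<Sum>m\<in>{..<N}. coord a (e m) * wt (e m))"
      using coord(1)[OF a] by (intro finsum_q) (auto simp: FT_FC)
    also have "(\<Sum>m\<in>{..<N}. coord a (e m) * wt (e m)) = (\<Sum>c\<in>colorings. coord a c * wt c)"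
      using sum.reindex_bij_betw[OF e, of "\<lambda>c. coord a c * wt c"] by (simp add: lessThan_atLeast0)
    finally show ?thesis using coord(2)[OF a] by simp
  qed
  have om_i': "om (i' x) = i x" if x: "x \<in> carrier P" for x
  proof (rule free_lmod_eqI[OF om_closed[OF lmod_homD(1)[OF i' x]] lmod_homD(1)[OF i x]])
    fix a assume a: "a < k"
    have "om (i' x) a = (\<Oplus>\<^bsub>AA\<^esub>m\<in>{..<N}. psi (i x a) (e m) \<otimes>\<^bsub>AA\<^esub> w m)"
      unfolding om_apply[OF a] i'_def using a lt psi_closed[OF ic[OF x a]] w
      by (intro AA.finsum_cong') (auto simp: dm HH_subset)
    then show "om (i' x) a = i x a" using recon[OF ic[OF x a]] by simp
  qed
  define p' where "p' = p \<circ> om"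
  have p': "p' \<in> lmod_hom HH (free_lmod HH (k * N)) P"
    unfolding p'_def by (rule lmod_hom_comp[OF om HH_lmod_hom[OF p]])
  have data: "HH.proj_data P (k * N) i' p'"
    unfolding HH.proj_data_def using HH_left_module[OF P] i' p' om_i' ip by (auto simp: p'_def)
  have om_unit: "om (unit_vec HH (k * N) (a * N + m)) = w m \<odot>\<^bsub>free_lmod AA k\<^esub> unit_vec AA k a"
    if a: "a < k" and m: "m < N" for a m
  proof (rule free_lmod_eqI[OF om_closed[OF HH.unit_vec_closed] FA.smult_closed[OF w AA.unit_vec_closed]])
    fix a' assume a': "a' < k"
    have "a' * N + m' = a * N + m \<longleftrightarrow> a' = a \<and> m' = m" if "m' < N" for m'
      using dm[OF that, of a'] dm[OF m, of a] by metis
    then have "om (unit_vec HH (k * N) (a * N + m)) a'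
        = (\<Oplus>\<^bsub>AA\<^esub>m'\<in>{..<N}. if m = m' then (if a' = a then w m' else \<zero>\<^bsub>AA\<^esub>) else \<zero>\<^bsub>AA\<^esub>)"
      unfolding om_apply[OF a'] using w lt[OF a'] by (intro AA.finsum_cong') (auto simp: unit_vec_def)
    also have "\<dots> = (if a' = a then w m else \<zero>\<^bsub>AA\<^esub>)"
      using m w by (intro AA.add.finprod_singleton) auto
    finally show "om (unit_vec HH (k * N) (a * N + m)) a' = (w m \<odot>\<^bsub>free_lmod AA k\<^esub> unit_vec AA k a) a'"
      using w a' by (simp add: free_lmod_apply unit_vec_def)
  qed
  have "HH.data_trace \<chi> (k * N) i' p'
      = (\<Sum>a<k. \<Sum>c\<in>colorings. \<chi> (psi (q (wt c) \<otimes>\<^bsub>AA\<^esub> i (p (unit_vec AA k a)) a) c))" for \<chi>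
  proof -
    have "HH.data_trace \<chi> (k * N) i' p' = (\<Sum>a<k. \<Sum>b\<in>{a * N..<a * N + N}. \<chi> (i' (p' (unit_vec HH (k * N) b)) b))"
      unfolding HH.data_trace_def by (rule sum.nat_group[symmetric])
    also have "\<dots> = (\<Sum>a<k. \<Sum>m<N. \<chi> (i' (p' (unit_vec HH (k * N) (a * N + m))) (a * N + m)))"
    proof -
      have "(\<Sum>b\<in>{a * N..<a * N + N}. f b) = (\<Sum>m<N. f (a * N + m))" for a and f :: "nat \<Rightarrow> complex"
        by (rule sum.reindex_bij_witness[of _ "\<lambda>m. a * N + m" "\<lambda>b. b - a * N"]) auto
      then show ?thesis by (simp only:)
    qed
    also have "\<dots> = (\<Sum>a<k. \<Sum>m<N. \<chi> (psi (w m \<otimes>\<^bsub>AA\<^esub> i (p (unit_vec AA k a)) a) (e m)))"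
    proof (intro sum.cong refl)
      fix a m assume "a \<in> {..<k}" "m \<in> {..<N}"
      then have am: "a < k" "m < N" by auto
      have pu: "p (unit_vec AA k a) \<in> carrier P" by (rule lmod_homD(1)[OF p AA.unit_vec_closed])
      have "p' (unit_vec HH (k * N) (a * N + m)) = w m \<odot>\<^bsub>P\<^esub> p (unit_vec AA k a)"
        by (simp add: p'_def om_unit[OF am] lmod_homD(3)[OF p w AA.unit_vec_closed])
      then have "i (p' (unit_vec HH (k * N) (a * N + m))) a = w m \<otimes>\<^bsub>AA\<^esub> i (p (unit_vec AA k a)) a"
        by (simp add: lmod_homD(3)[OF i w pu] free_lmod_apply[OF am(1)])
      then show "\<chi> (i' (p' (unit_vec HH (k * N) (a * N + m))) (a * N + m))
          = \<chi> (psi (w m \<otimes>\<^bsub>AA\<^esub> i (p (unit_vec AA k a)) a) (e m))"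
        using am lt[OF am] by (simp add: i'_def dm[OF am(2)])
    qed
    also have "\<dots> = (\<Sum>a<k. \<Sum>c\<in>colorings. \<chi> (psi (q (wt c) \<otimes>\<^bsub>AA\<^esub> i (p (unit_vec AA k a)) a) c))"
      unfolding w_def
      using sum.reindex_bij_betw[OF e, of "\<lambda>c. \<chi> (psi (q (wt c) \<otimes>\<^bsub>AA\<^esub> i (p (unit_vec AA k a)) a) c)" for a]
      by (simp add: lessThan_atLeast0)
    finally show ?thesis .
  qed
  then show ?thesis using data by blast
qed

lemma HH_fd_projective: "fd_projective AA P \<Longrightarrow> fd_projective HH P"
  unfolding AA.fd_projective_iff HH.fd_projective_iff HH_fin_dim using HH_proj_data by blast

subsection \<open>Characters\<close>

fun gen_val :: "nat set \<Rightarrow> (nat \<Rightarrow> nat) \<Rightarrow> gen \<Rightarrow> complex"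
  where
    "gen_val D c (T i) = (if i \<in> D then -1 else 0)"
  | "gen_val D c (Xi j) = u (c j)"

definition ev :: "nat set \<Rightarrow> (nat \<Rightarrow> nat) \<Rightarrow> (gen list \<Rightarrow>\<^sub>0 complex) \<Rightarrow> complex"
  where "ev D c = lin_ext (\<lambda>w. prod_list (map (gen_val D c) w))"

lemma ev_simps [simp]:
  "ev D c (p + p') = ev D c p + ev D c p'" "ev D c (k *\<^sub>k p) = k * ev D c p" "ev D c 0 = 0"
  "ev D c (p - p') = ev D c p - ev D c p'" "ev D c (letter a) = gen_val D c a"
  by (simp_all add: ev_def lin_ext_diff letter_def)

lemma ev_uminus [simp]: "ev D c (- p) = - ev D c p"
  using ev_simps(4)[of D c 0 p] by simp

lemma ev_one [simp]: "ev D c 1 = 1"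
  unfolding ev_def using lin_ext_single[of "\<lambda>w. prod_list (map (gen_val D c) w)" "[]" 1]
  by (simp add: single_Nil_one)

lemma ev_mult [simp]: "ev D c (p * p') = ev D c p * ev D c p'"
proof (induction p rule: poly_mapping_linear_induct)
  case (single v a)
  show ?case
  proof (induction p' rule: poly_mapping_linear_induct)
    case (single w b)
    show ?case by (simp add: ev_def mult_single plus_list_def)
  qed (simp add: distrib_left)
qed (simp add: distrib_right)

lemma ev_sum: "ev D c (\<Sum>b\<in>B. f b) = (\<Sum>b\<in>B. ev D c (f b))"
  by (induction B rule: infinite_finite_induct) auto

lemma ev_prod_list: "ev D c (prod_list (map f ls)) = (\<Prod>l\<leftarrow>ls. ev D c (f l))"
  by (induction ls) auto

text \<open>The relation between T_i and xi_i forces a character with colors \<open>c\<close> to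
  send T_i to -1 where \<open>c\<close> increases and to 0 where it decreases; only equal
  neighboring colors leave the value free.\<close>

definition compat :: "nat set \<Rightarrow> (nat \<Rightarrow> nat) \<Rightarrow> bool"
  where "compat D c \<longleftrightarrow> c \<in> colorings \<and>
    (\<forall>i\<in>{1..<n}. (c i < c (Suc i) \<longrightarrow> i \<in> D) \<and> (c (Suc i) < c i \<longrightarrow> i \<notin> D))"

lemma ev_lag:
  assumes "c \<in> colorings" "1 \<le> j" "j \<le> n" "k \<in> {1..r}"
  shows "ev D c (lag u r k (x j)) = (if c j = k then 1 else 0)"
  unfolding lag_def ev_prod_list using lag_scalar[OF u_inj assms(4) coloringsD[OF assms(1-3)]] by simp

lemma ev_corr:
  assumes c: "c \<in> colorings" and i: "1 \<le> i" "i < n"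
  shows "ev D c (corr i) = (if c i < c (Suc i) then u (c (Suc i)) - u (c i) else 0)"
proof -
  let ?B = "{(a, b). 1 \<le> a \<and> a < b \<and> b \<le> r}"
  have fin: "finite ?B" by (rule finite_subset[of _ "{1..r} \<times> {1..r}"]) auto
  have ci: "c i \<in> {1..r}" "c (Suc i) \<in> {1..r}" using coloringsD[OF c] i by auto
  have "ev D c (corr i) = (\<Sum>ab\<in>?B. if ab = (c i, c (Suc i)) then u (c (Suc i)) - u (c i) else 0)"
    unfolding corr_def ev_sum
  proof (intro sum.cong refl)
    fix ab assume "ab \<in> ?B"
    then obtain a b where ab: "ab = (a, b)" "a \<in> {1..r}" "b \<in> {1..r}" by auto
    have "ev D c (lag u r a (x i)) = (if c i = a then 1 else 0)"
      "ev D c (lag u r b (x (i + 1))) = (if c (i + 1) = b then 1 else 0)"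
      using i ab ev_lag[OF c, of i a D] ev_lag[OF c, of "i + 1" b D] by auto
    then show "ev D c (case ab of (a, b) \<Rightarrow> (u b - u a) *\<^sub>k (lag u r a (x i) * lag u r b (x (i + 1))))
        = (if ab = (c i, c (Suc i)) then u (c (Suc i)) - u (c i) else 0)"
      using ab(1) by auto
  qed
  then show ?thesis using fin ci by auto
qed

lemma ev_relator:
  assumes D: "compat D c" and p: "p \<in> AKS_relators n r u"
  shows "ev D c p = 0"
proof -
  have c: "c \<in> colorings" using D by (simp add: compat_def)
  from p show ?thesis
    unfolding AKS_relators_def Let_def Un_iff mem_Collect_eq
  proof (elim disjE exE conjE)
    fix j assume p: "p = prod_list (map (\<lambda>l. x j - u l *\<^sub>k 1) [1..<Suc r])" and j: "j \<in> {1..n}"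
    have "c j \<in> set [1..<Suc r]" using coloringsD[OF c, of j] j by auto
    then show ?thesis unfolding p ev_prod_list
      by (auto simp: prod_list_zero_iff image_iff simp del: upt_Suc)
  next
    fix i assume "p = t i * x i - (x (i + 1) * t i + (\<Sum>(a, b) \<in> {(a, b). 1 \<le> a \<and> a < b \<and> b \<le> r}.
            (u b - u a) *\<^sub>k (lag u r a (x i) * lag u r b (x (i + 1)))))" and i: "i \<in> {1..<n}"
    then have p: "p = t i * x i - (x (i + 1) * t i + corr i)" by (simp add: corr_def)
    have "(c i < c (Suc i) \<longrightarrow> i \<in> D) \<and> (c (Suc i) < c i \<longrightarrow> i \<notin> D)" using D i by (simp add: compat_def)
    then show ?thesis using ev_corr[OF c, of i D] i unfolding p
      by (cases "c i" "c (Suc i)" rule: linorder_cases) auto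
  qed auto
qed

lemma ev_J:
  assumes D: "compat D c" and p: "p \<in> J"
  shows "ev D c p = 0"
proof -
  define K where "K = {p \<in> FC. ev D c p = 0}"
  have "ideal K F"
  proof (rule idealI)
    interpret R: ring F by (rule F_ring)
    have "- p \<in> K" if "p \<in> K" for p
      using that ev_simps(4)[of D c 0 p] unfolding K_def by auto
    moreover have "\<ominus>\<^bsub>F\<^esub> p = - p" if "p \<in> FC" for p using F_minus[OF FC_zero that] that
      by (simp add: a_minus_def F_simps R.minus_equality)
    ultimately show "subgroup K (add_monoid F)"
      by (intro R.add.subgroupI) (auto simp: K_def F_simps a_inv_def[symmetric])
  qed (auto simp: K_def F_simps F_ring)
  moreover have "AKS_relators n r u \<subseteq> K" using relators_subset ev_relator[OF D] unfolding K_def by blast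
  ultimately have "J \<subseteq> K" unfolding AKS_ideal_def by (rule ring.genideal_minimal[OF F_ring])
  then show ?thesis using p unfolding K_def by blast
qed

definition chi :: "nat set \<Rightarrow> (nat \<Rightarrow> nat) \<Rightarrow> (gen list \<Rightarrow>\<^sub>0 complex) set \<Rightarrow> complex"
  where "chi D c a = ev D c (SOME p. p \<in> FC \<and> q p = a)"

lemma chi_q:
  assumes "compat D c" "p \<in> FC"
  shows "chi D c (q p) = ev D c p"
proof -
  have "(SOME p'. p' \<in> FC \<and> q p' = q p) \<in> FC \<and> q (SOME p'. p' \<in> FC \<and> q p' = q p) = q p"
    by (rule someI[of "\<lambda>p'. p' \<in> FC \<and> q p' = q p" p]) (use assms(2) in simp)
  then have "(SOME p'. p' \<in> FC \<and> q p' = q p) \<asymp> p" using assms(2) q_eq_iff by blast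
  then have "ev D c ((SOME p'. p' \<in> FC \<and> q p' = q p) - p) = 0" unfolding cong_def by (rule ev_J[OF assms(1)])
  then show ?thesis by (simp add: chi_def)
qed

lemma chi_character:
  assumes "compat D c"
  shows "AA.character (chi D c)"
  unfolding AA.character_def
proof (intro conjI ballI allI)
  fix a b assume "a \<in> carrier AA" "b \<in> carrier AA"
  then obtain p p' where "p \<in> FC" "a = q p" "p' \<in> FC" "b = q p'" by (auto simp: AA_carrier)
  then show "chi D c (a \<oplus>\<^bsub>AA\<^esub> b) = chi D c a + chi D c b" "chi D c (a \<otimes>\<^bsub>AA\<^esub> b) = chi D c a * chi D c b"
    using assms by (simp_all add: AA_simps chi_q)
next
  fix z show "chi D c (z \<odot>\<^bsub>AA\<^esub> \<one>\<^bsub>AA\<^esub>) = z" using assms by (simp add: AA_sc chi_q)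
qed

text \<open>A constant coloring is compatible with every \<open>D\<close>, so each character of
  H_n(0) is obtained by restricting a character of the whole algebra.\<close>

definition base_col :: "nat \<Rightarrow> nat"
  where "base_col = (\<lambda>j\<in>{1..n}. 1)"

lemma compat_base: "compat D base_col"
proof -
  have "base_col i = base_col (Suc i)" if "i \<in> {1..<n}" for i using that by (simp add: base_col_def)
  moreover have "base_col \<in> colorings" using r_pos by (auto simp: base_col_def colorings_def)
  ultimately show ?thesis by (auto simp: compat_def)
qed

text \<open>The character of the simple module of \<open>H\<^sub>n(0)\<close> with descent set \<open>D\<close>.\<close>

abbreviation "hchi D \<equiv> chi D base_col"

section \<open>The coinduced module: its diagonal characters, energy and matrix entries\<close>

definition induced_des :: "nat set \<Rightarrow> (nat \<Rightarrow> nat) \<Rightarrow> nat set"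
  where "induced_des D c = {i \<in> {1..<n}. c i < c (Suc i) \<or> c i = c (Suc i) \<and> i \<in> D}"

lemma compat_induced: "c \<in> colorings \<Longrightarrow> compat (induced_des D c) c"
  by (auto simp: compat_def induced_des_def)

text \<open>The matrix entries of the module coinduced from the one-dimensional module \<open>D\<close> are triangular
  with respect to this energy.\<close>

primrec energy_weight :: "nat set \<Rightarrow> nat \<Rightarrow> int"
  where
    "energy_weight D 0 = 0"
  | "energy_weight D (Suc i) = energy_weight D i + (if i \<in> D then 1 else -1)"

definition energy :: "nat set \<Rightarrow> (nat \<Rightarrow> nat) \<Rightarrow> int"
  where "energy D c = (\<Sum>j\<in>{1..n}. energy_weight D j * int (c j))"

text \<open>Consecutive weights differ by 1 or -1 according to \<open>D\<close>, so the change is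
  this sign times a difference of two colors. It is negative exactly when
  \<open>c i < c (Suc i)\<close> for \<open>i\<close> in \<open>D\<close>, or
  \<open>c (Suc i) < c i\<close> for \<open>i\<close> outside \<open>D\<close>.\<close>

lemma energy_swap:
  assumes i: "1 \<le> i" "i < n"
  shows "energy D (swap_at i c) - energy D c = (if i \<in> D then -1 else 1) * (int (c (Suc i)) - int (c i))"
proof -
  have set: "{1..n} = insert i (insert (Suc i) ({1..n} - {i, Suc i}))" using i by auto
  have split: "energy D c = energy_weight D i * int (c i) + energy_weight D (Suc i) * int (c (Suc i))
      + (\<Sum>j\<in>{1..n} - {i, Suc i}. energy_weight D j * int (c j))" for c
    unfolding energy_def by (subst set) (simp add: add.assoc)
  have "(\<Sum>j\<in>{1..n} - {i, Suc i}. energy_weight D j * int (swap_at i c j))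
      = (\<Sum>j\<in>{1..n} - {i, Suc i}. energy_weight D j * int (c j))"
    by (intro sum.cong) auto
  then show ?thesis unfolding split by (simp add: algebra_simps)
qed

text \<open>The matrix of right multiplication by \<open>p\<close> in the basis of weight
  idempotents, with its coefficients from H_n(0) evaluated by the character of
  \<open>D\<close>.\<close>

definition mat_entry :: "nat set \<Rightarrow> (gen list \<Rightarrow>\<^sub>0 complex) \<Rightarrow> (nat \<Rightarrow> nat) \<Rightarrow> (nat \<Rightarrow> nat) \<Rightarrow> complex"
  where "mat_entry D p c d = hchi D (psi (q (wt c * p)) d)"

lemma mat_entry_eq:
  assumes p: "p \<in> FC" and h: "\<And>d. h d \<in> FT" and eq: "wt c * p \<asymp> (\<Sum>d\<in>colorings. h d * wt d)" and d: "d \<in> colorings"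
  shows "mat_entry D p c d = ev D base_col (h d)"
proof -
  have "q (wt c * p) = q (\<Sum>d\<in>colorings. h d * wt d)" using eq h p by (simp add: q_eq_iff)
  then show ?thesis unfolding mat_entry_def using psi_eq[OF h d] FT_FC[OF h] by (simp add: chi_q[OF compat_base])
qed

lemma mat_entry_expand:
  assumes p: "p \<in> FC"
  obtains h where "\<And>d. h d \<in> FT" "wt c * p \<asymp> (\<Sum>d\<in>colorings. h d * wt d)"
    "\<And>D d. d \<in> colorings \<Longrightarrow> mat_entry D p c d = ev D base_col (h d)"
proof -
  obtain h where h: "\<forall>d. h d \<in> FT" "wt c * p \<asymp> (\<Sum>d\<in>colorings. h d * wt d)"
    using wt_span[of "wt c * p"] p by auto
  have "mat_entry D p c d = ev D base_col (h d)" if "d \<in> colorings" for D d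
    by (rule mat_entry_eq[OF p _ h(2) that]) (use h(1) in blast)
  then show thesis using h by (intro that[of h]) auto
qed

lemma mat_entry_add:
  assumes "p \<in> FC" "p' \<in> FC" "d \<in> colorings"
  shows "mat_entry D (p + p') c d = mat_entry D p c d + mat_entry D p' c d"
proof -
  obtain h where h: "\<And>d. h d \<in> FT" "wt c * p \<asymp> (\<Sum>d\<in>colorings. h d * wt d)"
    "\<And>D d. d \<in> colorings \<Longrightarrow> mat_entry D p c d = ev D base_col (h d)" using mat_entry_expand[OF assms(1)] by blast
  obtain h' where h': "\<And>d. h' d \<in> FT" "wt c * p' \<asymp> (\<Sum>d\<in>colorings. h' d * wt d)"
    "\<And>D d. d \<in> colorings \<Longrightarrow> mat_entry D p' c d = ev D base_col (h' d)" using mat_entry_expand[OF assms(2)] by blast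
  have "wt c * (p + p') \<asymp> (\<Sum>d\<in>colorings. (h d + h' d) * wt d)"
    using cong_add[OF h(2) h'(2)] by (simp add: distrib_left distrib_right sum.distrib)
  then have "mat_entry D (p + p') c d = ev D base_col (h d + h' d)"
    using assms h(1) h'(1) by (intro mat_entry_eq) auto
  then show ?thesis using h(3) h'(3) assms by simp
qed

lemma mat_entry_cscale:
  assumes "p \<in> FC" "d \<in> colorings"
  shows "mat_entry D (k *\<^sub>k p) c d = k * mat_entry D p c d"
proof -
  obtain h where h: "\<And>d. h d \<in> FT" "wt c * p \<asymp> (\<Sum>d\<in>colorings. h d * wt d)"
    "\<And>D d. d \<in> colorings \<Longrightarrow> mat_entry D p c d = ev D base_col (h d)" using mat_entry_expand[OF assms(1)] by blast
  have "wt c * (k *\<^sub>k p) \<asymp> (\<Sum>d\<in>colorings. (k *\<^sub>k h d) * wt d)"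
    using cong_cscale[OF h(2), of k] by (simp add: cscale_sum)
  then have "mat_entry D (k *\<^sub>k p) c d = ev D base_col (k *\<^sub>k h d)"
    using assms h(1) by (intro mat_entry_eq) auto
  then show ?thesis using h(3) assms by simp
qed

text \<open>Expanding \<open>wt c * p\<close> and then every \<open>wt e * s\<close> produces the
  coefficients \<open>h e * g e d\<close>, in the order of a matrix product, and \<open>ev\<close>
  is multiplicative.\<close>

lemma mat_entry_mult:
  assumes p: "p \<in> FC" and s: "s \<in> FC" and d: "d \<in> colorings"
  shows "mat_entry D (p * s) c d = (\<Sum>e\<in>colorings. mat_entry D p c e * mat_entry D s e d)"
proof -
  obtain h where h: "\<And>d. h d \<in> FT" "wt c * p \<asymp> (\<Sum>d\<in>colorings. h d * wt d)"
    "\<And>D d. d \<in> colorings \<Longrightarrow> mat_entry D p c d = ev D base_col (h d)" using mat_entry_expand[OF p] by blast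
  define g where "g e = (SOME g. (\<forall>d. g d \<in> FT) \<and> wt e * s \<asymp> (\<Sum>d\<in>colorings. g d * wt d))" for e
  have "\<exists>g. (\<forall>d. g d \<in> FT) \<and> wt e * s \<asymp> (\<Sum>d\<in>colorings. g d * wt d)" for e
    using wt_span[of "wt e * s"] s by simp
  from someI_ex[OF this, folded g_def] have g: "\<And>e d. g e d \<in> FT" "\<And>e. wt e * s \<asymp> (\<Sum>d\<in>colorings. g e d * wt d)" by auto
  have g': "mat_entry D s e d = ev D base_col (g e d)" for e
    by (rule mat_entry_eq[OF s g(1) g(2) d])
  have "wt c * (p * s) \<asymp> (\<Sum>e\<in>colorings. h e * wt e) * s"
    using cong_mult_right[OF h(2) s] by (simp add: mult.assoc)
  also have "\<dots> = (\<Sum>e\<in>colorings. h e * (wt e * s))" by (simp add: sum_distrib_right mult.assoc)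
  also have "\<dots> \<asymp> (\<Sum>e\<in>colorings. h e * (\<Sum>d\<in>colorings. g e d * wt d))"
    by (intro cong_sum cong_mult_left g FT_FC h)
  also have "\<dots> = (\<Sum>e\<in>colorings. \<Sum>d\<in>colorings. h e * g e d * wt d)"
    by (simp add: sum_distrib_left mult.assoc)
  also have "\<dots> = (\<Sum>d\<in>colorings. (\<Sum>e\<in>colorings. h e * g e d) * wt d)"
    by (subst sum.swap) (simp add: sum_distrib_right)
  finally have eq: "wt c * (p * s) \<asymp> (\<Sum>d\<in>colorings. (\<Sum>e\<in>colorings. h e * g e d) * wt d)" .
  have FTs: "(\<Sum>e\<in>B. h e * g e d) \<in> FT" for B d
    using h(1) g(1) by (induction B rule: infinite_finite_induct) auto
  have "mat_entry D (p * s) c d = ev D base_col (\<Sum>e\<in>colorings. h e * g e d)"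
    using p s FTs by (intro mat_entry_eq[OF _ _ eq d]) auto
  then show ?thesis using h(3) g' by (simp add: ev_sum)
qed

lemma mat_entry_one: "c \<in> colorings \<Longrightarrow> d \<in> colorings \<Longrightarrow> mat_entry D 1 c d = (if d = c then 1 else 0)"
proof -
  assume c: "c \<in> colorings" and d: "d \<in> colorings"
  have "(\<Sum>e\<in>colorings. (if e = c then 1 else 0) * wt e) = (\<Sum>e\<in>colorings. if e = c then wt e else 0)"
    by (intro sum.cong) auto
  also have "\<dots> = wt c" using finite_colorings c by simp
  finally have "wt c * 1 \<asymp> (\<Sum>e\<in>colorings. (if e = c then 1 else 0) * wt e)" by simp
  then have "mat_entry D 1 c d = ev D base_col (if d = c then 1 else 0)"
    by (intro mat_entry_eq) (use d in auto)
  then show ?thesis by simp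
qed

lemma mat_entry_x:
  assumes c: "c \<in> colorings" and d: "d \<in> colorings" and j: "1 \<le> j" "j \<le> n"
  shows "mat_entry D (x j) c d = (if d = c then u (c j) else 0)"
proof -
  have "(\<Sum>e\<in>colorings. (if e = c then u (c j) *\<^sub>k 1 else 0) * wt e) = (\<Sum>e\<in>colorings. if e = c then u (c j) *\<^sub>k wt e else 0)"
    by (intro sum.cong) auto
  also have "\<dots> = u (c j) *\<^sub>k wt c" using finite_colorings c by simp
  finally have "wt c * x j \<asymp> (\<Sum>e\<in>colorings. (if e = c then u (c j) *\<^sub>k 1 else 0) * wt e)"
    using wt_x[OF j c] by simp
  then have "mat_entry D (x j) c d = ev D base_col (if d = c then u (c j) *\<^sub>k 1 else 0)"
    by (intro mat_entry_eq) (use d j in auto)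
  then show ?thesis by simp
qed

lemma mat_entry_t:
  assumes c: "c \<in> colorings" and d: "d \<in> colorings" and i: "1 \<le> i" "i < n"
  shows "mat_entry D (t i) c d = (if d = swap_at i c then (if i \<in> D then -1 else 0) + ascb i (swap_at i c) else 0)
    - (if d = c then ascb i c else 0)"
proof -
  let ?h = "\<lambda>e. (if e = swap_at i c then t i + ascb i (swap_at i c) *\<^sub>k 1 else 0) + (if e = c then (- ascb i c) *\<^sub>k 1 else 0)"
  have sc: "swap_at i c \<in> colorings" by (rule swap_at_colorings[OF c i])
  have "(\<Sum>e\<in>colorings. ?h e * wt e) = (\<Sum>e\<in>colorings. (if e = swap_at i c then t i * wt e + ascb i (swap_at i c) *\<^sub>k wt e else 0)
      + (if e = c then (- ascb i c) *\<^sub>k wt e else 0))"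
    by (intro sum.cong) (auto simp: algebra_simps)
  also have "\<dots> = t i * wt (swap_at i c) + ascb i (swap_at i c) *\<^sub>k wt (swap_at i c) - ascb i c *\<^sub>k wt c"
    using finite_colorings c sc by (simp add: sum.distrib formal.scale_minus_left)
  finally have "wt c * t i \<asymp> (\<Sum>e\<in>colorings. ?h e * wt e)" using wt_t[OF i c] by simp
  then have "mat_entry D (t i) c d = ev D base_col (?h d)"
    by (intro mat_entry_eq) (use d i in auto)
  then show ?thesis by simp
qed

text \<open>Triangular matrices are closed under products and their diagonals multiply, so
  generators suffice. For T_i between different colors, the coefficient of the swapped coloring is
  nonzero only when the swap lowers the energy, and the diagonal entry is -1 exactly on
  \<open>induced_des D c\<close>.\<close>

lemma mat_entry_triangular:
  assumes "p \<in> FC"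
  shows "\<forall>c\<in>colorings. \<forall>d\<in>colorings. (mat_entry D p c d \<noteq> 0 \<longrightarrow> d = c \<or> energy D d < energy D c) \<and>
    mat_entry D p c c = ev (induced_des D c) c p"
proof -
  define Q where "Q p \<longleftrightarrow> p \<in> FC \<and> (\<forall>c\<in>colorings. \<forall>d\<in>colorings. (mat_entry D p c d \<noteq> 0 \<longrightarrow> d = c \<or> energy D d < energy D c) \<and>
    mat_entry D p c c = ev (induced_des D c) c p)" for p
  have add: "Q (p + p')" if "Q p" "Q p'" for p p'
    using that unfolding Q_def by (auto simp: mat_entry_add) (metis add.right_neutral)+
  have scale: "Q (k *\<^sub>k p)" if "Q p" for k p
    using that unfolding Q_def by (auto simp: mat_entry_cscale)
  have mult: "Q (p * s)" if p: "Q p" and s: "Q s" for p s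
    unfolding Q_def
  proof (intro conjI ballI impI)
    have F: "p \<in> FC" "s \<in> FC" using p s by (auto simp: Q_def)
    then show "p * s \<in> FC" by simp
    fix c d assume c: "c \<in> colorings" and d: "d \<in> colorings"
    show "d = c \<or> energy D d < energy D c" if nz: "mat_entry D (p * s) c d \<noteq> 0"
    proof -
      obtain e where e: "e \<in> colorings" "mat_entry D p c e * mat_entry D s e d \<noteq> 0"
        using nz unfolding mat_entry_mult[OF F d] by (rule sum.not_neutral_contains_not_neutral)
      then have "mat_entry D p c e \<noteq> 0" "mat_entry D s e d \<noteq> 0" by auto
      then have "e = c \<or> energy D e < energy D c" "d = e \<or> energy D d < energy D e"
        using p s c d e(1) unfolding Q_def by blast+
      then show ?thesis by auto
    qed
    \<comment> \<open>A nonzero term with \<open>e\<close> different from \<open>c\<close> would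
      make the energy drop from \<open>c\<close> to \<open>e\<close> and again from \<open>e\<close>
      to \<open>c\<close>.\<close>
    have "mat_entry D p c e * mat_entry D s e c = (if e = c then mat_entry D p c c * mat_entry D s c c else 0)"
      if e: "e \<in> colorings" for e
    proof (cases "e = c")
      case False
      have "mat_entry D p c e = 0 \<or> mat_entry D s e c = 0"
      proof (rule ccontr)
        assume "\<not> ?thesis"
        then have "mat_entry D p c e \<noteq> 0" "mat_entry D s e c \<noteq> 0" by auto
        then have "e = c \<or> energy D e < energy D c" "c = e \<or> energy D c < energy D e"
          using p s c e unfolding Q_def by blast+
        then show False using False by auto
      qed
      then show ?thesis using False by auto
    qed simp
    then have "mat_entry D (p * s) c c = (\<Sum>e\<in>colorings. if e = c then mat_entry D p c c * mat_entry D s c c else 0)"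
      unfolding mat_entry_mult[OF F c] by (rule sum.cong[OF refl])
    also have "\<dots> = mat_entry D p c c * mat_entry D s c c" using finite_colorings c by simp
    also have "mat_entry D p c c = ev (induced_des D c) c p" using p c unfolding Q_def by blast
    also have "mat_entry D s c c = ev (induced_des D c) c s" using s c unfolding Q_def by blast
    finally show "mat_entry D (p * s) c c = ev (induced_des D c) c (p * s)" by simp
  qed
  have Qt: "Q (t i)" if i: "1 \<le> i" "i < n" for i
    unfolding Q_def
  proof (intro conjI ballI impI)
    show "t i \<in> FC" using i by simp
    fix c d assume c: "c \<in> colorings" and d: "d \<in> colorings"
    show "d = c \<or> energy D d < energy D c" if nz: "mat_entry D (t i) c d \<noteq> 0"
    proof (cases "d = c")
      case False
      then have ds: "d = swap_at i c" and nz': "(if i \<in> D then -1 else 0) + ascb i (swap_at i c) \<noteq> 0"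
        using nz unfolding mat_entry_t[OF c d i] by (auto split: if_splits)
      have "c i \<noteq> c (Suc i)" using False ds by (auto simp: swap_at_def)
      then have "(if i \<in> D then -1 else 1) * (int (c (Suc i)) - int (c i)) < 0"
        using nz' by (auto simp: ascb_def split: if_splits)
      then show ?thesis using energy_swap[OF i, of D c] ds by simp
    qed simp
    have sw: "c = swap_at i c \<longleftrightarrow> c i = c (Suc i)"
    proof
      assume "c = swap_at i c"
      then have "c i = swap_at i c i" by (rule arg_cong)
      then show "c i = c (Suc i)" by simp
    next
      assume "c i = c (Suc i)"
      then show "c = swap_at i c" by (intro ext) (simp add: swap_at_def)
    qed
    show "mat_entry D (t i) c c = ev (induced_des D c) c (t i)"
      unfolding mat_entry_t[OF c c i] sw using i
      by (cases "c i" "c (Suc i)" rule: linorder_cases) (simp_all add: induced_des_def ascb_def)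
  qed
  have Qx: "Q (x j)" if "1 \<le> j" "j \<le> n" for j
    using that unfolding Q_def by (auto simp: mat_entry_x split: if_splits)
  have Q1: "Q 1" unfolding Q_def by (auto simp: mat_entry_one split: if_splits)
  have "Q p"
    using assms[unfolded FC_def]
  proof (induction p rule: words_induct)
    case zero
    show ?case using scale[OF Q1, of 0] by simp
  next
    case (letter a p)
    then have "Q (letter a)" using Qt Qx by auto
    then show ?case using letter by (intro mult)
  qed (use Q1 add scale in blast)+
  then show ?thesis unfolding Q_def by blast
qed

text \<open>The trace over H_n(0) adds up the diagonal entries of the coinduced matrices of the
  entries of the idempotent. By triangularity these are characters of the whole algebra, and for
  fixed \<open>c\<close> their sum over \<open>a\<close> is a trace of \<open>P\<close>.\<close>

theorem mtrace_restrict: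
  assumes "fd_projective AA P"
  shows "HH.mtrace (hchi D) P = (\<Sum>c\<in>colorings. AA.mtrace (chi (induced_des D c) c) P)"
proof -
  obtain k i p where d: "AA.proj_data P k i p" using assms unfolding AA.fd_projective_iff by blast
  have i: "i \<in> lmod_hom AA P (free_lmod AA k)" and p: "p \<in> lmod_hom AA (free_lmod AA k) P"
    using d by (auto simp: AA.proj_data_def)
  obtain k' i' p' where d': "HH.proj_data P k' i' p'" and tr: "\<And>\<chi>. HH.data_trace \<chi> k' i' p'
    = (\<Sum>a<k. \<Sum>c\<in>colorings. \<chi> (psi (q (wt c) \<otimes>\<^bsub>AA\<^esub> i (p (unit_vec AA k a)) a) c))"
    using HH_proj_data[OF d] by blast
  have "HH.mtrace (hchi D) P = (\<Sum>a<k. \<Sum>c\<in>colorings. hchi D (psi (q (wt c) \<otimes>\<^bsub>AA\<^esub> i (p (unit_vec AA k a)) a) c))"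
    unfolding HH.mtrace_eq[OF HH_character[OF chi_character[OF compat_base]] d'] tr ..
  also have "\<dots> = (\<Sum>a<k. \<Sum>c\<in>colorings. chi (induced_des D c) c (i (p (unit_vec AA k a)) a))"
  proof (intro sum.cong refl)
    fix a c assume a: "a \<in> {..<k}" and c: "c \<in> colorings"
    have "i (p (unit_vec AA k a)) a \<in> carrier AA"
      using a by (intro free_lmod_closed[OF lmod_homD(1)[OF i lmod_homD(1)[OF p AA.unit_vec_closed]]]) simp
    then obtain s where s: "s \<in> FC" "i (p (unit_vec AA k a)) a = q s" by (auto simp: AA_carrier)
    have "hchi D (psi (q (wt c) \<otimes>\<^bsub>AA\<^esub> q s) c) = mat_entry D s c c" using s by (simp add: AA_simps mat_entry_def)
    also have "\<dots> = chi (induced_des D c) c (q s)"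
      using mat_entry_triangular[OF s(1)] c chi_q[OF compat_induced[OF c] s(1)] by simp
    finally show "hchi D (psi (q (wt c) \<otimes>\<^bsub>AA\<^esub> i (p (unit_vec AA k a)) a) c)
        = chi (induced_des D c) c (i (p (unit_vec AA k a)) a)" using s(2) by simp
  qed
  also have "\<dots> = (\<Sum>c\<in>colorings. \<Sum>a<k. chi (induced_des D c) c (i (p (unit_vec AA k a)) a))"
    by (rule sum.swap)
  also have "\<dots> = (\<Sum>c\<in>colorings. AA.mtrace (chi (induced_des D c) c) P)"
    by (intro sum.cong refl) (simp add: AA.mtrace_eq[OF chi_character[OF compat_induced] d] AA.data_trace_def)
  finally show ?thesis .
qed

end

subsection \<open>Eigenfunctionals\<close>

text \<open>Operators satisfying the relations of \<open>H\<^sub>n(0)\<close> have a common eigenfunctional. In the induction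
  step an eigenfunctional \<open>g\<close> of the first \<open>m - 1\<close> operators is replaced by the last nonzero one among
  \<open>g\<close>, \<open>g \<rho>\<^sub>m\<close>, \<open>g \<rho>\<^sub>m \<rho>\<^sub>m\<^sub>-\<^sub>1\<close>, \<open>\<dots>\<close>, \<open>g \<rho>\<^sub>m \<dots> \<rho>\<^sub>1\<close>.\<close>

lemma hecke_eigenfunctional:
  fixes \<rho> :: "nat \<Rightarrow> 'v \<Rightarrow> 'v" and V :: "'v set" and G :: "('v \<Rightarrow> complex) set"
  assumes closed: "\<And>i x. 1 \<le> i \<Longrightarrow> i < n \<Longrightarrow> x \<in> V \<Longrightarrow> \<rho> i x \<in> V"
    and quad: "\<And>g i x. g \<in> G \<Longrightarrow> 1 \<le> i \<Longrightarrow> i < n \<Longrightarrow> x \<in> V \<Longrightarrow> g (\<rho> i (\<rho> i x)) = - g (\<rho> i x)"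
    and braid: "\<And>i x. 1 \<le> i \<Longrightarrow> Suc i < n \<Longrightarrow> x \<in> V \<Longrightarrow>
      \<rho> i (\<rho> (Suc i) (\<rho> i x)) = \<rho> (Suc i) (\<rho> i (\<rho> (Suc i) x))"
    and comm: "\<And>i j x. 1 \<le> i \<Longrightarrow> i + 2 \<le> j \<Longrightarrow> j < n \<Longrightarrow> x \<in> V \<Longrightarrow> \<rho> i (\<rho> j x) = \<rho> j (\<rho> i x)"
    and G: "\<And>g i. g \<in> G \<Longrightarrow> 1 \<le> i \<Longrightarrow> i < n \<Longrightarrow> (\<lambda>x. g (\<rho> i x)) \<in> G"
    and ex: "g0 \<in> G" "x0 \<in> V" "g0 x0 \<noteq> 0"
  shows "\<exists>g\<in>G. \<exists>D. (\<exists>x\<in>V. g x \<noteq> 0) \<and>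
    (\<forall>i\<in>{1..<n}. \<forall>x\<in>V. g (\<rho> i x) = (if i \<in> D then -1 else 0) * g x)"
proof -
  have "\<exists>g\<in>G. \<exists>D. (\<exists>x\<in>V. g x \<noteq> 0) \<and>
      (\<forall>i\<in>{1..<m}. \<forall>x\<in>V. g (\<rho> i x) = (if i \<in> D then -1 else 0) * g x)" if "m \<le> n" for m
    using that
  proof (induction m)
    case 0
    then show ?case using ex by auto
  next
    case (Suc m)
    then have "m \<le> n" by simp
    from Suc.IH[OF this] obtain g D where g: "g \<in> G" "\<exists>x\<in>V. g x \<noteq> 0"
      and eig': "\<forall>i\<in>{1..<m}. \<forall>x\<in>V. g (\<rho> i x) = (if i \<in> D then -1 else 0) * g x"
      by blast
    have eig: "g (\<rho> i x) = (if i \<in> D then -1 else 0) * g x" if "1 \<le> i" "i < m" "x \<in> V" for i x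
      using eig' that by auto
    note mn = Suc.prems
    show ?case
    proof (cases "m = 0")
      case True
      then show ?thesis using g by auto
    next
      case False
      \<comment> \<open>\<open>W k\<close> is the composition of the operators with indices
        \<open>m\<close>, \<open>m - 1\<close>, ..., \<open>m - k + 1\<close>, with index
        \<open>m\<close> applied last.\<close>
      define W where "W k = rec_nat (\<lambda>x. x) (\<lambda>k f x. f (\<rho> (m - k) x)) k" for k
      have W_0: "W 0 x = x" and W_Suc: "W (Suc k) x = W k (\<rho> (m - k) x)" for k x by (simp_all add: W_def)
      have W_closed: "W k x \<in> V" if "k \<le> m" "x \<in> V" for k x
        using that
      proof (induction k arbitrary: x)
        case (Suc k)
        then show ?case using Suc.prems mn unfolding W_Suc by (intro Suc.IH closed) auto
      qed (simp add: W_0)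
      have W_comm: "W k (\<rho> i x) = \<rho> i (W k x)" if "1 \<le> i" "i + k < m" "x \<in> V" for k i x
        using that
      proof (induction k arbitrary: x)
        case (Suc k)
        have "\<rho> (m - k) (\<rho> i x) = \<rho> i (\<rho> (m - k) x)"
          using Suc.prems mn by (intro comm[symmetric]) auto
        then show ?case unfolding W_Suc using Suc.prems mn by (simp add: Suc.IH closed)
      qed (simp add: W_0)
      \<comment> \<open>The operator of index \<open>i\<close> commutes with the factors it meets
        until it reaches the one of index \<open>i - 1\<close>. The braid relation with the factor
        of index \<open>i\<close> turns it into the operator of index \<open>i - 1\<close>, which
        commutes with the rest.\<close>
      have W_shift: "W k (\<rho> i x) = \<rho> (i - 1) (W k x)" if "m + 1 < i + k" "i \<le> m" "k \<le> m" "x \<in> V" for k i x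
        using that
      proof (induction k arbitrary: x)
        case (Suc k)
        show ?case
        proof (cases "m + 1 < i + k")
          case True
          have "\<rho> (m - k) (\<rho> i x) = \<rho> i (\<rho> (m - k) x)"
            using Suc.prems True mn by (intro comm) auto
          then show ?thesis unfolding W_Suc using Suc.prems True mn by (simp add: Suc.IH closed)
        next
          case False
          then have i: "i = Suc (m - k)" and "k \<noteq> 0" using Suc.prems by auto
          then obtain l where l: "k = Suc l" by (cases k) auto
          have il: "m - l = i" "m - k = i - 1" "Suc (i - 1) = i" "1 \<le> i - 1" using i l Suc.prems by auto
          have x: "x \<in> V" "\<rho> (i - 1) x \<in> V" "\<rho> i (\<rho> (i - 1) x) \<in> V" 
            using Suc.prems il mn by (auto intro!: closed)
          have "W (Suc k) (\<rho> i x) = W l (\<rho> i (\<rho> (i - 1) (\<rho> i x)))" by (simp add: W_Suc l il del: One_nat_def) (use il l in simp)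
          also have "\<rho> i (\<rho> (i - 1) (\<rho> i x)) = \<rho> (i - 1) (\<rho> i (\<rho> (i - 1) x))"
            using braid[of "i - 1" x] il Suc.prems mn by auto
          also have "W l (\<rho> (i - 1) (\<rho> i (\<rho> (i - 1) x))) = \<rho> (i - 1) (W l (\<rho> i (\<rho> (i - 1) x)))"
            using il l Suc.prems i by (intro W_comm x) auto
          also have "W l (\<rho> i (\<rho> (i - 1) x)) = W (Suc k) x" by (simp add: W_Suc l il del: One_nat_def) (use il l in simp)
          finally show ?thesis .
        qed
      qed simp
      have W_G: "(\<lambda>x. g (W k x)) \<in> G" if "k \<le> m" for k
        using that
      proof (induction k)
        case (Suc k)
        then have "(\<lambda>x. g (W k x)) \<in> G" by simp
        from G[OF this, of "m - k"] show ?case unfolding W_Suc using Suc.prems mn by auto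
      qed (simp add: W_0 g)
      define k where "k = (GREATEST k. k \<le> m \<and> (\<exists>x\<in>V. g (W k x) \<noteq> 0))"
      have k0: "0 \<le> m \<and> (\<exists>x\<in>V. g (W 0 x) \<noteq> 0)" using g by (simp add: W_0)
      have k: "k \<le> m" "\<exists>x\<in>V. g (W k x) \<noteq> 0"
        using GreatestI_nat[of "\<lambda>k. k \<le> m \<and> (\<exists>x\<in>V. g (W k x) \<noteq> 0)", OF k0, of m] unfolding k_def by auto
      have max: "g (W (Suc k) x) = 0" if "Suc k \<le> m" "x \<in> V" for x
      proof (rule ccontr)
        assume "g (W (Suc k) x) \<noteq> 0"
        then have "Suc k \<le> m \<and> (\<exists>x\<in>V. g (W (Suc k) x) \<noteq> 0)" using that by blast
        then have "Suc k \<le> k"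
          using Greatest_le_nat[of "\<lambda>k. k \<le> m \<and> (\<exists>x\<in>V. g (W k x) \<noteq> 0)" "Suc k" m] by (simp only: k_def[symmetric])
        then show False by simp
      qed
      \<comment> \<open>Below \<open>m - k\<close> the operators commute with \<open>W k\<close>, so
        the old eigenvalue stays; at \<open>m - k\<close> the value is 0 because \<open>k\<close> is
        maximal; at \<open>m - k + 1\<close> the quadratic relation gives -1; above that the index
        is lowered by one, and with it the old eigenvalue is moved.\<close>
      define D' where "D' = {i. (i + k < m \<and> i \<in> D) \<or> i + k = m + 1 \<or> (m + 1 < i + k \<and> i - 1 \<in> D)}"
      have "g (W k (\<rho> i x)) = (if i \<in> D' then -1 else 0) * g (W k x)" if i: "1 \<le> i" "i \<le> m" and x: "x \<in> V" for i x
      proof -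
        consider "i + k < m" | "i + k = m" | "i + k = m + 1" | "m + 1 < i + k" by linarith
        then show ?thesis
        proof cases
          case 1
          then show ?thesis using W_comm[OF i(1) 1 x] eig[OF i(1) _ W_closed[OF k(1) x]] by (auto simp: D'_def)
        next
          case 2
          then have "m - k = i" by simp
          then have "g (W k (\<rho> i x)) = 0" using max[OF _ x] 2 i by (simp add: W_Suc)
          then show ?thesis using 2 by (simp add: D'_def)
        next
          case 3
          then obtain l where l: "k = Suc l" using i by (cases k) auto
          have il: "m - l = i" using 3 l by simp
          have "(\<lambda>x. g (W l x)) \<in> G" using W_G[of l] k(1) l by simp
          from quad[OF this i(1) _ x] have "g (W k (\<rho> i x)) = - g (W k x)"
            unfolding l W_Suc il using i mn by simp
          then show ?thesis using 3 by (simp add: D'_def)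
        next
          case 4
          have "1 \<le> i - 1" "i - 1 < m" using 4 k(1) i by auto
          then show ?thesis using W_shift[OF 4 i(2) k(1) x] eig[OF _ _ W_closed[OF k(1) x], of "i - 1"] 4
            by (auto simp: D'_def)
        qed
      qed
      then show ?thesis using W_G[OF k(1)] k(2) by (intro bexI[of _ "\<lambda>x. g (W k x)"] exI[of _ D']) auto
    qed
  qed
  from this[OF order_refl] show ?thesis .
qed

context aks_algebra
begin

definition lin_functional :: "((gen list \<Rightarrow>\<^sub>0 complex) set, 'v) module \<Rightarrow> ('v \<Rightarrow> complex) \<Rightarrow> bool"
  where "lin_functional M g \<longleftrightarrow> (\<forall>x\<in>carrier M. \<forall>y\<in>carrier M. g (x \<oplus>\<^bsub>M\<^esub> y) = g x + g y) \<and>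
    (\<forall>z. \<forall>x\<in>carrier M. g (q (z *\<^sub>k 1) \<odot>\<^bsub>M\<^esub> x) = z * g x)"

lemma lin_functionalD:
  assumes "lin_functional M g"
  shows "v \<in> carrier M \<Longrightarrow> w \<in> carrier M \<Longrightarrow> g (v \<oplus>\<^bsub>M\<^esub> w) = g v + g w"
    "v \<in> carrier M \<Longrightarrow> g (q (z *\<^sub>k 1) \<odot>\<^bsub>M\<^esub> v) = z * g v"
  using assms by (auto simp: lin_functional_def)

text \<open>A nonzero element of a projective module has a nonzero coordinate in the free module,
  and a functional on the algebra separates this coordinate from zero.\<close>

lemma lin_functional_exists:
  assumes M: "fd_projective HH M" and ne: "carrier M \<noteq> {\<zero>\<^bsub>M\<^esub>}"
  shows "\<exists>g. lin_functional M g \<and> (\<exists>x\<in>carrier M. g x \<noteq> 0)"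
proof -
  obtain k i p where "HH.proj_data M k i p" using M unfolding HH.fd_projective_iff by blast
  then have lM: "left_module HH M" and i: "i \<in> lmod_hom HH M (free_lmod HH k)"
    and p: "p \<in> lmod_hom HH (free_lmod HH k) M" and ip: "\<And>x. x \<in> carrier M \<Longrightarrow> p (i x) = x"
    by (auto simp: HH.proj_data_def)
  interpret M: left_module HH M by (rule lM)
  interpret FH: left_module HH "free_lmod HH k" by (rule free_lmod_left_module) (rule HH_ring)
  obtain x0 where x0: "x0 \<in> carrier M" "x0 \<noteq> \<zero>\<^bsub>M\<^esub>" using ne M.M.zero_closed by blast
  have ic: "i x b \<in> carrier AA" if "x \<in> carrier M" "b < k" for x b
    by (rule HH_subset[OF free_lmod_closed[OF lmod_homD(1)[OF i that(1)] that(2)]])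
  have "\<exists>b<k. i x0 b \<noteq> \<zero>\<^bsub>AA\<^esub>"
  proof (rule ccontr)
    assume "\<not> ?thesis"
    then have "i x0 b = \<zero>\<^bsub>free_lmod HH k\<^esub> b" if "b < k" for b using that by (simp add: free_lmod_apply)
    then have "i x0 = \<zero>\<^bsub>free_lmod HH k\<^esub>"
      by (intro free_lmod_eqI[OF lmod_homD(1)[OF i x0(1)] FH.M.zero_closed])
    then show False using ip[OF x0(1)] lmod_hom_zero[OF FH.left_module_axioms lM p] x0(2) by simp
  qed
  then obtain b where b: "b < k" "i x0 b \<noteq> \<zero>\<^bsub>AA\<^esub>" by blast
  obtain y where y: "y \<in> FC" "i x0 b = q y" using ic[OF x0(1) b(1)] by (auto simp: AA_carrier)
  have "y \<notin> J" using b(2) y by (auto simp: AA_zero q_eq_iff cong_def)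
  then obtain \<phi> :: "(gen list \<Rightarrow>\<^sub>0 complex) \<Rightarrow> complex" where \<phi>: "\<And>a b. \<phi> (a + b) = \<phi> a + \<phi> b"
    "\<And>k a. \<phi> (k *\<^sub>k a) = k * \<phi> a" "\<And>a. a \<in> J \<Longrightarrow> \<phi> a = 0" "\<phi> y \<noteq> 0"
    using separating_functional by blast
  define \<psi> where "\<psi> a = \<phi> (SOME p. p \<in> FC \<and> q p = a)" for a
  have \<psi>: "\<psi> (q p) = \<phi> p" if p: "p \<in> FC" for p
  proof -
    define p' where "p' = (SOME p'. p' \<in> FC \<and> q p' = q p)"
    have "p' \<in> FC \<and> q p' = q p"
      unfolding p'_def by (rule someI[of "\<lambda>p'. p' \<in> FC \<and> q p' = q p" p]) (use p in simp)
    then have "p' \<asymp> p" using p q_eq_iff by blast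
    then have "\<phi> (p' - p) = 0" unfolding cong_def by (rule \<phi>(3))
    then have "\<phi> p' = \<phi> p" using \<phi>(1)[of "p' - p" p] by simp
    then show ?thesis by (simp add: \<psi>_def p'_def)
  qed
  define g where "g x = \<psi> (i x b)" for x
  have "g (x \<oplus>\<^bsub>M\<^esub> y) = g x + g y" if xy: "x \<in> carrier M" "y \<in> carrier M" for x y
  proof -
    obtain a a' where "a \<in> FC" "i x b = q a" "a' \<in> FC" "i y b = q a'"
      using ic[OF xy(1) b(1)] ic[OF xy(2) b(1)] by (auto simp: AA_carrier)
    then show ?thesis
      using \<phi>(1) by (simp add: g_def lmod_homD(2)[OF i xy] free_lmod_apply[OF b(1)] AA_simps \<psi>)
  qed
  moreover have "g (q (z *\<^sub>k 1) \<odot>\<^bsub>M\<^esub> x) = z * g x" if x: "x \<in> carrier M" for x z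
  proof -
    obtain a where "a \<in> FC" "i x b = q a" using ic[OF x b(1)] by (auto simp: AA_carrier)
    moreover have "q (z *\<^sub>k 1) \<in> carrier HH" by (simp add: HH_carrier)
    ultimately show ?thesis
      using \<phi>(2) by (simp add: g_def lmod_homD(3)[OF i _ x] free_lmod_apply[OF b(1)] AA_simps \<psi>)
  qed
  moreover have "g x0 \<noteq> 0" using y \<phi>(4) by (simp add: g_def \<psi>)
  ultimately show ?thesis using x0(1) unfolding lin_functional_def by blast
qed

lemma q_t_HH: "1 \<le> i \<Longrightarrow> i < n \<Longrightarrow> q (t i) \<in> carrier HH"
  by (simp add: HH_carrier)

lemma hecke_eigen:
  assumes M: "fd_projective HH M" and ne: "carrier M \<noteq> {\<zero>\<^bsub>M\<^esub>}"
  obtains g D where "lin_functional M g" "\<exists>x\<in>carrier M. g x \<noteq> 0"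
    "\<And>i x. 1 \<le> i \<Longrightarrow> i < n \<Longrightarrow> x \<in> carrier M \<Longrightarrow> g (q (t i) \<odot>\<^bsub>M\<^esub> x) = (if i \<in> D then -1 else 0) * g x"
proof -
  interpret M: left_module HH M using M by (simp add: fd_projective_def)
  obtain g0 x0 where g0: "lin_functional M g0" "x0 \<in> carrier M" "g0 x0 \<noteq> 0"
    using lin_functional_exists[OF assms] by blast
  have assoc: "q p \<odot>\<^bsub>M\<^esub> (q p' \<odot>\<^bsub>M\<^esub> x) = q (p * p') \<odot>\<^bsub>M\<^esub> x"
    if "p \<in> FT" "p' \<in> FT" "x \<in> carrier M" for p p' x
    using M.smult_assoc[of "q p" "q p'" x] that by (simp add: HH_carrier AA_simps FT_FC)
  have smult: "q p \<odot>\<^bsub>M\<^esub> x \<in> carrier M" if "p \<in> FT" "x \<in> carrier M" for p x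
    using M.smult_closed[of "q p" x] that by (simp add: HH_carrier)
  have "\<exists>g\<in>Collect (lin_functional M). \<exists>D. (\<exists>x\<in>carrier M. g x \<noteq> 0) \<and>
    (\<forall>i\<in>{1..<n}. \<forall>x\<in>carrier M. g (q (t i) \<odot>\<^bsub>M\<^esub> x) = (if i \<in> D then -1 else 0) * g x)"
  proof (rule hecke_eigenfunctional[where \<rho> = "\<lambda>i x. q (t i) \<odot>\<^bsub>M\<^esub> x"])
    show "q (t i) \<odot>\<^bsub>M\<^esub> x \<in> carrier M" if "1 \<le> i" "i < n" "x \<in> carrier M" for i x
      using that by (simp add: smult)
    show "g (q (t i) \<odot>\<^bsub>M\<^esub> (q (t i) \<odot>\<^bsub>M\<^esub> x)) = - g (q (t i) \<odot>\<^bsub>M\<^esub> x)"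
      if g: "g \<in> Collect (lin_functional M)" and i: "1 \<le> i" "i < n" and x: "x \<in> carrier M" for g i x
    proof -
      have "q (t i * t i) = q ((-1) *\<^sub>k 1 * t i)"
        using rel_quad[OF i] i by (subst q_eq_iff) (auto simp: formal.scale_minus_left)
      then have "q (t i) \<odot>\<^bsub>M\<^esub> (q (t i) \<odot>\<^bsub>M\<^esub> x) = q ((-1) *\<^sub>k 1) \<odot>\<^bsub>M\<^esub> (q (t i) \<odot>\<^bsub>M\<^esub> x)"
        using i x by (simp only: assoc FT_t FT_cscale FT_one)
      then show ?thesis using g lin_functionalD(2)[of M g "q (t i) \<odot>\<^bsub>M\<^esub> x" "-1"] smult[of "t i" x] i x by simp
    qed
    show "q (t i) \<odot>\<^bsub>M\<^esub> (q (t (Suc i)) \<odot>\<^bsub>M\<^esub> (q (t i) \<odot>\<^bsub>M\<^esub> x))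
        = q (t (Suc i)) \<odot>\<^bsub>M\<^esub> (q (t i) \<odot>\<^bsub>M\<^esub> (q (t (Suc i)) \<odot>\<^bsub>M\<^esub> x))"
      if i: "1 \<le> i" "Suc i < n" and x: "x \<in> carrier M" for i x
    proof -
      have "q (t i * (t (Suc i) * t i)) = q (t (Suc i) * (t i * t (Suc i)))"
        using rel_braid[OF i] i by (subst q_eq_iff) (auto simp: mult.assoc)
      then show ?thesis using i x by (simp add: assoc)
    qed
    show "q (t i) \<odot>\<^bsub>M\<^esub> (q (t j) \<odot>\<^bsub>M\<^esub> x) = q (t j) \<odot>\<^bsub>M\<^esub> (q (t i) \<odot>\<^bsub>M\<^esub> x)"
      if i: "1 \<le> i" "i + 2 \<le> j" "j < n" and x: "x \<in> carrier M" for i j x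
    proof -
      have "q (t i * t j) = q (t j * t i)"
        using rel_comm[of i j] i by (subst q_eq_iff) auto
      then show ?thesis using i x by (simp add: assoc)
    qed
    show "(\<lambda>x. g (q (t i) \<odot>\<^bsub>M\<^esub> x)) \<in> Collect (lin_functional M)"
      if g: "g \<in> Collect (lin_functional M)" and i: "1 \<le> i" "i < n" for g i
    proof -
      have "q (t i) \<odot>\<^bsub>M\<^esub> (q (z *\<^sub>k 1) \<odot>\<^bsub>M\<^esub> x) = q (z *\<^sub>k 1) \<odot>\<^bsub>M\<^esub> (q (t i) \<odot>\<^bsub>M\<^esub> x)" if "x \<in> carrier M" for z x
        using that i by (simp add: assoc)
      then show ?thesis using g i smult
        by (simp add: lin_functional_def M.smult_r_distr[OF q_t_HH[OF i]])
    qed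
  qed (use g0 in auto)
  then obtain g D where "lin_functional M g" "\<exists>x\<in>carrier M. g x \<noteq> 0"
    "\<forall>i\<in>{1..<n}. \<forall>x\<in>carrier M. g (q (t i) \<odot>\<^bsub>M\<^esub> x) = (if i \<in> D then -1 else 0) * g x" by blast
  then show thesis by (intro that[of g D]) auto
qed

section \<open>Extending eigenvalue equations from generators to either algebra\<close>

context
  fixes B :: "(complex, (gen list \<Rightarrow>\<^sub>0 complex) set) module" and M :: "((gen list \<Rightarrow>\<^sub>0 complex) set, 'v) module"
    and Gs :: "gen set"
  assumes M: "left_module B M" and B_carrier: "carrier B = q ` words Gs" and Gs: "words Gs \<subseteq> FC"
    and B_ops: "ring.add B = ring.add AA" "monoid.mult B = monoid.mult AA" "monoid.one B = monoid.one AA"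
begin

interpretation M: left_module B M by (rule M)

lemma smult_words:
  assumes v: "v \<in> carrier M" and p: "p \<in> words Gs"
  shows "q p \<odot>\<^bsub>M\<^esub> v \<in> carrier M" "q 1 \<odot>\<^bsub>M\<^esub> v = v"
    "p' \<in> words Gs \<Longrightarrow> q (p + p') \<odot>\<^bsub>M\<^esub> v = q p \<odot>\<^bsub>M\<^esub> v \<oplus>\<^bsub>M\<^esub> q p' \<odot>\<^bsub>M\<^esub> v"
    "p' \<in> words Gs \<Longrightarrow> q (p * p') \<odot>\<^bsub>M\<^esub> v = q p \<odot>\<^bsub>M\<^esub> (q p' \<odot>\<^bsub>M\<^esub> v)"
    "q (z *\<^sub>k p) \<odot>\<^bsub>M\<^esub> v = q (z *\<^sub>k 1) \<odot>\<^bsub>M\<^esub> (q p \<odot>\<^bsub>M\<^esub> v)"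
proof -
  have c: "q s \<in> carrier B" if "s \<in> words Gs" for s using that by (simp add: B_carrier)
  show "q p \<odot>\<^bsub>M\<^esub> v \<in> carrier M" by (rule M.smult_closed[OF c[OF p] v])
  show "q 1 \<odot>\<^bsub>M\<^esub> v = v" using M.smult_one[OF v] by (simp add: B_ops AA_one)
  show "q (p + p') \<odot>\<^bsub>M\<^esub> v = q p \<odot>\<^bsub>M\<^esub> v \<oplus>\<^bsub>M\<^esub> q p' \<odot>\<^bsub>M\<^esub> v" if p': "p' \<in> words Gs"
    using M.smult_l_distr[OF c[OF p] c[OF p'] v] p p' Gs by (simp add: B_ops AA_simps subsetD)
  have *: "q (s * p') \<odot>\<^bsub>M\<^esub> v = q s \<odot>\<^bsub>M\<^esub> (q p' \<odot>\<^bsub>M\<^esub> v)" if s: "s \<in> words Gs" and p': "p' \<in> words Gs" for s p'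
    using M.smult_assoc[OF c[OF s] c[OF p'] v] s p' Gs by (simp add: B_ops AA_simps subsetD)
  show "p' \<in> words Gs \<Longrightarrow> q (p * p') \<odot>\<^bsub>M\<^esub> v = q p \<odot>\<^bsub>M\<^esub> (q p' \<odot>\<^bsub>M\<^esub> v)" by (rule *[OF p])
  show "q (z *\<^sub>k p) \<odot>\<^bsub>M\<^esub> v = q (z *\<^sub>k 1) \<odot>\<^bsub>M\<^esub> (q p \<odot>\<^bsub>M\<^esub> v)"
    using *[OF words_cscale[OF words_one] p, of z] by simp
qed

lemma functional_ev:
  assumes g: "lin_functional M g" and p: "p \<in> words Gs"
    and gens: "\<And>a v. a \<in> Gs \<Longrightarrow> v \<in> carrier M \<Longrightarrow> g (q (letter a) \<odot>\<^bsub>M\<^esub> v) = gen_val D c a * g v"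
  shows "v \<in> carrier M \<Longrightarrow> g (q p \<odot>\<^bsub>M\<^esub> v) = ev D c p * g v"
  using p
proof (induction p arbitrary: v rule: words_induct)
  case zero
  then show ?case using lin_functionalD(2)[OF g, of v 0] by simp
next
  case one
  then show ?case by (simp add: smult_words(2)[OF _ words_one])
next
  case (letter a p)
  then show ?case using gens[OF letter(1) smult_words(1)[OF letter(4,2)]] by (simp add: smult_words(4)[OF _ words_letter])
next
  case (add p p')
  then show ?case by (simp add: smult_words(1,3) lin_functionalD(1)[OF g] algebra_simps)
next
  case (scale z p)
  then show ?case using smult_words(1,5)[OF scale(3,1)] by (simp add: lin_functionalD(2)[OF g])
qed

lemma acts_ev:
  assumes p: "p \<in> words Gs"
    and gens: "\<And>a v. a \<in> Gs \<Longrightarrow> v \<in> carrier M \<Longrightarrow> q (letter a) \<odot>\<^bsub>M\<^esub> v = q (gen_val D c a *\<^sub>k 1) \<odot>\<^bsub>M\<^esub> v"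
  shows "v \<in> carrier M \<Longrightarrow> q p \<odot>\<^bsub>M\<^esub> v = q (ev D c p *\<^sub>k 1) \<odot>\<^bsub>M\<^esub> v"
  using p
proof (induction p arbitrary: v rule: words_induct)
  case (letter a p)
  have s: "z *\<^sub>k 1 \<in> words Gs" for z by (simp add: words_cscale words_one)
  have "q (letter a * p) \<odot>\<^bsub>M\<^esub> v = q (gen_val D c a *\<^sub>k 1) \<odot>\<^bsub>M\<^esub> (q (ev D c p *\<^sub>k 1) \<odot>\<^bsub>M\<^esub> v)"
    using letter gens[OF letter(1) smult_words(1)[OF letter(4,2)]] by (simp add: smult_words(4)[OF _ words_letter])
  then show ?case using smult_words(4)[OF letter(4) s s, of "gen_val D c a" "ev D c p"] by (simp add: mult.commute)
next
  case (add p p')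
  have s: "z *\<^sub>k 1 \<in> words Gs" for z by (simp add: words_cscale words_one)
  show ?case using add smult_words(3)[OF add(5) s s, of "ev D c p" "ev D c p'"]
    by (simp add: smult_words(3) formal.scale_left_distrib)
next
  case (scale z p)
  have s: "z *\<^sub>k 1 \<in> words Gs" for z by (simp add: words_cscale words_one)
  show ?case using scale smult_words(5)[OF scale(3,1), of z] smult_words(4)[OF scale(3) s s, of z "ev D c p"] by (simp add: mult.commute)
qed simp_all

end

lemma HH_carrier_words: "carrier HH = q ` words (T ` {1..<n})"
  unfolding HH_carrier FT_def ..

lemma AA_carrier_words: "carrier AA = q ` words (T ` {1..<n} \<union> Xi ` {1..n})"
  unfolding AA_carrier FC_def ..

lemmas HH_words = HH_carrier_words FT_subset[unfolded FT_def] HH_simps(4,1,2)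
lemmas AA_words = AA_carrier_words equalityD2[OF FC_def] refl refl refl

lemma HH_functional_exists:
  assumes M: "fd_projective HH M" and ne: "carrier M \<noteq> {\<zero>\<^bsub>M\<^esub>}"
  shows "\<exists>D g. D \<subseteq> {1..<n} \<and> HH.char_functional (hchi D) M g \<and> (\<exists>x\<in>carrier M. g x \<noteq> 0)"
proof -
  have lM: "left_module HH M" using M by (simp add: fd_projective_def)
  obtain g D where g: "lin_functional M g" "\<exists>x\<in>carrier M. g x \<noteq> 0"
    and eig: "\<And>i x. 1 \<le> i \<Longrightarrow> i < n \<Longrightarrow> x \<in> carrier M \<Longrightarrow> g (q (t i) \<odot>\<^bsub>M\<^esub> x) = (if i \<in> D then -1 else 0) * g x"
    using hecke_eigen[OF assms] by blast
  \<comment> \<open>The intersection discards indices that belong to no generator, so the set is the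
    descent set of a composition.\<close>
  have "HH.char_functional (hchi (D \<inter> {1..<n})) M g"
    unfolding HH.char_functional_def
  proof (intro conjI ballI)
    fix a x assume "a \<in> carrier HH" and x: "x \<in> carrier M"
    then obtain p where p: "p \<in> words (T ` {1..<n})" "a = q p" by (auto simp: HH_carrier_words)
    have "g (q p \<odot>\<^bsub>M\<^esub> x) = ev (D \<inter> {1..<n}) base_col p * g x"
      using eig by (intro functional_ev[OF lM HH_words g(1) p(1) _ x]) auto
    then show "g (a \<odot>\<^bsub>M\<^esub> x) = hchi (D \<inter> {1..<n}) a * g x" using p FT_FC by (simp add: chi_q[OF compat_base] FT_def)
  qed (use g(1) in \<open>simp add: lin_functionalD\<close>)
  then show ?thesis using g(2) by blast
qed

text \<open>Take an eigenfunctional \<open>g\<close> of the T_i and, among the colorings for which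
  \<open>x \<mapsto> g (wt c x)\<close> is nonzero, one of least energy. In \<open>wt_t\<close> the
  term of the swapped coloring has coefficient 0, or it belongs to lower energy and vanishes by
  minimality, so this functional is an eigenfunctional for all generators.\<close>

lemma AA_functional_exists:
  assumes M: "fd_projective AA M" and ne: "carrier M \<noteq> {\<zero>\<^bsub>M\<^esub>}"
  shows "\<exists>D. \<exists>c\<in>colorings. \<exists>g. AA.char_functional (chi (induced_des D c) c) M g \<and> (\<exists>x\<in>carrier M. g x \<noteq> 0)"
proof -
  have lM: "left_module AA M" using M by (simp add: fd_projective_def)
  obtain g D where g: "lin_functional M g" "\<exists>x\<in>carrier M. g x \<noteq> 0"
    and eig: "\<And>i x. 1 \<le> i \<Longrightarrow> i < n \<Longrightarrow> x \<in> carrier M \<Longrightarrow> g (q (t i) \<odot>\<^bsub>M\<^esub> x) = (if i \<in> D then -1 else 0) * g x"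
    using hecke_eigen[OF HH_fd_projective[OF M] ne] by blast
  note sm = smult_words[OF lM AA_words, folded FC_def]
  define h where "h p x = g (q p \<odot>\<^bsub>M\<^esub> x)" for p x
  have h_add: "h (p + p') x = h p x + h p' x" if "p \<in> FC" "p' \<in> FC" "x \<in> carrier M" for p p' x
    unfolding h_def sm(3)[OF that(3,1,2)]
    by (rule lin_functionalD(1)[OF g(1) sm(1)[OF that(3,1)] sm(1)[OF that(3,2)]])
  have h_scale: "h (z *\<^sub>k p) x = z * h p x" if "p \<in> FC" "x \<in> carrier M" for p z x
    unfolding h_def sm(5)[OF that(2,1)] by (rule lin_functionalD(2)[OF g(1) sm(1)[OF that(2,1)]])
  have h_diff: "h (p - p') x = h p x - h p' x" if "p \<in> FC" "p' \<in> FC" "x \<in> carrier M" for p p' x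
    using h_add[of "p - p'" p' x] that by simp
  have h_mult: "h (p * p') x = h p (q p' \<odot>\<^bsub>M\<^esub> x)" if "p \<in> FC" "p' \<in> FC" "x \<in> carrier M" for p p' x
    using that by (simp add: h_def sm(4))
  have h_cong: "h p x = h p' x" if "p \<asymp> p'" "p \<in> FC" "p' \<in> FC" for p p' x
    using that by (simp add: h_def q_eq_iff[symmetric])
  have h_lin: "lin_functional M (h p)" if p: "p \<in> FC" for p
    unfolding lin_functional_def
  proof (intro conjI ballI allI)
    fix x y assume xy: "x \<in> carrier M" "y \<in> carrier M"
    have "q p \<odot>\<^bsub>M\<^esub> (x \<oplus>\<^bsub>M\<^esub> y) = q p \<odot>\<^bsub>M\<^esub> x \<oplus>\<^bsub>M\<^esub> q p \<odot>\<^bsub>M\<^esub> y"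
      using left_module.smult_r_distr[OF lM _ xy, of "q p"] p by (simp add: AA_carrier)
    then show "h p (x \<oplus>\<^bsub>M\<^esub> y) = h p x + h p y" using xy p by (simp add: h_def sm(1) lin_functionalD(1)[OF g(1)])
  next
    fix z x assume x: "x \<in> carrier M"
    have "h p (q (z *\<^sub>k 1) \<odot>\<^bsub>M\<^esub> x) = h (p * z *\<^sub>k 1) x" using p x by (simp only: h_mult FC_cscale FC_one)
    also have "\<dots> = z * h p x" using p x by (simp add: h_scale)
    finally show "h p (q (z *\<^sub>k 1) \<odot>\<^bsub>M\<^esub> x) = z * h p x" .
  qed
  \<comment> \<open>\<open>C\<close> is nonempty because the weight idempotents sum to 1 and
    \<open>g\<close> is nonzero.\<close>
  define C where "C = {c \<in> colorings. \<exists>x\<in>carrier M. h (wt c) x \<noteq> 0}"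
  have "finite C" unfolding C_def using finite_colorings by simp
  moreover have "C \<noteq> {}"
  proof
    assume "C = {}"
    obtain x where x: "x \<in> carrier M" "g x \<noteq> 0" using g(2) by blast
    have "h (\<Sum>c\<in>K. wt c) x = (\<Sum>c\<in>K. h (wt c) x)" if "K \<subseteq> colorings" for K
      using finite_subset[OF that finite_colorings]
    proof (induction K rule: finite_induct)
      case empty
      show ?case using h_scale[of 0 x 0] x(1) by simp
    next
      case (insert c K)
      then show ?case using x(1) by (simp add: h_add)
    qed
    from this[OF order_refl] have "h 1 x = (\<Sum>c\<in>colorings. h (wt c) x)" by (simp add: sum_wt)
    also have "\<dots> = 0" using \<open>C = {}\<close> x(1) by (intro sum.neutral) (auto simp: C_def)
    finally show False using x by (simp add: h_def sm(2)[OF x(1) FC_one])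
  qed
  ultimately obtain c where c: "c \<in> C" "\<And>d. d \<in> C \<Longrightarrow> energy D c \<le> energy D d"
    using arg_min_if_finite[of C "energy D"] by (metis not_le)
  have cC: "c \<in> colorings" and nz: "\<exists>x\<in>carrier M. h (wt c) x \<noteq> 0" using c(1) by (auto simp: C_def)
  have lower: "h (wt d) x = 0" if "d \<in> colorings" "energy D d < energy D c" "x \<in> carrier M" for d x
    using c(2)[of d] that by (auto simp: C_def)
  have "h (wt c) (q (letter a) \<odot>\<^bsub>M\<^esub> x) = gen_val (induced_des D c) c a * h (wt c) x"
    if a: "a \<in> T ` {1..<n} \<union> Xi ` {1..n}" and x: "x \<in> carrier M" for a x
    using a
  proof (elim UnE imageE)
    fix j assume a: "a = Xi j" and "j \<in> {1..n}"
    then have j: "1 \<le> j" "j \<le> n" by auto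
    have "h (wt c) (q (letter (Xi j)) \<odot>\<^bsub>M\<^esub> x) = h (wt c * letter (Xi j)) x" using j x by (simp add: h_mult)
    also have "\<dots> = h (u (c j) *\<^sub>k wt c) x" using j cC by (intro h_cong wt_x) auto
    finally show ?thesis using a x by (simp add: h_scale)
  next
    fix i assume a: "a = T i" and "i \<in> {1..<n}"
    then have i: "1 \<le> i" "i < n" by auto
    let ?s = "swap_at i c"
    have s: "?s \<in> colorings" by (rule swap_at_colorings[OF cC i])
    have ht: "h (t i * wt d) x = (if i \<in> D then -1 else 0) * h (wt d) x" for d
      using eig[OF i sm(1)[OF x FC_wt]] i x by (simp add: h_def sm(4))
    have "h (wt c) (q (t i) \<odot>\<^bsub>M\<^esub> x) = h (wt c * t i) x" using i x by (simp add: h_mult)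
    also have "\<dots> = h (t i * wt ?s + ascb i ?s *\<^sub>k wt ?s - ascb i c *\<^sub>k wt c) x" using i cC by (intro h_cong wt_t) auto
    also have "\<dots> = ((if i \<in> D then -1 else 0) + ascb i ?s) * h (wt ?s) x - ascb i c * h (wt c) x"
      using i x by (simp add: h_diff h_add h_scale ht algebra_simps)
    finally have eq: "h (wt c) (q (t i) \<odot>\<^bsub>M\<^esub> x)
        = ((if i \<in> D then -1 else 0) + ascb i ?s) * h (wt ?s) x - ascb i c * h (wt c) x" .
    consider "c i = c (Suc i)" | "c i < c (Suc i)" | "c (Suc i) < c i" by linarith
    then show ?thesis
    proof cases
      case 1
      then have "?s = c" by (intro ext) (simp add: swap_at_def)
      then show ?thesis using eq 1 a i by (simp add: ascb_def induced_des_def)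
    next
      case 2
      have "i \<in> D \<Longrightarrow> h (wt ?s) x = 0" using energy_swap[OF i, of D c] 2 by (intro lower s x) auto
      then show ?thesis using eq 2 a i by (auto simp: ascb_def induced_des_def)
    next
      case 3
      have "i \<notin> D \<Longrightarrow> h (wt ?s) x = 0" using energy_swap[OF i, of D c] 3 by (intro lower s x) auto
      then show ?thesis using eq 3 a i by (auto simp: ascb_def induced_des_def)
    qed
  qed
  note gens = this
  have "AA.char_functional (chi (induced_des D c) c) M (h (wt c))"
    unfolding AA.char_functional_def
  proof (intro conjI ballI)
    fix a x assume "a \<in> carrier AA" and x: "x \<in> carrier M"
    then obtain p where p: "p \<in> words (T ` {1..<n} \<union> Xi ` {1..n})" "a = q p" by (auto simp: AA_carrier_words)
    have "h (wt c) (q p \<odot>\<^bsub>M\<^esub> x) = ev (induced_des D c) c p * h (wt c) x"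
      by (rule functional_ev[OF lM AA_words h_lin[OF FC_wt] p(1) gens x])
    then show "h (wt c) (a \<odot>\<^bsub>M\<^esub> x) = chi (induced_des D c) c a * h (wt c) x"
      using p by (simp add: chi_q[OF compat_induced[OF cC]] FC_def)
  qed (use h_lin[OF FC_wt] in \<open>simp add: lin_functionalD\<close>)
  then show ?thesis using cC nz by blast
qed

end

subsection \<open>The characteristic maps\<close>

context aks_algebra
begin

definition coloring_of :: "nat list \<Rightarrow> nat \<Rightarrow> nat"
  where "coloring_of c = (\<lambda>j\<in>{1..n}. col c j)"

definition color_word :: "(nat \<Rightarrow> nat) \<Rightarrow> nat list"
  where "color_word c = map c [1..<Suc n]"

lemma col_color_word: "1 \<le> j \<Longrightarrow> j \<le> n \<Longrightarrow> col (color_word c) j = c j"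
  by (simp add: color_word_def col_def nth_append del: upt_Suc)

lemma length_color_word [simp]: "length (color_word c) = n"
  by (simp add: color_word_def)

lemma coloring_of_color_word: "c \<in> colorings \<Longrightarrow> coloring_of (color_word c) = c"
  by (rule ext) (auto simp: colorings_def coloring_of_def col_color_word PiE_def extensional_def)

lemma color_word_coloring_of: "length c = n \<Longrightarrow> color_word (coloring_of c) = c"
  by (rule nth_equalityI) (auto simp: color_word_def coloring_of_def col_def simp del: upt_Suc)

lemma coloring_of_colorings: "length c = n \<Longrightarrow> set c \<subseteq> {1..r} \<Longrightarrow> coloring_of c \<in> colorings"
  unfolding colorings_def coloring_of_def
proof (rule restrict_PiE_iff[THEN iffD2], rule ballI)
  fix j assume "length c = n" "set c \<subseteq> {1..r}" "j \<in> {1..n}"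
  then have "c ! (j - 1) \<in> set c" by (intro nth_mem) auto
  then show "col c j \<in> {1..r}" using \<open>set c \<subseteq> {1..r}\<close> unfolding col_def by blast
qed

lemma anticycloribbonD:
  assumes "anticycloribbon n r (K, c)"
  shows "composition n K" "length c = n" "coloring_of c \<in> colorings" "compat (Des K) (coloring_of c)"
proof -
  show "composition n K" "length c = n" and c: "coloring_of c \<in> colorings"
    using assms coloring_of_colorings by (auto simp: anticycloribbon_def colored_ribbon_def)
  show "compat (Des K) (coloring_of c)"
    unfolding compat_def
  proof (intro conjI ballI c impI)
    fix j assume j: "j \<in> {1..<n}"
    then have "if j \<in> Des K then col c j \<le> col c (j + 1) else col c (j + 1) \<le> col c j"
      using assms unfolding anticycloribbon_def split_conv by blast
    then show "coloring_of c j < coloring_of c (Suc j) \<Longrightarrow> j \<in> Des K"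
      "coloring_of c (Suc j) < coloring_of c j \<Longrightarrow> j \<notin> Des K"
      using j by (auto simp: coloring_of_def split: if_splits)
  qed
qed

lemma induced_anticycloribbon:
  assumes c: "c \<in> colorings" and K: "composition n K" "Des K = induced_des D c"
  shows "anticycloribbon n r (K, color_word c)"
  unfolding anticycloribbon_def colored_ribbon_def
proof (clarsimp simp: K(1), intro conjI)
  show "set (color_word c) \<subseteq> {Suc 0..r}" using coloringsD[OF c] by (auto simp: color_word_def simp del: upt_Suc)
  show "\<forall>j\<in>{Suc 0..<n}. (j \<in> Des K \<longrightarrow> col (color_word c) j \<le> col (color_word c) (Suc j)) \<and>
      (j \<notin> Des K \<longrightarrow> col (color_word c) (Suc j) \<le> col (color_word c) j)"
    unfolding K(2) by (auto simp: induced_des_def col_color_word)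
qed

lemma finite_anticycloribbons: "finite {Kc. anticycloribbon n r Kc}"
proof (rule finite_subset)
  show "{Kc. anticycloribbon n r Kc} \<subseteq> {I. composition n I} \<times> {c. set c \<subseteq> {1..r} \<and> length c = n}"
    by (auto simp: anticycloribbon_def colored_ribbon_def)
  show "finite ({I. composition n I} \<times> {c. set c \<subseteq> {1..r} \<and> length c = n})"
    by (intro finite_cartesian_product finite_compositions finite_lists_length_eq) simp
qed

lemma Des_eqI:
  assumes "composition n I" "composition n I'" "\<And>i. 1 \<le> i \<Longrightarrow> i < n \<Longrightarrow> i \<in> Des I \<longleftrightarrow> i \<in> Des I'"
  shows "I = I'"
proof (rule Des_inj[OF assms(1,2)])
  show "Des I = Des I'" using Des_subset[OF assms(1)] Des_subset[OF assms(2)] assms(3) by fastforce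
qed

definition AA_char :: "nat list \<times> nat list \<Rightarrow> (gen list \<Rightarrow>\<^sub>0 complex) set \<Rightarrow> complex"
  where "AA_char = (\<lambda>(K, c). chi (Des K) (coloring_of c))"

text \<open>The values at the xi_j recover the colors because \<open>u\<close> is injective, and
  those at the T_i recover the descents, so different anticycloribbons have different
  characters.\<close>

sublocale AAF: char_family AA "{Kc. anticycloribbon n r Kc}" AA_char
proof (intro char_family.intro char_family_axioms.intro AA.complex_algebra_axioms)
  show "finite {Kc. anticycloribbon n r Kc}" by (rule finite_anticycloribbons)
  show "AA.character (AA_char Kc)" if "Kc \<in> {Kc. anticycloribbon n r Kc}" for Kc
    using that by (cases Kc) (auto simp: AA_char_def intro: chi_character anticycloribbonD)
  show "Kc = Lc" if Kc: "Kc \<in> {Kc. anticycloribbon n r Kc}" and Lc: "Lc \<in> {Kc. anticycloribbon n r Kc}"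
    and eq: "\<forall>a\<in>carrier AA. AA_char Kc a = AA_char Lc a" for Kc Lc
  proof -
    obtain K c L d where KL: "Kc = (K, c)" "Lc = (L, d)" by (metis surj_pair)
    have K: "anticycloribbon n r (K, c)" and L: "anticycloribbon n r (L, d)" using Kc Lc KL by auto
    note K' = anticycloribbonD[OF K] and L' = anticycloribbonD[OF L]
    have eq': "ev (Des K) (coloring_of c) p = ev (Des L) (coloring_of d) p" if "p \<in> FC" for p
      using eq that by (auto simp: KL AA_char_def AA_carrier chi_q[OF K'(4)] chi_q[OF L'(4)])
    have "coloring_of c = coloring_of d"
    proof (rule colorings_eqI[OF K'(3) L'(3)])
      fix j assume j: "1 \<le> j" "j \<le> n"
      show "coloring_of c j = coloring_of d j"
        using eq'[of "letter (Xi j)"] j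
        by (intro inj_onD[OF u_inj _ coloringsD[OF K'(3) j] coloringsD[OF L'(3) j]]) simp
    qed
    then have "c = d" using color_word_coloring_of K'(2) L'(2) by metis
    moreover have "K = L"
    proof (rule Des_eqI[OF K'(1) L'(1)])
      fix i assume i: "1 \<le> i" "i < n"
      show "i \<in> Des K \<longleftrightarrow> i \<in> Des L" using eq'[of "letter (T i)"] i by (auto split: if_splits)
    qed
    ultimately show ?thesis by (simp add: KL)
  qed
  fix M :: "(gen list \<Rightarrow>\<^sub>0 complex) set umodule"
  assume "fd_projective AA M" "carrier M \<noteq> {\<zero>\<^bsub>M\<^esub>}"
  then obtain D c g where c: "c \<in> colorings" and g: "AA.char_functional (chi (induced_des D c) c) M g"
    "\<exists>x\<in>carrier M. g x \<noteq> 0"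
    using AA_functional_exists by blast
  have "induced_des D c \<subseteq> {1..<n}" by (auto simp: induced_des_def)
  then obtain K where K: "composition n K" "Des K = induced_des D c" using Des_surj by blast
  have "AA_char (K, color_word c) = chi (induced_des D c) c"
    by (simp add: AA_char_def K coloring_of_color_word[OF c])
  then show "\<exists>k\<in>{Kc. anticycloribbon n r Kc}. \<exists>g. AA.char_functional (AA_char k) M g \<and> (\<exists>x\<in>carrier M. g x \<noteq> 0)"
    using g induced_anticycloribbon[OF c K] by (intro bexI[of _ "(K, color_word c)"]) auto
qed

sublocale HHF: char_family HH "{I. composition n I}" "\<lambda>I. hchi (Des I)"
proof (intro char_family.intro char_family_axioms.intro HH.complex_algebra_axioms)
  show "finite {I. composition n I}" by (rule finite_compositions)
  show "HH.character (hchi (Des I))" for I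
    by (rule HH_character[OF chi_character[OF compat_base]])
  show "I = I'" if I: "I \<in> {I. composition n I}" "I' \<in> {I. composition n I}"
    and eq: "\<forall>a\<in>carrier HH. hchi (Des I) a = hchi (Des I') a" for I I'
  proof (rule Des_eqI)
    fix i assume i: "1 \<le> i" "i < n"
    then have "hchi (Des I) (q (letter (T i))) = hchi (Des I') (q (letter (T i)))" using eq q_t_HH by blast
    then show "i \<in> Des I \<longleftrightarrow> i \<in> Des I'" using i by (auto simp: chi_q[OF compat_base] split: if_splits)
  qed (use I in auto)
  fix M :: "(gen list \<Rightarrow>\<^sub>0 complex) set umodule"
  assume "fd_projective HH M" "carrier M \<noteq> {\<zero>\<^bsub>M\<^esub>}"
  then obtain D g where D: "D \<subseteq> {1..<n}" and g: "HH.char_functional (hchi D) M g" "\<exists>x\<in>carrier M. g x \<noteq> 0"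
    using HH_functional_exists by blast
  obtain I where "composition n I" "Des I = D" using Des_surj[OF D] by blast
  then show "\<exists>k\<in>{I. composition n I}. \<exists>g. HH.char_functional (hchi (Des k)) M g \<and> (\<exists>x\<in>carrier M. g x \<noteq> 0)"
    using g by blast
qed

lemma acts_by_AA: "acts_by AA L a z \<longleftrightarrow> (\<forall>v\<in>carrier L. a \<odot>\<^bsub>L\<^esub> v = q (z *\<^sub>k 1) \<odot>\<^bsub>L\<^esub> v)"
  and acts_by_HH: "acts_by HH L a z \<longleftrightarrow> (\<forall>v\<in>carrier L. a \<odot>\<^bsub>L\<^esub> v = q (z *\<^sub>k 1) \<odot>\<^bsub>L\<^esub> v)"
  by (simp_all add: acts_by_def AA_sc)

text \<open>The action of T_i is prescribed by a second application of \<open>phi\<close>, so it is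
  governed by \<open>Des K\<close>. Scalar actions of the generators determine a scalar action of
  the whole algebra, given by the character.\<close>

lemma AKS_simple_iff:
  fixes L :: "(gen list \<Rightarrow>\<^sub>0 complex) set umodule"
  assumes Kc: "anticycloribbon n r (K, c)"
  shows "AKS_simple n r u (phi n (K, c)) L \<longleftrightarrow>
    one_dim AA L \<and> (\<forall>a\<in>carrier AA. acts_by AA L a (AA_char (K, c) a))"
proof -
  note K = anticycloribbonD[OF Kc]
  obtain K' where K': "phi n (K, c) = (K', c)"
    using phi_simps(1)[OF K(1), of c] by (metis prod.collapse)
  have Des: "Des (fst (phi n (K', c))) = Des K" using Des_phi_phi[OF K(1), of c] K' by simp
  have char: "AA_char (K, c) (q p) = ev (Des K) (coloring_of c) p" if "p \<in> FC" for p
    using that by (simp add: AA_char_def chi_q[OF K(4)])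
  have 1: "AKS_simple n r u (phi n (K, c)) L \<longleftrightarrow> one_dim AA L \<and>
      (\<forall>i\<in>{1..n}. acts_by AA L (q (letter (Xi i))) (u (col c i))) \<and>
      (\<forall>i\<in>{1..<n}. acts_by AA L (q (t i)) (if i \<in> Des K then -1 else 0))"
    unfolding K' AKS_simple_def AKS_gen_def by (simp add: Des)
  show ?thesis
  proof
    assume "AKS_simple n r u (phi n (K, c)) L"
    then have L: "one_dim AA L" and X: "\<And>i. i \<in> {1..n} \<Longrightarrow> acts_by AA L (q (letter (Xi i))) (u (col c i))"
      and T: "\<And>i. i \<in> {1..<n} \<Longrightarrow> acts_by AA L (q (t i)) (if i \<in> Des K then -1 else 0)"
      unfolding 1 by auto
    have lL: "left_module AA L" using L by (simp add: one_dim_def)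
    have "q (letter a) \<odot>\<^bsub>L\<^esub> v = q (gen_val (Des K) (coloring_of c) a *\<^sub>k 1) \<odot>\<^bsub>L\<^esub> v"
      if "a \<in> T ` {1..<n} \<union> Xi ` {1..n}" "v \<in> carrier L" for a v
      using that
    proof (elim UnE imageE)
      fix j assume "a = Xi j" "j \<in> {1..n}"
      then show ?thesis using X[of j] that(2) by (simp add: acts_by_AA coloring_of_def)
    next
      fix i assume "a = T i" "i \<in> {1..<n}"
      then show ?thesis using T[of i] that(2) by (simp add: acts_by_AA)
    qed
    from acts_ev[OF lL AA_words _ this]
    have "acts_by AA L (q p) (ev (Des K) (coloring_of c) p)" if "p \<in> FC" for p
      using that by (auto simp: acts_by_AA FC_def)
    then show "one_dim AA L \<and> (\<forall>a\<in>carrier AA. acts_by AA L a (AA_char (K, c) a))"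
      using L by (auto simp: AA_carrier char)
  next
    assume "one_dim AA L \<and> (\<forall>a\<in>carrier AA. acts_by AA L a (AA_char (K, c) a))"
    then have "one_dim AA L" and a: "\<And>p. p \<in> FC \<Longrightarrow> acts_by AA L (q p) (ev (Des K) (coloring_of c) p)"
      using char by (auto simp: AA_carrier)
    moreover have "acts_by AA L (q (letter (Xi i))) (u (col c i))" if "i \<in> {1..n}" for i
      using a[of "letter (Xi i)"] that by (simp add: coloring_of_def)
    moreover have "acts_by AA L (q (t i)) (if i \<in> Des K then -1 else 0)" if "i \<in> {1..<n}" for i
      using a[of "t i"] that by simp
    ultimately show "AKS_simple n r u (phi n (K, c)) L" unfolding 1 by blast
  qed
qed

lemma Hecke0_simple_iff:
  fixes L :: "(gen list \<Rightarrow>\<^sub>0 complex) set umodule"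
  shows "Hecke0_simple n r u I L \<longleftrightarrow>
    one_dim HH L \<and> (\<forall>a\<in>carrier HH. acts_by HH L a (hchi (Des I) a))"
proof
  assume "Hecke0_simple n r u I L"
  then have L: "one_dim HH L" and T: "\<And>i. i \<in> {1..<n} \<Longrightarrow> acts_by HH L (q (t i)) (if i \<in> Des I then -1 else 0)"
    unfolding Hecke0_simple_def AKS_gen_def by auto
  have lL: "left_module HH L" using L by (simp add: one_dim_def)
  have "q (letter a) \<odot>\<^bsub>L\<^esub> v = q (gen_val (Des I) base_col a *\<^sub>k 1) \<odot>\<^bsub>L\<^esub> v"
    if "a \<in> T ` {1..<n}" "v \<in> carrier L" for a v
    using that(1)
  proof
    fix i assume "a = T i" "i \<in> {1..<n}"
    then show ?thesis using T[of i] that(2) by (simp add: acts_by_HH)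
  qed
  from acts_ev[OF lL HH_words _ this]
  have "q p \<odot>\<^bsub>L\<^esub> v = q (ev (Des I) base_col p *\<^sub>k 1) \<odot>\<^bsub>L\<^esub> v" if "p \<in> FT" "v \<in> carrier L" for p v
    using that unfolding FT_def by blast
  then have "acts_by HH L (q p) (ev (Des I) base_col p)" if "p \<in> FT" for p
    using that unfolding acts_by_HH by blast
  then have "acts_by HH L (q p) (hchi (Des I) (q p))" if "p \<in> FT" for p
    using that by (simp add: chi_q[OF compat_base] FT_FC)
  then show "one_dim HH L \<and> (\<forall>a\<in>carrier HH. acts_by HH L a (hchi (Des I) a))"
    using L by (auto simp: HH_carrier)
next
  assume "one_dim HH L \<and> (\<forall>a\<in>carrier HH. acts_by HH L a (hchi (Des I) a))"
  then have "one_dim HH L" and a: "\<And>p. p \<in> FT \<Longrightarrow> acts_by HH L (q p) (ev (Des I) base_col p)"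
    by (auto simp: HH_carrier chi_q[OF compat_base] FT_FC)
  then show "Hecke0_simple n r u I L"
    unfolding Hecke0_simple_def AKS_gen_def using a[of "letter (T i)" for i] by simp
qed

lemma AKS_proj_iff:
  fixes M :: "(gen list \<Rightarrow>\<^sub>0 complex) set umodule"
  assumes "anticycloribbon n r Kc"
  shows "AKS_proj n r u Kc M \<longleftrightarrow> AA.simple_proj (AA_char Kc) M"
  using AKS_simple_iff assms unfolding AKS_proj_def AA.simple_proj_def
  by (cases Kc) (simp add: conj_assoc)

lemma Hecke0_proj_iff:
  fixes M :: "(gen list \<Rightarrow>\<^sub>0 complex) set umodule"
  shows "Hecke0_proj n r u I M \<longleftrightarrow> HH.simple_proj (hchi (Des I)) M"
  unfolding Hecke0_proj_def HH.simple_proj_def Hecke0_simple_iff by (simp add: conj_assoc)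

lemma ch_value:
  assumes "fd_projective AA P"
  shows "ch n r u (K0_class AA P) = (\<Sum>Kc\<in>{Kc. anticycloribbon n r Kc}.
    AA.mtrace (AA_char Kc) P *\<^sub>k ribbon (colored_comp_of n Kc))"
proof -
  have "ch n r u = K0_map AA (\<lambda>M y. \<exists>Kc\<in>{Kc. anticycloribbon n r Kc}.
      AA.simple_proj (AA_char Kc) M \<and> y = ribbon (colored_comp_of n Kc))"
    unfolding ch_def Bex_def mem_Collect_eq
    by (intro arg_cong[of _ _ "K0_map AA"] ext arg_cong[of _ _ Ex] conj_cong refl) (simp add: AKS_proj_iff)
  then show ?thesis using AAF.K0_map_value[OF assms, of "\<lambda>Kc. ribbon (colored_comp_of n Kc)"]
    by (simp add: AAF.trace_sum_def)
qed

lemma ch0_value: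
  assumes "fd_projective HH P"
  shows "ch0 n r u (K0_class HH P) = (\<Sum>I\<in>{I. composition n I}. HH.mtrace (hchi (Des I)) P *\<^sub>k Sym_ribbon I)"
proof -
  have "ch0 n r u = K0_map HH (\<lambda>M y. \<exists>I\<in>{I. composition n I}.
      HH.simple_proj (hchi (Des I)) M \<and> y = Sym_ribbon I)"
    unfolding ch0_def Bex_def mem_Collect_eq Hecke0_proj_iff ..
  then show ?thesis using HHF.K0_map_value[OF assms, of Sym_ribbon] by (simp add: HHF.trace_sum_def)
qed

text \<open>Where the colors differ, an anticycloribbon has a descent exactly if the color
  increases, as in \<open>induced_des\<close>; the equality of the two sets is therefore a condition
  at equal colors only.\<close>

lemma Des_anticycloribbon_iff:
  assumes Kc: "anticycloribbon n r (K, c)"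
  shows "(\<forall>j\<in>{1..<n}. col c j = col c (j + 1) \<longrightarrow> (j \<in> D \<longleftrightarrow> j \<in> Des K)) \<longleftrightarrow>
    Des K = induced_des D (coloring_of c)"
proof -
  have "(col c j = col c (j + 1) \<longrightarrow> (j \<in> D \<longleftrightarrow> j \<in> Des K)) \<longleftrightarrow>
      (j \<in> Des K \<longleftrightarrow> j \<in> induced_des D (coloring_of c))" if j: "j \<in> {1..<n}" for j
  proof -
    have "if j \<in> Des K then col c j \<le> col c (j + 1) else col c (j + 1) \<le> col c j"
      using Kc j unfolding anticycloribbon_def split_conv by blast
    moreover have "j \<in> induced_des D (coloring_of c) \<longleftrightarrow>
        col c j < col c (j + 1) \<or> col c j = col c (j + 1) \<and> j \<in> D"
      using j by (auto simp: induced_des_def coloring_of_def)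
    ultimately show ?thesis
      by (cases "col c j" "col c (j + 1)" rule: linorder_cases) (auto split: if_splits)
  qed
  \<comment> \<open>The pointwise equivalence turns the left-hand side into agreement of the two
    sets on {1..<n}; it remains that both sets are contained there.\<close>
  then have "?thesis \<longleftrightarrow> ((\<forall>j\<in>{1..<n}. j \<in> Des K \<longleftrightarrow> j \<in> induced_des D (coloring_of c)) \<longleftrightarrow>
      Des K = induced_des D (coloring_of c))" by simp
  moreover have "Des K \<subseteq> {1..<n}" "induced_des D (coloring_of c) \<subseteq> {1..<n}"
    using Des_subset[OF anticycloribbonD(1)[OF Kc]] by (auto simp: induced_des_def)
  ultimately show ?thesis by blast
qed

text \<open>The left side becomes a sum over pairs of an anticycloribbon and a composition
  \<open>I\<close> from the image of its ribbon, the right side a sum over pairs of \<open>I\<close>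
  and a coloring \<open>c\<close>. The pairs correspond: the shape of the anticycloribbon is
  recovered from its descent set \<open>induced_des (Des I) c\<close>.\<close>

theorem mr_to_sym_ch:
  assumes P: "fd_projective AA P"
  shows "mr_to_sym (ch n r u (K0_class AA P)) = ch0 n r u (K0_class HH P)"
proof -
  let ?K = "{Kc. anticycloribbon n r Kc}" and ?I = "{I. composition n I}"
  define G where "G Kc = {I. composition n I \<and> Des (fst Kc) = induced_des (Des I) (coloring_of (snd Kc))}" for Kc
  define K where "K I c = (THE K. composition n K \<and> Des K = induced_des (Des I) c)" for I c
  have K: "composition n (K I c)" "Des (K I c) = induced_des (Des I) c" for I c
  proof -
    have "induced_des (Des I) c \<subseteq> {1..<n}" by (auto simp: induced_des_def)
    from the_composition[OF this] show "composition n (K I c)" "Des (K I c) = induced_des (Des I) c"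
      unfolding K_def by blast+
  qed
  have fin: "finite (G Kc)" for Kc
    by (rule finite_subset[OF _ finite_compositions[of n]]) (auto simp: G_def)
  have rib: "mr_to_sym (ribbon (colored_comp_of n Kc)) = (\<Sum>I\<in>G Kc. Sym_ribbon I)" if "Kc \<in> ?K" for Kc
  proof (cases Kc)
    case (Pair K c)
    then have a: "anticycloribbon n r (K, c)" using that by simp
    show ?thesis
      unfolding Pair mr_to_sym_ribbon[OF anticycloribbonD(1,2)[OF a]]
      by (simp only: Des_anticycloribbon_iff[OF a] G_def fst_conv snd_conv)
  qed
  have "mr_to_sym (ch n r u (K0_class AA P))
      = (\<Sum>Kc\<in>?K. AA.mtrace (AA_char Kc) P *\<^sub>k mr_to_sym (ribbon (colored_comp_of n Kc)))"
    unfolding ch_value[OF P] mr_to_sym_def by simp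
  also have "\<dots> = (\<Sum>Kc\<in>?K. \<Sum>I\<in>G Kc. AA.mtrace (AA_char Kc) P *\<^sub>k Sym_ribbon I)"
    by (intro sum.cong refl) (simp add: rib cscale_sum)
  also have "\<dots> = (\<Sum>(Kc, I)\<in>Sigma ?K G. AA.mtrace (AA_char Kc) P *\<^sub>k Sym_ribbon I)"
    using finite_anticycloribbons fin by (simp add: sum.Sigma)
  also have "\<dots> = (\<Sum>(I, c)\<in>?I \<times> colorings. AA.mtrace (chi (induced_des (Des I) c) c) P *\<^sub>k Sym_ribbon I)"
  proof (rule sum.reindex_bij_witness[of _ "\<lambda>(I, c). ((K I c, color_word c), I)" "\<lambda>(Kc, I). (I, coloring_of (snd Kc))"])
    fix a assume "a \<in> Sigma ?K G"
    then obtain L c I where a: "a = ((L, c), I)" and Lc: "anticycloribbon n r (L, c)" and I: "composition n I"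
      "Des L = induced_des (Des I) (coloring_of c)"
      by (cases a) (auto simp: G_def)
    note L = anticycloribbonD[OF Lc]
    have "K I (coloring_of c) = L" using K[of I "coloring_of c"] I(2) L(1) by (intro Des_inj[of n]) auto
    then show "(case case a of (Kc, I) \<Rightarrow> (I, coloring_of (snd Kc)) of (I, c) \<Rightarrow> ((K I c, color_word c), I)) = a"
      using color_word_coloring_of[OF L(2)] by (simp add: a)
    show "(case a of (Kc, I) \<Rightarrow> (I, coloring_of (snd Kc))) \<in> ?I \<times> colorings" using I L(3) by (simp add: a)
    show "(case case a of (Kc, I) \<Rightarrow> (I, coloring_of (snd Kc)) of
        (I, c) \<Rightarrow> AA.mtrace (chi (induced_des (Des I) c) c) P *\<^sub>k Sym_ribbon I)
        = (case a of (Kc, I) \<Rightarrow> AA.mtrace (AA_char Kc) P *\<^sub>k Sym_ribbon I)"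
      by (simp add: a AA_char_def I(2))
  next
    fix b assume "b \<in> ?I \<times> colorings"
    then obtain I c where b: "b = (I, c)" "composition n I" "c \<in> colorings" by (cases b) auto
    show "(case case b of (I, c) \<Rightarrow> ((K I c, color_word c), I) of (Kc, I) \<Rightarrow> (I, coloring_of (snd Kc))) = b"
      by (simp add: b coloring_of_color_word)
    show "(case b of (I, c) \<Rightarrow> ((K I c, color_word c), I)) \<in> Sigma ?K G"
      using b induced_anticycloribbon[OF b(3) K] by (simp add: G_def K coloring_of_color_word)
  qed
  also have "\<dots> = (\<Sum>I\<in>?I. HH.mtrace (hchi (Des I)) P *\<^sub>k Sym_ribbon I)"
    unfolding sum.cartesian_product[symmetric] mtrace_restrict[OF P] formal.scale_sum_left ..
  also have "\<dots> = ch0 n r u (K0_class HH P)" by (rule ch0_value[OF HH_fd_projective[OF P], symmetric])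
  finally show ?thesis .
qed

end

theorem theorem4p2:
  fixes r :: nat and u :: "nat \<Rightarrow> complex"
  assumes "1 \<le> r"
    and "inj_on u {1..r}"
  shows "hopf_hom r 1 mr_to_sym \<and>
    (\<forall>i\<in>{1..r}. \<forall>j\<ge>1. mr_to_sym (S j i) = S j 1) \<and>
    (\<forall>n\<ge>1. \<forall>P :: ((gen list \<Rightarrow>\<^sub>0 complex) set, 'v) module.
      fd_projective (AKS n r u) P \<longrightarrow>
        fd_projective (Hecke0 n r u) P \<and>
        mr_to_sym (ch n r u (K0_class (AKS n r u) P)) = ch0 n r u (K0_class (Hecke0 n r u) P))"
proof -
  interpret aks_algebra n r u for n using assms by (rule aks_algebra.intro)
  show ?thesis using hopf_hom_mr_to_sym HH_fd_projective mr_to_sym_ch by auto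
qed

end
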